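(* Let $\mathbf f=(f_1,\dots,f_d)$ be a system of formal Taylor expansions about the origin and let $\mathbf m=(m_1,\dots,m_d)\in\mathbb Z_+^d\setminus\{\mathbf 0\}$. Let $q_{n,\mathbf m}$ be the (monic) common denominators of the Hermite-Padé approximants of $\mathbf f$ with respect to $\mathbf m$. Assume that $$\lim_{n\to\infty}q_{n,\mathbf m}=q_{|\mathbf m|},\qquad \deg q_{|\mathbf m|}=|\mathbf m|,\qquad q_{|\mathbf m|}(0)\ne0,$$ and that all the zeros of the polynomial $q_{|\mathbf m|}$ are simple. Fix an integer $m^*$ with $1\le m^*\le\max\{m_k:k=1,\dots,d\}$. Assume that for all sufficiently large $n$ the polynomial $q_{n,\mathbf m}$ is unique and $\deg q_{n,\mathbf m}=|\mathbf m|$. Let $$F=\sum_{k=1}^d p_kf_k,\qquad \deg p_k\le m_k-m^*,$$ where the $p_k$ are arbitrary fixed polynomials, not all identically zero (by convention $\deg p_k<0$ means $p_k\equiv0$). Then the closure of $D_{m^*-1}(F)$ contains at least $m^*$ singular points of $F$ which are zeros of $q_{|\mathbf m|}$, and those lying in $D_{m^*-1}(F)$ are simple poles of $F$. In particular, all such zeros are system singularities of $\mathbf f$ with respect to $\mathbf m$.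
   Context: Hermite-Padé approximants. Let $|\mathbf m|=m_1+\cdots+m_d$. For each $n\ge\max\{m_1,\dots,m_d\}$ there exist polynomials $q,p_1,\dots,p_d$ with $\deg p_k\le n-m_k$ ($k=1,\dots,d$), $\deg q\le|\mathbf m|$, $q\not\equiv0$, and $q(z)f_k(z)-p_k(z)=A_kz^{n+1}+\cdots$ (only powers $z^j$ with $j\ge n+1$) for $k=1,\dots,d$. The vector $(p_1/q,\dots,p_d/q)$ is called an $(n,\mathbf m)$ (type II) Hermite-Padé approximant of $\mathbf f$. For each $n$ one particular solution is chosen, and after cancelling common factors it is written $(p_{n,\mathbf m,1},\dots,p_{n,\mathbf m,d})/q_{n,\mathbf m}$ with $q_{n,\mathbf m}$ monic and having no zero common to all the $p_{n,\mathbf m,k}$. Limits of polynomials of bounded degree are coefficientwise. Disks of meromorphy. For a power series $F$ about the origin with positive radius of convergence and an integer $j\ge0$, $D_j(F)$ is the largest open disk centered at the origin to which $F$ extends as a meromorphic function with at most $j$ poles counting multiplicities; $R_j(F)$ denotes its radius. If the radius of convergence is $0$, $D_j(F)=\emptyset$. A singular point of $F$ in the closure of $D_j(F)$ is a pole of $F$ in $D_j(F)$ or a boundary point of $D_j(F)$ to a neighborhood of which $F$ has no holomorphic extension. System singularities. A point $\zeta\in\mathbb C\setminus\{0\}$ is a system singularity of $\mathbf f$ with respect to $\mathbf m$ if there exists at least one polynomial combination $G=\sum_{k=1}^d p_kf_k$, with polynomials $\deg p_k<m_k$ (and $p_k\equiv0$ if $m_k=0$), which is analytic on the disk $\{z:|z|<|\zeta|\}$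 and for which $\zeta$ is a singular point. *)

theory Defs
  imports
    "HOL-Complex_Analysis.Complex_Analysis"
    "HOL-Computational_Algebra.Polynomial_FPS"
begin

section \<open>Hermite-Pade approximants\<close>

text \<open>
  Multi-indices and systems of series are functions on \<open>nat\<close>, used only on \<open>{1..d}\<close>.
\<close>

definition hp_solution ::
  "nat \<Rightarrow> (nat \<Rightarrow> complex fps) \<Rightarrow> (nat \<Rightarrow> nat) \<Rightarrow> nat \<Rightarrow> complex poly \<Rightarrow> (nat \<Rightarrow> complex poly) \<Rightarrow> bool"
  where "hp_solution d f m n q p \<longleftrightarrow>
    q \<noteq> 0 \<and> degree q \<le> (\<Sum>k\<in>{1..d}. m k) \<and>
    (\<forall>k\<in>{1..d}. degree (p k) \<le> n - m k \<and>
       (\<forall>j\<le>n. fps_nth (fps_of_poly q * f k - fps_of_poly (p k)) j = 0))"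

text \<open>
  The normalised denominators: cancel a common factor \<open>g\<close> from a solution so that the
  denominator is monic and no zero is common to it and all the numerators. The subtraction
  \<open>n - m k\<close> above is on \<open>nat\<close>, so this is meaningful only for \<open>n\<close> at least the maximum of \<open>m\<close>.
\<close>

definition hp_denominator ::
  "nat \<Rightarrow> (nat \<Rightarrow> complex fps) \<Rightarrow> (nat \<Rightarrow> nat) \<Rightarrow> nat \<Rightarrow> complex poly \<Rightarrow> bool"
  where "hp_denominator d f m n Q \<longleftrightarrow>
    (\<exists>q p g P. hp_solution d f m n q p \<and>
       q = g * Q \<and> (\<forall>k\<in>{1..d}. p k = g * P k) \<and>
       lead_coeff Q = 1 \<and>
       \<not> (\<exists>z. poly Q z = 0 \<and> (\<forall>k\<in>{1..d}. poly (P k) z = 0)))"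

definition poly_combination ::
  "nat \<Rightarrow> (nat \<Rightarrow> complex fps) \<Rightarrow> (nat \<Rightarrow> complex poly) \<Rightarrow> complex fps"
  where "poly_combination d f p = (\<Sum>k\<in>{1..d}. fps_of_poly (p k) * f k)"


section \<open>Disks of meromorphy and singular points\<close>

text \<open>
  \<open>g\<close> is a meromorphic extension of \<open>F\<close> to \<open>D\<close> with at most \<open>j\<close> poles, counting
  multiplicities. By \<open>nicely_meromorphic_on\<close>, removable singularities are removed and \<open>g\<close>
  vanishes at its poles, so \<open>g\<close> is unique on a disk \<open>D\<close> about the origin. The predicate
  \<open>has_fps_expansion\<close> includes that \<open>F\<close> has positive radius of convergence.
\<close>

definition mero_extension ::
  "complex fps \<Rightarrow> complex set \<Rightarrow> nat \<Rightarrow> (complex \<Rightarrow> complex) \<Rightarrow> bool"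
  where "mero_extension F D j g \<longleftrightarrow>
    g has_fps_expansion F \<and> g nicely_meromorphic_on D \<and>
    finite {z\<in>D. is_pole g z} \<and>
    (\<Sum>z | z \<in> D \<and> is_pole g z. nat (- zorder g z)) \<le> j"

text \<open>
  Extensions to concentric disks agree, and their numbers of poles are bounded by \<open>j\<close>, so the
  supremum is attained when \<open>F\<close> has positive radius of convergence. Otherwise it is \<open>0\<close>, and
  the disk is empty.
\<close>

definition mero_radius :: "nat \<Rightarrow> complex fps \<Rightarrow> ereal"
  where "mero_radius j F =
    Sup (insert 0 {r. \<exists>g. mero_extension F (eball 0 r) j g})"

definition mero_disk :: "nat \<Rightarrow> complex fps \<Rightarrow> complex set"
  where "mero_disk j F = eball 0 (mero_radius j F)"

definition holo_extends_near ::
  "(complex \<Rightarrow> complex) \<Rightarrow> complex set \<Rightarrow> complex \<Rightarrow> bool"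
  where "holo_extends_near g D \<zeta> \<longleftrightarrow>
    (\<exists>U h. open U \<and> \<zeta> \<in> U \<and> h holomorphic_on U \<and> (\<forall>z\<in>U \<inter> D. h z = g z))"

definition singular_point :: "nat \<Rightarrow> complex fps \<Rightarrow> complex \<Rightarrow> bool"
  where "singular_point j F \<zeta> \<longleftrightarrow>
    (\<exists>g. mero_extension F (mero_disk j F) j g \<and>
       (\<zeta> \<in> mero_disk j F \<and> is_pole g \<zeta> \<or>
        \<zeta> \<in> frontier (mero_disk j F) \<and> \<not> holo_extends_near g (mero_disk j F) \<zeta>))"

definition simple_pole_in_disk :: "nat \<Rightarrow> complex fps \<Rightarrow> complex \<Rightarrow> bool"
  where "simple_pole_in_disk j F \<zeta> \<longleftrightarrow>
    \<zeta> \<in> mero_disk j F \<and>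
    (\<exists>g. mero_extension F (mero_disk j F) j g \<and> is_pole g \<zeta> \<and> zorder g \<zeta> = -1)"


section \<open>System singularities\<close>

text \<open>
  A formal series is analytic on \<open>{z. norm z < norm \<zeta>}\<close> iff its radius of convergence is at
  least \<open>norm \<zeta>\<close>; a point \<open>\<zeta>\<close> on the boundary is then singular iff there is no holomorphic
  extension to a neighbourhood of \<open>\<zeta>\<close>.
\<close>

definition system_singularity ::
  "nat \<Rightarrow> (nat \<Rightarrow> complex fps) \<Rightarrow> (nat \<Rightarrow> nat) \<Rightarrow> complex \<Rightarrow> bool"
  where "system_singularity d f m \<zeta> \<longleftrightarrow>
    \<zeta> \<noteq> 0 \<and>
    (\<exists>p. (\<forall>k\<in>{1..d}. p k = 0 \<or> degree (p k) < m k) \<and>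
       ereal (norm \<zeta>) \<le> fps_conv_radius (poly_combination d f p) \<and>
       \<not> holo_extends_near (eval_fps (poly_combination d f p)) (ball 0 (norm \<zeta>)) \<zeta>)"

end

theory Submission
  imports Defs "HOL-Computational_Algebra.Fundamental_Theorem_Algebra"
begin

text \<open>
  For large \<open>n\<close> the coefficient of \<open>z ^ n\<close> in \<open>q n * v * F\<close> vanishes for every polynomial \<open>v\<close> of
  degree less than \<open>m*\<close>. Let \<open>R\<close> be the radius of the disk of meromorphy, and let \<open>w\<close> be the monic
  polynomial of minimal degree such that \<open>G = w F\<close> is analytic in that disk. A zero of \<open>w\<close> is a pole
  of \<open>F\<close>, and the recurrence forces it to be a zero of \<open>Q\<close>, and a multiple pole to be a multiple
  zero of \<open>Q\<close>. It remains to find \<open>D = m* - degree w\<close> singular zeros of \<open>Q\<close> on the circle of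
  radius \<open>R\<close>.

  By maximality of the disk, all nonzero \<open>v G\<close> with \<open>degree v < D\<close> have radius of convergence
  exactly \<open>R\<close>. For a zero \<open>\<zeta>\<close> of \<open>Q\<close> let \<open>y \<zeta> k\<close> be the coefficient of \<open>z ^ k\<close> in
  \<open>Q / (z - \<zeta>) * v * G\<close>. As \<open>q n\<close> tends to \<open>Q\<close>, the difference \<open>y \<zeta> k - \<zeta> * y \<zeta> (k + 1)\<close> is
  small compared with all the \<open>y \<zeta>' (k + 1)\<close>, and Poincare--Perron dominance leaves only the
  \<open>\<zeta>\<close> with \<open>\<bar>\<zeta>\<bar> = R\<close>. Normalise \<open>R = 1\<close>. Weighting \<open>y \<zeta> k\<close> with \<open>binomial k s * r ^ k\<close>, which
  belongs to the \<open>s\<close>-th derivative and is concentrated on a time window, makes the components at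
  regular \<open>\<zeta>\<close> negligible by Cauchy's estimate. Modulating with \<open>2 P + 1\<close> low frequencies gives
  \<open>D (2 P + 1)\<close> independent vectors localised in time and frequency and carried by the singular
  \<open>\<zeta>\<close>; the uncertainty principle leaves room for only about \<open>2 P + 1\<close> such vectors in each
  component, so there are at least \<open>D\<close> singular \<open>\<zeta>\<close>.
\<close>


section \<open>Time and frequency localisation\<close>

text \<open>The convergence of \<open>q n\<close> to \<open>Q\<close> carries no rate. The relative
  error \<open>e\<close> of one step can be fixed small, but over a window of length
  \<open>L = K * s\<close> it accumulates to factors such as \<open>(1 + e) ^ L\<close>, so
  solutions cannot be diagonalised and regular components cannot be discarded coefficient by
  coefficient. Every gain is therefore exponential with a base fixed before \<open>e\<close>:
  outside the window the weight drops by \<open>\<theta> ^ L\<close>, and inside it is at least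
  \<open>(K / 8) ^ s\<close>, whereas Cauchy's estimate at a regular point costs
  \<open>(2 / \<rho>) ^ s\<close>. Taking \<open>K\<close> large against \<open>1 / \<rho>\<close>,
  and then \<open>e\<close> small against \<open>K\<close>, beats the accumulated error. A bound on
  \<open>e\<close> also permits slow drift, so \<open>D\<close> independent solutions might share
  one component at \<open>D\<close> slightly different frequencies. Saturating all
  \<open>2 * P + 1\<close> nearby frequencies by modulation leaves no such room: with relative
  errors below \<open>1 / D\<close>, \<open>D - 1\<close> components cannot hold
  \<open>D * (2 * P + 1)\<close> vectors.\<close>

definition cip :: "'a set \<Rightarrow> ('a \<Rightarrow> complex) \<Rightarrow> ('a \<Rightarrow> complex) \<Rightarrow> complex" where
  "cip X f g = (\<Sum>x\<in>X. f x * cnj (g x))"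

definition nsq :: "'a set \<Rightarrow> ('a \<Rightarrow> complex) \<Rightarrow> real" where
  "nsq X f = (\<Sum>x\<in>X. (cmod (f x))\<^sup>2)"

lemma nsq_nonneg: "0 \<le> nsq X f"
  by (simp add: nsq_def sum_nonneg)

lemma nsq_scale: "nsq X (\<lambda>x. c * f x) = (cmod c)\<^sup>2 * nsq X f"
  by (simp add: nsq_def norm_mult power_mult_distrib sum_distrib_left)

lemma cip_self: "cip X f f = of_real (nsq X f)"
  by (simp add: cip_def nsq_def complex_norm_square[symmetric])

lemma cip_diff_left: "cip X (\<lambda>x. f x - g x) h = cip X f h - cip X g h"
  by (simp add: cip_def algebra_simps sum_subtractf)

lemma cip_scale_left: "cip X (\<lambda>x. c * f x) h = c * cip X f h"
  by (simp add: cip_def sum_distrib_left mult.assoc)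

lemma cip_sum_left: "cip X (\<lambda>x. \<Sum>i\<in>I. c i * f i x) h = (\<Sum>i\<in>I. c i * cip X (f i) h)"
  by (simp add: cip_def sum_distrib_left sum_distrib_right sum.swap[of _ I] mult.assoc)

lemma cip_commute: "cip X f g = cnj (cip X g f)"
  by (simp add: cip_def mult.commute)

lemma cip_sum_right: "cip X h (\<lambda>x. \<Sum>i\<in>I. c i * f i x) = (\<Sum>i\<in>I. cnj (c i) * cip X h (f i))"
  by (simp add: cip_def sum_distrib_left sum_distrib_right sum.swap[of _ I] mult_ac)

lemma cip_diff_right: "cip X h (\<lambda>x. f x - g x) = cip X h f - cip X h g"
  by (simp add: cip_def algebra_simps sum_subtractf)

lemma cip_add_right: "cip X h (\<lambda>x. f x + g x) = cip X h f + cip X h g"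
  by (simp add: cip_def algebra_simps sum.distrib)

lemma nsq_diff: "nsq X (\<lambda>x. f x - g x) = nsq X f - 2 * Re (cip X f g) + nsq X g"
proof -
  have "complex_of_real (nsq X (\<lambda>x. f x - g x)) = cip X f f - cip X f g - (cip X g f - cip X g g)"
    by (simp only: cip_self[symmetric] cip_diff_left cip_diff_right)
  also have "\<dots> = of_real (nsq X f) - cip X f g - cnj (cip X f g) + of_real (nsq X g)"
    by (simp add: cip_self cip_commute[of X g f])
  finally have "Re (complex_of_real (nsq X (\<lambda>x. f x - g x))) =
     Re (of_real (nsq X f) - cip X f g - cnj (cip X f g) + of_real (nsq X g))" by simp
  thus ?thesis by simp
qed

lemma nsq_eq_0_cip:
  assumes "finite X" "nsq X g = 0" shows "cip X f g = 0"
proof -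
  have "\<forall>x\<in>X. g x = 0"
    using assms by (auto simp: nsq_def sum_nonneg_eq_0_iff)
  thus ?thesis by (simp add: cip_def)
qed

lemma projection_exists:
  assumes "finite X"
  shows "\<exists>\<beta>. \<forall>b<(m::nat). cip X (\<lambda>x. z x - (\<Sum>i<m. \<beta> i * u i x)) (u b) = 0"
proof (induction m arbitrary: z)
  case 0 show ?case by simp
next
  case (Suc m)
  obtain \<beta> where \<beta>: "\<forall>b<m. cip X (\<lambda>x. z x - (\<Sum>i<m. \<beta> i * u i x)) (u b) = 0" using Suc by blast
  obtain \<gamma> where \<gamma>: "\<forall>b<m. cip X (\<lambda>x. u m x - (\<Sum>i<m. \<gamma> i * u i x)) (u b) = 0" using Suc by blast
  define z' where "z' = (\<lambda>x. z x - (\<Sum>i<m. \<beta> i * u i x))"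
  define w where "w = (\<lambda>x. u m x - (\<Sum>i<m. \<gamma> i * u i x))"
  \<comment> \<open>If \<open>w\<close> vanishes on \<open>X\<close>, division by zero gives
    \<open>c = 0\<close>, and both sides of the next equation are 0, so dependent \<open>u i\<close>
    do no harm.\<close>
  define c where "c = cip X z' w / cip X w w"
  have c: "cip X z' w = c * cip X w w"
    using nsq_eq_0_cip[OF assms, of w z'] by (cases "cip X w w = 0") (auto simp: c_def cip_self)
  define \<delta> where "\<delta> = (\<lambda>i. if i = m then c else \<beta> i - c * \<gamma> i)"
  have eq: "(\<lambda>x. z x - (\<Sum>i<Suc m. \<delta> i * u i x)) = (\<lambda>x. z' x - c * w x)"
    by (rule ext) (simp add: \<delta>_def z'_def w_def algebra_simps sum_subtractf sum_distrib_left)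
  have lt: "cip X (\<lambda>x. z' x - c * w x) (u b) = 0" if "b < m" for b
    using \<beta> \<gamma> that unfolding cip_diff_left cip_scale_left z'_def[symmetric] w_def[symmetric] by simp
  have um: "u m = (\<lambda>x. w x + (\<Sum>i<m. \<gamma> i * u i x))" by (simp add: w_def)
  have "cip X (\<lambda>x. z' x - c * w x) (u m) = cip X (\<lambda>x. z' x - c * w x) w +
     (\<Sum>i<m. cnj (\<gamma> i) * cip X (\<lambda>x. z' x - c * w x) (u i))"
    by (subst um) (simp only: cip_add_right cip_sum_right)
  also have "\<dots> = 0" using c by (simp add: lt) (simp only: cip_diff_left cip_scale_left, simp)
  finally have "\<forall>b<Suc m. cip X (\<lambda>x. z' x - c * w x) (u b) = 0" using lt less_Suc_eq by auto
  thus ?case using eq by (intro exI[of _ \<delta>]) simp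
qed

text \<open>Triangularity makes a diagonal operator have its eigenvalues on the diagonal.\<close>

lemma gram_schmidt_triangular:
  assumes fin: "finite X"
    and indep: "\<And>\<alpha>. (\<exists>i<(N::nat). \<alpha> i \<noteq> 0) \<Longrightarrow> 0 < nsq X (\<lambda>x. \<Sum>b<N. \<alpha> b * v b x)"
  obtains t u where "\<And>i. u i = (\<lambda>x. \<Sum>b<N. t i b * v b x)"
    "\<And>i b. i < N \<Longrightarrow> i < b \<Longrightarrow> t i b = 0"
    "\<And>i. i < N \<Longrightarrow> nsq X (u i) = 1"
    "\<And>i j. i < N \<Longrightarrow> j < N \<Longrightarrow> i \<noteq> j \<Longrightarrow> cip X (u i) (u j) = 0"
    "\<And>i \<mu>. i < N \<Longrightarrow> cip X (\<lambda>x. \<Sum>b<N. t i b * \<mu> b * v b x) (u i) = \<mu> i"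
proof -
  have ex: "\<exists>s. (\<forall>b>i. s b = 0) \<and> nsq X (\<lambda>x. \<Sum>b<N. s b * v b x) = 1 \<and>
      (\<forall>b<i. cip X (\<lambda>x. \<Sum>b<N. s b * v b x) (v b) = 0)" if i: "i < N" for i
  proof -
    obtain \<beta> where \<beta>: "\<forall>b<i. cip X (\<lambda>x. v i x - (\<Sum>j<i. \<beta> j * v j x)) (v b) = 0"
      using projection_exists[OF fin, of i "v i" v] by (elim exE)
    define s0 where "s0 = (\<lambda>b. if b < i then - \<beta> b else if b = i then 1 else 0)"
    have split: "{..<N} = {..<i} \<union> {i} \<union> {i<..<N}" using i by auto
    have s0: "(\<Sum>b<N. s0 b * v b x) = v i x - (\<Sum>j<i. \<beta> j * v j x)" for x
    proof -
      have "(\<Sum>b<N. s0 b * v b x) = (\<Sum>b<i. s0 b * v b x) + s0 i * v i x + (\<Sum>b\<in>{i<..<N}. s0 b * v b x)"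
        unfolding split by (subst sum.union_disjoint, auto)+
      thus ?thesis by (simp add: s0_def sum_negf)
    qed
    define \<nu> where "\<nu> = nsq X (\<lambda>x. \<Sum>b<N. s0 b * v b x)"
    have \<nu>: "\<nu> > 0" unfolding \<nu>_def by (rule indep) (use i in \<open>auto simp: s0_def intro!: exI[of _ i]\<close>)
    define c where "c = complex_of_real (1 / sqrt \<nu>)"
    have eq: "(\<Sum>b<N. (c * s0 b) * v b x) = c * (\<Sum>b<N. s0 b * v b x)" for x
      by (simp add: sum_distrib_left mult.assoc)
    have "nsq X (\<lambda>x. \<Sum>b<N. (c * s0 b) * v b x) = (cmod c)\<^sup>2 * \<nu>"
      unfolding eq \<nu>_def by (rule nsq_scale)
    also have "\<dots> = 1" using \<nu> by (simp add: c_def norm_divide power_divide)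
    finally have 1: "nsq X (\<lambda>x. \<Sum>b<N. (c * s0 b) * v b x) = 1" .
    have "\<forall>b<i. cip X (\<lambda>x. \<Sum>b<N. (c * s0 b) * v b x) (v b) = 0"
      unfolding eq cip_scale_left s0 using \<beta> by simp
    thus ?thesis using 1 by (intro exI[of _ "\<lambda>b. c * s0 b"]) (auto simp: s0_def)
  qed
  have "\<forall>i\<in>{..<N}. \<exists>s. (\<forall>b>i. s b = 0) \<and> nsq X (\<lambda>x. \<Sum>b<N. s b * v b x) = 1 \<and>
      (\<forall>b<i. cip X (\<lambda>x. \<Sum>b<N. s b * v b x) (v b) = 0)" by (rule ballI, rule ex, simp only: lessThan_iff)
  from bchoice[OF this] obtain t where
    tt: "\<forall>i\<in>{..<N}. (\<forall>b>i. t i b = 0) \<and> nsq X (\<lambda>x. \<Sum>b<N. t i b * v b x) = 1 \<and>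
      (\<forall>b<i. cip X (\<lambda>x. \<Sum>b<N. t i b * v b x) (v b) = 0)" by (elim exE)
  have t: "(\<forall>b>i. t i b = 0) \<and> nsq X (\<lambda>x. \<Sum>b<N. t i b * v b x) = 1 \<and>
      (\<forall>b<i. cip X (\<lambda>x. \<Sum>b<N. t i b * v b x) (v b) = 0)" if "i < N" for i
    by (rule bspec[OF tt]) (simp add: that)
  define u where "u = (\<lambda>i x. \<Sum>b<N. t i b * v b x)"
  have u_eq: "u i = (\<lambda>x. \<Sum>b<N. t i b * v b x)" for i by (simp add: u_def)
  have orth: "cip X (u i) (v b) = 0" if "i < N" "b < i" for i b using t that by (simp add: u_def)
  have o1: "cip X (u i) (u j) = 0" if "i < N" "j < i" for i j
  proof -
    have "cip X (u i) (u j) = (\<Sum>b<N. cnj (t j b) * cip X (u i) (v b))"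
      unfolding u_eq[of j] by (rule cip_sum_right)
    also have "\<dots> = 0"
    proof (rule sum.neutral, safe)
      fix b assume "b < N"
      show "cnj (t j b) * cip X (u i) (v b) = 0"
        using orth[of i b] t[of j] that by (cases "b < i") auto
    qed
    finally show ?thesis .
  qed
  show ?thesis
  proof (rule that[of u t])
    fix i j assume "i < N" "j < N" "i \<noteq> j"
    thus "cip X (u i) (u j) = 0" using o1[of i j] o1[of j i] cip_commute[of X "u i" "u j"]
      by (cases "j < i") auto
  next
    fix i and \<mu> :: "nat \<Rightarrow> complex" assume i: "i < N"
    \<comment> \<open>Each summand vanishes: \<open>t i b = 0\<close> for \<open>b > i\<close>,
      \<open>v b\<close> is orthogonal to \<open>u i\<close> for \<open>b < i\<close>, and the
      factor \<open>\<mu> b - \<mu> i\<close> vanishes for \<open>b = i\<close>.\<close>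
    have "cip X (\<lambda>x. \<Sum>b<N. t i b * \<mu> b * v b x) (u i) - \<mu> i * cip X (u i) (u i) =
       (\<Sum>b<N. t i b * (\<mu> b - \<mu> i) * cip X (v b) (u i))"
      unfolding u_eq[of i] cip_sum_left
      by (simp add: sum_distrib_left algebra_simps sum_subtractf)
    also have "\<dots> = 0"
    proof (rule sum.neutral, safe)
      fix b assume "b < N"
      show "t i b * (\<mu> b - \<mu> i) * cip X (v b) (u i) = 0"
        using orth[of i b] t[of i] i cip_commute[of X "v b" "u i"]
        by (cases "b < i"; cases "b = i") auto
    qed
    finally show "cip X (\<lambda>x. \<Sum>b<N. t i b * \<mu> b * v b x) (u i) = \<mu> i"
      using t[OF i] by (simp add: cip_self u_def)
  qed (use t in \<open>auto simp: u_def\<close>)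
qed

lemma bessel_inequality:
  assumes fin: "finite X"
    and unit: "\<And>i. i < N \<Longrightarrow> nsq X (u i) = 1"
    and orth: "\<And>i j. i < N \<Longrightarrow> j < N \<Longrightarrow> i \<noteq> j \<Longrightarrow> cip X (u i) (u j) = 0"
  shows "(\<Sum>i<(N::nat). (cmod (cip X g (u i)))\<^sup>2) \<le> nsq X g"
proof -
  define c where "c = (\<lambda>i. cip X g (u i))"
  define p where "p = (\<lambda>x. \<Sum>i<N. c i * u i x)"
  have "cip X p (u j) = c j" if "j < N" for j
  proof -
    have "cip X p (u j) = (\<Sum>i<N. c i * cip X (u i) (u j))" unfolding p_def by (rule cip_sum_left)
    also have "\<dots> = (\<Sum>i<N. if i = j then c j else 0)"
      by (rule sum.cong) (auto simp: orth unit cip_self that)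
    finally show ?thesis using that by simp
  qed
  hence pp: "cip X p p = (\<Sum>i<N. cnj (c i) * c i)"
    unfolding p_def[of ] by (subst cip_sum_right) (simp add: p_def)
  have gp: "cip X g p = (\<Sum>i<N. cnj (c i) * c i)"
    unfolding p_def by (subst cip_sum_right) (simp add: c_def)
  have s: "(\<Sum>i<N. cnj (c i) * c i) = of_real (\<Sum>i<N. (cmod (c i))\<^sup>2)"
    by (simp add: complex_norm_square[symmetric] mult.commute)
  have "0 \<le> nsq X (\<lambda>x. g x - p x)" by (rule nsq_nonneg)
  also have "\<dots> = nsq X g - (\<Sum>i<N. (cmod (c i))\<^sup>2)"
    using pp gp unfolding nsq_diff s cip_self of_real_eq_iff by simp
  finally show ?thesis by (simp add: c_def)
qed

section \<open>Discrete Fourier transform and sampled cosine profiles\<close>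

lemma roots_of_unity_orthogonal:
  assumes "k < K" "l < K"
  shows "(\<Sum>t<K. cis (2 * pi * real t * real k / real K) * cnj (cis (2 * pi * real t * real l / real K)))
     = (if k = l then of_nat K else 0)"
proof (cases "k = l")
  case True thus ?thesis by (simp add: cis_cnj cis_mult)
next
  case False
  define \<theta> where "\<theta> = 2 * pi * (real k - real l) / real K"
  have K: "real K > 0" using assms by simp
  have "(\<Sum>t<K. cis (2 * pi * real t * real k / real K) * cnj (cis (2 * pi * real t * real l / real K)))
     = (\<Sum>t<K. cis \<theta> ^ t)"
    by (rule sum.cong)
       (auto simp: cis_cnj cis_mult Complex.DeMoivre \<theta>_def field_simps)
  also have "\<dots> = (1 - cis \<theta> ^ K) / (1 - cis \<theta>)"
  proof -
    have "cis \<theta> \<noteq> 1"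
    proof
      assume "cis \<theta> = 1"
      hence "cos \<theta> = 1" by (metis cis.simps(1) one_complex.simps(1))
      then obtain n :: int where n: "\<theta> = n * 2 * pi" using cos_one_2pi_int by auto
      hence "2 * pi * (real k - real l) = 2 * pi * (real_of_int n * real K)"
        using K unfolding \<theta>_def by (simp add: field_simps)
      hence "real k - real l = real_of_int n * real K" using pi_gt_zero by simp
      hence "real_of_int (int k - int l) = real_of_int (n * int K)" by simp
      hence "int k - int l = n * int K" by (simp only: of_int_eq_iff)
      hence "int K dvd (int k - int l)" by simp
      hence "\<bar>int k - int l\<bar> \<ge> int K" using dvd_imp_le_int[of "int k - int l" "int K"] False by simp
      thus False using assms by auto
    qed
    thus ?thesis by (simp add: sum_gp_strict)
  qed
  also have "cis \<theta> ^ K = 1"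
  proof -
    have "real K * \<theta> = 2 * pi * real k - 2 * pi * real l" using K by (simp add: \<theta>_def field_simps)
    hence "cis \<theta> ^ K = cis (2 * pi * real k) / cis (2 * pi * real l)"
      by (simp only: Complex.DeMoivre cis_divide)
    thus ?thesis by (simp add: cis_multiple_2pi)
  qed
  finally show ?thesis using False by simp
qed

lemma discrete_parseval:
  "(\<Sum>t<K. (cmod (\<Sum>k<K. f k * cis (2 * pi * real t * real k / real K)))\<^sup>2) = real K * (\<Sum>k<K. (cmod (f k))\<^sup>2)"
proof -
  let ?e = "\<lambda>t k. cis (2 * pi * real t * real k / real K)"
  have "complex_of_real (\<Sum>t<K. (cmod (\<Sum>k<K. f k * ?e t k))\<^sup>2)
     = (\<Sum>t<K. (\<Sum>k<K. f k * ?e t k) * (\<Sum>l<K. cnj (f l) * cnj (?e t l)))"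
    by (simp only: of_real_sum complex_norm_square cnj_sum complex_cnj_mult)
  also have "\<dots> = (\<Sum>t<K. \<Sum>k<K. \<Sum>l<K. f k * cnj (f l) * (?e t k * cnj (?e t l)))"
    by (simp add: sum_product mult_ac)
  also have "\<dots> = (\<Sum>k<K. \<Sum>l<K. f k * cnj (f l) * (\<Sum>t<K. ?e t k * cnj (?e t l)))"
    by (subst sum.swap, rule sum.cong[OF refl], subst sum.swap) (simp only: sum_distrib_left)
  also have "\<dots> = (\<Sum>k<K. \<Sum>l<K. if l = k then f k * cnj (f k) * of_nat K else 0)"
    by (intro sum.cong refl) (use roots_of_unity_orthogonal in auto)
  also have "\<dots> = of_real (real K * (\<Sum>k<K. (cmod (f k))\<^sup>2))"
    by (simp add: sum_distrib_left complex_norm_square[symmetric] mult_ac)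
  finally show ?thesis by (simp only: of_real_eq_iff)
qed

lemma norm_one_minus_cis: "(cmod (1 - cis t))\<^sup>2 = 2 - 2 * cos t"
proof -
  have "(cmod (1 - cis t))\<^sup>2 = (1 - cos t)\<^sup>2 + (sin t)\<^sup>2" by (simp add: cmod_power2)
  also have "\<dots> = 1 - 2 * cos t + ((cos t)\<^sup>2 + (sin t)\<^sup>2)" by (simp add: power2_eq_square algebra_simps)
  finally show ?thesis by simp
qed

lemma sum_double_range: "(\<Sum>t<2 * n. g t) = (\<Sum>i<n. g (2 * i) + g (Suc (2 * i)) :: real)"
  by (induction n) auto

lemma sum_lessThan_add:
  fixes g :: "nat \<Rightarrow> 'a :: comm_monoid_add"
  shows "(\<Sum>b<p + q. g b) = (\<Sum>b<p. g b) + (\<Sum>i<q. g (p + i))"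
  by (induction q) (auto simp: add.assoc)

text \<open>The positive part of one cosine profile is sampled at spacing 1/2 on the left and at the
  integers \<open>-P..P\<close> on the right. The profile decreases away from 0, so a half-integer
  sample is at most its integer neighbour nearer to 0. Each integer sample is thus used at most
  twice, except the peak, which is used three times; hence the extra
  \<open>\<Lambda>\<close>.\<close>

lemma hat_function_sum:
  fixes L P :: nat
  assumes P: "2 * P \<le> L" and L: "0 < L"
  defines "\<Lambda> \<equiv> 2 - 2 * cos (2 * pi * real P / real L)"
  shows "(\<Sum>t<2 * L. max 0 (\<Lambda> - (2 - 2 * cos (2 * pi * real t / real (2 * L)))))
    \<le> 2 * (\<Sum>b<2 * P + 1. \<Lambda> - (2 - 2 * cos (2 * pi * (real b - real P) / real L))) + \<Lambda>"
proof -
  define f where "f = (\<lambda>x::real. \<Lambda> - (2 - 2 * cos (2 * pi * x / real L)))"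
  define g where "g = (\<lambda>t::nat. max 0 (f (real t / 2)))"
  have fm: "f (-x) = f x" for x by (simp add: f_def)
  have mono: "f y \<le> f x" if "0 \<le> x" "x \<le> y" "2 * y \<le> real L" for x y
  proof -
    have "2 * pi * y / real L \<le> pi"
      using that L mult_left_mono[OF that(3), of pi] by (simp add: field_simps)
    moreover have "2 * pi * x / real L \<le> 2 * pi * y / real L"
      using that L by (simp add: divide_right_mono)
    ultimately have "cos (2 * pi * y / real L) \<le> cos (2 * pi * x / real L)"
      using that by (intro cos_monotone_0_pi_le) auto
    thus ?thesis by (simp add: f_def)
  qed
  have fP: "f (real P) = 0" and f0: "f 0 = \<Lambda>" by (simp_all add: f_def \<Lambda>_def)
  have \<Lambda>0: "\<Lambda> \<ge> 0" by (simp add: \<Lambda>_def)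
  have gsym: "g (2 * L - t) = g t" if "t \<le> 2 * L" for t
  proof -
    have "2 * pi * (real (2 * L - t) / 2) / real L = 2 * pi - 2 * pi * (real t / 2) / real L"
      using L that by (simp add: field_simps of_nat_diff)
    hence "cos (2 * pi * (real (2 * L - t) / 2) / real L) = cos (2 * pi * (real t / 2) / real L)"
      by (simp only: cos_2pi_minus)
    thus ?thesis by (simp only: g_def f_def)
  qed
  have g0: "g t = 0" if "2 * P \<le> t" "t \<le> 2 * L - 2 * P" for t
  proof (cases "t \<le> L")
    case True
    have "f (real t / 2) \<le> f (real P)" by (rule mono) (use that True in auto)
    thus ?thesis by (simp add: g_def fP)
  next
    case False
    have "f (real (2 * L - t) / 2) \<le> f (real P)"
      by (rule mono) (use that False P in auto)
    hence "g (2 * L - t) = 0" by (simp add: g_def fP)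
    thus ?thesis using gsym[of t] that by simp
  qed
  define H where "H = (\<Sum>i<P. f (real i))"
  have shift: "(\<Sum>i<P. f (real (Suc i))) = H - \<Lambda>"
  proof -
    have "(\<Sum>i<Suc P. f (real i)) = f (real 0) + (\<Sum>i<P. f (real (Suc i)))" by (rule sum.lessThan_Suc_shift)
    thus ?thesis by (simp add: H_def fP f0)
  qed
  have S: "(\<Sum>b<2 * P + 1. f (real b - real P)) = 2 * H - \<Lambda>"
  proof -
    have "2 * P + 1 = P + Suc P" by simp
    hence "(\<Sum>b<2 * P + 1. f (real b - real P)) = (\<Sum>b<P. f (real b - real P)) + (\<Sum>i<Suc P. f (real (P + i) - real P))"
      by (simp only: sum_lessThan_add)
    also have "(\<Sum>i<Suc P. f (real (P + i) - real P)) = (\<Sum>i<Suc P. f (real i))" by simp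
    also have "\<dots> = \<Lambda> + (H - \<Lambda>)"
      unfolding shift[symmetric] by (subst sum.lessThan_Suc_shift) (simp add: f0)
    also have "(\<Sum>b<P. f (real b - real P)) = (\<Sum>i<P. f (real (P - Suc i) - real P))"
      by (rule sum.nat_diff_reindex[symmetric])
    also have "\<dots> = (\<Sum>i<P. f (real (Suc i)))"
    proof (rule sum.cong[OF refl])
      fix i assume "i \<in> {..<P}"
      hence "real (P - Suc i) - real P = - real (Suc i)" by (simp add: of_nat_diff)
      thus "f (real (P - Suc i) - real P) = f (real (Suc i))" by (simp only: fm)
    qed
    finally show ?thesis unfolding shift by linarith
  qed
  have G: "(\<Sum>t<2 * L. g t) \<le> 4 * H - \<Lambda>"
  proof (cases "P = 0")
    case True
    have "(\<Sum>t<2 * L. g t) = 0" by (rule sum.neutral) (use g0 True in auto)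
    moreover have "H = 0" "\<Lambda> = 0" using True by (auto simp: H_def \<Lambda>_def)
    ultimately show ?thesis by simp
  next
    case False
    have sub: "{..<2 * L} = {..<2 * P} \<union> {2 * P..2 * L - 2 * P} \<union> {2 * L - 2 * P<..<2 * L}"
      using P L False by auto
    have "(\<Sum>t<2 * L. g t) \<le> (\<Sum>t<2 * P. g t) + (\<Sum>t=2 * P..2 * L - 2 * P. g t) + (\<Sum>t\<in>{2 * L - 2 * P<..<2 * L}. g t)"
    proof -
      have nn: "g t \<ge> 0" for t by (simp add: g_def)
      have "(\<Sum>t\<in>B \<union> B'. g t) \<le> (\<Sum>t\<in>B. g t) + (\<Sum>t\<in>B'. g t)" if "finite B" "finite B'" for B B'
        using sum.union_inter[OF that, of g] sum_nonneg[of "B \<inter> B'" g] nn by auto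
      from this[of "{..<2 * P} \<union> {2 * P..2 * L - 2 * P}" "{2 * L - 2 * P<..<2 * L}"]
           this[of "{..<2 * P}" "{2 * P..2 * L - 2 * P}"]
      show ?thesis unfolding sub by auto
    qed
    also have "(\<Sum>t=2 * P..2 * L - 2 * P. g t) = 0" by (rule sum.neutral) (use g0 in auto)
    also have "(\<Sum>t\<in>{2 * L - 2 * P<..<2 * L}. g t) = (\<Sum>t\<in>{1..<2 * P}. g t)"
      by (rule sum.reindex_bij_witness[of _ "\<lambda>t. 2 * L - t" "\<lambda>t. 2 * L - t"])
         (use P gsym in auto)
    also have "(\<Sum>t\<in>{1..<2 * P}. g t) = (\<Sum>t<2 * P. g t) - \<Lambda>"
    proof -
      have "{..<2 * P} = insert 0 {1..<2 * P}" using False by auto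
      hence "(\<Sum>t<2 * P. g t) = g 0 + (\<Sum>t\<in>{1..<2 * P}. g t)" by simp
      thus ?thesis using \<Lambda>0 by (simp add: g_def f0)
    qed
    also have "(\<Sum>t<2 * P. g t) \<le> 2 * H"
    proof -
      have "(\<Sum>t<2 * P. g t) = (\<Sum>i<P. g (2 * i) + g (Suc (2 * i)))" by (rule sum_double_range)
      also have "\<dots> \<le> (\<Sum>i<P. 2 * f (real i))"
      proof (rule sum_mono)
        fix i assume i: "i \<in> {..<P}"
        have 1: "f (real (Suc (2 * i)) / 2) \<le> f (real i)" by (rule mono) (use i P in auto)
        have "f (real P) \<le> f (real i)" by (rule mono) (use i P in auto)
        thus "g (2 * i) + g (Suc (2 * i)) \<le> 2 * f (real i)" using 1 by (simp add: g_def fP)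
      qed
      finally show ?thesis by (simp add: H_def sum_distrib_left)
    qed
    finally show ?thesis by simp
  qed
  have "(\<Sum>t<2 * L. max 0 (\<Lambda> - (2 - 2 * cos (2 * pi * real t / real (2 * L))))) = (\<Sum>t<2 * L. g t)"
    by (simp add: g_def f_def field_simps)
  moreover have "(\<Sum>b<2 * P + 1. \<Lambda> - (2 - 2 * cos (2 * pi * (real b - real P) / real L))) = 2 * H - \<Lambda>"
    using S by (simp only: f_def)
  ultimately show ?thesis using G by simp
qed

lemma sum_blocks:
  fixes F :: "nat \<Rightarrow> 'a :: comm_monoid_add"
  shows "(\<Sum>b<D * P. F b) = (\<Sum>j<D. \<Sum>l<P. F (j * P + l))"
proof (induction D)
  case (Suc D)
  have "Suc D * P = D * P + P" by simp
  thus ?case using Suc by (simp only: sum_lessThan_add sum.lessThan_Suc)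
qed simp

lemma sum_mod_blocks:
  fixes h :: "nat \<Rightarrow> real"
  shows "(\<Sum>i<D * P. h (i mod P)) = real D * (\<Sum>b<P. h b)"
  unfolding sum_blocks by simp

text \<open>
  Landau--Pollak type counting: \<open>N = D (2 P + 1)\<close> vectors that are frequency-limited to
  \<open>2 P + 1\<close> of \<open>L\<close> frequencies, and essentially time-limited to \<open>{lo..hi}\<close>, cannot have
  their mass carried by fewer than about \<open>D\<close> components. The trace of the shift in an
  orthonormal basis is computed from its eigenvalues \<open>\<omega>\<close>.
\<close>

lemma time_frequency_count:
  fixes x :: "nat \<Rightarrow> nat \<times> complex \<Rightarrow> complex" and C A :: "complex set"
    and D P L T lo hi :: nat and e2 \<xi> c1 q c2 c3 :: real
  defines "\<omega> \<equiv> \<lambda>b. cis (2 * pi * (real (b mod (2 * P + 1)) - real P) / real L)"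
    and "N \<equiv> D * (2 * P + 1)" and "X \<equiv> {..T} \<times> C"
  defines "comb \<equiv> \<lambda>\<alpha> z. \<Sum>b<N. \<alpha> b * x b z"
  defines "\<Lambda> \<equiv> 2 - 2 * cos (2 * pi * real P / real L)"
  defines "h \<equiv> \<lambda>b. 2 - 2 * cos (2 * pi * (real b - real P) / real L)"
  assumes C: "finite C" "\<And>\<zeta>. \<zeta> \<in> C \<Longrightarrow> cmod \<zeta> = 1" and A: "A \<subseteq> C"
    and lohi: "lo \<le> hi" "hi \<le> T" "hi - lo + 2 \<le> 2 * L" and PL: "2 * P \<le> L" "0 < L"
    and indep: "\<And>\<alpha>. (\<exists>i<N. \<alpha> i \<noteq> 0) \<Longrightarrow> 0 < nsq X (comb \<alpha>)"
    and shift: "\<And>\<alpha>. nsq X (comb (\<lambda>b. \<alpha> b * \<omega> b)) \<le> (1 + e2) * nsq X (comb \<alpha>)"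
    and diff: "\<And>\<alpha>. (\<Sum>k\<in>{lo..<hi}. \<Sum>\<zeta>\<in>A. (cmod (comb \<alpha> (k, \<zeta>) - \<zeta> * comb \<alpha> (Suc k, \<zeta>)))\<^sup>2)
        \<le> (1 + \<xi>) * nsq X (comb (\<lambda>b. \<alpha> b * (1 - \<omega> b))) + c1 * nsq X (comb \<alpha>)"
    and tail: "\<And>\<alpha>. nsq (({..T} - {lo..hi}) \<times> C) (comb \<alpha>) \<le> q * nsq X (comb \<alpha>)"
    and regular: "\<And>\<alpha> b. b \<in> C - A \<Longrightarrow> (\<Sum>k\<le>T. (cmod (comb \<alpha> (k, b)))\<^sup>2)
        \<le> c2 * nsq X (comb (\<lambda>b. \<alpha> b * (1 - \<omega> b))) + c3 * nsq X (comb \<alpha>)"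
    and nn: "0 \<le> \<xi>" "0 \<le> c2" "0 \<le> c3" "0 \<le> e2"
  shows "\<Lambda> * (real N * (1 - q - real (card C) * (c2 * (\<Lambda> + e2) + c3)))
      - (1 + \<xi>) * (real D * (\<Sum>b<2 * P + 1. h b) + e2 * real N) - c1 * real N - 2 * real (card A)
    \<le> real (card A) * real (hi - lo + 1) / real (2 * L) * (2 * (\<Sum>b<2 * P + 1. \<Lambda> - h b) + \<Lambda>)"
proof -
  have finX: "finite X" using C by (simp add: X_def)
  have finA: "finite A" using A C finite_subset by blast
  obtain t u where u: "\<And>i. u i = comb (t i)"
    and unit: "\<And>i. i < N \<Longrightarrow> nsq X (u i) = 1"
    and orth: "\<And>i j. i < N \<Longrightarrow> j < N \<Longrightarrow> i \<noteq> j \<Longrightarrow> cip X (u i) (u j) = 0"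
    and diag: "\<And>i. i < N \<Longrightarrow> cip X (comb (\<lambda>b. t i b * \<omega> b)) (u i) = \<omega> i"
  proof (rule gram_schmidt_triangular[of X N x, OF finX indep[unfolded comb_def]])
    fix t u
    assume *: "\<And>i. u i = (\<lambda>z. \<Sum>b<N. t i b * x b z)"
      "\<And>i. i < N \<Longrightarrow> nsq X (u i) = 1"
      "\<And>i j. i < N \<Longrightarrow> j < N \<Longrightarrow> i \<noteq> j \<Longrightarrow> cip X (u i) (u j) = 0"
      "\<And>i \<mu>. i < N \<Longrightarrow> cip X (\<lambda>z. \<Sum>b<N. t i b * \<mu> b * x b z) (u i) = \<mu> i"
    show thesis by (rule that[of u t]) (use * in \<open>auto simp: comb_def\<close>)
  qed auto
  note bessel = bessel_inequality[OF finX unit orth]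
  have h_le: "h b \<le> \<Lambda>" if "b < 2 * P + 1" for b
  proof -
    have le: "\<bar>real b - real P\<bar> \<le> real P" using that by auto
    have eq: "cos (2 * pi * (real b - real P) / real L) = cos (2 * pi * \<bar>real b - real P\<bar> / real L)"
      by (cases "real b - real P \<ge> 0") (simp_all add: abs_if, metis cos_minus minus_diff_eq minus_divide_left mult_minus_right)
    have "2 * pi * real P / real L \<le> pi"
      using PL by (simp add: field_simps)
    moreover have "2 * pi * \<bar>real b - real P\<bar> / real L \<le> 2 * pi * real P / real L"
      using le PL by (simp add: divide_right_mono)
    ultimately have "cos (2 * pi * real P / real L) \<le> cos (2 * pi * \<bar>real b - real P\<bar> / real L)"
      by (intro cos_monotone_0_pi_le) auto
    thus ?thesis by (simp add: h_def \<Lambda>_def eq)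
  qed
  have \<Lambda>0: "\<Lambda> \<ge> 0" by (simp add: \<Lambda>_def)
  define H where "H = (\<Sum>b<2 * P + 1. h b)"
  define Z where "Z = real D * H + e2 * real N"
  \<comment> \<open>The modulation has diagonal entry \<open>\<omega> i\<close>, so expanding the
    square leaves \<open>1 - 2 * Re (\<omega> i) + (1 + e2)\<close>, which is
    \<open>h + e2\<close>.\<close>
  have E: "nsq X (comb (\<lambda>b. t i b * (1 - \<omega> b))) \<le> h (i mod (2 * P + 1)) + e2" if i: "i < N" for i
  proof -
    have "comb (\<lambda>b. t i b * (1 - \<omega> b)) = (\<lambda>z. u i z - comb (\<lambda>b. t i b * \<omega> b) z)"
      by (rule ext) (simp add: u comb_def algebra_simps sum_subtractf)
    hence "nsq X (comb (\<lambda>b. t i b * (1 - \<omega> b))) =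
       nsq X (u i) - 2 * Re (cip X (u i) (comb (\<lambda>b. t i b * \<omega> b))) + nsq X (comb (\<lambda>b. t i b * \<omega> b))"
      by (simp only: nsq_diff)
    also have "Re (cip X (u i) (comb (\<lambda>b. t i b * \<omega> b))) = Re (\<omega> i)"
      using diag[OF i] cip_commute[of X "u i" "comb (\<lambda>b. t i b * \<omega> b)"] by simp
    also have "nsq X (comb (\<lambda>b. t i b * \<omega> b)) \<le> (1 + e2) * nsq X (u i)"
      using shift[of "t i"] by (simp add: u)
    finally show ?thesis using unit[OF i] by (simp add: h_def \<omega>_def)
  qed
  have EZ: "(\<Sum>i<N. nsq X (comb (\<lambda>b. t i b * (1 - \<omega> b)))) \<le> Z"
  proof -
    have "(\<Sum>i<N. nsq X (comb (\<lambda>b. t i b * (1 - \<omega> b)))) \<le> (\<Sum>i<N. h (i mod (2 * P + 1)) + e2)"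
      by (rule sum_mono) (use E in auto)
    also have "\<dots> = real D * H + e2 * real N"
      unfolding sum.distrib N_def sum_mod_blocks H_def by simp
    finally show ?thesis by (simp add: Z_def)
  qed
  have H_le: "real D * H \<le> \<Lambda> * real N"
  proof -
    have "H \<le> (\<Sum>b<2 * P + 1. \<Lambda>)" unfolding H_def by (rule sum_mono) (use h_le in auto)
    hence "real D * H \<le> real D * (real (2 * P + 1) * \<Lambda>)" by (intro mult_left_mono) auto
    thus ?thesis by (simp add: N_def algebra_simps)
  qed
  have Z_le: "Z \<le> (\<Lambda> + e2) * real N" using H_le by (simp add: Z_def algebra_simps)
  define W where "W = {lo..hi}"
  \<comment> \<open>The part of the \<open>N\<close> unit vectors that lies in the window and in the
    components \<open>A\<close>. It is bounded below by removing tails and regular components, and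
    above, weighted by \<open>\<Lambda>\<close>, through the Fourier transform.\<close>
  define mass where "mass = (\<Sum>i<N. \<Sum>a\<in>A. \<Sum>k\<in>W. (cmod (u i (k, a)))\<^sup>2)"
  have mass_ge: "real N * (1 - q - real (card C) * (c2 * (\<Lambda> + e2) + c3)) \<le> mass"
  proof -
    have one: "1 \<le> (\<Sum>a\<in>A. \<Sum>k\<in>W. (cmod (u i (k, a)))\<^sup>2) + q +
        (\<Sum>b\<in>C - A. c2 * nsq X (comb (\<lambda>b. t i b * (1 - \<omega> b))) + c3)" if i: "i < N" for i
    proof -
      let ?n = "\<lambda>z. (cmod (u i z))\<^sup>2"
      have sub: "X \<subseteq> W \<times> A \<union> ({..T} - {lo..hi}) \<times> C \<union> {..T} \<times> (C - A)"
        unfolding X_def W_def by auto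
      have fin: "finite (W \<times> A)" "finite (({..T} - {lo..hi}) \<times> C)" "finite ({..T} \<times> (C - A))"
        using finA C by (auto simp: W_def)
      have un: "sum ?n (B \<union> B') \<le> sum ?n B + sum ?n B'" if "finite B" "finite B'" for B B'
        using sum.union_inter[OF that, of ?n] sum_nonneg[of "B \<inter> B'" ?n] by auto
      have "1 = sum ?n X" using unit[OF i] by (simp add: nsq_def)
      also have "\<dots> \<le> sum ?n (W \<times> A \<union> ({..T} - {lo..hi}) \<times> C \<union> {..T} \<times> (C - A))"
        by (rule sum_mono2) (use sub fin in auto)
      also have "\<dots> \<le> sum ?n (W \<times> A) + sum ?n (({..T} - {lo..hi}) \<times> C) + sum ?n ({..T} \<times> (C - A))"
        using un[of "W \<times> A \<union> ({..T} - {lo..hi}) \<times> C" "{..T} \<times> (C - A)"]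
              un[of "W \<times> A" "({..T} - {lo..hi}) \<times> C"] fin by auto
      also have "sum ?n (W \<times> A) = (\<Sum>a\<in>A. \<Sum>k\<in>W. ?n (k, a))"
        by (subst sum.swap) (simp add: sum.cartesian_product)
      also have "sum ?n (({..T} - {lo..hi}) \<times> C) \<le> q"
        using tail[of "t i"] unit[OF i] by (simp add: nsq_def u)
      also have "sum ?n ({..T} \<times> (C - A)) = (\<Sum>b\<in>C - A. \<Sum>k\<le>T. ?n (k, b))"
        by (subst sum.swap) (simp add: sum.cartesian_product)
      also have "\<dots> \<le> (\<Sum>b\<in>C - A. c2 * nsq X (comb (\<lambda>b. t i b * (1 - \<omega> b))) + c3)"
        by (rule sum_mono) (use regular[of _ "t i"] unit[OF i] in \<open>simp add: u\<close>)
      finally show ?thesis by simp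
    qed
    have "real N \<le> (\<Sum>i<N. (\<Sum>a\<in>A. \<Sum>k\<in>W. (cmod (u i (k, a)))\<^sup>2) + q +
        (\<Sum>b\<in>C - A. c2 * nsq X (comb (\<lambda>b. t i b * (1 - \<omega> b))) + c3))"
      using sum_mono[of "{..<N}" "\<lambda>_. 1::real"] one by fastforce
    also have "\<dots> = mass + q * real N + real (card (C - A)) *
        (c2 * (\<Sum>i<N. nsq X (comb (\<lambda>b. t i b * (1 - \<omega> b)))) + c3 * real N)"
      by (simp add: sum.distrib mass_def sum_distrib_left algebra_simps)
    also have "\<dots> \<le> mass + q * real N + real (card C) * (c2 * ((\<Lambda> + e2) * real N) + c3 * real N)"
    proof -
      have "real (card (C - A)) * (c2 * (\<Sum>i<N. nsq X (comb (\<lambda>b. t i b * (1 - \<omega> b)))) + c3 * real N)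
          \<le> real (card C) * (c2 * ((\<Lambda> + e2) * real N) + c3 * real N)"
      proof (rule mult_mono)
        show "c2 * (\<Sum>i<N. nsq X (comb (\<lambda>b. t i b * (1 - \<omega> b)))) + c3 * real N \<le> c2 * ((\<Lambda> + e2) * real N) + c3 * real N"
          using mult_left_mono[OF order_trans[OF EZ Z_le] nn(2)] by simp
        show "real (card (C - A)) \<le> real (card C)" using C by (simp add: card_mono)
        show "0 \<le> c2 * (\<Sum>i<N. nsq X (comb (\<lambda>b. t i b * (1 - \<omega> b)))) + c3 * real N"
          using nn by (intro add_nonneg_nonneg mult_nonneg_nonneg sum_nonneg nsq_nonneg) auto
      qed simp
      thus ?thesis by simp
    qed
    finally show ?thesis by (simp add: algebra_simps)
  qed
  \<comment> \<open>The window of \<open>n + 1\<close> times and its zero-extended difference of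
    \<open>n + 2\<close> entries both fit into the period \<open>2 * L\<close> without wrapping
    around.\<close>
  define K where "K = 2 * L"
  define n where "n = hi - lo"
  have nK: "Suc n < K" using lohi by (simp add: K_def n_def)
  \<comment> \<open>The twist by \<open>a ^ k\<close> turns the rotating difference into an ordinary
    one, up to a unimodular factor and sign.\<close>
  define F where "F = (\<lambda>i a k. if k \<le> n then u i (lo + k, a) * a ^ k else 0)"
  define e where "e = (\<lambda>t k. cis (2 * pi * real t * real k / real K))"
  define G where "G = (\<lambda>i a t. \<Sum>k<K. F i a k * e t k)"
  have norm_a: "cmod a = 1" if "a \<in> A" for a using that A C by auto
  have reidx: "(\<Sum>k\<in>W. g k) = (\<Sum>k\<le>n. g (lo + k))" for g :: "nat \<Rightarrow> real"
    by (rule sum.reindex_bij_witness[of _ "\<lambda>k. lo + k" "\<lambda>k. k - lo"]) (use lohi in \<open>auto simp: W_def n_def\<close>)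
  have mass_F: "(\<Sum>t<K. (cmod (G i a t))\<^sup>2) = real K * (\<Sum>k\<in>W. (cmod (u i (k, a)))\<^sup>2)" if a: "a \<in> A" for i a
  proof -
    have "(\<Sum>t<K. (cmod (G i a t))\<^sup>2) = real K * (\<Sum>k<K. (cmod (F i a k))\<^sup>2)"
      unfolding G_def e_def by (rule discrete_parseval)
    also have "(\<Sum>k<K. (cmod (F i a k))\<^sup>2) = (\<Sum>k\<le>n. (cmod (F i a k))\<^sup>2)"
      by (rule sum.mono_neutral_right) (use nK in \<open>auto simp: F_def\<close>)
    also have "\<dots> = (\<Sum>k\<in>W. (cmod (u i (k, a)))\<^sup>2)"
      unfolding reidx by (rule sum.cong) (simp_all add: F_def norm_mult norm_power norm_a a)
    finally show ?thesis .
  qed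
  \<comment> \<open>Cutting the window off makes the two end values appear as differences with
    0.\<close>
  have diff_F: "(\<Sum>t<K. (cmod (1 - e t 1))\<^sup>2 * (cmod (G i a t))\<^sup>2) = real K *
      ((cmod (u i (lo, a)))\<^sup>2 + (\<Sum>k\<in>{lo..<hi}. (cmod (u i (k, a) - a * u i (Suc k, a)))\<^sup>2) + (cmod (u i (hi, a)))\<^sup>2)"
    if a: "a \<in> A" for i a
  proof -
    define F' where "F' = (\<lambda>k. if k = 0 then F i a 0 else F i a k - F i a (k - 1))"
    have "(1 - e t 1) * G i a t = (\<Sum>k<K. F' k * e t k)" for t
    proof -
      obtain K' where K': "K = Suc K'" using nK by (cases K) auto
      have last: "F i a K' = 0" using nK K' by (simp add: F_def)
      have e1: "e t 1 * e t k = e t (Suc k)" for k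
        by (simp add: e_def cis_mult add_divide_distrib[symmetric] algebra_simps)
      have "e t 1 * G i a t = (\<Sum>k<K. F i a k * e t (Suc k))"
        unfolding G_def sum_distrib_left by (rule sum.cong[OF refl], subst e1[symmetric]) (rule mult.left_commute)
      also have "\<dots> = (\<Sum>k<K'. F i a k * e t (Suc k))" using last by (simp add: K')
      also have "\<dots> = (\<Sum>k<K. (if k = 0 then 0 else F i a (k - 1)) * e t k)"
        unfolding K' by (subst sum.lessThan_Suc_shift) simp
      finally have "(1 - e t 1) * G i a t = G i a t - (\<Sum>k<K. (if k = 0 then 0 else F i a (k - 1)) * e t k)"
        by (simp add: algebra_simps)
      also have "\<dots> = (\<Sum>k<K. F' k * e t k)"
        unfolding G_def sum_subtractf[symmetric] by (rule sum.cong) (auto simp: F'_def algebra_simps)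
      finally show ?thesis .
    qed
    hence "(\<Sum>t<K. (cmod (1 - e t 1))\<^sup>2 * (cmod (G i a t))\<^sup>2) = (\<Sum>t<K. (cmod (\<Sum>k<K. F' k * e t k))\<^sup>2)"
      by (metis (no_types, lifting) norm_mult power_mult_distrib)
    also have "\<dots> = real K * (\<Sum>k<K. (cmod (F' k))\<^sup>2)" unfolding e_def by (rule discrete_parseval)
    also have "(\<Sum>k<K. (cmod (F' k))\<^sup>2) = (\<Sum>k<Suc (Suc n). (cmod (F' k))\<^sup>2)"
      by (rule sum.mono_neutral_right) (use nK in \<open>auto simp: F_def F'_def\<close>)
    also have "\<dots> = (cmod (F' 0))\<^sup>2 + ((\<Sum>k<n. (cmod (F' (Suc k)))\<^sup>2) + (cmod (F' (Suc n)))\<^sup>2)"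
      by (subst sum.lessThan_Suc_shift) simp
    also have "(\<Sum>k<n. (cmod (F' (Suc k)))\<^sup>2) = (\<Sum>k\<in>{lo..<hi}. (cmod (u i (k, a) - a * u i (Suc k, a)))\<^sup>2)"
    proof (rule sum.reindex_bij_witness[of _ "\<lambda>k. k - lo" "\<lambda>k. lo + k"])
      fix k assume "k \<in> {..<n}"
      hence "F' (Suc k) = - (a ^ k * (u i (lo + k, a) - a * u i (Suc (lo + k), a)))"
        by (simp add: F'_def F_def algebra_simps)
      thus "(cmod (u i (lo + k, a) - a * u i (Suc (lo + k), a)))\<^sup>2 = (cmod (F' (Suc k)))\<^sup>2"
        by (simp add: norm_mult norm_power norm_a a)
    qed (auto simp: n_def)
    also have "cmod (F' 0) = cmod (u i (lo, a))" by (simp add: F'_def F_def)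
    also have "cmod (F' (Suc n)) = cmod (u i (hi, a))"
      using lohi by (simp add: F'_def F_def norm_mult norm_power norm_a a n_def)
    finally show ?thesis by (simp add: add.assoc)
  qed
  \<comment> \<open>Bessel's inequality against a point mass: the \<open>N\<close> vectors together
    put at most 1 on each point, so the end values cost only \<open>2 * card A\<close> instead of a
    multiple of \<open>N\<close>.\<close>
  have point: "(\<Sum>i<N. (cmod (u i z))\<^sup>2) \<le> 1" if z: "z \<in> X" for z
  proof -
    have "cip X (\<lambda>y. if y = z then 1 else 0) (u i) = cnj (u i z)" for i
    proof -
      have "cip X (\<lambda>y. if y = z then 1 else 0) (u i) = (\<Sum>y\<in>X. if y = z then cnj (u i z) else 0)"
        unfolding cip_def by (rule sum.cong) auto
      thus ?thesis using z finX by simp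
    qed
    moreover have "nsq X (\<lambda>y. if y = z then 1 else 0) = 1"
    proof -
      have "nsq X (\<lambda>y. if y = z then 1 else 0) = (\<Sum>y\<in>X. if y = z then 1 else 0)"
        unfolding nsq_def by (rule sum.cong) auto
      thus ?thesis using z finX by simp
    qed
    ultimately show ?thesis using bessel[of N "\<lambda>i. i" "\<lambda>y. if y = z then 1 else 0"] by (simp del: if_distrib)
  qed
  \<comment> \<open>The same against a pure exponential on the window, of square norm
    \<open>n + 1\<close>: this limits how much the \<open>N\<close> vectors can jointly put on one
    frequency of one component.\<close>
  have G_bound: "(\<Sum>i<N. (cmod (G i a t))\<^sup>2) \<le> real (n + 1)" if a: "a \<in> A" for a t
  proof -
    define g where "g = (\<lambda>z. if snd z = a \<and> lo \<le> fst z \<and> fst z \<le> hi then cnj (a ^ (fst z - lo) * e t (fst z - lo)) else 0)"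
    have WX: "(\<lambda>k. (k, a)) ` W \<subseteq> X" using a A lohi by (auto simp: X_def W_def)
    have inj: "inj_on (\<lambda>k. (k, a)) W" by (simp add: inj_on_def)
    have "cip X (u i) g = G i a t" for i
    proof -
      have "cip X (u i) g = (\<Sum>z\<in>(\<lambda>k. (k, a)) ` W. u i z * cnj (g z))"
        unfolding cip_def by (rule sum.mono_neutral_right) (use finX WX in \<open>auto simp: g_def W_def\<close>)
      also have "\<dots> = (\<Sum>k\<in>W. u i (k, a) * (a ^ (k - lo) * e t (k - lo)))"
        by (subst sum.reindex[OF inj]) (auto simp: g_def W_def)
      also have "\<dots> = (\<Sum>k\<le>n. u i (lo + k, a) * (a ^ k * e t k))"
        by (rule sum.reindex_bij_witness[of _ "\<lambda>k. lo + k" "\<lambda>k. k - lo"]) (use lohi in \<open>auto simp: W_def n_def\<close>)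
      also have "\<dots> = (\<Sum>k\<le>n. F i a k * e t k)" by (rule sum.cong) (auto simp: F_def)
      also have "\<dots> = G i a t"
        unfolding G_def by (rule sum.mono_neutral_left) (use nK in \<open>auto simp: F_def\<close>)
      finally show ?thesis .
    qed
    hence "cmod (cip X g (u i)) = cmod (G i a t)" for i using cip_commute[of X g "u i"] by simp
    moreover have "nsq X g = real (n + 1)"
    proof -
      have "nsq X g = (\<Sum>z\<in>(\<lambda>k. (k, a)) ` W. (cmod (g z))\<^sup>2)"
        unfolding nsq_def by (rule sum.mono_neutral_right) (use finX WX in \<open>auto simp: g_def W_def\<close>)
      also have "\<dots> = (\<Sum>k\<in>W. (cmod (g (k, a)))\<^sup>2)" by (subst sum.reindex[OF inj]) simp
      also have "\<dots> = (\<Sum>k\<in>W. 1)"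
        by (rule sum.cong) (auto simp: g_def W_def norm_mult norm_power norm_a a e_def)
      finally show ?thesis using lohi by (simp add: W_def n_def)
    qed
    ultimately show ?thesis using bessel[of N "\<lambda>i. i" g] by simp
  qed
  define \<eta> where "\<eta> = (\<lambda>t. (cmod (1 - e t 1))\<^sup>2)"
  have \<eta>_eq: "\<eta> t = 2 - 2 * cos (2 * pi * real t / real (2 * L))" for t
    by (simp add: \<eta>_def e_def norm_one_minus_cis K_def)
  define B where "B = (\<Sum>i<N. \<Sum>a\<in>A. \<Sum>k\<in>{lo..<hi}. (cmod (u i (k, a) - a * u i (Suc k, a)))\<^sup>2)"
  have B_le: "B \<le> (1 + \<xi>) * Z + c1 * real N"
  proof -
    have "B \<le> (\<Sum>i<N. (1 + \<xi>) * nsq X (comb (\<lambda>b. t i b * (1 - \<omega> b))) + c1)"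
      unfolding B_def
    proof (rule sum_mono)
      fix i assume i: "i \<in> {..<N}"
      have "(\<Sum>a\<in>A. \<Sum>k\<in>{lo..<hi}. (cmod (u i (k, a) - a * u i (Suc k, a)))\<^sup>2)
          = (\<Sum>k\<in>{lo..<hi}. \<Sum>a\<in>A. (cmod (u i (k, a) - a * u i (Suc k, a)))\<^sup>2)" by (rule sum.swap)
      also have "\<dots> \<le> (1 + \<xi>) * nsq X (comb (\<lambda>b. t i b * (1 - \<omega> b))) + c1"
        using diff[of "t i"] unit[of i] i by (simp add: u)
      finally show "(\<Sum>a\<in>A. \<Sum>k\<in>{lo..<hi}. (cmod (u i (k, a) - a * u i (Suc k, a)))\<^sup>2)
         \<le> (1 + \<xi>) * nsq X (comb (\<lambda>b. t i b * (1 - \<omega> b))) + c1" .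
    qed
    also have "\<dots> = (1 + \<xi>) * (\<Sum>i<N. nsq X (comb (\<lambda>b. t i b * (1 - \<omega> b)))) + c1 * real N"
      by (simp add: sum.distrib sum_distrib_left)
    also have "\<dots> \<le> (1 + \<xi>) * Z + c1 * real N" using EZ nn by (intro add_right_mono mult_left_mono) auto
    finally show ?thesis .
  qed
  have ends: "(\<Sum>i<N. \<Sum>a\<in>A. (cmod (u i (lo, a)))\<^sup>2 + (cmod (u i (hi, a)))\<^sup>2) \<le> 2 * real (card A)"
  proof -
    have "(\<Sum>i<N. \<Sum>a\<in>A. (cmod (u i (lo, a)))\<^sup>2 + (cmod (u i (hi, a)))\<^sup>2)
       = (\<Sum>a\<in>A. (\<Sum>i<N. (cmod (u i (lo, a)))\<^sup>2) + (\<Sum>i<N. (cmod (u i (hi, a)))\<^sup>2))"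
      by (subst sum.swap) (simp add: sum.distrib)
    also have "\<dots> \<le> (\<Sum>a\<in>A. 1 + 1)"
      by (intro sum_mono add_mono point) (use A lohi in \<open>auto simp: X_def\<close>)
    finally show ?thesis by simp
  qed
  \<comment> \<open>By Parseval both the mass and the difference energy become sums over
    frequencies, the latter with multiplier \<open>\<eta>\<close>. Only frequencies with
    \<open>\<eta> t < \<Lambda>\<close> count positively; the others are dropped next.\<close>
  have "real K * (\<Lambda> * mass - (B + (\<Sum>i<N. \<Sum>a\<in>A. (cmod (u i (lo, a)))\<^sup>2 + (cmod (u i (hi, a)))\<^sup>2)))
     = (\<Sum>i<N. \<Sum>a\<in>A. \<Sum>t<K. (\<Lambda> - \<eta> t) * (cmod (G i a t))\<^sup>2)"
  proof -
    have "(\<Sum>t<K. (\<Lambda> - \<eta> t) * (cmod (G i a t))\<^sup>2) = real K * (\<Lambda> * (\<Sum>k\<in>W. (cmod (u i (k, a)))\<^sup>2)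
        - ((\<Sum>k\<in>{lo..<hi}. (cmod (u i (k, a) - a * u i (Suc k, a)))\<^sup>2) + ((cmod (u i (lo, a)))\<^sup>2 + (cmod (u i (hi, a)))\<^sup>2)))"
      if "a \<in> A" for i a
      using mass_F[OF that, of i] diff_F[OF that, of i]
      by (simp add: \<eta>_def left_diff_distrib sum_subtractf sum_distrib_left[symmetric] algebra_simps)
    hence "(\<Sum>i<N. \<Sum>a\<in>A. \<Sum>t<K. (\<Lambda> - \<eta> t) * (cmod (G i a t))\<^sup>2) = (\<Sum>i<N. \<Sum>a\<in>A. real K * (\<Lambda> * (\<Sum>k\<in>W. (cmod (u i (k, a)))\<^sup>2)
        - ((\<Sum>k\<in>{lo..<hi}. (cmod (u i (k, a) - a * u i (Suc k, a)))\<^sup>2) + ((cmod (u i (lo, a)))\<^sup>2 + (cmod (u i (hi, a)))\<^sup>2))))"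
      by (intro sum.cong refl) auto
    also have "\<dots> = real K * (\<Lambda> * mass - (B + (\<Sum>i<N. \<Sum>a\<in>A. (cmod (u i (lo, a)))\<^sup>2 + (cmod (u i (hi, a)))\<^sup>2)))"
      unfolding sum_distrib_left[symmetric] sum_subtractf sum.distrib mass_def B_def ..
    finally show ?thesis by simp
  qed
  also have "\<dots> \<le> (\<Sum>i<N. \<Sum>a\<in>A. \<Sum>t<K. max 0 (\<Lambda> - \<eta> t) * (cmod (G i a t))\<^sup>2)"
    by (intro sum_mono mult_right_mono) auto
  also have "\<dots> = (\<Sum>a\<in>A. \<Sum>t<K. max 0 (\<Lambda> - \<eta> t) * (\<Sum>i<N. (cmod (G i a t))\<^sup>2))"
    by (subst sum.swap, rule sum.cong[OF refl], subst sum.swap) (simp only: sum_distrib_left)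
  also have "\<dots> \<le> (\<Sum>a\<in>A. \<Sum>t<K. max 0 (\<Lambda> - \<eta> t) * real (n + 1))"
    by (intro sum_mono mult_left_mono G_bound) auto
  also have "\<dots> = real (card A) * real (n + 1) * (\<Sum>t<K. max 0 (\<Lambda> - \<eta> t))"
    by (simp only: sum_distrib_right[symmetric] sum_constant) (simp add: mult_ac)
  also have "(\<Sum>t<K. max 0 (\<Lambda> - \<eta> t)) \<le> 2 * (\<Sum>b<2 * P + 1. \<Lambda> - h b) + \<Lambda>"
    unfolding \<eta>_eq K_def h_def \<Lambda>_def by (rule hat_function_sum[OF PL])
  finally have fin: "real K * (\<Lambda> * mass - (B + (\<Sum>i<N. \<Sum>a\<in>A. (cmod (u i (lo, a)))\<^sup>2 + (cmod (u i (hi, a)))\<^sup>2)))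
     \<le> real (card A) * real (n + 1) * (2 * (\<Sum>b<2 * P + 1. \<Lambda> - h b) + \<Lambda>)"
    by (simp add: mult_left_mono)
  have Kpos: "real K > 0" using PL by (simp add: K_def)
  have "\<Lambda> * mass - (B + (\<Sum>i<N. \<Sum>a\<in>A. (cmod (u i (lo, a)))\<^sup>2 + (cmod (u i (hi, a)))\<^sup>2))
     \<le> real (card A) * real (n + 1) * (2 * (\<Sum>b<2 * P + 1. \<Lambda> - h b) + \<Lambda>) / real K"
    using fin Kpos by (simp add: pos_le_divide_eq mult.commute)
  moreover have "\<Lambda> * (real N * (1 - q - real (card C) * (c2 * (\<Lambda> + e2) + c3))) \<le> \<Lambda> * mass"
    using mass_ge \<Lambda>0 by (rule mult_left_mono)
  ultimately show ?thesis using B_le ends unfolding Z_def H_def K_def n_def by simp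
qed


section \<open>Binomial weights and Cauchy estimates\<close>

text \<open>Consecutive weights have quotient \<open>r * (k + 1) / (k + 1 - s)\<close>. For
  \<open>r = 1 - 1 / (2 * K)\<close> this is 1 at \<open>k + 1 = 2 * K * s\<close>, the peak of the
  weight.\<close>

definition binom_weight :: "nat \<Rightarrow> real \<Rightarrow> nat \<Rightarrow> real" where
  "binom_weight s r k = real (k choose s) * r ^ k"

lemma binom_weight_nonneg: "0 \<le> r \<Longrightarrow> 0 \<le> binom_weight s r k"
  by (simp add: binom_weight_def)

lemma binom_weight_zero: "k < s \<Longrightarrow> binom_weight s r k = 0"
  by (simp add: binom_weight_def binomial_eq_0)

lemma binom_weight_Suc:
  assumes "s \<le> k"
  shows "binom_weight s r (Suc k) * (real (Suc k) - real s) = binom_weight s r k * (r * real (Suc k))"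
proof -
  have "(Suc k - s) * (Suc k choose s) = Suc k * (k choose s)"
    using binomial_absorb_comp[of "Suc k" s] by simp
  hence "real ((Suc k - s) * (Suc k choose s)) = real (Suc k * (k choose s))" by (simp only:)
  hence "(real (Suc k) - real s) * real (Suc k choose s) = real (Suc k) * real (k choose s)"
    using assms by (simp only: of_nat_mult of_nat_diff)
  thus ?thesis by (simp add: binom_weight_def mult_ac)
qed

text \<open>The quotient of the weights at \<open>k + L\<close> and \<open>k\<close>, kept as a
  product so that shifts in \<open>k\<close> can be compared factor by factor.\<close>

definition binom_ratio :: "nat \<Rightarrow> real \<Rightarrow> nat \<Rightarrow> nat \<Rightarrow> real" where
  "binom_ratio s r L k = (\<Prod>i<L. r * (real (k + Suc i) / (real (k + Suc i) - real s)))"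

lemma binom_ratio:
  assumes "s \<le> k"
  shows "binom_weight s r (k + L) = binom_ratio s r L k * binom_weight s r k"
proof (induction L)
  case (Suc L)
  have "real (Suc (k + L)) - real s > 0" using assms by simp
  moreover have "s \<le> k + L" using assms by simp
  ultimately have "binom_weight s r (k + Suc L) = binom_weight s r (k + L) * (r * (real (Suc (k + L)) / (real (Suc (k + L)) - real s)))"
    using binom_weight_Suc[of s "k + L" r] by (simp add: field_simps)
  thus ?case using Suc by (simp add: binom_ratio_def)
qed (simp add: binom_ratio_def)

lemma binom_ratio_mono:
  assumes "s \<le> k" "k \<le> k'" "0 \<le> r"
  shows "binom_ratio s r L k' \<le> binom_ratio s r L k"
  unfolding binom_ratio_def
proof (rule prod_mono, safe)
  fix i
  have p: "real (k + Suc i) - real s > 0" "real (k' + Suc i) - real s > 0" using assms by auto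
  show "0 \<le> r * (real (k' + Suc i) / (real (k' + Suc i) - real s))" using assms p by auto
  have "real (k' + Suc i) * (real (k + Suc i) - real s) \<le> real (k + Suc i) * (real (k' + Suc i) - real s)"
    using mult_right_mono[of "real k" "real k'" "real s"] assms by (simp add: algebra_simps)
  hence "real (k' + Suc i) / (real (k' + Suc i) - real s) \<le> real (k + Suc i) / (real (k + Suc i) - real s)"
    using p by (simp add: frac_le_eq field_simps divide_le_cancel)
  thus "r * (real (k' + Suc i) / (real (k' + Suc i) - real s)) \<le> r * (real (k + Suc i) / (real (k + Suc i) - real s))"
    using assms by (intro mult_left_mono) auto
qed

text \<open>With \<open>X = k + i + 1\<close>, a shift by \<open>u\<close> multiplies the factor
  \<open>X / (X - s)\<close> by exactly \<open>1 - u * s / (X * (X + u - s))\<close>, and both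
  factors of that denominator are at most \<open>4 * M\<close>.\<close>

lemma binom_ratio_contract:
  assumes "s \<le> k" "k + u + L \<le> 4 * M" "0 \<le> r" "0 < M"
  shows "binom_ratio s r L (k + u) \<le> (1 - real u * real s / (16 * (real M)\<^sup>2)) ^ L * binom_ratio s r L k"
proof -
  define th where "th = 1 - real u * real s / (16 * (real M)\<^sup>2)"
  have "binom_ratio s r L (k + u) \<le> (\<Prod>i<L. th * (r * (real (k + Suc i) / (real (k + Suc i) - real s))))"
    unfolding binom_ratio_def
  proof (rule prod_mono, safe)
    fix i assume i: "i < L"
    define X where "X = real (k + Suc i)"
    have p: "X - real s > 0" "X + real u - real s > 0" "X > 0" using assms by (auto simp: X_def)
    have b: "X \<le> 4 * real M" "X + real u - real s \<le> 4 * real M" using assms i by (auto simp: X_def)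
    show "0 \<le> r * (real (k + u + Suc i) / (real (k + u + Suc i) - real s))" using assms by auto
    have "X * (X + real u - real s) \<le> (4 * real M) * (4 * real M)"
      using b p by (intro mult_mono) auto
    hence "real u * real s / (16 * (real M)\<^sup>2) \<le> real u * real s / (X * (X + real u - real s))"
      using p by (intro divide_left_mono) (auto simp: power2_eq_square assms)
    hence 1: "1 - real u * real s / (X * (X + real u - real s)) \<le> th" by (simp add: th_def)
    have 2: "(X + real u) / (X + real u - real s) = (1 - real u * real s / (X * (X + real u - real s))) * (X / (X - real s))"
      using p by (simp add: divide_simps) (simp add: algebra_simps)
    have "X / (X - real s) \<ge> 0" using p by simp
    with 1 have "(X + real u) / (X + real u - real s) \<le> th * (X / (X - real s))"
      unfolding 2 by (rule mult_right_mono)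
    hence "r * ((X + real u) / (X + real u - real s)) \<le> r * (th * (X / (X - real s)))"
      using assms by (intro mult_left_mono)
    thus "r * (real (k + u + Suc i) / (real (k + u + Suc i) - real s)) \<le> th * (r * (real (k + Suc i) / (real (k + Suc i) - real s)))"
      by (simp add: X_def algebra_simps)
  qed
  also have "\<dots> = th ^ L * binom_ratio s r L k"
    unfolding binom_ratio_def by (simp only: prod.distrib prod_constant card_lessThan)
  finally show ?thesis by (simp only: th_def)
qed

text \<open>Weights are compared at distance \<open>L\<close> because the modulations will have
  period \<open>L\<close>. The window starts at the balance point \<open>n1\<close>, the first
  \<open>k\<close> from \<open>L\<close> on whose weight is not exceeded by the one at
  \<open>k + L\<close>. A distance of \<open>u\<close> from the balance changes the quotient by the
  factor \<open>\<theta> ^ L\<close>, by \<open>binom_ratio_contract\<close> with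
  \<open>M = K * s\<close>.\<close>

lemma binom_weight_peak:
  fixes K s u :: nat
  assumes K: "2 \<le> K" and s: "1 \<le> s" and u: "u \<le> K * s"
  defines "L \<equiv> K * s" and "r \<equiv> 1 - 1 / (2 * real K)"
    and "\<theta> \<equiv> 1 - real u * real s / (16 * (real (K * s))\<^sup>2)"
  obtains n1 where "L \<le> n1" "n1 \<le> 2 * L"
    "\<And>k. n1 + L + u \<le> k \<Longrightarrow> binom_weight s r k \<le> \<theta> ^ L * binom_weight s r (k - L)"
    "\<And>k. k + u < n1 \<Longrightarrow> binom_weight s r k \<le> \<theta> ^ L * binom_weight s r (k + L)"
proof -
  have r: "0 < r" using K by (simp add: r_def field_simps)
  have L0: "0 < L" "s \<le> L" using K s by (auto simp: L_def)
  have step_le: "r * (real k / (real k - real s)) \<le> 1" if "2 * L \<le> k" for k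
  proof -
    have "real (2 * L) \<le> real k" using that by (simp only: of_nat_le_iff)
    hence "2 * real K * real s \<le> real k" by (simp add: L_def)
    hence "real s \<le> real k / (2 * real K)" using K by (simp add: field_simps)
    hence "r * real k \<le> real k - real s" by (simp add: r_def algebra_simps)
    moreover have "real k - real s > 0" using that L0 by auto
    ultimately show ?thesis by (simp add: field_simps)
  qed
  have step_ge: "1 \<le> r * (real k / (real k - real s))" if "k \<le> 2 * L" "s < k" for k
  proof -
    have "real k \<le> real (2 * L)" using that by (simp only: of_nat_le_iff)
    hence "real k \<le> 2 * real K * real s" by (simp add: L_def)
    hence "real k / (2 * real K) \<le> real s" using K by (simp add: field_simps)
    hence "real k - real s \<le> r * real k" by (simp add: r_def algebra_simps)
    moreover have "real k - real s > 0" using that by auto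
    ultimately show ?thesis by (simp add: field_simps)
  qed
  \<comment> \<open>All factors lie past the peak at \<open>2 * L\<close>, so the least element
    below exists and is at most \<open>2 * L\<close>.\<close>
  have "binom_ratio s r L (2 * L) \<le> 1"
    unfolding binom_ratio_def
  proof (rule prod_le_1)
    fix i
    show "0 \<le> r * (real (2 * L + Suc i) / (real (2 * L + Suc i) - real s)) \<and>
        r * (real (2 * L + Suc i) / (real (2 * L + Suc i) - real s)) \<le> 1"
      using step_le[of "2 * L + Suc i"] r L0 by (auto intro!: mult_nonneg_nonneg divide_nonneg_nonneg simp del: of_nat_Suc of_nat_add)
  qed
  define n1 where "n1 = (LEAST k. L \<le> k \<and> binom_ratio s r L k \<le> 1)"
  have ex: "L \<le> 2 * L \<and> binom_ratio s r L (2 * L) \<le> 1" using \<open>_ \<le> 1\<close> by simp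
  have n1: "L \<le> n1" "binom_ratio s r L n1 \<le> 1" "n1 \<le> 2 * L"
    using LeastI[of "\<lambda>k. L \<le> k \<and> binom_ratio s r L k \<le> 1", OF ex]
      Least_le[of "\<lambda>k. L \<le> k \<and> binom_ratio s r L k \<le> 1", OF ex]
    unfolding n1_def by auto
  \<comment> \<open>For \<open>k < L\<close> minimality of \<open>n1\<close> says nothing, but then
    no factor lies past the peak.\<close>
  have below: "1 \<le> binom_ratio s r L k" if "k < n1" "s \<le> k" for k
  proof (cases "L \<le> k")
    case True
    hence "\<not> binom_ratio s r L k \<le> 1" using not_less_Least[OF that(1)[unfolded n1_def]] by auto
    thus ?thesis by simp
  next
    case False
    show ?thesis unfolding binom_ratio_def
    proof (rule prod_ge_1)
      fix i assume "i \<in> {..<L}"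
      thus "1 \<le> r * (real (k + Suc i) / (real (k + Suc i) - real s))"
        using step_ge[of "k + Suc i"] that False by (simp del: of_nat_Suc of_nat_add)
    qed
  qed
  have \<theta>0: "0 \<le> \<theta>"
  proof -
    have "real u * real s \<le> real (K * s) * real (K * s)"
    proof (rule mult_mono)
      show "real u \<le> real (K * s)" using u by (simp only: of_nat_le_iff)
      show "real s \<le> real (K * s)" using L0 by (simp only: of_nat_le_iff L_def)
    qed auto
    hence "real u * real s / (16 * (real (K * s))\<^sup>2) \<le> 1"
      using L0 by (simp add: L_def power2_eq_square divide_le_eq)
    thus ?thesis by (simp add: \<theta>_def)
  qed
  show ?thesis
  proof (rule that[of n1])
    fix k assume k: "n1 + L + u \<le> k"
    have sk: "s \<le> k - L" "s \<le> n1" using k n1 L0 by auto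
    have "binom_ratio s r L (k - L) \<le> binom_ratio s r L (n1 + u)"
      by (rule binom_ratio_mono) (use k sk r in auto)
    also have "\<dots> \<le> \<theta> ^ L * binom_ratio s r L n1"
      unfolding \<theta>_def by (rule binom_ratio_contract[where M = "K * s"]) (use sk(2) n1 u r L0(1) in \<open>auto simp: L_def\<close>)
    also have "\<dots> \<le> \<theta> ^ L" using n1 \<theta>0 by (simp add: mult_left_le)
    finally have "binom_ratio s r L (k - L) \<le> \<theta> ^ L" .
    moreover have "binom_weight s r k = binom_ratio s r L (k - L) * binom_weight s r (k - L)"
      using binom_ratio[OF sk(1), of r L] k by simp
    ultimately show "binom_weight s r k \<le> \<theta> ^ L * binom_weight s r (k - L)"
      using binom_weight_nonneg[of r s "k - L"] r by (simp add: mult_right_mono)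
  next
    fix k assume k: "k + u < n1"
    show "binom_weight s r k \<le> \<theta> ^ L * binom_weight s r (k + L)"
    proof (cases "s \<le> k")
      case False
      thus ?thesis using binom_weight_zero[of k s r] \<theta>0 binom_weight_nonneg[of r s "k + L"] r by simp
    next
      case True
      have "1 \<le> binom_ratio s r L (k + u)" by (rule below) (use k True in auto)
      also have "\<dots> \<le> \<theta> ^ L * binom_ratio s r L k"
        unfolding \<theta>_def by (rule binom_ratio_contract[where M = "K * s"]) (use True k n1 r L0 in \<open>auto simp: L_def\<close>)
      finally have "1 * binom_weight s r k \<le> (\<theta> ^ L * binom_ratio s r L k) * binom_weight s r k"
        using binom_weight_nonneg[of r s k] r by (intro mult_right_mono) auto
      thus ?thesis using binom_ratio[OF True, of r L] by (simp add: mult.assoc)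
    qed
  qed (use n1 in auto)
qed

text \<open>The quotient of consecutive weights is \<open>(1 - x) / r\<close> with
  \<open>x = s / (k + 1)\<close>. From \<open>k = K * s / 2\<close> on, both \<open>x\<close> and
  \<open>1 - r\<close> are of order \<open>1 / K\<close>.\<close>

lemma binom_weight_variation:
  fixes K s k :: nat
  assumes K: "2 \<le> K" and k: "K * s \<le> 2 * k" and s: "1 \<le> s"
  defines "r \<equiv> 1 - 1 / (2 * real K)"
  shows "\<bar>binom_weight s r k - binom_weight s r (Suc k)\<bar> \<le> 2 / real K * binom_weight s r (Suc k)"
proof -
  have "s * 2 \<le> K * s" using K by simp
  hence sk: "s \<le> k" using k by linarith
  have r: "1 / 2 < r" "r < 1" using K by (auto simp: r_def field_simps)
  define x where "x = real s / real (Suc k)"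
  have x0: "0 \<le> x" by (simp add: x_def)
  have x1: "x \<le> 2 / real K"
  proof -
    have "real (K * s) \<le> real (2 * k)" using k by (simp only: of_nat_le_iff)
    hence "real K * real s \<le> 2 * real (Suc k)" by simp
    thus ?thesis using K by (simp add: x_def field_simps)
  qed
  have w: "binom_weight s r k = (1 - x) / r * binom_weight s r (Suc k)"
  proof -
    have "real (Suc k) - real s = real (Suc k) * (1 - x)" by (simp add: x_def algebra_simps del: of_nat_Suc)
    hence "real (Suc k) * (binom_weight s r (Suc k) * (1 - x)) = real (Suc k) * (binom_weight s r k * r)"
      using binom_weight_Suc[OF sk, of r] by (simp only: mult_ac)
    hence "binom_weight s r (Suc k) * (1 - x) = binom_weight s r k * r"
      by (subst (asm) mult_left_cancel) auto
    thus ?thesis using r by (simp add: field_simps)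
  qed
  have K0: "real K \<ge> 2" using K by simp
  have "\<bar>(1 - x) / r - 1\<bar> \<le> 2 / real K"
  proof (rule abs_leI)
    have "(1 - x) / r \<le> 1 / r" using x0 r by (simp add: divide_right_mono)
    also have "1 / r \<le> 1 + 1 / real K" using K0 by (simp add: r_def field_simps)
    also have "\<dots> \<le> 1 + 2 / real K" by (simp add: divide_right_mono)
    finally show "(1 - x) / r - 1 \<le> 2 / real K" by simp
  next
    have "1 - x \<le> (1 - x) / r"
    proof (cases "x \<le> 1")
      case True
      hence "0 \<le> (1 - r) * (1 - x)" using r by simp
      thus ?thesis using r by (simp add: pos_le_divide_eq) (simp add: algebra_simps)
    next
      case False
      have "real s \<le> real (Suc k)" using sk by simp
      thus ?thesis using False by (simp add: x_def field_simps)
    qed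
    thus "- ((1 - x) / r - 1) \<le> 2 / real K" using x1 by simp
  qed
  hence "\<bar>(1 - x) / r - 1\<bar> * binom_weight s r (Suc k) \<le> 2 / real K * binom_weight s r (Suc k)"
    using binom_weight_nonneg[of r s "Suc k"] r by (intro mult_right_mono) auto
  moreover have "binom_weight s r k - binom_weight s r (Suc k) = ((1 - x) / r - 1) * binom_weight s r (Suc k)"
    by (simp add: w algebra_simps)
  ultimately show ?thesis using binom_weight_nonneg[of r s "Suc k"] r by (simp add: abs_mult)
qed

text \<open>The binomial coefficient is at least \<open>(k / s) ^ s\<close>, hence
  \<open>K ^ s\<close>, while \<open>r ^ K\<close> is at least 1/2 by Bernoulli, so over
  \<open>3 * K * s\<close> steps the damping costs only \<open>8 ^ s\<close>. This growth in
  \<open>K\<close> is what exceeds Cauchy's bound at regular points.\<close>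

lemma binom_weight_lower:
  fixes K s k :: nat
  assumes K: "2 \<le> K" and k: "K * s \<le> k" "k \<le> 3 * (K * s)" and s: "1 \<le> s"
  defines "r \<equiv> 1 - 1 / (2 * real K)"
  shows "(real K / 8) ^ s \<le> binom_weight s r k"
proof -
  have r: "0 < r" "r < 1" using K by (auto simp: r_def field_simps)
  have "s * 2 \<le> K * s" using K by simp
  hence sk: "s \<le> k" using k by linarith
  have "real (K * s) \<le> real k" using k by (simp only: of_nat_le_iff)
  hence "real K \<le> real k / real s" using s by (simp add: field_simps)
  hence "real K ^ s \<le> (real k / real s) ^ s" by (intro power_mono) auto
  also have "\<dots> \<le> real (k choose s)" using binomial_ge_n_over_k_pow_k[OF sk, where ?'a = real] by simp
  finally have 1: "real K ^ s \<le> real (k choose s)" .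
  have "1 / 2 \<le> r ^ K"
  proof -
    have "1 + real K * (- (1 / (2 * real K))) \<le> (1 + (- (1 / (2 * real K)))) ^ K"
      by (rule Bernoulli_inequality) (use K in \<open>auto simp: field_simps\<close>)
    thus ?thesis using K by (simp add: r_def)
  qed
  hence "(1 / 2) ^ (3 * s) \<le> (r ^ K) ^ (3 * s)" by (intro power_mono) auto
  also have "\<dots> = r ^ (3 * (K * s))" by (simp add: power_mult[symmetric] mult_ac)
  also have "\<dots> \<le> r ^ k" using k r by (intro power_decreasing) auto
  finally have 2: "(1 / 8) ^ s \<le> r ^ k" by (simp add: power_mult power_one_over)
  have "(real K / 8) ^ s = real K ^ s * (1 / 8) ^ s" by (simp add: power_divide)
  also have "\<dots> \<le> real (k choose s) * r ^ k" using 1 2 by (intro mult_mono) auto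
  finally show ?thesis by (simp add: binom_weight_def)
qed

section \<open>Higher derivatives of power series and Cauchy's estimate\<close>

lemma fps_nth_higher_deriv:
  "fps_nth ((fps_deriv ^^ s) F) k = fact s * of_nat ((k + s) choose s) * fps_nth (F :: complex fps) (k + s)"
proof (induction s arbitrary: k)
  case (Suc s)
  have "Suc s * (Suc (k + s) choose Suc s) = (Suc k) * (Suc (k + s) choose s)"
    using binomial_absorb_comp[of "Suc (k + s)" s] Suc_times_binomial_eq[of "k + s" s] by (simp add: mult.commute)
  hence *: "of_nat (Suc s) * of_nat (Suc (k + s) choose Suc s) = (of_nat (Suc k) * of_nat (Suc (k + s) choose s) :: complex)"
    by (simp only: of_nat_mult[symmetric])
  have "fps_nth ((fps_deriv ^^ Suc s) F) k = of_nat (Suc k) * fps_nth ((fps_deriv ^^ s) F) (Suc k)" by simp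
  also have "\<dots> = (of_nat (Suc k) * of_nat (Suc (k + s) choose s)) * (fact s * fps_nth F (Suc (k + s)))"
    by (simp only: Suc add_Suc mult_ac)
  also have "\<dots> = fact (Suc s) * of_nat ((k + Suc s) choose Suc s) * fps_nth F (k + Suc s)"
    unfolding *[symmetric] by (simp only: fact_Suc add_Suc_right mult_ac of_nat_mult)
  finally show ?case .
qed simp

lemma fps_conv_radius_higher_deriv:
  "fps_conv_radius (F :: complex fps) \<le> fps_conv_radius ((fps_deriv ^^ s) F)"
proof (induction s)
  case (Suc s)
  thus ?case using fps_conv_radius_deriv[of "(fps_deriv ^^ s) F"] by (auto intro: order_trans)
qed simp

lemma eval_fps_higher_deriv:
  assumes "ereal (norm z) < fps_conv_radius (F :: complex fps)"
  shows "eval_fps ((fps_deriv ^^ s) F) z = (deriv ^^ s) (eval_fps F) z"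
  using assms
proof (induction s arbitrary: z)
  case (Suc s)
  have "open (eball 0 (fps_conv_radius F) :: complex set)" by simp
  hence ev: "\<forall>\<^sub>F w in nhds z. w \<in> eball 0 (fps_conv_radius F)"
    using Suc.prems by (intro eventually_nhds_in_open) auto
  have "eval_fps ((fps_deriv ^^ Suc s) F) z = deriv (eval_fps ((fps_deriv ^^ s) F)) z"
    using Suc.prems fps_conv_radius_higher_deriv[of F s] by (simp add: eval_fps_deriv)
  also have "\<dots> = deriv ((deriv ^^ s) (eval_fps F)) z"
    by (rule deriv_cong_ev[OF eventually_mono[OF ev]]) (use Suc.IH in auto)
  finally show ?case by simp
qed simp

lemma binomial_series_sums:
  fixes F :: "complex fps"
  assumes "ereal (norm p) < fps_conv_radius F"
  shows "(\<lambda>k. of_nat (k choose s) * fps_nth F k * p ^ k) sums (p ^ s * (deriv ^^ s) (eval_fps F) p / fact s)"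
proof -
  have "ereal (norm p) < fps_conv_radius ((fps_deriv ^^ s) F)"
    using assms fps_conv_radius_higher_deriv[of F s] by simp
  hence "(\<lambda>k. fps_nth ((fps_deriv ^^ s) F) k * p ^ k) sums eval_fps ((fps_deriv ^^ s) F) p"
    by (rule sums_eval_fps)
  from sums_mult[OF this, of "p ^ s / fact s"]
  have "(\<lambda>k. of_nat ((k + s) choose s) * fps_nth F (k + s) * p ^ (k + s)) sums (p ^ s * (deriv ^^ s) (eval_fps F) p / fact s)"
    by (simp add: fps_nth_higher_deriv eval_fps_higher_deriv[OF assms] power_add mult_ac)
  moreover have "(\<Sum>k<s. of_nat (k choose s) * fps_nth F k * p ^ k) = 0"
    by (rule sum.neutral) (auto simp: binomial_eq_0)
  ultimately show ?thesis
    using sums_iff_shift[of "\<lambda>k. of_nat (k choose s) * fps_nth F k * p ^ k" s] by simp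
qed

text \<open>
  A point \<open>b\<close> of the unit circle at which the series is regular is detected by an exponentially
  small upper bound: derivatives of order \<open>s\<close> grow at most like \<open>\<rho>\<^bsup>-s\<^esup>\<close> near \<open>b\<close>.
\<close>

lemma binomial_series_bound:
  fixes F :: "complex fps"
  assumes conv: "1 \<le> fps_conv_radius F"
    and hol: "H holomorphic_on ball b (2 * \<rho>)" and \<rho>: "0 < \<rho>"
    and eq: "\<And>z. z \<in> ball b (2 * \<rho>) \<Longrightarrow> norm z < 1 \<Longrightarrow> H z = eval_fps F z"
    and bound: "\<And>z. z \<in> cball b \<rho> \<Longrightarrow> norm (H z) \<le> B"
    and p: "norm p < 1" "norm (p - b) \<le> \<rho> / 2"
  shows "norm (\<Sum>k. of_nat (k choose s) * fps_nth F k * p ^ k) \<le> B * (2 / \<rho>) ^ s"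
proof -
  have p': "ereal (norm p) < fps_conv_radius F" using p conv by (metis ereal_less(3) less_le_trans)
  have sub: "cball p (\<rho> / 2) \<subseteq> cball b \<rho>"
  proof
    fix z assume "z \<in> cball p (\<rho> / 2)"
    thus "z \<in> cball b \<rho>" using p norm_triangle_ineq[of "z - p" "p - b"]
      by (auto simp: dist_norm norm_minus_commute)
  qed
  also have "cball b \<rho> \<subseteq> ball b (2 * \<rho>)" using \<rho> by auto
  finally have sub2: "cball p (\<rho> / 2) \<subseteq> ball b (2 * \<rho>)" .
  have "norm ((deriv ^^ s) H p) \<le> fact s * B / (\<rho> / 2) ^ s"
  proof (rule Cauchy_inequality)
    show "H holomorphic_on ball p (\<rho> / 2)"
      by (rule holomorphic_on_subset[OF hol]) (use sub2 in auto)
    show "continuous_on (cball p (\<rho> / 2)) H"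
      by (rule continuous_on_subset[OF holomorphic_on_imp_continuous_on[OF hol] sub2])
    show "norm (H x) \<le> B" if "norm (p - x) = \<rho> / 2" for x
      using that sub by (intro bound) (auto simp: dist_norm)
  qed (use \<rho> in auto)
  moreover have "(deriv ^^ s) H p = (deriv ^^ s) (eval_fps F) p"
  proof (rule higher_deriv_cong_ev)
    have "p \<in> ball b (2 * \<rho>) \<inter> ball 0 1" using p \<rho> by (auto simp: dist_norm norm_minus_commute)
    hence "\<forall>\<^sub>F z in nhds p. z \<in> ball b (2 * \<rho>) \<inter> ball 0 1" by (intro eventually_nhds_in_open) auto
    thus "\<forall>\<^sub>F z in nhds p. H z = eval_fps F z" by eventually_elim (use eq in auto)
  qed simp
  ultimately have d: "norm ((deriv ^^ s) (eval_fps F) p) \<le> fact s * (B * (2 / \<rho>) ^ s)"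
    by (simp add: power_divide field_simps)
  have B0: "0 \<le> B" using bound[of b] \<rho> by (auto intro: order_trans[OF norm_ge_zero])
  have "(\<Sum>k. of_nat (k choose s) * fps_nth F k * p ^ k) = p ^ s * (deriv ^^ s) (eval_fps F) p / fact s"
    using binomial_series_sums[OF p', of s] by (simp add: sums_iff)
  also have "norm \<dots> = norm p ^ s * (norm ((deriv ^^ s) (eval_fps F) p) / fact s)"
    by (simp add: norm_mult norm_divide norm_power)
  also have "\<dots> \<le> 1 * (norm ((deriv ^^ s) (eval_fps F) p) / fact s)"
    using p by (intro mult_right_mono power_le_one) auto
  also have "\<dots> \<le> B * (2 / \<rho>) ^ s" using d by (simp add: field_simps)
  finally show ?thesis .
qed

lemma binomial_series_abs_summable:
  fixes F :: "complex fps"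
  assumes "1 \<le> fps_conv_radius F" "0 \<le> r" "r < 1"
  shows "summable (\<lambda>k. binom_weight s r k * norm (fps_nth F k))"
proof -
  let ?G = "(fps_deriv ^^ s) F"
  have "1 \<le> fps_conv_radius ?G" using order_trans[OF assms(1) fps_conv_radius_higher_deriv] .
  hence "ereal (norm (complex_of_real r)) < fps_conv_radius ?G"
    using assms by (metis abs_of_nonneg ereal_less(3) less_le_trans norm_of_real)
  hence "summable (\<lambda>k. norm (fps_nth ?G k * complex_of_real r ^ k))"
    unfolding fps_conv_radius_def by (rule abs_summable_in_conv_radius)
  hence "summable (\<lambda>k. r ^ s / fact s * norm (fps_nth ?G k * complex_of_real r ^ k))" by (rule summable_mult)
  hence "summable (\<lambda>k. binom_weight s r (k + s) * norm (fps_nth F (k + s)))"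
    using assms by (simp add: fps_nth_higher_deriv binom_weight_def norm_mult norm_power power_add mult_ac)
  thus ?thesis by (subst (asm) summable_iff_shift)
qed


section \<open>Slowly rotating components on the unit circle\<close>

lemma L2_set_square: "(L2_set f A)\<^sup>2 = (\<Sum>i\<in>A. (f i)\<^sup>2)"
  by (simp add: L2_set_def sum_nonneg)

lemma L2_set_norm_add: "L2_set (\<lambda>i. cmod (f i + g i)) A \<le> L2_set (\<lambda>i. cmod (f i)) A + L2_set (\<lambda>i. cmod (g i)) A"
  by (rule order_trans[OF L2_set_mono L2_set_triangle_ineq]) (auto intro: norm_triangle_ineq)

lemma L2_set_norm_scale: "L2_set (\<lambda>i. cmod (c * f i)) A = cmod c * L2_set (\<lambda>i. cmod (f i)) A"
  by (simp add: norm_mult L2_set_right_distrib)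

lemma square_add_le:
  fixes p q \<xi> :: real
  assumes "0 < \<xi>"
  shows "(p + q)\<^sup>2 \<le> (1 + \<xi>) * p\<^sup>2 + (1 + 1 / \<xi>) * q\<^sup>2"
proof -
  have "0 \<le> (\<xi> * p - q)\<^sup>2 / \<xi>" using assms by simp
  also have "\<dots> = \<xi> * p\<^sup>2 - 2 * p * q + q\<^sup>2 / \<xi>"
    using assms by (simp add: power2_eq_square field_simps)
  finally show ?thesis by (simp add: power2_eq_square algebra_simps)
qed

text \<open>\<open>y \<zeta> j\<close> stands for the component at \<open>\<zeta>\<close> of the
  \<open>j\<close>-th of \<open>D\<close> basis solutions; the vectors \<open>g\<close> below are
  coefficients with respect to this basis.\<close>

locale component_family =
  fixes C :: "complex set" and D :: nat and y :: "complex \<Rightarrow> nat \<Rightarrow> nat \<Rightarrow> complex"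
  assumes finite_C: "finite C" and norm_C: "\<And>\<zeta>. \<zeta> \<in> C \<Longrightarrow> cmod \<zeta> = 1"
begin

definition Y :: "complex \<Rightarrow> (nat \<Rightarrow> complex) \<Rightarrow> nat \<Rightarrow> complex" where
  "Y \<zeta> g k = (\<Sum>j<D. g j * y \<zeta> j k)"

definition size_at :: "(nat \<Rightarrow> complex) \<Rightarrow> nat \<Rightarrow> real" where
  "size_at g k = L2_set (\<lambda>\<zeta>. cmod (Y \<zeta> g k)) C"

text \<open>Each component rotates nearly like \<open>\<zeta> ^ (-k)\<close>. The error is relative
  to the joint size of all components, uniformly in \<open>g\<close>, since a single component may
  be small or vanish.\<close>

definition slow :: "real \<Rightarrow> nat \<Rightarrow> bool" where
  "slow e k1 \<longleftrightarrow> (\<forall>k\<ge>k1. \<forall>g. L2_set (\<lambda>\<zeta>. cmod (Y \<zeta> g k - \<zeta> * Y \<zeta> g (Suc k))) C \<le> e * size_at g (Suc k))"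

lemma size_at_nonneg: "0 \<le> size_at g k"
  by (simp add: size_at_def L2_set_nonneg)

lemma size_at_rotate: "L2_set (\<lambda>\<zeta>. cmod (\<zeta> * Y \<zeta> g k)) C = size_at g k"
  unfolding size_at_def by (rule L2_set_cong) (auto simp: norm_mult norm_C)

lemma slow_step:
  assumes "slow e k1" "k1 \<le> k"
  shows "size_at g k \<le> (1 + e) * size_at g (Suc k)" "(1 - e) * size_at g (Suc k) \<le> size_at g k"
proof -
  have s: "L2_set (\<lambda>\<zeta>. cmod (Y \<zeta> g k - \<zeta> * Y \<zeta> g (Suc k))) C \<le> e * size_at g (Suc k)"
    using assms by (simp add: slow_def)
  have "size_at g k \<le> L2_set (\<lambda>\<zeta>. cmod (Y \<zeta> g k - \<zeta> * Y \<zeta> g (Suc k))) C + L2_set (\<lambda>\<zeta>. cmod (\<zeta> * Y \<zeta> g (Suc k))) C"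
    unfolding size_at_def using L2_set_norm_add[of "\<lambda>\<zeta>. Y \<zeta> g k - \<zeta> * Y \<zeta> g (Suc k)" "\<lambda>\<zeta>. \<zeta> * Y \<zeta> g (Suc k)" C] by simp
  thus "size_at g k \<le> (1 + e) * size_at g (Suc k)" using s by (simp add: size_at_rotate algebra_simps)
  have "L2_set (\<lambda>\<zeta>. cmod (\<zeta> * Y \<zeta> g (Suc k))) C \<le> L2_set (\<lambda>\<zeta>. cmod (\<zeta> * Y \<zeta> g (Suc k) - Y \<zeta> g k)) C + size_at g k"
    unfolding size_at_def using L2_set_norm_add[of "\<lambda>\<zeta>. \<zeta> * Y \<zeta> g (Suc k) - Y \<zeta> g k" "\<lambda>\<zeta>. Y \<zeta> g k" C] by simp
  thus "(1 - e) * size_at g (Suc k) \<le> size_at g k" using s by (simp add: size_at_rotate norm_minus_commute algebra_simps)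
qed

lemma slow_iterate:
  assumes "slow e k1" "k1 \<le> k" "0 \<le> e" "e \<le> 1"
  shows "size_at g k \<le> (1 + e) ^ i * size_at g (k + i)" "(1 - e) ^ i * size_at g (k + i) \<le> size_at g k"
proof -
  show "size_at g k \<le> (1 + e) ^ i * size_at g (k + i)"
  proof (induction i)
    case (Suc i)
    have "(1 + e) ^ i * size_at g (k + i) \<le> (1 + e) ^ i * ((1 + e) * size_at g (Suc (k + i)))"
      using slow_step(1)[OF assms(1), of "k + i" g] assms by (intro mult_left_mono) auto
    thus ?case using Suc by (simp add: mult_ac)
  qed simp
  show "(1 - e) ^ i * size_at g (k + i) \<le> size_at g k"
  proof (induction i)
    case (Suc i)
    have "(1 - e) ^ i * ((1 - e) * size_at g (Suc (k + i))) \<le> (1 - e) ^ i * size_at g (k + i)"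
      using slow_step(2)[OF assms(1), of "k + i" g] assms by (intro mult_left_mono) auto
    thus ?case using Suc by (simp add: mult_ac)
  qed simp
qed

end

text \<open>
  \<open>u\<close> is the width of the transition zones of the weight around the window \<open>{n1..n1 + K * s}\<close>, and
  \<open>q0\<close> the relative mass outside of it.
\<close>

locale windowed_family = component_family C D y
  for C :: "complex set" and D :: nat and y :: "complex \<Rightarrow> nat \<Rightarrow> nat \<Rightarrow> complex" +
  fixes e t q0 mm :: real and s K u P T n1 :: nat
  assumes K: "16 \<le> K" and s: "1 \<le> s" and u: "2 * u + 2 \<le> K * s" and D: "0 < D"
    and e: "0 \<le> e" "e \<le> 1 / 2"
    and slow: "slow e s"
    and mm: "0 < mm"
    and lower: "\<And>k g. K * s \<le> k \<Longrightarrow> k \<le> 3 * (K * s) \<Longrightarrow> mm * L2_set (\<lambda>j. cmod (g j)) {..<D} \<le> size_at g k"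
    and n1: "K * s \<le> n1" "n1 \<le> 2 * (K * s)"
    and peak_right: "\<And>k. n1 + K * s + u \<le> k \<Longrightarrow>
      binom_weight s (1 - 1 / (2 * real K)) k \<le> t * binom_weight s (1 - 1 / (2 * real K)) (k - K * s)"
    and peak_left: "\<And>k. k + u < n1 \<Longrightarrow>
      binom_weight s (1 - 1 / (2 * real K)) k \<le> t * binom_weight s (1 - 1 / (2 * real K)) (k + K * s)"
    and T: "n1 + K * s + u < T"
    and t0: "0 \<le> t"
    and q0: "t * (1 + e) ^ (K * s) \<le> q0" "t \<le> q0 * (1 - e) ^ (K * s)" "2 * q0\<^sup>2 \<le> 1 / 2"
    and P: "2 * P + 1 \<le> K * s"
begin

abbreviation "L \<equiv> K * s"
abbreviation "r \<equiv> 1 - 1 / (2 * real K)"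
abbreviation "w \<equiv> binom_weight s r"
abbreviation "\<kappa> \<equiv> 2 / real K"
text \<open>Chosen so that \<open>k \<le> lo\<close> means \<open>k + u < n1\<close> and
  \<open>hi \<le> k\<close> means \<open>n1 + L + u \<le> k\<close>: the two peak estimates cover
  everything outside \<open>{lo<..<hi}\<close>.\<close>

definition lo where "lo = n1 - u - 1"
definition hi where "hi = n1 + L + u"
definition P1 where "P1 = 2 * P + 1"
text \<open>An index \<open>b < D * P1\<close> encodes the basis solution \<open>b div P1\<close>
  and an integer frequency \<open>b mod P1 - P\<close> between \<open>-P\<close> and
  \<open>P\<close>. The division by \<open>L\<close> makes every modulation an \<open>L\<close>-th
  root of unity, hence of period \<open>L\<close>.\<close>

definition \<omega> :: "nat \<Rightarrow> complex" where "\<omega> b = cis (2 * pi * (real (b mod P1) - real P) / real L)"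
text \<open>At time \<open>k\<close> the modulated combination \<open>\<alpha>\<close> looks like
  one ordinary solution, with coefficient vector \<open>v \<alpha> k\<close>. This vector changes
  with \<open>k\<close>, but has period \<open>L\<close>.\<close>

definition v :: "(nat \<Rightarrow> complex) \<Rightarrow> nat \<Rightarrow> nat \<Rightarrow> complex" where
  "v \<alpha> k j = (\<Sum>l<P1. \<alpha> (j * P1 + l) * \<omega> l ^ k)"
definition x :: "nat \<Rightarrow> nat \<times> complex \<Rightarrow> complex" where
  "x b z = of_real (w (fst z)) * \<omega> b ^ fst z * y (snd z) (b div P1) (fst z)"
definition comb :: "(nat \<Rightarrow> complex) \<Rightarrow> nat \<times> complex \<Rightarrow> complex" where
  "comb \<alpha> z = (\<Sum>b<D * P1. \<alpha> b * x b z)"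
definition X where "X = {..T} \<times> C"
definition a :: "(nat \<Rightarrow> complex) \<Rightarrow> nat \<Rightarrow> real" where "a \<alpha> k = w k * size_at (v \<alpha> k) k"

lemma r: "1 / 2 < r" "r < 1" using K by (auto simp: field_simps)

lemma w_nonneg: "0 \<le> w k" using r by (intro binom_weight_nonneg) auto

lemma L_pos: "0 < L" using K s by simp

lemma \<omega>_mod: "\<omega> (j * P1 + l) = \<omega> l" by (simp add: \<omega>_def)

lemma norm_\<omega>: "cmod (\<omega> b) = 1" by (simp add: \<omega>_def)

lemma \<omega>_period: "\<omega> b ^ L = 1"
proof -
  have "\<omega> b ^ L = cis (real L * (2 * pi * (real (b mod P1) - real P) / real L))"
    unfolding \<omega>_def by (rule Complex.DeMoivre)
  also have "real L * (2 * pi * (real (b mod P1) - real P) / real L) = 2 * pi * (real (b mod P1) - real P)"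
    using L_pos by simp
  finally show ?thesis by (simp only: cis_multiple_2pi Ints_diff Ints_of_nat)
qed

lemma comb_eq: "comb \<alpha> (k, \<zeta>) = of_real (w k) * Y \<zeta> (v \<alpha> k) k"
proof -
  have "comb \<alpha> (k, \<zeta>) = (\<Sum>j<D. \<Sum>l<P1. of_real (w k) * (\<alpha> (j * P1 + l) * \<omega> l ^ k * y \<zeta> j k))"
    unfolding comb_def sum_blocks
  proof (intro sum.cong refl)
    fix j l assume "l \<in> {..<P1}"
    hence "(j * P1 + l) div P1 = j" by simp
    thus "\<alpha> (j * P1 + l) * x (j * P1 + l) (k, \<zeta>) = of_real (w k) * (\<alpha> (j * P1 + l) * \<omega> l ^ k * y \<zeta> j k)"
      by (simp only: x_def \<omega>_mod fst_conv snd_conv mult_ac)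
  qed
  also have "\<dots> = of_real (w k) * Y \<zeta> (v \<alpha> k) k"
    by (simp add: Y_def v_def sum_distrib_left sum_distrib_right)
  finally show ?thesis .
qed

lemma v_shift: "v (\<lambda>b. \<alpha> b * \<omega> b) k = v \<alpha> (Suc k)"
proof (rule ext)
  fix j
  show "v (\<lambda>b. \<alpha> b * \<omega> b) k j = v \<alpha> (Suc k) j"
    unfolding v_def
  proof (rule sum.cong[OF refl])
    fix l
    show "\<alpha> (j * P1 + l) * \<omega> (j * P1 + l) * \<omega> l ^ k = \<alpha> (j * P1 + l) * \<omega> l ^ Suc k"
      by (subst \<omega>_mod) simp
  qed
qed

lemma v_diff: "v (\<lambda>b. \<alpha> b * (1 - \<omega> b)) k = (\<lambda>j. v \<alpha> k j - v \<alpha> (Suc k) j)"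
proof (rule ext)
  fix j
  show "v (\<lambda>b. \<alpha> b * (1 - \<omega> b)) k j = v \<alpha> k j - v \<alpha> (Suc k) j"
    unfolding v_def sum_subtractf[symmetric]
  proof (rule sum.cong[OF refl])
    fix l
    show "\<alpha> (j * P1 + l) * (1 - \<omega> (j * P1 + l)) * \<omega> l ^ k = \<alpha> (j * P1 + l) * \<omega> l ^ k - \<alpha> (j * P1 + l) * \<omega> l ^ Suc k"
      by (subst \<omega>_mod) (simp add: algebra_simps)
  qed
qed

lemma v_period: "v \<alpha> (k + L) = v \<alpha> k"
  by (rule ext) (simp add: v_def power_add \<omega>_period)

lemma a_nonneg: "0 \<le> a \<alpha> k" by (simp add: a_def w_nonneg size_at_nonneg)

lemma a_eq: "a \<alpha> k = L2_set (\<lambda>\<zeta>. cmod (comb \<alpha> (k, \<zeta>))) C"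
  unfolding comb_eq L2_set_norm_scale a_def size_at_def using w_nonneg[of k] by simp

lemma nsq_comb: "nsq (B \<times> C) (comb \<alpha>) = (\<Sum>k\<in>B. (a \<alpha> k)\<^sup>2)"
  by (simp add: nsq_def a_eq L2_set_square sum.cartesian_product)

lemma nsq_X: "nsq X (comb \<alpha>) = (\<Sum>k\<le>T. (a \<alpha> k)\<^sup>2)"
  by (simp add: X_def nsq_comb)

lemma q0_nonneg: "0 \<le> q0"
  using q0(1) t0 e by (intro order_trans[OF _ q0(1)] mult_nonneg_nonneg) auto

text \<open>By periodicity the times \<open>k\<close> and \<open>k + L\<close> see the same
  solution, whose size changes by at most \<open>(1 + e) ^ L\<close> in between; the factor
  \<open>t\<close> gained from the weight beats this. On the right the loss is
  \<open>(1 - e) ^ L\<close> instead.\<close>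

lemma tail_left: "k \<le> lo \<Longrightarrow> a \<alpha> k \<le> q0 * a \<alpha> (k + L)"
proof -
  assume k: "k \<le> lo"
  hence ku: "k + u < n1" using u n1 by (simp add: lo_def)
  show ?thesis
  proof (cases "s \<le> k")
    case False
    thus ?thesis using a_nonneg[of \<alpha> "k + L"] q0_nonneg by (simp add: a_def binom_weight_zero)
  next
    case True
    have 1: "size_at (v \<alpha> k) k \<le> (1 + e) ^ L * size_at (v \<alpha> k) (k + L)"
      using e by (intro slow_iterate(1)[OF slow True]) auto
    have "a \<alpha> k \<le> (t * w (k + L)) * ((1 + e) ^ L * size_at (v \<alpha> k) (k + L))"
      unfolding a_def by (intro mult_mono peak_left ku 1 mult_nonneg_nonneg size_at_nonneg w_nonneg t0)
    also have "\<dots> = (t * (1 + e) ^ L) * a \<alpha> (k + L)" by (simp add: a_def v_period)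
    also have "\<dots> \<le> q0 * a \<alpha> (k + L)" using q0 a_nonneg by (intro mult_right_mono) auto
    finally show ?thesis .
  qed
qed

lemma tail_right: "hi \<le> k \<Longrightarrow> a \<alpha> k \<le> q0 * a \<alpha> (k - L)"
proof -
  assume k: "hi \<le> k"
  have sL: "s \<le> L" using K by simp
  have kL: "k - L + L = k" "s \<le> k - L" using k sL n1 unfolding hi_def by linarith+
  have e1: "0 < (1 - e) ^ L" using e by simp
  have 1: "(1 - e) ^ L * size_at (v \<alpha> k) k \<le> size_at (v \<alpha> k) (k - L)"
    using slow_iterate(2)[OF slow kL(2), where g = "v \<alpha> k" and i = L] e kL by simp
  have "a \<alpha> k \<le> (t * w (k - L)) * size_at (v \<alpha> k) k"
    unfolding a_def by (intro mult_right_mono peak_right size_at_nonneg) (use k in \<open>simp add: hi_def\<close>)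
  also have "\<dots> \<le> ((q0 * (1 - e) ^ L) * w (k - L)) * size_at (v \<alpha> k) k"
    using q0 by (intro mult_right_mono w_nonneg size_at_nonneg) auto
  also have "\<dots> = (q0 * w (k - L)) * ((1 - e) ^ L * size_at (v \<alpha> k) k)" by (simp add: mult_ac)
  also have "\<dots> \<le> (q0 * w (k - L)) * size_at (v \<alpha> k) (k - L)"
    by (intro mult_left_mono 1 mult_nonneg_nonneg q0_nonneg w_nonneg)
  also have "v \<alpha> k = v \<alpha> (k - L)" using v_period[of \<alpha> "k - L"] kL by simp
  finally show ?thesis by (simp add: a_def mult_ac)
qed

lemma lo_hi: "lo < hi" "hi < T" "hi - lo + 1 = L + 2 * u + 2" "L \<le> 2 * lo"
  using u n1 T unfolding lo_def hi_def by linarith+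

lemma tail_sum: "(\<Sum>k\<in>{..T} - {lo<..<hi}. (a \<alpha> k)\<^sup>2) \<le> 2 * q0\<^sup>2 * nsq X (comb \<alpha>)"
proof -
  have sq: "(a \<alpha> k)\<^sup>2 \<le> q0\<^sup>2 * (a \<alpha> k')\<^sup>2" if "a \<alpha> k \<le> q0 * a \<alpha> k'" for k k'
    using power_mono[OF that a_nonneg, of 2] by (simp add: power_mult_distrib)
  have eq: "{..T} - {lo<..<hi} = {..lo} \<union> {hi..T}" using lo_hi by auto
  have split: "(\<Sum>k\<in>{..T} - {lo<..<hi}. (a \<alpha> k)\<^sup>2) = (\<Sum>k\<le>lo. (a \<alpha> k)\<^sup>2) + (\<Sum>k=hi..T. (a \<alpha> k)\<^sup>2)"
    unfolding eq by (rule sum.union_disjoint) (use lo_hi in auto)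
  have "(\<Sum>k\<le>lo. (a \<alpha> k)\<^sup>2) \<le> (\<Sum>k\<le>lo. q0\<^sup>2 * (a \<alpha> (k + L))\<^sup>2)"
    by (rule sum_mono) (use sq tail_left in auto)
  also have "\<dots> = q0\<^sup>2 * (\<Sum>k\<in>(\<lambda>k. k + L) ` {..lo}. (a \<alpha> k)\<^sup>2)"
    by (subst sum.reindex) (auto simp: sum_distrib_left)
  also have "\<dots> \<le> q0\<^sup>2 * nsq X (comb \<alpha>)"
    unfolding nsq_X by (intro mult_left_mono sum_mono2) (use T in \<open>auto simp: lo_def\<close>)
  finally have left: "(\<Sum>k\<le>lo. (a \<alpha> k)\<^sup>2) \<le> q0\<^sup>2 * nsq X (comb \<alpha>)" .
  have "(\<Sum>k=hi..T. (a \<alpha> k)\<^sup>2) \<le> (\<Sum>k=hi..T. q0\<^sup>2 * (a \<alpha> (k - L))\<^sup>2)"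
    by (rule sum_mono) (use sq tail_right in auto)
  also have "\<dots> = q0\<^sup>2 * (\<Sum>k\<in>(\<lambda>k. k - L) ` {hi..T}. (a \<alpha> k)\<^sup>2)"
    by (subst sum.reindex) (auto simp: sum_distrib_left hi_def inj_on_def)
  also have "\<dots> \<le> q0\<^sup>2 * nsq X (comb \<alpha>)"
    unfolding nsq_X by (intro mult_left_mono sum_mono2) auto
  finally show ?thesis using left split by linarith
qed

lemma variation: "lo \<le> k \<Longrightarrow> \<bar>w k - w (Suc k)\<bar> \<le> \<kappa> * w (Suc k)"
  by (rule binom_weight_variation) (use K s lo_hi in auto)

lemma lo_ge_s: "s \<le> lo"
proof -
  have "2 * s \<le> L" using K by simp
  thus ?thesis using lo_hi(4) by linarith
qed

text \<open>Multiplying by \<open>\<omega>\<close> advances the coefficient vector by one step, so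
  inside the window time \<open>k\<close> of the new combination compares with time
  \<open>k + 1\<close> of the old one. The mass of the new combination outside the window is
  absorbed on the left, whence the factor \<open>1 - 2 * q0\<^sup>2\<close>.\<close>

lemma shift_bound: "nsq X (comb (\<lambda>b. \<alpha> b * \<omega> b)) * (1 - 2 * q0\<^sup>2) \<le> ((1 + \<kappa>) * (1 + e))\<^sup>2 * nsq X (comb \<alpha>)"
proof -
  define \<beta> where "\<beta> = (\<lambda>b. \<alpha> b * \<omega> b)"
  have step: "a \<beta> k \<le> ((1 + \<kappa>) * (1 + e)) * a \<alpha> (Suc k)" if "k \<in> {lo<..<hi}" for k
  proof -
    have lk: "lo \<le> k" using that by simp
    have "w k \<le> (1 + \<kappa>) * w (Suc k)" using variation[OF lk] by (simp add: algebra_simps)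
    moreover have "size_at (v \<alpha> (Suc k)) k \<le> (1 + e) * size_at (v \<alpha> (Suc k)) (Suc k)"
      using lk lo_ge_s by (intro slow_step(1)[OF slow]) auto
    ultimately have "w k * size_at (v \<alpha> (Suc k)) k \<le> ((1 + \<kappa>) * w (Suc k)) * ((1 + e) * size_at (v \<alpha> (Suc k)) (Suc k))"
      using e by (intro mult_mono mult_nonneg_nonneg w_nonneg size_at_nonneg) auto
    thus ?thesis by (simp add: a_def \<beta>_def v_shift mult_ac)
  qed
  have "{..T} = {lo<..<hi} \<union> ({..T} - {lo<..<hi})" using lo_hi by auto
  hence split: "nsq X (comb \<beta>) = (\<Sum>k\<in>{lo<..<hi}. (a \<beta> k)\<^sup>2) + (\<Sum>k\<in>{..T} - {lo<..<hi}. (a \<beta> k)\<^sup>2)"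
    unfolding nsq_X by (subst sum.union_disjoint[symmetric]) auto
  have "(\<Sum>k\<in>{lo<..<hi}. (a \<beta> k)\<^sup>2) \<le> (\<Sum>k\<in>{lo<..<hi}. (((1 + \<kappa>) * (1 + e)) * a \<alpha> (Suc k))\<^sup>2)"
    by (intro sum_mono power_mono step a_nonneg)
  also have "\<dots> = ((1 + \<kappa>) * (1 + e))\<^sup>2 * (\<Sum>k\<in>Suc ` {lo<..<hi}. (a \<alpha> k)\<^sup>2)"
    by (subst sum.reindex) (auto simp: sum_distrib_left power_mult_distrib)
  also have "\<dots> \<le> ((1 + \<kappa>) * (1 + e))\<^sup>2 * nsq X (comb \<alpha>)"
    unfolding nsq_X by (intro mult_left_mono sum_mono2) (use lo_hi in auto)
  finally have "(\<Sum>k\<in>{lo<..<hi}. (a \<beta> k)\<^sup>2) \<le> ((1 + \<kappa>) * (1 + e))\<^sup>2 * nsq X (comb \<alpha>)" .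
  hence "nsq X (comb \<beta>) \<le> ((1 + \<kappa>) * (1 + e))\<^sup>2 * nsq X (comb \<alpha>) + 2 * q0\<^sup>2 * nsq X (comb \<beta>)"
    using tail_sum[of \<beta>] split by linarith
  thus ?thesis unfolding \<beta>_def[symmetric] by (simp add: algebra_simps)
qed

text \<open>Relative one-step error: the drift \<open>e\<close>, at a weight at most
  \<open>1 + \<kappa>\<close> times the next one, plus the variation \<open>\<kappa>\<close> of the
  weight.\<close>

definition e1 where "e1 = e * (1 + \<kappa>) + \<kappa>"

definition remainder :: "(nat \<Rightarrow> complex) \<Rightarrow> nat \<Rightarrow> complex \<Rightarrow> complex" where
  "remainder \<alpha> k \<zeta> = of_real (w k) * Y \<zeta> (v \<alpha> (Suc k)) k - \<zeta> * (of_real (w (Suc k)) * Y \<zeta> (v \<alpha> (Suc k)) (Suc k))"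

lemma comb_difference: "comb \<alpha> (k, \<zeta>) - \<zeta> * comb \<alpha> (Suc k, \<zeta>) = comb (\<lambda>b. \<alpha> b * (1 - \<omega> b)) (k, \<zeta>) + remainder \<alpha> k \<zeta>"
proof -
  have Yd: "Y \<zeta> (\<lambda>j. v \<alpha> k j - v \<alpha> (Suc k) j) k = Y \<zeta> (v \<alpha> k) k - Y \<zeta> (v \<alpha> (Suc k)) k"
    by (simp add: Y_def algebra_simps sum_subtractf)
  show ?thesis unfolding comb_eq remainder_def v_diff Yd by (simp add: algebra_simps)
qed

lemma remainder_bound:
  assumes k: "lo \<le> k"
  shows "(\<Sum>\<zeta>\<in>C. (cmod (remainder \<alpha> k \<zeta>))\<^sup>2) \<le> e1\<^sup>2 * (a \<alpha> (Suc k))\<^sup>2"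
proof -
  let ?g = "v \<alpha> (Suc k)"
  have "remainder \<alpha> k \<zeta> = of_real (w k) * (Y \<zeta> ?g k - \<zeta> * Y \<zeta> ?g (Suc k))
      + of_real (w k - w (Suc k)) * (\<zeta> * Y \<zeta> ?g (Suc k))" for \<zeta>
    by (simp add: remainder_def algebra_simps)
  hence "L2_set (\<lambda>\<zeta>. cmod (remainder \<alpha> k \<zeta>)) C \<le>
      L2_set (\<lambda>\<zeta>. cmod (of_real (w k) * (Y \<zeta> ?g k - \<zeta> * Y \<zeta> ?g (Suc k)))) C +
      L2_set (\<lambda>\<zeta>. cmod (of_real (w k - w (Suc k)) * (\<zeta> * Y \<zeta> ?g (Suc k)))) C"
    by (simp only: L2_set_norm_add)
  also have "\<dots> = w k * L2_set (\<lambda>\<zeta>. cmod (Y \<zeta> ?g k - \<zeta> * Y \<zeta> ?g (Suc k))) C + \<bar>w k - w (Suc k)\<bar> * size_at ?g (Suc k)"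
    unfolding L2_set_norm_scale size_at_rotate norm_of_real using w_nonneg[of k] by simp
  also have "\<dots> \<le> ((1 + \<kappa>) * w (Suc k)) * (e * size_at ?g (Suc k)) + (\<kappa> * w (Suc k)) * size_at ?g (Suc k)"
  proof (intro add_mono mult_mono mult_right_mono variation k size_at_nonneg)
    show "w k \<le> (1 + \<kappa>) * w (Suc k)" using variation[OF k] by (simp add: algebra_simps)
    show "L2_set (\<lambda>\<zeta>. cmod (Y \<zeta> ?g k - \<zeta> * Y \<zeta> ?g (Suc k))) C \<le> e * size_at ?g (Suc k)"
      using slow k lo_ge_s unfolding slow_def by auto
  qed (auto intro!: mult_nonneg_nonneg divide_nonneg_nonneg w_nonneg L2_set_nonneg)
  also have "\<dots> = e1 * a \<alpha> (Suc k)" by (simp add: e1_def a_def algebra_simps)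
  finally have "(L2_set (\<lambda>\<zeta>. cmod (remainder \<alpha> k \<zeta>)) C)\<^sup>2 \<le> (e1 * a \<alpha> (Suc k))\<^sup>2"
    by (rule power_mono) (rule L2_set_nonneg)
  thus ?thesis by (simp add: L2_set_square power_mult_distrib)
qed

text \<open>The split with parameter \<open>\<xi>\<close> keeps the modulation term with a factor
  close to 1. A fixed larger constant in its place would ruin the final count, which weighs this
  energy against \<open>\<Lambda>\<close>.\<close>

lemma difference_bound:
  assumes \<xi>: "0 < \<xi>" and A: "A \<subseteq> C"
  shows "(\<Sum>k\<in>{lo..<hi}. \<Sum>\<zeta>\<in>A. (cmod (comb \<alpha> (k, \<zeta>) - \<zeta> * comb \<alpha> (Suc k, \<zeta>)))\<^sup>2)
    \<le> (1 + \<xi>) * nsq X (comb (\<lambda>b. \<alpha> b * (1 - \<omega> b))) + (1 + 1 / \<xi>) * e1\<^sup>2 * nsq X (comb \<alpha>)"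
proof -
  let ?\<gamma> = "\<lambda>b. \<alpha> b * (1 - \<omega> b)"
  have one: "(\<Sum>\<zeta>\<in>A. (cmod (comb \<alpha> (k, \<zeta>) - \<zeta> * comb \<alpha> (Suc k, \<zeta>)))\<^sup>2)
      \<le> (1 + \<xi>) * (a ?\<gamma> k)\<^sup>2 + (1 + 1 / \<xi>) * (e1\<^sup>2 * (a \<alpha> (Suc k))\<^sup>2)" if k: "lo \<le> k" for k
  proof -
    have "(\<Sum>\<zeta>\<in>A. (cmod (comb \<alpha> (k, \<zeta>) - \<zeta> * comb \<alpha> (Suc k, \<zeta>)))\<^sup>2)
       \<le> (\<Sum>\<zeta>\<in>C. (cmod (comb \<alpha> (k, \<zeta>) - \<zeta> * comb \<alpha> (Suc k, \<zeta>)))\<^sup>2)"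
      by (rule sum_mono2[OF finite_C A]) simp
    also have "\<dots> \<le> (\<Sum>\<zeta>\<in>C. (1 + \<xi>) * (cmod (comb ?\<gamma> (k, \<zeta>)))\<^sup>2 + (1 + 1 / \<xi>) * (cmod (remainder \<alpha> k \<zeta>))\<^sup>2)"
    proof (rule sum_mono)
      fix \<zeta>
      have "(cmod (comb \<alpha> (k, \<zeta>) - \<zeta> * comb \<alpha> (Suc k, \<zeta>)))\<^sup>2 \<le> (cmod (comb ?\<gamma> (k, \<zeta>)) + cmod (remainder \<alpha> k \<zeta>))\<^sup>2"
        unfolding comb_difference by (intro power_mono norm_triangle_ineq) auto
      also have "\<dots> \<le> (1 + \<xi>) * (cmod (comb ?\<gamma> (k, \<zeta>)))\<^sup>2 + (1 + 1 / \<xi>) * (cmod (remainder \<alpha> k \<zeta>))\<^sup>2"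
        by (rule square_add_le[OF \<xi>])
      finally show "(cmod (comb \<alpha> (k, \<zeta>) - \<zeta> * comb \<alpha> (Suc k, \<zeta>)))\<^sup>2 \<le> \<dots>" .
    qed
    also have "\<dots> = (1 + \<xi>) * (a ?\<gamma> k)\<^sup>2 + (1 + 1 / \<xi>) * (\<Sum>\<zeta>\<in>C. (cmod (remainder \<alpha> k \<zeta>))\<^sup>2)"
      by (simp add: sum.distrib sum_distrib_left a_eq L2_set_square)
    also have "\<dots> \<le> (1 + \<xi>) * (a ?\<gamma> k)\<^sup>2 + (1 + 1 / \<xi>) * (e1\<^sup>2 * (a \<alpha> (Suc k))\<^sup>2)"
      using remainder_bound[OF k, of \<alpha>] \<xi> by (intro add_left_mono mult_left_mono) auto
    finally show ?thesis .
  qed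
  have "(\<Sum>k\<in>{lo..<hi}. \<Sum>\<zeta>\<in>A. (cmod (comb \<alpha> (k, \<zeta>) - \<zeta> * comb \<alpha> (Suc k, \<zeta>)))\<^sup>2)
     \<le> (\<Sum>k\<in>{lo..<hi}. (1 + \<xi>) * (a ?\<gamma> k)\<^sup>2 + (1 + 1 / \<xi>) * (e1\<^sup>2 * (a \<alpha> (Suc k))\<^sup>2))"
    by (rule sum_mono) (use one in auto)
  also have "\<dots> = (1 + \<xi>) * (\<Sum>k\<in>{lo..<hi}. (a ?\<gamma> k)\<^sup>2) + (1 + 1 / \<xi>) * e1\<^sup>2 * (\<Sum>k\<in>Suc ` {lo..<hi}. (a \<alpha> k)\<^sup>2)"
    by (subst sum.reindex) (auto simp: sum.distrib sum_distrib_left mult.assoc)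
  also have "\<dots> \<le> (1 + \<xi>) * nsq X (comb ?\<gamma>) + (1 + 1 / \<xi>) * e1\<^sup>2 * nsq X (comb \<alpha>)"
    unfolding nsq_X using \<xi> by (intro add_mono mult_left_mono sum_mono2) (use lo_hi in auto)
  finally show ?thesis .
qed

text \<open>The sequence behaves like \<open>b ^ (-k)\<close>, so its generating polynomial should
  live near \<open>z = b\<close>. There it is small by \<open>near\<close>; at distance at least
  \<open>\<delta>\<close> it is controlled by its product with \<open>z - b\<close>, whose
  coefficients are the differences already estimated.\<close>

lemma regular_bound:
  assumes b: "b \<in> C" and \<delta>: "0 < \<delta>"
    and near: "\<And>z. cmod z = 1 \<Longrightarrow> cmod (z - b) < \<delta> \<Longrightarrow> (cmod (\<Sum>k\<le>T. comb \<alpha> (k, b) * z ^ k))\<^sup>2 \<le> q1 * nsq X (comb \<alpha>)"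
  shows "(\<Sum>k\<le>T. (cmod (comb \<alpha> (k, b)))\<^sup>2) \<le> 2 / \<delta>\<^sup>2 * nsq X (comb (\<lambda>b. \<alpha> b * (1 - \<omega> b)))
     + ((2 * e1\<^sup>2 + 10 * q0\<^sup>2) / \<delta>\<^sup>2 + q1) * nsq X (comb \<alpha>)"
proof -
  let ?\<gamma> = "\<lambda>b. \<alpha> b * (1 - \<omega> b)"
  define c where "c = (\<lambda>k. if k \<le> T then comb \<alpha> (k, b) else 0)"
  define c' where "c' = (\<lambda>k. (if k = 0 then 0 else c (k - 1)) - b * c k)"
  \<comment> \<open>The product with \<open>z - b\<close> has degree \<open>T + 1\<close>, so at
    \<open>T + 2\<close> sample points Parseval holds for both polynomials.\<close>
  define N where "N = T + 2"
  define E where "E = (\<lambda>i k. cis (2 * pi * real i * real k / real N))"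
  define U where "U = (\<lambda>i. \<Sum>k<N. c k * E i k)"
  have N0: "real N > 0" by (simp add: N_def)
  have E_pow: "E i k = E i 1 ^ k" for i k
    by (simp add: E_def Complex.DeMoivre algebra_simps)
  have Ueq: "U i = (\<Sum>k\<le>T. comb \<alpha> (k, b) * (E i 1) ^ k)" for i
    unfolding U_def E_pow[symmetric] by (rule sum.mono_neutral_cong_right) (auto simp: c_def N_def)
  have U': "(E i 1 - b) * U i = (\<Sum>k<N. c' k * E i k)" for i
  proof -
    have "E i 1 * U i = (\<Sum>k<Suc T. c k * E i (Suc k))"
    proof -
      have "E i 1 * U i = (\<Sum>k<N. c k * E i (Suc k))"
        unfolding U_def sum_distrib_left
      proof (rule sum.cong[OF refl])
        fix k
        have "E i (Suc k) = E i 1 * E i k" using E_pow[of i "Suc k"] E_pow[of i k] by simp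
        thus "E i 1 * (c k * E i k) = c k * E i (Suc k)" by simp
      qed
      thus ?thesis by (simp add: N_def c_def)
    qed
    also have "\<dots> = (\<Sum>k<N. (if k = 0 then 0 else c (k - 1)) * E i k)"
      unfolding N_def by (simp only: add_2_eq_Suc' sum.lessThan_Suc_shift[of _ "Suc T"]) simp
    finally have "(E i 1 - b) * U i = (\<Sum>k<N. (if k = 0 then 0 else c (k - 1)) * E i k) - b * U i"
      by (simp add: algebra_simps)
    also have "\<dots> = (\<Sum>k<N. c' k * E i k)"
      unfolding U_def sum_distrib_left sum_subtractf[symmetric]
      by (rule sum.cong) (auto simp: c'_def algebra_simps)
    finally show ?thesis .
  qed
  have pars: "real N * (\<Sum>k\<le>T. (cmod (comb \<alpha> (k, b)))\<^sup>2) = (\<Sum>i<N. (cmod (U i))\<^sup>2)"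
  proof -
    have "(\<Sum>i<N. (cmod (U i))\<^sup>2) = real N * (\<Sum>k<N. (cmod (c k))\<^sup>2)"
      unfolding U_def E_def by (rule discrete_parseval)
    also have "(\<Sum>k<N. (cmod (c k))\<^sup>2) = (\<Sum>k\<le>T. (cmod (comb \<alpha> (k, b)))\<^sup>2)"
      by (rule sum.mono_neutral_cong_right) (auto simp: c_def N_def)
    finally show ?thesis by simp
  qed
  have pars': "(\<Sum>i<N. (cmod (E i 1 - b))\<^sup>2 * (cmod (U i))\<^sup>2) = real N * (\<Sum>k<N. (cmod (c' k))\<^sup>2)"
  proof -
    have "(\<Sum>i<N. (cmod (E i 1 - b))\<^sup>2 * (cmod (U i))\<^sup>2) = (\<Sum>i<N. (cmod (\<Sum>k<N. c' k * E i k))\<^sup>2)"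
      unfolding U'[symmetric] by (simp add: norm_mult power_mult_distrib)
    also have "\<dots> = real N * (\<Sum>k<N. (cmod (c' k))\<^sup>2)" unfolding E_def by (rule discrete_parseval)
    finally show ?thesis .
  qed
  define S where "S = nsq X (comb \<alpha>)"
  have S0: "0 \<le> S" by (simp add: S_def nsq_nonneg)
  have pt: "(cmod (U i))\<^sup>2 \<le> 1 / \<delta>\<^sup>2 * ((cmod (E i 1 - b))\<^sup>2 * (cmod (U i))\<^sup>2) + max 0 q1 * S" for i
  proof (cases "cmod (E i 1 - b) < \<delta>")
    case True
    have "cmod (E i 1) = 1" by (simp add: E_def)
    hence "(cmod (U i))\<^sup>2 \<le> q1 * S" unfolding Ueq S_def using True by (intro near) auto
    also have "\<dots> \<le> max 0 q1 * S" using S0 by (intro mult_right_mono) auto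
    finally have A: "(cmod (U i))\<^sup>2 \<le> max 0 q1 * S" .
    have "0 \<le> 1 / \<delta>\<^sup>2 * ((cmod (E i 1 - b))\<^sup>2 * (cmod (U i))\<^sup>2)" by simp
    thus ?thesis using A by linarith
  next
    case False
    hence "\<delta>\<^sup>2 \<le> (cmod (E i 1 - b))\<^sup>2" using \<delta> by (intro power_mono) auto
    hence "\<delta>\<^sup>2 * (cmod (U i))\<^sup>2 \<le> (cmod (E i 1 - b))\<^sup>2 * (cmod (U i))\<^sup>2" by (intro mult_right_mono) auto
    hence "(cmod (U i))\<^sup>2 \<le> 1 / \<delta>\<^sup>2 * ((cmod (E i 1 - b))\<^sup>2 * (cmod (U i))\<^sup>2)"
      using \<delta> by (simp add: field_simps)
    thus ?thesis using S0 by (simp add: add_increasing2)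
  qed
  \<comment> \<open>If \<open>q1 < 0\<close>, then \<open>near\<close> at \<open>z = b\<close>
    forces \<open>S = 0\<close>, and both sides vanish.\<close>
  have q1S: "max 0 q1 * S = q1 * S"
  proof (cases "0 \<le> q1")
    case False
    have "0 \<le> q1 * S" using order_trans[OF _ near[of b]] norm_C[OF b] \<delta> by (simp add: S_def)
    hence "S = 0" using False S0 by (simp add: zero_le_mult_iff)
    thus ?thesis by simp
  qed simp
  have "real N * (\<Sum>k\<le>T. (cmod (comb \<alpha> (k, b)))\<^sup>2) \<le> (\<Sum>i<N. 1 / \<delta>\<^sup>2 * ((cmod (E i 1 - b))\<^sup>2 * (cmod (U i))\<^sup>2) + q1 * S)"
    unfolding pars q1S[symmetric] by (rule sum_mono) (rule pt)
  also have "\<dots> = real N * (1 / \<delta>\<^sup>2 * (\<Sum>k<N. (cmod (c' k))\<^sup>2) + q1 * S)"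
    unfolding sum.distrib sum_distrib_left[symmetric] pars' by (simp add: algebra_simps)
  finally have main: "(\<Sum>k\<le>T. (cmod (comb \<alpha> (k, b)))\<^sup>2) \<le> 1 / \<delta>\<^sup>2 * (\<Sum>k<N. (cmod (c' k))\<^sup>2) + q1 * S"
    using N0 by simp
  define d where "d = (\<lambda>k. (cmod (comb \<alpha> (k, b) - b * comb \<alpha> (Suc k, b)))\<^sup>2)"
  have comb_a: "(cmod (comb \<alpha> (k, b)))\<^sup>2 \<le> (a \<alpha> k)\<^sup>2" for k
    unfolding a_eq L2_set_square by (rule member_le_sum[OF b]) (auto simp: finite_C)
  have c0: "comb \<alpha> (0, b) = 0" using s by (simp add: comb_eq binom_weight_zero)
  have "(\<Sum>k<N. (cmod (c' k))\<^sup>2) = (\<Sum>k<T. d k) + (cmod (comb \<alpha> (T, b)))\<^sup>2"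
  proof -
    have "(\<Sum>k<N. (cmod (c' k))\<^sup>2) = (cmod (c' 0))\<^sup>2 + (\<Sum>k<Suc T. (cmod (c' (Suc k)))\<^sup>2)"
      unfolding N_def by (simp only: add_2_eq_Suc' sum.lessThan_Suc_shift[of _ "Suc T"])
    also have "c' 0 = 0" by (simp add: c'_def c_def c0)
    also have "(\<Sum>k<Suc T. (cmod (c' (Suc k)))\<^sup>2) = (\<Sum>k<T. d k) + (cmod (comb \<alpha> (T, b)))\<^sup>2"
      by (simp add: c'_def c_def d_def)
    finally show ?thesis by simp
  qed
  moreover have "(cmod (comb \<alpha> (T, b)))\<^sup>2 \<le> 2 * q0\<^sup>2 * S"
  proof -
    have "(a \<alpha> T)\<^sup>2 \<le> (\<Sum>k\<in>{..T} - {lo<..<hi}. (a \<alpha> k)\<^sup>2)"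
      by (rule member_le_sum) (use lo_hi in auto)
    thus ?thesis using comb_a[of T] tail_sum[of \<alpha>] by (simp add: S_def)
  qed
  moreover have "(\<Sum>k<T. d k) \<le> 2 * nsq X (comb ?\<gamma>) + 2 * e1\<^sup>2 * S + 8 * q0\<^sup>2 * S"
  proof -
    have d_tail: "d k \<le> 2 * (a \<alpha> k)\<^sup>2 + 2 * (a \<alpha> (Suc k))\<^sup>2" for k
    proof -
      have "d k \<le> (cmod (comb \<alpha> (k, b)) + cmod (comb \<alpha> (Suc k, b)))\<^sup>2"
        unfolding d_def using norm_triangle_ineq4[of "comb \<alpha> (k, b)" "b * comb \<alpha> (Suc k, b)"] norm_C[OF b]
        by (intro power_mono) (auto simp: norm_mult)
      also have "\<dots> \<le> 2 * (cmod (comb \<alpha> (k, b)))\<^sup>2 + 2 * (cmod (comb \<alpha> (Suc k, b)))\<^sup>2"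
        using square_add_le[of 1 "cmod (comb \<alpha> (k, b))" "cmod (comb \<alpha> (Suc k, b))"] by simp
      also have "\<dots> \<le> 2 * (a \<alpha> k)\<^sup>2 + 2 * (a \<alpha> (Suc k))\<^sup>2"
        by (intro add_mono mult_left_mono comb_a) auto
      finally show ?thesis .
    qed
    have eq: "{..<T} = {lo..<hi} \<union> ({..<lo} \<union> {hi..<T})" using lo_hi by auto
    have "(\<Sum>k<T. d k) = (\<Sum>k\<in>{lo..<hi}. d k) + (\<Sum>k\<in>{..<lo} \<union> {hi..<T}. d k)"
      unfolding eq by (rule sum.union_disjoint) (use lo_hi in auto)
    moreover have "(\<Sum>k\<in>{lo..<hi}. d k) \<le> 2 * nsq X (comb ?\<gamma>) + 2 * e1\<^sup>2 * S"
      using difference_bound[of 1 "{b}" \<alpha>] b by (simp add: d_def S_def)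
    moreover have "(\<Sum>k\<in>{..<lo} \<union> {hi..<T}. d k) \<le> 8 * q0\<^sup>2 * S"
    proof -
      have "(\<Sum>k\<in>{..<lo} \<union> {hi..<T}. d k) \<le> 2 * (\<Sum>k\<in>{..<lo} \<union> {hi..<T}. (a \<alpha> k)\<^sup>2) + 2 * (\<Sum>k\<in>Suc ` ({..<lo} \<union> {hi..<T}). (a \<alpha> k)\<^sup>2)"
        by (subst sum.reindex) (auto simp: sum_distrib_left sum.distrib[symmetric] intro!: sum_mono d_tail)
      also have "\<dots> \<le> 2 * (\<Sum>k\<in>{..T} - {lo<..<hi}. (a \<alpha> k)\<^sup>2) + 2 * (\<Sum>k\<in>{..T} - {lo<..<hi}. (a \<alpha> k)\<^sup>2)"
        by (intro add_mono mult_left_mono sum_mono2) (use lo_hi in auto)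
      also have "\<dots> \<le> 8 * q0\<^sup>2 * S" using tail_sum[of \<alpha>] by (simp add: S_def)
      finally show ?thesis .
    qed
    ultimately show ?thesis by linarith
  qed
  ultimately have "(\<Sum>k<N. (cmod (c' k))\<^sup>2) \<le> 2 * nsq X (comb ?\<gamma>) + (2 * e1\<^sup>2 + 10 * q0\<^sup>2) * S"
    by (simp add: algebra_simps)
  hence "1 / \<delta>\<^sup>2 * (\<Sum>k<N. (cmod (c' k))\<^sup>2) \<le> 1 / \<delta>\<^sup>2 * (2 * nsq X (comb ?\<gamma>) + (2 * e1\<^sup>2 + 10 * q0\<^sup>2) * S)"
    by (intro mult_left_mono) auto
  with main show ?thesis by (simp add: S_def algebra_simps add_divide_distrib)
qed

text \<open>Over a full period of \<open>L\<close> times starting at \<open>n1\<close>, Parseval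
  recovers the coefficients \<open>\<alpha>\<close> from \<open>v \<alpha>\<close>, and there the
  weight is at least \<open>(K / 8) ^ s\<close>. Besides linear independence this gives the
  quantitative lower bound that is opposed to Cauchy's estimate.\<close>

lemma nsq_lower:
  "((real K / 8) ^ s * mm)\<^sup>2 * (real L * (\<Sum>b<D * P1. (cmod (\<alpha> b))\<^sup>2)) \<le> nsq X (comb \<alpha>)"
proof -
  have pars: "(\<Sum>i<L. (cmod (v \<alpha> (n1 + i) j))\<^sup>2) = real L * (\<Sum>l<P1. (cmod (\<alpha> (j * P1 + l)))\<^sup>2)" for j
  proof -
    define \<beta> where "\<beta> = (\<lambda>l. if l < P1 then \<alpha> (j * P1 + l) * \<omega> l ^ n1 else 0)"
    have pl: "P1 \<le> L" using P by (simp add: P1_def)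
    have "cmod (v \<alpha> (n1 + i) j) = cmod (\<Sum>l<L. \<beta> l * cis (2 * pi * real i * real l / real L))" for i
    proof -
      \<comment> \<open>The frequency offset \<open>P\<close> contributes a phase independent of
        \<open>l\<close>, which disappears in the modulus.\<close>
      have om: "\<omega> l ^ i = cis (- (2 * pi * real i * real P / real L)) * cis (2 * pi * real i * real l / real L)" if "l < P1" for l
        using that by (simp add: \<omega>_def Complex.DeMoivre cis_mult algebra_simps diff_divide_distrib)
      have "v \<alpha> (n1 + i) j = (\<Sum>l<P1. cis (- (2 * pi * real i * real P / real L)) * (\<beta> l * cis (2 * pi * real i * real l / real L)))"
        unfolding v_def by (rule sum.cong) (simp_all add: \<beta>_def power_add om mult_ac)
      also have "\<dots> = cis (- (2 * pi * real i * real P / real L)) * (\<Sum>l<P1. \<beta> l * cis (2 * pi * real i * real l / real L))"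
        by (simp add: sum_distrib_left)
      also have "(\<Sum>l<P1. \<beta> l * cis (2 * pi * real i * real l / real L)) = (\<Sum>l<L. \<beta> l * cis (2 * pi * real i * real l / real L))"
        by (rule sum.mono_neutral_left) (use pl in \<open>auto simp: \<beta>_def\<close>)
      finally show ?thesis by (simp add: norm_mult)
    qed
    hence "(\<Sum>i<L. (cmod (v \<alpha> (n1 + i) j))\<^sup>2) = real L * (\<Sum>l<L. (cmod (\<beta> l))\<^sup>2)"
      using discrete_parseval[of \<beta> L] by simp
    also have "(\<Sum>l<L. (cmod (\<beta> l))\<^sup>2) = (\<Sum>l<P1. (cmod (\<alpha> (j * P1 + l)))\<^sup>2)"
      by (rule sum.mono_neutral_cong_right) (use pl in \<open>auto simp: \<beta>_def norm_mult norm_power norm_\<omega>\<close>)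
    finally show ?thesis .
  qed
  have one: "((real K / 8) ^ s * mm)\<^sup>2 * (\<Sum>j<D. (cmod (v \<alpha> (n1 + i) j))\<^sup>2) \<le> (a \<alpha> (n1 + i))\<^sup>2" if i: "i < L" for i
  proof -
    have r3: "L \<le> n1 + i" "n1 + i \<le> 3 * L" using i n1 by auto
    have "(real K / 8) ^ s * (mm * L2_set (\<lambda>j. cmod (v \<alpha> (n1 + i) j)) {..<D}) \<le> w (n1 + i) * size_at (v \<alpha> (n1 + i)) (n1 + i)"
      using mm K s by (intro mult_mono binom_weight_lower lower r3 w_nonneg mult_nonneg_nonneg L2_set_nonneg) auto
    hence "((real K / 8) ^ s * mm * L2_set (\<lambda>j. cmod (v \<alpha> (n1 + i) j)) {..<D})\<^sup>2 \<le> (a \<alpha> (n1 + i))\<^sup>2"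
      unfolding a_def mult.assoc using mm by (intro power_mono mult_nonneg_nonneg L2_set_nonneg) auto
    thus ?thesis by (simp add: power_mult_distrib L2_set_square)
  qed
  have "((real K / 8) ^ s * mm)\<^sup>2 * (real L * (\<Sum>b<D * P1. (cmod (\<alpha> b))\<^sup>2))
      = ((real K / 8) ^ s * mm)\<^sup>2 * (\<Sum>i<L. \<Sum>j<D. (cmod (v \<alpha> (n1 + i) j))\<^sup>2)"
    by (subst sum.swap) (simp only: pars sum_blocks[of _ D P1] sum_distrib_left)
  also have "\<dots> = (\<Sum>i<L. ((real K / 8) ^ s * mm)\<^sup>2 * (\<Sum>j<D. (cmod (v \<alpha> (n1 + i) j))\<^sup>2))"
    by (rule sum_distrib_left)
  also have "\<dots> \<le> (\<Sum>i<L. (a \<alpha> (n1 + i))\<^sup>2)" by (rule sum_mono) (use one in auto)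
  also have "\<dots> = (\<Sum>k\<in>(\<lambda>i. n1 + i) ` {..<L}. (a \<alpha> k)\<^sup>2)" by (subst sum.reindex) auto
  also have "\<dots> \<le> nsq X (comb \<alpha>)" unfolding nsq_X by (rule sum_mono2) (use T in auto)
  finally show ?thesis .
qed

end

text \<open>At least \<open>P\<close> frequencies lie within \<open>P / 2\<close> of the centre. As
  \<open>4 * P \<le> L\<close> keeps the largest angle below \<open>pi / 2\<close>, the half-angle
  formula shows that each of them uses at most half of \<open>\<Lambda>\<close>; and
  \<open>P\<close> is at least a third of \<open>2 * P + 1\<close>.\<close>

lemma frequency_gap_sum:
  fixes L P :: nat
  assumes P: "4 * P \<le> L" "1 \<le> P"
  defines "\<Lambda> \<equiv> 2 - 2 * cos (2 * pi * real P / real L)"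
  shows "\<Lambda> * real (2 * P + 1) / 6 \<le> (\<Sum>b<2 * P + 1. \<Lambda> - (2 - 2 * cos (2 * pi * (real b - real P) / real L)))"
proof -
  have L0: "real L > 0" using P by simp
  define \<phi> where "\<phi> = 2 * pi * real P / real L"
  have \<phi>: "0 \<le> \<phi>" "\<phi> \<le> pi / 2"
  proof -
    have "real (4 * P) \<le> real L" using P by (simp only: of_nat_le_iff)
    hence "4 * real P * pi \<le> real L * pi" by (intro mult_right_mono) auto
    thus "\<phi> \<le> pi / 2" using L0 by (simp add: \<phi>_def field_simps)
  qed (simp add: \<phi>_def)
  have half: "2 * (1 - cos (\<phi> / 2)) \<le> 1 - cos \<phi>"
  proof -
    have "cos \<phi> = 2 * (cos (\<phi> / 2))\<^sup>2 - 1" using cos_double_cos[of "\<phi> / 2"] by simp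
    hence "1 - cos \<phi> = 2 * (1 - cos (\<phi> / 2)) * (1 + cos (\<phi> / 2))"
      by (simp add: power2_eq_square algebra_simps)
    moreover have "0 \<le> cos (\<phi> / 2)" using \<phi> by (intro cos_ge_zero) auto
    ultimately show ?thesis using mult_left_mono[of 1 "1 + cos (\<phi> / 2)" "2 * (1 - cos (\<phi> / 2))"] by simp
  qed
  have abs: "cos (2 * pi * (real b - real P) / real L) = cos (2 * pi * \<bar>real b - real P\<bar> / real L)" for b
  proof (cases "real b - real P \<ge> 0")
    case False
    hence "\<bar>real b - real P\<bar> = - (real b - real P)" by simp
    hence "2 * pi * \<bar>real b - real P\<bar> / real L = - (2 * pi * (real b - real P) / real L)"
      by (simp only: mult_minus_right minus_divide_left)
    thus ?thesis by (simp only: cos_minus)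
  qed simp
  have le1: "0 \<le> \<Lambda> - (2 - 2 * cos (2 * pi * (real b - real P) / real L))" if "b < 2 * P + 1" for b
  proof -
    have "\<bar>real b - real P\<bar> \<le> real P" using that by auto
    hence "2 * pi * \<bar>real b - real P\<bar> / real L \<le> \<phi>" using L0 by (simp add: \<phi>_def divide_right_mono)
    hence "cos \<phi> \<le> cos (2 * pi * \<bar>real b - real P\<bar> / real L)"
      using \<phi> L0 by (intro cos_monotone_0_pi_le) auto
    thus ?thesis by (simp add: abs \<Lambda>_def \<phi>_def)
  qed
  have le2: "\<Lambda> / 2 \<le> \<Lambda> - (2 - 2 * cos (2 * pi * (real b - real P) / real L))" if "P \<le> 2 * b" "2 * b \<le> 3 * P" for b
  proof -
    have "real P \<le> real (2 * b)" "real (2 * b) \<le> real (3 * P)" using that by (simp_all only: of_nat_le_iff)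
    hence "2 * \<bar>real b - real P\<bar> \<le> real P" by (simp add: abs_if)
    hence "2 * pi * \<bar>real b - real P\<bar> / real L \<le> \<phi> / 2" using L0 by (simp add: \<phi>_def field_simps)
    hence "cos (\<phi> / 2) \<le> cos (2 * pi * \<bar>real b - real P\<bar> / real L)"
      using \<phi> L0 by (intro cos_monotone_0_pi_le) auto
    thus ?thesis using half by (simp add: abs \<Lambda>_def \<phi>_def)
  qed
  define B where "B = {P - P div 2..P + P div 2}"
  have cB: "P \<le> card B" by (simp add: B_def)
  have "\<Lambda> * real (2 * P + 1) / 6 \<le> real P * (\<Lambda> / 2)"
  proof -
    have "0 \<le> \<Lambda>" by (simp add: \<Lambda>_def)
    hence "\<Lambda> * real (2 * P + 1) \<le> \<Lambda> * (3 * real P)" using P by (intro mult_left_mono) auto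
    thus ?thesis by (simp add: algebra_simps)
  qed
  also have "\<dots> \<le> real (card B) * (\<Lambda> / 2)" using cB by (intro mult_right_mono) (auto simp: \<Lambda>_def)
  also have "\<dots> = (\<Sum>b\<in>B. \<Lambda> / 2)" by simp
  also have "\<dots> \<le> (\<Sum>b\<in>B. \<Lambda> - (2 - 2 * cos (2 * pi * (real b - real P) / real L)))"
  proof (rule sum_mono)
    fix b assume "b \<in> B"
    hence "P \<le> 2 * b" "2 * b \<le> 3 * P" unfolding B_def by auto
    thus "\<Lambda> / 2 \<le> \<Lambda> - (2 - 2 * cos (2 * pi * (real b - real P) / real L))" by (rule le2)
  qed
  also have "\<dots> \<le> (\<Sum>b<2 * P + 1. \<Lambda> - (2 - 2 * cos (2 * pi * (real b - real P) / real L)))"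
    by (rule sum_mono2) (use le1 in \<open>auto simp: B_def\<close>)
  finally show ?thesis .
qed

lemma norm_cis_minus_1_le: "cmod (cis x - 1) \<le> \<bar>x\<bar>"
proof -
  have "(cmod (1 - cis x))\<^sup>2 = 4 * (sin (x / 2))\<^sup>2"
    unfolding norm_one_minus_cis using cos_double_sin[of "x / 2"] by simp
  also have "\<dots> \<le> 4 * (\<bar>x / 2\<bar>)\<^sup>2"
    using power_mono[OF abs_sin_x_le_abs_x[of "x / 2"], of 2] by simp
  also have "\<dots> = \<bar>x\<bar>\<^sup>2" by (simp add: power_divide)
  finally have "cmod (1 - cis x) \<le> \<bar>x\<bar>" by (rule power2_le_imp_le) simp
  thus ?thesis by (simp add: norm_minus_commute)
qed

text \<open>Each basis vector contributes the truncated binomially weighted series at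
  \<open>p = r * \<omega> i * z\<close>, a point inside the unit disk and within
  \<open>\<rho> / 2\<close> of \<open>b\<close>. Cauchy's estimate bounds the full series by
  \<open>B * (2 / \<rho>) ^ s\<close>, and \<open>nsq_lower\<close> turns the resulting bound in
  terms of \<open>\<alpha>\<close> into one relative to the norm.\<close>

lemma (in windowed_family) near_bound:
  assumes b: "b \<in> C" "\<And>j. j < D \<Longrightarrow> 1 \<le> fps_conv_radius (Abs_fps (y b j))"
    and H: "\<And>j. j < D \<Longrightarrow> H j holomorphic_on ball b (2 * \<rho>)"
      "\<And>j z. j < D \<Longrightarrow> z \<in> ball b (2 * \<rho>) \<Longrightarrow> norm z < 1 \<Longrightarrow> H j z = eval_fps (Abs_fps (y b j)) z"
      "\<And>j z. j < D \<Longrightarrow> z \<in> cball b \<rho> \<Longrightarrow> norm (H j z) \<le> B"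
    and \<rho>: "0 < \<rho>" "\<rho> \<le> 1"
    and small: "1 / (2 * real K) \<le> \<rho> / 8" "2 * pi * real P / real L \<le> \<rho> / 8"
    and T_tail: "\<And>j. j < D \<Longrightarrow> (\<Sum>k. w (k + Suc T) * cmod (y b j (k + Suc T))) \<le> 1"
    and z: "cmod z = 1" "cmod (z - b) < \<rho> / 4"
  shows "(cmod (\<Sum>k\<le>T. comb \<alpha> (k, b) * z ^ k))\<^sup>2 \<le>
     real D * (((B + 1) * (2 / \<rho>) ^ s) / ((real K / 8) ^ s * mm))\<^sup>2 * nsq X (comb \<alpha>)"
proof -
  define E where "E = (B + 1) * (2 / \<rho>) ^ s"
  have B0: "0 \<le> B"
  proof -
    have "norm (H 0 b) \<le> B" using H(3)[OF D, of b] \<rho> by simp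
    thus ?thesis by (rule order_trans[OF norm_ge_zero])
  qed
  have one: "cmod (\<Sum>k\<le>T. x i (k, b) * z ^ k) \<le> E" if i: "i < D * P1" for i
  proof -
    define j where "j = i div P1"
    have j: "j < D" using i by (simp add: j_def less_mult_imp_div_less)
    define p where "p = complex_of_real r * \<omega> i * z"
    have np: "cmod p = r"
      unfolding p_def norm_mult norm_\<omega> z norm_of_real using r by simp
    have dist_\<omega>: "cmod (\<omega> i - 1) \<le> \<rho> / 8"
    proof -
      have "\<bar>real (i mod P1) - real P\<bar> \<le> real P"
      proof -
        have "i mod P1 < P1" by (simp add: P1_def)
        hence "i mod P1 \<le> 2 * P" by (simp add: P1_def)
        hence "real (i mod P1) \<le> 2 * real P" by (metis of_nat_le_iff of_nat_mult of_nat_numeral)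
        thus ?thesis by (simp add: abs_le_iff)
      qed
      hence "\<bar>2 * pi * (real (i mod P1) - real P) / real L\<bar> \<le> 2 * pi * real P / real L"
        by (simp add: abs_mult divide_right_mono)
      thus ?thesis using norm_cis_minus_1_le[of "2 * pi * (real (i mod P1) - real P) / real L"] small
        unfolding \<omega>_def by linarith
    qed
    \<comment> \<open>Radius, modulation and the position of \<open>z\<close> contribute at most
      \<open>\<rho> / 8\<close>, \<open>\<rho> / 8\<close> and \<open>\<rho> / 4\<close>.\<close>
    have "p - b = (complex_of_real r - 1) * (\<omega> i * z) + ((\<omega> i - 1) * z + (z - b))"
      by (simp add: p_def algebra_simps)
    hence "cmod (p - b) \<le> cmod ((complex_of_real r - 1) * (\<omega> i * z)) + (cmod ((\<omega> i - 1) * z) + cmod (z - b))"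
      by (simp only:) (intro order_trans[OF norm_triangle_ineq] add_left_mono norm_triangle_ineq)
    also have "cmod ((complex_of_real r - 1) * (\<omega> i * z)) = 1 / (2 * real K)"
    proof -
      have "cmod (complex_of_real r - 1) = 1 / (2 * real K)"
        using K by (simp add: norm_divide)
      thus ?thesis by (simp only: norm_mult norm_\<omega> z mult_1_right)
    qed
    finally have pb: "cmod (p - b) \<le> \<rho> / 2" using small dist_\<omega> z by (simp add: norm_mult)
    let ?F = "Abs_fps (y b j)"
    define f where "f = (\<lambda>k. of_nat (k choose s) * fps_nth ?F k * p ^ k)"
    have full: "cmod (suminf f) \<le> B * (2 / \<rho>) ^ s"
      unfolding f_def by (rule binomial_series_bound[OF b(2)[OF j] H(1)[OF j]]) (use H j \<rho> np r pb in auto)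
    have p': "ereal (norm p) < fps_conv_radius ?F" using np r b(2)[OF j] by (metis ereal_less(3) less_le_trans)
    have sm: "summable f" unfolding f_def using binomial_series_sums[OF p', of s] by (rule sums_summable)
    have nf: "norm (f k) = w k * cmod (y b j k)" for k
      by (simp add: f_def norm_mult norm_power np binom_weight_def)
    have sn: "summable (\<lambda>k. norm (f k))"
      unfolding nf using binomial_series_abs_summable[OF b(2)[OF j], of r s] r by simp
    have "(\<Sum>k\<le>T. x i (k, b) * z ^ k) = (\<Sum>k<Suc T. f k)"
      by (simp add: lessThan_Suc_atMost, intro sum.cong refl)
         (simp add: f_def x_def p_def j_def binom_weight_def power_mult_distrib)
    also have "\<dots> = suminf f - (\<Sum>k. f (k + Suc T))"
      using suminf_split_initial_segment[OF sm, of "Suc T"] by simp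
    also have "cmod \<dots> \<le> cmod (suminf f) + cmod (\<Sum>k. f (k + Suc T))" by (rule norm_triangle_ineq4)
    also have "cmod (\<Sum>k. f (k + Suc T)) \<le> (\<Sum>k. norm (f (k + Suc T)))"
      by (rule summable_norm) (use sn in \<open>subst summable_iff_shift[of "\<lambda>k. norm (f k)"]\<close>)
    also have "\<dots> \<le> 1" unfolding nf by (rule T_tail[OF j])
    also have "cmod (suminf f) + 1 \<le> B * (2 / \<rho>) ^ s + 1 * (2 / \<rho>) ^ s"
      using full \<rho> by (intro add_mono) (auto intro!: one_le_power)
    finally show ?thesis by (simp add: E_def algebra_simps)
  qed
  define N where "N = D * P1"
  define \<sigma> where "\<sigma> = (\<Sum>i<N. (cmod (\<alpha> i))\<^sup>2)"
  have E0: "0 \<le> E" using B0 \<rho> by (simp add: E_def)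
  have "(\<Sum>k\<le>T. comb \<alpha> (k, b) * z ^ k) = (\<Sum>i<N. \<alpha> i * (\<Sum>k\<le>T. x i (k, b) * z ^ k))"
    unfolding comb_def N_def sum_distrib_right sum_distrib_left
    by (subst sum.swap) (simp only: mult.assoc)
  also have "cmod \<dots> \<le> (\<Sum>i<N. cmod (\<alpha> i) * E)"
    by (rule sum_norm_le) (use one in \<open>auto simp: N_def norm_mult intro!: mult_left_mono\<close>)
  finally have "(cmod (\<Sum>k\<le>T. comb \<alpha> (k, b) * z ^ k))\<^sup>2 \<le> ((\<Sum>i<N. cmod (\<alpha> i)) * E)\<^sup>2"
    by (intro power_mono) (auto simp: sum_distrib_right)
  also have "\<dots> = (\<Sum>i<N. cmod (\<alpha> i) * 1)\<^sup>2 * E\<^sup>2" by (simp add: power_mult_distrib)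
  also have "(\<Sum>i<N. cmod (\<alpha> i) * 1)\<^sup>2 \<le> \<sigma> * (\<Sum>i<N. 1\<^sup>2)"
    unfolding \<sigma>_def by (rule Cauchy_Schwarz_ineq_sum)
  also have "\<sigma> * (\<Sum>i<N. 1\<^sup>2) \<le> real D * (real L * \<sigma>)"
  proof -
    have "real N \<le> real (D * L)" unfolding N_def P1_def of_nat_le_iff using P by (intro mult_left_mono) auto
    hence "real N * \<sigma> \<le> real (D * L) * \<sigma>" by (intro mult_right_mono) (auto simp: \<sigma>_def sum_nonneg)
    thus ?thesis by (simp add: mult_ac)
  qed
  finally have 1: "(cmod (\<Sum>k\<le>T. comb \<alpha> (k, b) * z ^ k))\<^sup>2 \<le> real D * (real L * \<sigma>) * E\<^sup>2"
    by (simp add: mult_right_mono)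
  define W where "W = (real K / 8) ^ s * mm"
  have W0: "0 < W" using K mm by (simp add: W_def)
  have "W\<^sup>2 * (real L * \<sigma>) \<le> nsq X (comb \<alpha>)"
    unfolding W_def \<sigma>_def N_def by (rule nsq_lower)
  hence "real L * \<sigma> \<le> nsq X (comb \<alpha>) / W\<^sup>2" using W0 by (simp add: field_simps)
  hence "real D * (real L * \<sigma>) * E\<^sup>2 \<le> real D * (nsq X (comb \<alpha>) / W\<^sup>2) * E\<^sup>2"
    by (intro mult_right_mono mult_left_mono) auto
  also have "\<dots> = real D * (E / W)\<^sup>2 * nsq X (comb \<alpha>)" by (simp add: power_divide)
  finally show ?thesis using 1 unfolding E_def W_def by linarith
qed

text \<open>If only \<open>D - 1\<close> components are available, \<open>D * S\<close> on the left
  exceeds the right side by \<open>3 / 4 * S\<close>; a quarter of the gap is lost because the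
  window is longer than \<open>L\<close>. The errors sum to at most \<open>6 / 64\<close> of
  \<open>\<Lambda> * P1\<close>, while \<open>S \<ge> \<Lambda> * P1 / 6\<close> makes the gap at
  least \<open>8 / 64\<close> of it.\<close>

lemma count_arithmetic:
  fixes D S \<Lambda> H P1 aA Wd \<eta> \<xi> z :: real
  assumes D: "1 \<le> D" and \<Lambda>: "0 < \<Lambda>" and P1: "1 \<le> P1" and S: "\<Lambda> * P1 / 6 \<le> S" and H: "H = P1 * \<Lambda> - S" "0 \<le> H"
    and aA: "0 \<le> aA" "aA \<le> D - 1" and Wd: "Wd \<le> 1 + 1 / (4 * D)"
    and \<eta>: "\<eta> \<le> 3 / (64 * D)" and \<xi>: "\<xi> = 1 / (64 * D)" and z: "z \<le> \<Lambda> / (64 * D)"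
    and big: "D * \<Lambda> / 2 + 2 * D \<le> \<Lambda> * P1 / 64"
    and ineq: "\<Lambda> * (D * P1) * (1 - \<eta>) - (1 + \<xi>) * (D * H) - z * (D * P1) - 2 * aA \<le> aA * Wd * (S + \<Lambda> / 2)"
  shows False
proof -
  have S0: "0 \<le> S" using S \<Lambda> P1 by (smt (verit) divide_nonneg_pos mult_nonneg_nonneg)
  have DP: "0 < D * P1" using D P1 by simp
  have "aA * Wd \<le> (D - 1) * (1 + 1 / (4 * D))"
  proof (cases "0 \<le> Wd")
    case True
    thus ?thesis using aA Wd D by (intro mult_mono) auto
  next
    case False
    hence "aA * Wd \<le> 0" using aA by (simp add: mult_nonneg_nonpos)
    also have "0 \<le> (D - 1) * (1 + 1 / (4 * D))" using D by (intro mult_nonneg_nonneg) auto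
    finally show ?thesis .
  qed
  also have "\<dots> \<le> D - 3 / 4" using D by (simp add: field_simps)
  finally have r: "aA * Wd * (S + \<Lambda> / 2) \<le> (D - 3 / 4) * (S + \<Lambda> / 2)"
    using S0 \<Lambda> by (intro mult_right_mono) auto
  have e1: "\<Lambda> * (D * P1) * \<eta> \<le> \<Lambda> * P1 * 3 / 64"
  proof -
    have "0 \<le> \<Lambda> * (D * P1)" using \<Lambda> D P1 by (intro mult_nonneg_nonneg) auto
    from mult_left_mono[OF \<eta> this] show ?thesis using D by (simp add: field_simps)
  qed
  have "\<xi> * (D * H) = H / 64" using \<xi> D by simp
  moreover have "H \<le> \<Lambda> * P1" using H(1) S0 by (simp add: mult.commute)
  ultimately have e2: "\<xi> * (D * H) \<le> \<Lambda> * P1 / 64" by linarith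
  have e3: "z * (D * P1) \<le> \<Lambda> * P1 / 64"
    using mult_right_mono[OF z, of "D * P1"] DP D by (simp add: field_simps)
  have "D * H = \<Lambda> * (D * P1) - D * S" by (simp add: H algebra_simps)
  moreover have "\<Lambda> * (D * P1) * (1 - \<eta>) - (1 + \<xi>) * (D * H) = \<Lambda> * (D * P1) - \<Lambda> * (D * P1) * \<eta> - D * H - \<xi> * (D * H)"
    by (simp add: algebra_simps)
  moreover have "(D - 3 / 4) * (S + \<Lambda> / 2) \<le> D * S - 3 / 4 * S + D * \<Lambda> / 2"
    using \<Lambda> by (simp add: algebra_simps)
  ultimately have "3 / 4 * S \<le> \<Lambda> * P1 * 5 / 64 + (D * \<Lambda> / 2 + 2 * D)"
    using ineq r e1 e2 e3 aA D by linarith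
  also have "\<dots> \<le> \<Lambda> * P1 * 6 / 64" using big by linarith
  finally have "\<Lambda> * P1 / 8 \<le> \<Lambda> * P1 * 6 / 64" using S by linarith
  moreover have "0 < \<Lambda> * P1" using \<Lambda> P1 by simp
  ultimately show False by linarith
qed

lemma uniform_extension:
  fixes F :: "'i \<Rightarrow> complex \<Rightarrow> complex" and c :: "'i \<Rightarrow> complex"
  assumes fin: "finite I"
    and ext: "\<And>i. i \<in> I \<Longrightarrow> \<exists>\<rho>>0. \<exists>H. H holomorphic_on ball (c i) \<rho> \<and> (\<forall>z\<in>ball (c i) \<rho>. norm z < 1 \<longrightarrow> H z = F i z)"
  obtains \<rho> B H where "0 < \<rho>" "\<rho> \<le> 1" "0 \<le> B"
    "\<And>i. i \<in> I \<Longrightarrow> H i holomorphic_on ball (c i) (2 * \<rho>)"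
    "\<And>i z. i \<in> I \<Longrightarrow> z \<in> ball (c i) (2 * \<rho>) \<Longrightarrow> norm z < 1 \<Longrightarrow> H i z = F i z"
    "\<And>i z. i \<in> I \<Longrightarrow> z \<in> cball (c i) \<rho> \<Longrightarrow> norm (H i z) \<le> B"
proof -
  have "\<forall>i\<in>I. \<exists>\<rho>. \<rho> > 0 \<and> (\<exists>H. H holomorphic_on ball (c i) \<rho> \<and> (\<forall>z\<in>ball (c i) \<rho>. norm z < 1 \<longrightarrow> H z = F i z))"
    using ext by blast
  from bchoice[OF this] obtain R where R: "\<forall>i\<in>I. R i > 0 \<and> (\<exists>H. H holomorphic_on ball (c i) (R i) \<and> (\<forall>z\<in>ball (c i) (R i). norm z < 1 \<longrightarrow> H z = F i z))"
    by (elim exE)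
  hence "\<forall>i\<in>I. \<exists>H. H holomorphic_on ball (c i) (R i) \<and> (\<forall>z\<in>ball (c i) (R i). norm z < 1 \<longrightarrow> H z = F i z)" by blast
  from bchoice[OF this] obtain H where H: "\<forall>i\<in>I. H i holomorphic_on ball (c i) (R i) \<and> (\<forall>z\<in>ball (c i) (R i). norm z < 1 \<longrightarrow> H i z = F i z)"
    by (elim exE)
  define \<rho> where "\<rho> = Min (insert 1 (R ` I)) / 2"
  have \<rho>: "0 < \<rho>" unfolding \<rho>_def using fin R by (subst zero_less_divide_iff) (auto simp: Min_gr_iff)
  have \<rho>1: "2 * \<rho> \<le> 1" unfolding \<rho>_def using fin by simp
  have \<rho>R: "2 * \<rho> \<le> R i" if "i \<in> I" for i unfolding \<rho>_def using fin that by simp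
  have "\<forall>i\<in>I. \<exists>B. \<forall>z\<in>cball (c i) \<rho>. norm (H i z) \<le> B"
  proof
    fix i assume i: "i \<in> I"
    have "cball (c i) \<rho> \<subseteq> ball (c i) (R i)" using \<rho>R[OF i] \<rho> by auto
    hence "continuous_on (cball (c i) \<rho>) (H i)"
      using H i by (meson continuous_on_subset holomorphic_on_imp_continuous_on)
    hence "bounded (H i ` cball (c i) \<rho>)"
      by (intro compact_imp_bounded compact_continuous_image) auto
    thus "\<exists>B. \<forall>z\<in>cball (c i) \<rho>. norm (H i z) \<le> B" by (auto simp: bounded_iff)
  qed
  from bchoice[OF this] obtain B where B: "\<forall>i\<in>I. \<forall>z\<in>cball (c i) \<rho>. norm (H i z) \<le> B i" by (elim exE)
  show ?thesis
  proof (rule that[of \<rho> "Max (insert 0 (B ` I))" H])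
    show "\<rho> \<le> 1" using \<rho> \<rho>1 by simp
    show "0 \<le> Max (insert 0 (B ` I))" using fin by simp
    fix i assume i: "i \<in> I"
    have sub: "ball (c i) (2 * \<rho>) \<subseteq> ball (c i) (R i)" using \<rho>R[OF i] by auto
    show "H i holomorphic_on ball (c i) (2 * \<rho>)" using H i sub holomorphic_on_subset by blast
    fix z
    show "z \<in> ball (c i) (2 * \<rho>) \<Longrightarrow> norm z < 1 \<Longrightarrow> H i z = F i z" using H i sub by blast
    assume "z \<in> cball (c i) \<rho>"
    hence "norm (H i z) \<le> B i" using B i by blast
    also have "\<dots> \<le> Max (insert 0 (B ` I))" using fin i by (intro Max_ge) auto
    finally show "norm (H i z) \<le> Max (insert 0 (B ` I))" .
  qed (use \<rho> in auto)
qed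

lemma tail_suminf_tendsto_0:
  fixes f :: "nat \<Rightarrow> real"
  assumes "summable f"
  shows "(\<lambda>T. \<Sum>k. f (k + Suc T)) \<longlonglongrightarrow> 0"
proof -
  have "(\<Sum>k. f (k + Suc T)) = suminf f - (\<Sum>k<Suc T. f k)" for T
    using suminf_split_initial_segment[OF assms, of "Suc T"] by simp
  moreover have "(\<lambda>T. suminf f - (\<Sum>k<Suc T. f k)) \<longlonglongrightarrow> suminf f - suminf f"
    by (intro tendsto_diff tendsto_const LIMSEQ_Suc summable_LIMSEQ assms)
  ultimately show ?thesis by simp
qed

text \<open>The constants are chosen in a forced order: \<open>\<rho>\<close> and
  \<open>\<delta>\<close> from the regular points, \<open>J\<close> (hence
  \<open>\<Lambda>\<close>), \<open>K\<close>, the error \<open>e\<close>, then \<open>s\<close>,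
  and \<open>T\<close> last. Each is small or large against the earlier ones only; in particular
  \<open>e\<close> depends on \<open>K\<close> but not on \<open>s\<close>.\<close>

lemma (in component_family) component_count:
  assumes D: "0 < D" and A: "A \<subseteq> C"
    and slow: "\<And>e. 0 < e \<Longrightarrow> \<exists>k1. slow e k1"
    and nondeg: "\<exists>k0. \<forall>k\<ge>k0. \<exists>m>0. \<forall>g. m * L2_set (\<lambda>j. cmod (g j)) {..<D} \<le> size_at g k"
    and conv: "\<And>b j. b \<in> C - A \<Longrightarrow> j < D \<Longrightarrow> 1 \<le> fps_conv_radius (Abs_fps (y b j))"
    and reg: "\<And>b j. b \<in> C - A \<Longrightarrow> j < D \<Longrightarrow> \<exists>\<rho>>0. \<exists>H. H holomorphic_on ball b \<rho> \<and>
        (\<forall>z\<in>ball b \<rho>. norm z < 1 \<longrightarrow> H z = eval_fps (Abs_fps (y b j)) z)"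
  shows "D \<le> card A"
proof (rule ccontr)
  assume "\<not> D \<le> card A"
  hence cA: "real (card A) \<le> real D - 1" by simp
  have D1: "1 \<le> real D" using D by simp
  define cC where "cC = real (card C)"
  have cC0: "0 \<le> cC" by (simp add: cC_def)
  obtain \<rho> B H' where \<rho>: "0 < \<rho>" "\<rho> \<le> 1" and B: "0 \<le> B"
    and H': "\<And>i. i \<in> (C - A) \<times> {..<D} \<Longrightarrow> H' i holomorphic_on ball (fst i) (2 * \<rho>)"
      "\<And>i z. i \<in> (C - A) \<times> {..<D} \<Longrightarrow> z \<in> ball (fst i) (2 * \<rho>) \<Longrightarrow> norm z < 1 \<Longrightarrow> H' i z = eval_fps (Abs_fps (y (fst i) (snd i))) z"
      "\<And>i z. i \<in> (C - A) \<times> {..<D} \<Longrightarrow> z \<in> cball (fst i) \<rho> \<Longrightarrow> norm (H' i z) \<le> B"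
  proof (rule uniform_extension[of "(C - A) \<times> {..<D}" fst "\<lambda>i. eval_fps (Abs_fps (y (fst i) (snd i)))"])
    show "finite ((C - A) \<times> {..<D})" using finite_C by simp
    show "\<exists>\<rho>>0. \<exists>H. H holomorphic_on ball (fst i) \<rho> \<and>
        (\<forall>z\<in>ball (fst i) \<rho>. norm z < 1 \<longrightarrow> H z = eval_fps (Abs_fps (y (fst i) (snd i))) z)"
      if "i \<in> (C - A) \<times> {..<D}" for i using reg[of "fst i" "snd i"] that by auto
  qed blast
  define \<delta> where "\<delta> = \<rho> / 4"
  have \<delta>: "0 < \<delta>" using \<rho> by (simp add: \<delta>_def)
  define \<xi> where "\<xi> = 1 / (64 * real D)"
  have \<xi>: "0 < \<xi>" using D by (simp add: \<xi>_def)
  \<comment> \<open>\<open>J\<close> will be the ratio \<open>L / P\<close>, so it fixes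
    \<open>\<Lambda>\<close> for all later \<open>s\<close>. The last condition makes the leakage
    into regular components, of order \<open>\<Lambda> / \<delta>\<^sup>2\<close>, small against
    \<open>1 / D\<close>.\<close>
  obtain J :: nat where J: "4 \<le> J" "2 * pi / real J < \<rho> / 8"
    "cC * (2 / \<delta>\<^sup>2) * (2 * (2 - 2 * cos (2 * pi / real J))) < 1 / (64 * real D)"
  proof -
    have 1: "(\<lambda>J. 2 * pi / real J) \<longlonglongrightarrow> 0" by (rule lim_const_over_n)
    have 2: "(\<lambda>J. cC * (2 / \<delta>\<^sup>2) * (2 * (2 - 2 * cos (2 * pi / real J)))) \<longlonglongrightarrow> cC * (2 / \<delta>\<^sup>2) * (2 * (2 - 2 * cos 0))"
      by (intro tendsto_intros 1)
    have "\<forall>\<^sub>F J in sequentially. 4 \<le> J \<and> 2 * pi / real J < \<rho> / 8 \<and> cC * (2 / \<delta>\<^sup>2) * (2 * (2 - 2 * cos (2 * pi / real J))) < 1 / (64 * real D)"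
      using \<rho> D order_tendstoD(2)[OF 1, of "\<rho> / 8"] order_tendstoD(2)[OF 2, of "1 / (64 * real D)"]
      by (intro eventually_conj eventually_ge_at_top) auto
    thus ?thesis using that by (auto dest: eventually_happens)
  qed
  define \<Lambda> where "\<Lambda> = 2 - 2 * cos (2 * pi / real J)"
  have \<Lambda>: "0 < \<Lambda>"
  proof -
    have "2 * pi / real J \<le> pi / 2" using J by (simp add: field_simps)
    hence "2 * pi / real J < pi" using pi_gt_zero by linarith
    moreover have "0 < 2 * pi / real J" using J by simp
    ultimately have "cos (2 * pi / real J) < cos 0" by (intro cos_monotone_0_pi) auto
    thus ?thesis by (simp add: \<Lambda>_def)
  qed
  \<comment> \<open>With \<open>K = 16 * D * c\<close> and \<open>u = c * s\<close> the transition
    width is \<open>L / (16 * D)\<close>, so the window exceeds \<open>L\<close> by the relative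
    amount \<open>1 / (8 * D)\<close> plus rounding. The other conditions make
    \<open>\<kappa> = 2 / K\<close> small against \<open>\<rho>\<close>, \<open>\<Lambda>\<close>
    and \<open>\<delta>\<close>.\<close>
  obtain c :: nat where c: "1 \<le> c" and \<kappa>_c: "2 / real (16 * D * c) < \<rho> / 32" "2 / real (16 * D * c) < 1 / 8"
    "8 * (2 / real (16 * D * c)) < \<Lambda>"
    "(1 + \<xi>) * (8 * (2 / real (16 * D * c))) + (1 + 1 / \<xi>) * (3 * (2 / real (16 * D * c)))\<^sup>2 < \<Lambda> / (64 * real D)"
    "cC * (2 * (3 * (2 / real (16 * D * c)))\<^sup>2) / \<delta>\<^sup>2 < 1 / (128 * real D)"
  proof -
    have "2 / real (16 * D * c) = (1 / (8 * real D)) / real c" for c by simp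
    hence 0: "(\<lambda>c. 2 / real (16 * D * c)) \<longlonglongrightarrow> 0" by (simp only: lim_const_over_n)
    have 1: "(\<lambda>c. 8 * (2 / real (16 * D * c))) \<longlonglongrightarrow> 8 * 0" by (intro tendsto_intros 0)
    have 2: "(\<lambda>c. (1 + \<xi>) * (8 * (2 / real (16 * D * c))) + (1 + 1 / \<xi>) * (3 * (2 / real (16 * D * c)))\<^sup>2) \<longlonglongrightarrow>
       (1 + \<xi>) * (8 * 0) + (1 + 1 / \<xi>) * (3 * 0)\<^sup>2" by (intro tendsto_intros 0)
    have 3: "(\<lambda>c. cC * (2 * (3 * (2 / real (16 * D * c)))\<^sup>2) / \<delta>\<^sup>2) \<longlonglongrightarrow> cC * (2 * (3 * 0)\<^sup>2) / \<delta>\<^sup>2"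
      by (intro tendsto_intros 0) (use \<delta> in auto)
    have "\<forall>\<^sub>F c in sequentially. 1 \<le> c \<and> 2 / real (16 * D * c) < \<rho> / 32 \<and> 2 / real (16 * D * c) < 1 / 8 \<and>
       8 * (2 / real (16 * D * c)) < \<Lambda> \<and>
       (1 + \<xi>) * (8 * (2 / real (16 * D * c))) + (1 + 1 / \<xi>) * (3 * (2 / real (16 * D * c)))\<^sup>2 < \<Lambda> / (64 * real D) \<and>
       cC * (2 * (3 * (2 / real (16 * D * c)))\<^sup>2) / \<delta>\<^sup>2 < 1 / (128 * real D)"
      by (intro eventually_conj eventually_ge_at_top order_tendstoD(2)[OF 0] order_tendstoD(2)[OF 1]
          order_tendstoD(2)[OF 2] order_tendstoD(2)[OF 3]) (use \<rho> D \<Lambda> in auto)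
    thus ?thesis using that by (auto dest: eventually_happens)
  qed
  define K where "K = 16 * D * c"
  define \<kappa> where "\<kappa> = 2 / real K"
  have K: "16 \<le> K" using D c by (simp add: K_def)
  have \<kappa>: "0 < \<kappa>" "\<kappa> < \<rho> / 32" "\<kappa> < 1 / 8" "8 * \<kappa> < \<Lambda>"
    "(1 + \<xi>) * (8 * \<kappa>) + (1 + 1 / \<xi>) * (3 * \<kappa>)\<^sup>2 < \<Lambda> / (64 * real D)"
    "cC * (2 * (3 * \<kappa>)\<^sup>2) / \<delta>\<^sup>2 < 1 / (128 * real D)"
    using \<kappa>_c K by (simp_all add: \<kappa>_def K_def)
  \<comment> \<open>The contraction constant of \<open>binom_weight_peak\<close> for
    \<open>u = c * s\<close>, in which \<open>s\<close> cancels.\<close>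
  define \<theta> where "\<theta> = 1 - real c / (16 * (real K)\<^sup>2)"
  have \<theta>: "0 \<le> \<theta>" "\<theta> < 1"
  proof -
    have "real c \<le> real K" unfolding K_def of_nat_le_iff using D by simp
    also have "real K \<le> (real K)\<^sup>2" using K by (simp add: power2_eq_square)
    also have "(real K)\<^sup>2 \<le> 16 * (real K)\<^sup>2" by simp
    finally have "real c \<le> 16 * (real K)\<^sup>2" .
    thus "0 \<le> \<theta>" using K by (simp add: \<theta>_def)
    show "\<theta> < 1" using c K by (simp add: \<theta>_def)
  qed
  \<comment> \<open>A rate strictly between \<open>\<theta>\<close> and 1, so that the drifts
    \<open>(1 + e) ^ L\<close> and \<open>(1 - e) ^ L\<close> can be afforded in the two
    tails.\<close>
  define \<tau> where "\<tau> = (1 + \<theta>) / 2"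
  have \<tau>: "\<theta> < \<tau>" "0 < \<tau>" "\<tau> < 1" using \<theta> by (auto simp: \<tau>_def)
  obtain e where e: "0 < e" "e < \<kappa>" "e < 1 / 2" "\<theta> * (1 + e) < \<tau>" "\<theta> < \<tau> * (1 - e)" "(1 + e) ^ (6 * K) < 2"
  proof -
    have 1: "((\<lambda>e. \<theta> * (1 + e)) \<longlongrightarrow> \<theta> * (1 + 0)) (at_right 0)" by (intro tendsto_intros)
    have 2: "((\<lambda>e. \<tau> * (1 - e)) \<longlongrightarrow> \<tau> * (1 - 0)) (at_right 0)" by (intro tendsto_intros)
    have 3: "((\<lambda>e::real. (1 + e) ^ (6 * K)) \<longlongrightarrow> (1 + 0) ^ (6 * K)) (at_right 0)" by (intro tendsto_intros)
    have 4: "((\<lambda>e::real. e) \<longlongrightarrow> 0) (at_right 0)" by (intro tendsto_intros)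
    have "\<forall>\<^sub>F e in at_right 0. 0 < e \<and> e < \<kappa> \<and> e < 1 / 2 \<and> \<theta> * (1 + e) < \<tau> \<and> \<theta> < \<tau> * (1 - e) \<and> (1 + e) ^ (6 * K) < 2"
      by (intro eventually_conj eventually_at_right_less order_tendstoD(2)[OF 4] order_tendstoD(2)[OF 1]
          order_tendstoD(1)[OF 2] order_tendstoD(2)[OF 3]) (use \<kappa> \<tau> in auto)
    thus ?thesis using that by (auto dest: eventually_happens)
  qed
  obtain k1 where k1: "slow e k1" using slow e by blast
  obtain k0 where k0: "\<forall>k\<ge>k0. \<exists>m>0. \<forall>g. m * L2_set (\<lambda>j. cmod (g j)) {..<D} \<le> size_at g k" using nondeg by blast
  define kk where "kk = max k0 k1"
  obtain m where m: "0 < m" "\<And>g. m * L2_set (\<lambda>j. cmod (g j)) {..<D} \<le> size_at g kk"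
    using k0 kk_def by (metis max.cobounded1)
  \<comment> \<open>Per unit of \<open>s\<close>: the squared quotient of \<open>2 / \<rho>\<close>
    and \<open>K / 8\<close>, times the squared loss \<open>(1 + e) ^ (3 * K)\<close> suffered when
    nondegeneracy is carried from time \<open>kk\<close> to times up to
    \<open>3 * L\<close>.\<close>
  define \<beta> where "\<beta> = (16 / (\<rho> * real K))\<^sup>2 * (1 + e) ^ (6 * K)"
  have \<beta>: "0 \<le> \<beta>" "\<beta> < 1"
  proof -
    have "16 / (\<rho> * real K) \<le> 1 / 4" using \<kappa>(2) \<rho> K by (simp add: \<kappa>_def field_simps)
    hence "(16 / (\<rho> * real K))\<^sup>2 \<le> (1 / 4)\<^sup>2" using \<rho> by (intro power_mono) auto
    hence "\<beta> \<le> (1 / 4)\<^sup>2 * 2" unfolding \<beta>_def using e by (intro mult_mono) auto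
    thus "\<beta> < 1" by (simp add: power2_eq_square)
  qed (use e in \<open>simp add: \<beta>_def\<close>)
  define q1 where "q1 = (\<lambda>s. real D * ((B + 1) / m)\<^sup>2 * \<beta> ^ s)"
  obtain s' :: nat where s': "1 \<le> s'" "kk \<le> s'"
    "2 * (\<tau> ^ (K * (J * s')))\<^sup>2 < \<kappa>"
    "(2 + 10 * cC / \<delta>\<^sup>2) * (\<tau> ^ (K * (J * s')))\<^sup>2 + cC * q1 (J * s') < 3 / (128 * real D)"
    "real D * \<Lambda> / 2 + 2 * real D < \<Lambda> * real s' / 64" "16 * D \<le> s'"
  proof -
    have J0: "0 < J" "0 < K" using J K by auto
    have sub1: "filterlim (\<lambda>s'. J * s') sequentially sequentially"
      using J0 by (intro mult_nat_left_at_top) auto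
    have sub2: "filterlim (\<lambda>s'. K * (J * s')) sequentially sequentially"
      by (rule filterlim_compose[OF mult_nat_left_at_top[OF J0(2)] sub1])
    have t1: "(\<lambda>s'. \<tau> ^ (K * (J * s'))) \<longlonglongrightarrow> 0"
      by (rule filterlim_compose[OF LIMSEQ_power_zero sub2]) (use \<tau> in auto)
    have t2: "(\<lambda>s'. \<beta> ^ (J * s')) \<longlonglongrightarrow> 0"
      by (rule filterlim_compose[OF LIMSEQ_power_zero sub1]) (use \<beta> in auto)
    have 1: "(\<lambda>s'. 2 * (\<tau> ^ (K * (J * s')))\<^sup>2) \<longlonglongrightarrow> 2 * 0\<^sup>2" by (intro tendsto_intros t1)
    have 2: "(\<lambda>s'. (2 + 10 * cC / \<delta>\<^sup>2) * (\<tau> ^ (K * (J * s')))\<^sup>2 + cC * q1 (J * s')) \<longlonglongrightarrow>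
       (2 + 10 * cC / \<delta>\<^sup>2) * 0\<^sup>2 + cC * (real D * ((B + 1) / m)\<^sup>2 * 0)"
      unfolding q1_def by (intro tendsto_intros t1 t2)
    have 3: "\<forall>\<^sub>F s' in sequentially. real D * \<Lambda> / 2 + 2 * real D < \<Lambda> * real s' / 64"
    proof -
      have "\<forall>\<^sub>F s' in sequentially. 64 / \<Lambda> * (real D * \<Lambda> / 2 + 2 * real D) < real s'"
        using filterlim_real_sequentially unfolding filterlim_at_top_dense by blast
      thus ?thesis by eventually_elim (use \<Lambda> in \<open>simp add: field_simps\<close>)
    qed
    have "\<forall>\<^sub>F s' in sequentially. 1 \<le> s' \<and> kk \<le> s' \<and> 2 * (\<tau> ^ (K * (J * s')))\<^sup>2 < \<kappa> \<and>
      (2 + 10 * cC / \<delta>\<^sup>2) * (\<tau> ^ (K * (J * s')))\<^sup>2 + cC * q1 (J * s') < 3 / (128 * real D) \<and>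
      real D * \<Lambda> / 2 + 2 * real D < \<Lambda> * real s' / 64 \<and> 16 * D \<le> s'"
      by (intro eventually_conj eventually_ge_at_top order_tendstoD(2)[OF 1] order_tendstoD(2)[OF 2] 3)
         (use \<kappa> D in auto)
    thus ?thesis using that by (auto dest: eventually_happens)
  qed
  \<comment> \<open>These choices make \<open>L = J * P\<close> an exact equality.\<close>
  define s where "s = J * s'"
  define P where "P = K * s'"
  define u where "u = c * s"
  define L where "L = K * s"
  define q0 where "q0 = \<tau> ^ L"
  define r where "r = 1 - 1 / (2 * real K)"
  have s: "1 \<le> s" "s' \<le> s" "kk \<le> s" using s' J by (auto simp: s_def intro: order_trans[of _ s'])
  have LP: "L = J * P" by (simp add: L_def P_def s_def)
  have L_s: "s \<le> L" "16 * D * (c * s) = L" using K by (auto simp: L_def K_def)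
  have cs: "1 \<le> c * s" using c s by simp
  have q0: "0 \<le> q0" "2 * q0\<^sup>2 < \<kappa>" "(2 + 10 * cC / \<delta>\<^sup>2) * q0\<^sup>2 + cC * q1 s < 3 / (128 * real D)"
    using s' \<tau> by (auto simp: q0_def L_def s_def)
  have uL: "16 * u \<le> L"   proof -
    have "1 * (c * s) \<le> D * (c * s)" using D by (intro mult_right_mono) auto
    hence "c * s \<le> D * (c * s)" by (simp only: mult_1)
    moreover have "16 * (D * (c * s)) = L" using L_s(2) by (simp only: mult.assoc)
    ultimately show ?thesis unfolding u_def by linarith
  qed
  have \<theta>_eq: "1 - real u * real s / (16 * (real (K * s))\<^sup>2) = \<theta>"
    using s by (simp add: \<theta>_def u_def power2_eq_square field_simps)
  obtain n1 where n1: "K * s \<le> n1" "n1 \<le> 2 * (K * s)"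
    "\<And>k. n1 + K * s + u \<le> k \<Longrightarrow> binom_weight s r k \<le> \<theta> ^ L * binom_weight s r (k - K * s)"
    "\<And>k. k + u < n1 \<Longrightarrow> binom_weight s r k \<le> \<theta> ^ L * binom_weight s r (k + K * s)"
  proof (rule binom_weight_peak[of K s u])
    show "2 \<le> K" "1 \<le> s" "u \<le> K * s" using K s uL by (auto simp: L_def)
  qed (auto simp only: \<theta>_eq r_def L_def)
  obtain T where T: "n1 + L + u < T"
    "\<And>b j. b \<in> C - A \<Longrightarrow> j < D \<Longrightarrow> (\<Sum>k. binom_weight s r (k + Suc T) * cmod (y b j (k + Suc T))) \<le> 1"
  proof -
    have r01: "0 \<le> r" "r < 1" using K by (auto simp: r_def field_simps)
    have "\<forall>\<^sub>F T in sequentially. (\<Sum>k. binom_weight s r (k + Suc T) * cmod (y (fst i) (snd i) (k + Suc T))) < 1"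
      if "i \<in> (C - A) \<times> {..<D}" for i
    proof -
      have cv: "1 \<le> fps_conv_radius (Abs_fps (y (fst i) (snd i)))" using that conv by auto
      have "summable (\<lambda>k. binom_weight s r k * cmod (y (fst i) (snd i) k))"
        using binomial_series_abs_summable[OF cv r01] by simp
      from order_tendstoD(2)[OF tail_suminf_tendsto_0[OF this]] show ?thesis by simp
    qed
    hence "\<forall>\<^sub>F T in sequentially. \<forall>i\<in>(C - A) \<times> {..<D}. (\<Sum>k. binom_weight s r (k + Suc T) * cmod (y (fst i) (snd i) (k + Suc T))) < 1"
      using finite_C by (intro eventually_ball_finite) auto
    hence "\<forall>\<^sub>F T in sequentially. n1 + L + u < T \<and> (\<forall>i\<in>(C - A) \<times> {..<D}. (\<Sum>k. binom_weight s r (k + Suc T) * cmod (y (fst i) (snd i) (k + Suc T))) < 1)"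
      by (intro eventually_conj eventually_gt_at_top)
    then obtain T where "n1 + L + u < T" "\<forall>i\<in>(C - A) \<times> {..<D}. (\<Sum>k. binom_weight s r (k + Suc T) * cmod (y (fst i) (snd i) (k + Suc T))) < 1"
      by (auto dest: eventually_happens)
    thus ?thesis by (intro that[of T]) force+
  qed
  define mm where "mm = m / (1 + e) ^ (3 * L)"
  have mm: "0 < mm" using m e by (simp add: mm_def)
  have PL: "4 * P \<le> L" "1 \<le> P" using J K s' by (auto simp: LP P_def)
  interpret W: windowed_family C D y e "\<theta> ^ L" q0 mm s K u P T n1
  proof unfold_locales
    show "16 \<le> K" "1 \<le> s" "0 < D" "0 \<le> e" "e \<le> 1 / 2" "0 < mm" "K * s \<le> n1" "n1 \<le> 2 * (K * s)" "0 \<le> \<theta> ^ L"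
      using K s D e mm n1 \<theta> by auto
    show "2 * u + 2 \<le> K * s" using uL cs unfolding L_def[symmetric] u_def by linarith
    show "slow e s" using k1 s unfolding slow_def kk_def by auto
    show "n1 + K * s + u < T" using T by (simp add: L_def)
    show "2 * P + 1 \<le> K * s" using PL by (simp add: L_def)
    show "binom_weight s (1 - 1 / (2 * real K)) k \<le> \<theta> ^ L * binom_weight s (1 - 1 / (2 * real K)) (k - K * s)"
      if "n1 + K * s + u \<le> k" for k using n1(3)[OF that] by (simp only: r_def)
    show "binom_weight s (1 - 1 / (2 * real K)) k \<le> \<theta> ^ L * binom_weight s (1 - 1 / (2 * real K)) (k + K * s)"
      if "k + u < n1" for k using n1(4)[OF that] by (simp only: r_def)
    have "(\<theta> * (1 + e)) ^ L \<le> \<tau> ^ L" using e \<theta> by (intro power_mono) auto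
    thus "\<theta> ^ L * (1 + e) ^ (K * s) \<le> q0" by (simp add: q0_def L_def power_mult_distrib)
    have "\<theta> ^ L \<le> (\<tau> * (1 - e)) ^ L" using e \<theta> by (intro power_mono) auto
    thus "\<theta> ^ L \<le> q0 * (1 - e) ^ (K * s)" by (simp add: q0_def L_def power_mult_distrib)
    show "2 * q0\<^sup>2 \<le> 1 / 2" using q0 \<kappa> by linarith
    show "mm * L2_set (\<lambda>j. cmod (g j)) {..<D} \<le> size_at g k" if k: "K * s \<le> k" "k \<le> 3 * (K * s)" for k g
    proof -
      have kkk: "kk \<le> k" using k(1) s(3) L_s(1) unfolding L_def by linarith
      have "m * L2_set (\<lambda>j. cmod (g j)) {..<D} \<le> size_at g kk" by (rule m)
      also have "\<dots> \<le> (1 + e) ^ (k - kk) * size_at g (kk + (k - kk))"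
        by (rule slow_iterate(1)[OF k1]) (use e in \<open>auto simp: kk_def\<close>)
      also have "\<dots> = (1 + e) ^ (k - kk) * size_at g k" using kkk by simp
      also have "\<dots> \<le> (1 + e) ^ (3 * L) * size_at g k"
        using k e size_at_nonneg by (intro mult_right_mono power_increasing) (auto simp: L_def)
      finally show ?thesis using e by (simp add: mm_def field_simps)
    qed
  qed
  have L0: "0 < L" using W.L_pos by (simp add: L_def)
  have q1_eq: "real D * (((B + 1) * (2 / \<rho>) ^ s) / ((real K / 8) ^ s * mm))\<^sup>2 = q1 s"
  proof -
    have "((B + 1) * (2 / \<rho>) ^ s) / ((real K / 8) ^ s * mm) = (B + 1) / m * (16 / (\<rho> * real K)) ^ s * (1 + e) ^ (3 * L)"
    proof -
      have "2 / \<rho> / (real K / 8) = 16 / (\<rho> * real K)" by simp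
      hence 1: "(2 / \<rho>) ^ s / (real K / 8) ^ s = (16 / (\<rho> * real K)) ^ s" by (simp only: power_divide[symmetric])
      have "(B + 1) * X1 / (X2 * (m / X3)) = (B + 1) / m * (X1 / X2) * X3" for X1 X2 X3 :: real
        by (simp add: mult_ac)
      thus ?thesis unfolding mm_def 1[symmetric] .
    qed
    hence "(((B + 1) * (2 / \<rho>) ^ s) / ((real K / 8) ^ s * mm))\<^sup>2 = ((B + 1) / m)\<^sup>2 * (((16 / (\<rho> * real K)) ^ s)\<^sup>2 * ((1 + e) ^ (3 * L))\<^sup>2)"
      by (simp only: power_mult_distrib mult.assoc)
    also have "((16 / (\<rho> * real K)) ^ s)\<^sup>2 = ((16 / (\<rho> * real K))\<^sup>2) ^ s" by (simp add: power_mult[symmetric] mult.commute)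
    also have "((1 + e) ^ (3 * L))\<^sup>2 = ((1 + e) ^ (6 * K)) ^ s" by (simp add: power_mult[symmetric] L_def mult_ac)
    finally show ?thesis by (simp add: q1_def \<beta>_def power_mult_distrib)
  qed
  define S where "S = (\<Sum>b<2 * P + 1. \<Lambda> - (2 - 2 * cos (2 * pi * (real b - real P) / real L)))"
  define Hs where "Hs = (\<Sum>b<2 * P + 1. 2 - 2 * cos (2 * pi * (real b - real P) / real L))"
  have \<Lambda>_eq: "\<Lambda> = 2 - 2 * cos (2 * pi * real P / real L)"
    using PL J by (simp add: \<Lambda>_def LP)
  have S_ge: "\<Lambda> * real (2 * P + 1) / 6 \<le> S"
    unfolding S_def \<Lambda>_eq by (rule frequency_gap_sum[OF PL])
  have Hs: "Hs = real (2 * P + 1) * \<Lambda> - S" "0 \<le> Hs"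
  proof -
    have "S = (\<Sum>b<2 * P + 1. \<Lambda>) - Hs" unfolding S_def Hs_def by (rule sum_subtractf)
    thus "Hs = real (2 * P + 1) * \<Lambda> - S" by simp
    show "0 \<le> Hs" unfolding Hs_def by (rule sum_nonneg) simp
  qed
  have om: "W.\<omega> = (\<lambda>b. cis (2 * pi * (real (b mod (2 * P + 1)) - real P) / real L))"
    by (rule ext) (simp add: W.\<omega>_def W.P1_def L_def)
  have cmb: "W.comb = (\<lambda>\<alpha> z. \<Sum>b<D * (2 * P + 1). \<alpha> b * W.x b z)"
    by (intro ext) (simp add: W.comb_def W.P1_def)
  have XX: "W.X = {..T} \<times> C" by (simp add: W.X_def)
  have e1: "0 \<le> W.e1" "W.e1 \<le> 3 * \<kappa>"
  proof -
    have "e * \<kappa> \<le> e * 1" using e \<kappa> by (intro mult_left_mono) auto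
    hence "e * (1 + \<kappa>) + \<kappa> \<le> 2 * e + \<kappa>" by (simp add: algebra_simps)
    thus "W.e1 \<le> 3 * \<kappa>" using e unfolding W.e1_def \<kappa>_def[symmetric] by linarith
    show "0 \<le> W.e1" using e K by (simp add: W.e1_def)
  qed
  have e1sq: "W.e1\<^sup>2 \<le> (3 * \<kappa>)\<^sup>2" using e1 by (intro power_mono) auto
  define c3 where "c3 = (2 * W.e1\<^sup>2 + 10 * q0\<^sup>2) / \<delta>\<^sup>2 + q1 s"
  define c1 where "c1 = (1 + 1 / \<xi>) * W.e1\<^sup>2"
  have q1_0: "0 \<le> q1 s" using \<beta> by (simp add: q1_def)
  have count: "\<Lambda> * (real (D * (2 * P + 1)) * (1 - 2 * q0\<^sup>2 - real (card C) * (2 / \<delta>\<^sup>2 * (\<Lambda> + 8 * \<kappa>) + c3)))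
      - (1 + \<xi>) * (real D * Hs + 8 * \<kappa> * real (D * (2 * P + 1))) - c1 * real (D * (2 * P + 1)) - 2 * real (card A)
    \<le> real (card A) * real (W.hi - W.lo + 1) / real (2 * L) * (2 * S + \<Lambda>)"
    unfolding Hs_def S_def \<Lambda>_eq
  proof (rule time_frequency_count[where x = W.x and C = C and A = A and T = T])
    show "finite C" "A \<subseteq> C" using finite_C A by auto
    show "cmod \<zeta> = 1" if "\<zeta> \<in> C" for \<zeta> using norm_C[OF that] .
    show "W.lo \<le> W.hi" "W.hi \<le> T" using W.lo_hi by auto
    show "W.hi - W.lo + 2 \<le> 2 * L"
      using W.lo_hi(3) uL cs D L_s(2) unfolding L_def[symmetric] u_def by linarith
    show "2 * P \<le> L" "0 < L" using PL L0 by auto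
    show "0 \<le> \<xi>" "0 \<le> 2 / \<delta>\<^sup>2" "0 \<le> 8 * \<kappa>" "0 \<le> c3" using \<xi> \<kappa> q1_0 by (auto simp: c3_def)
  next
    fix \<alpha> :: "nat \<Rightarrow> complex" assume "\<exists>i<D * (2 * P + 1). \<alpha> i \<noteq> 0"
    then obtain i where i: "i < D * W.P1" "\<alpha> i \<noteq> 0" by (auto simp: W.P1_def)
    have "0 < (cmod (\<alpha> i))\<^sup>2" using i by simp
    also have "\<dots> \<le> (\<Sum>b<D * W.P1. (cmod (\<alpha> b))\<^sup>2)" by (rule member_le_sum) (use i in auto)
    finally have "0 < ((real K / 8) ^ s * mm)\<^sup>2 * (real (K * s) * (\<Sum>b<D * W.P1. (cmod (\<alpha> b))\<^sup>2))"
      using K s mm by simp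
    also have "\<dots> \<le> nsq W.X (W.comb \<alpha>)" by (rule W.nsq_lower)
    finally show "0 < nsq ({..T} \<times> C) (\<lambda>z. \<Sum>b<D * (2 * P + 1). \<alpha> b * W.x b z)"
      unfolding cmb XX .
  next
    fix \<alpha> :: "nat \<Rightarrow> complex"
    let ?n = "nsq W.X (W.comb \<alpha>)" and ?n' = "nsq W.X (W.comb (\<lambda>b. \<alpha> b * W.\<omega> b))"
    have nn: "0 \<le> ?n" "0 \<le> ?n'" by (simp_all add: nsq_nonneg)
    \<comment> \<open>The value \<open>8 * \<kappa>\<close> for \<open>e2\<close> has to cover four
      factors \<open>1 + \<kappa>\<close> and the division by
      \<open>1 - 2 * q0\<^sup>2\<close>.\<close>
    have "((1 + 2 / real K) * (1 + e))\<^sup>2 \<le> ((1 + \<kappa>) * (1 + \<kappa>))\<^sup>2"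
      unfolding \<kappa>_def[symmetric] using e \<kappa> by (intro power_mono mult_left_mono) auto
    also have "\<dots> \<le> (1 + 8 * \<kappa>) * (1 - \<kappa>)"
    proof -
      have k2: "\<kappa> * \<kappa> \<le> \<kappa> * (1 / 8)" using \<kappa> by (intro mult_left_mono) auto
      have a1: "(1 + \<kappa>) * (1 + \<kappa>) \<le> 1 + 17 / 8 * \<kappa>" using k2 by (simp add: algebra_simps)
      have "((1 + \<kappa>) * (1 + \<kappa>))\<^sup>2 \<le> (1 + 17 / 8 * \<kappa>)\<^sup>2" using a1 \<kappa> by (intro power_mono) auto
      also have "\<dots> = 1 + 17 / 4 * \<kappa> + 289 / 64 * (\<kappa> * \<kappa>)" by (simp add: power2_eq_square algebra_simps)
      also have "\<dots> \<le> 1 + 7 * \<kappa> - 8 * (\<kappa> * \<kappa>)" using k2 \<kappa> by linarith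
      also have "\<dots> = (1 + 8 * \<kappa>) * (1 - \<kappa>)" by (simp add: algebra_simps)
      finally show ?thesis .
    qed
    finally have k4: "((1 + 2 / real K) * (1 + e))\<^sup>2 \<le> (1 + 8 * \<kappa>) * (1 - \<kappa>)" .
    have "?n' * (1 - \<kappa>) \<le> ?n' * (1 - 2 * q0\<^sup>2)" using q0 nn by (intro mult_left_mono) auto
    also have "\<dots> \<le> ((1 + 2 / real K) * (1 + e))\<^sup>2 * ?n" by (rule W.shift_bound)
    also have "\<dots> \<le> (1 + 8 * \<kappa>) * (1 - \<kappa>) * ?n" using k4 nn by (intro mult_right_mono) auto
    finally have "?n' * (1 - \<kappa>) \<le> ((1 + 8 * \<kappa>) * ?n) * (1 - \<kappa>)" by (simp add: mult_ac)
    hence "?n' \<le> (1 + 8 * \<kappa>) * ?n" using \<kappa> by (simp add: mult_le_cancel_right)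
    thus "nsq ({..T} \<times> C) (\<lambda>z. \<Sum>b<D * (2 * P + 1). \<alpha> b * cis (2 * pi * (real (b mod (2 * P + 1)) - real P) / real L) * W.x b z)
      \<le> (1 + 8 * \<kappa>) * nsq ({..T} \<times> C) (\<lambda>z. \<Sum>b<D * (2 * P + 1). \<alpha> b * W.x b z)"
      unfolding cmb XX om .
    show "(\<Sum>k\<in>{W.lo..<W.hi}. \<Sum>\<zeta>\<in>A. (cmod ((\<Sum>b<D * (2 * P + 1). \<alpha> b * W.x b (k, \<zeta>)) - \<zeta> * (\<Sum>b<D * (2 * P + 1). \<alpha> b * W.x b (Suc k, \<zeta>))))\<^sup>2)
      \<le> (1 + \<xi>) * nsq ({..T} \<times> C) (\<lambda>z. \<Sum>b<D * (2 * P + 1). \<alpha> b * (1 - cis (2 * pi * (real (b mod (2 * P + 1)) - real P) / real L)) * W.x b z)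
        + c1 * nsq ({..T} \<times> C) (\<lambda>z. \<Sum>b<D * (2 * P + 1). \<alpha> b * W.x b z)"
      using W.difference_bound[OF \<xi> A, of \<alpha>] unfolding cmb XX om c1_def .
    have "nsq (({..T} - {W.lo..W.hi}) \<times> C) (W.comb \<alpha>) \<le> (\<Sum>k\<in>{..T} - {W.lo<..<W.hi}. (W.a \<alpha> k)\<^sup>2)"
      unfolding W.nsq_comb by (rule sum_mono2) auto
    also have "\<dots> \<le> 2 * q0\<^sup>2 * ?n" by (rule W.tail_sum)
    finally show "nsq (({..T} - {W.lo..W.hi}) \<times> C) (\<lambda>z. \<Sum>b<D * (2 * P + 1). \<alpha> b * W.x b z)
       \<le> 2 * q0\<^sup>2 * nsq ({..T} \<times> C) (\<lambda>z. \<Sum>b<D * (2 * P + 1). \<alpha> b * W.x b z)"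
      unfolding cmb XX .
    fix b assume b: "b \<in> C - A"
    have near: "(cmod (\<Sum>k\<le>T. W.comb \<alpha> (k, b) * z ^ k))\<^sup>2 \<le> q1 s * ?n" if z: "cmod z = 1" "cmod (z - b) < \<delta>" for z
      unfolding q1_eq[symmetric]
    proof (rule W.near_bound[where H = "\<lambda>j. H' (b, j)"])
      show "b \<in> C" using b by simp
      show "1 / (2 * real K) \<le> \<rho> / 8" using \<kappa>(2) K \<rho> by (simp add: \<kappa>_def field_simps)
      have "2 * pi * real P / real (K * s) = 2 * pi / real J" using PL J by (simp add: LP flip: L_def)
      thus "2 * pi * real P / real (K * s) \<le> \<rho> / 8" using J by simp
      show "(\<Sum>k. binom_weight s (1 - 1 / (2 * real K)) (k + Suc T) * cmod (y b j (k + Suc T))) \<le> 1" if "j < D" for j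
        using T(2)[OF b that] by (simp only: r_def)
    qed (use conv b H' \<rho> z in \<open>auto simp: \<delta>_def\<close>)
    from W.regular_bound[OF _ \<delta> near] b
    show "(\<Sum>k\<le>T. (cmod (\<Sum>b'<D * (2 * P + 1). \<alpha> b' * W.x b' (k, b)))\<^sup>2)
      \<le> 2 / \<delta>\<^sup>2 * nsq ({..T} \<times> C) (\<lambda>z. \<Sum>b<D * (2 * P + 1). \<alpha> b * (1 - cis (2 * pi * (real (b mod (2 * P + 1)) - real P) / real L)) * W.x b z)
       + c3 * nsq ({..T} \<times> C) (\<lambda>z. \<Sum>b<D * (2 * P + 1). \<alpha> b * W.x b z)"
      unfolding cmb XX om c3_def by blast
  qed
  define \<eta> where "\<eta> = 2 * q0\<^sup>2 + cC * (2 / \<delta>\<^sup>2 * (\<Lambda> + 8 * \<kappa>) + c3)"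
  have \<eta>: "\<eta> \<le> 3 / (64 * real D)"
  proof -
    have "cC * (2 / \<delta>\<^sup>2 * (\<Lambda> + 8 * \<kappa>)) \<le> cC * (2 / \<delta>\<^sup>2 * (2 * \<Lambda>))"
      using \<kappa> cC0 by (intro mult_left_mono) auto
    also have "\<dots> \<le> 1 / (64 * real D)" using J(3) by (simp add: \<Lambda>_def mult.assoc)
    finally have 1: "cC * (2 / \<delta>\<^sup>2 * (\<Lambda> + 8 * \<kappa>)) \<le> 1 / (64 * real D)" .
    have "cC * (2 * W.e1\<^sup>2) / \<delta>\<^sup>2 \<le> cC * (2 * (3 * \<kappa>)\<^sup>2) / \<delta>\<^sup>2"
      using e1sq cC0 by (intro divide_right_mono mult_left_mono) auto
    hence 2: "cC * (2 * W.e1\<^sup>2) / \<delta>\<^sup>2 \<le> 1 / (128 * real D)" using \<kappa>(6) by linarith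
    have "\<eta> = cC * (2 / \<delta>\<^sup>2 * (\<Lambda> + 8 * \<kappa>)) + cC * (2 * W.e1\<^sup>2) / \<delta>\<^sup>2 + ((2 + 10 * cC / \<delta>\<^sup>2) * q0\<^sup>2 + cC * q1 s)"
      by (simp add: \<eta>_def c3_def algebra_simps add_divide_distrib)
    also have "\<dots> \<le> 1 / (64 * real D) + 1 / (128 * real D) + 3 / (128 * real D)"
      using 1 2 q0(3) by linarith
    finally show ?thesis by (simp add: field_simps)
  qed
  have "(1 + \<xi>) * (8 * \<kappa>) + c1 \<le> \<Lambda> / (64 * real D)"
  proof -
    have "c1 \<le> (1 + 1 / \<xi>) * (3 * \<kappa>)\<^sup>2" unfolding c1_def using e1sq \<xi> by (intro mult_left_mono) auto
    thus ?thesis using \<kappa>(5) by linarith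
  qed
  moreover have "real (W.hi - W.lo + 1) / real L \<le> 1 + 1 / (4 * real D)"
  proof -
    have hl: "real (W.hi - W.lo + 1) = real L + 2 * real u + 2" unfolding W.lo_hi(3) by (simp add: L_def)
    have "16 * D \<le> L" using s' s L_s by linarith
    hence 1: "16 * real D \<le> real L" by (metis of_nat_le_iff of_nat_mult of_nat_numeral)
    have "real L = real (16 * D * (c * s))" by (simp only: L_s(2))
    hence 2: "real L = 16 * real D * real u" by (simp add: u_def)
    have u0: "0 < real u" using cs by (simp add: u_def)
    have "(real L + 2 * real u + 2) / real L = 1 + 2 * real u / real L + 2 / real L"
      using L0 by (simp add: field_simps)
    also have "2 * real u / real L = 1 / (8 * real D)" using u0 D by (simp add: 2)
    also have "2 / real L \<le> 2 / (16 * real D)" using 1 D by (intro divide_left_mono) auto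
    finally have "real (W.hi - W.lo + 1) / real L \<le> 1 + 1 / (8 * real D) + 2 / (16 * real D)"
      unfolding hl by simp
    also have "1 + 1 / (8 * real D) + 2 / (16 * real D) = 1 + 1 / (4 * real D)" using D by (simp add: field_simps)
    finally show ?thesis .
  qed
  moreover have "real D * \<Lambda> / 2 + 2 * real D \<le> \<Lambda> * real (2 * P + 1) / 64"
  proof -
    have "s' \<le> P" using K by (simp add: P_def)
    hence "real s' \<le> real (2 * P + 1)" by (simp only: of_nat_le_iff)
    hence "\<Lambda> * real s' \<le> \<Lambda> * real (2 * P + 1)" using \<Lambda> by (intro mult_left_mono) auto
    thus ?thesis using s' by linarith
  qed
  moreover have "\<Lambda> * (real D * real (2 * P + 1)) * (1 - \<eta>) - (1 + \<xi>) * (real D * Hs)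
      - ((1 + \<xi>) * (8 * \<kappa>) + c1) * (real D * real (2 * P + 1)) - 2 * real (card A)
      \<le> real (card A) * (real (W.hi - W.lo + 1) / real L) * (S + \<Lambda> / 2)"
  proof -
    have "real (card A) * real (W.hi - W.lo + 1) / real (2 * L) * (2 * S + \<Lambda>)
       = real (card A) * (real (W.hi - W.lo + 1) / real L) * (S + \<Lambda> / 2)"
      using L0 by (simp add: field_simps)
    thus ?thesis using count unfolding \<eta>_def cC_def of_nat_mult[of D] by (simp add: algebra_simps)
  qed
  ultimately show False
    using count_arithmetic[of "real D" \<Lambda> "real (2 * P + 1)" S Hs "real (card A)" "real (W.hi - W.lo + 1) / real L" \<eta> \<xi>
        "(1 + \<xi>) * (8 * \<kappa>) + c1"] D1 \<Lambda> S_ge Hs cA \<eta> \<xi>_def by simp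
qed


section \<open>Poincare--Perron dominance\<close>

lemma coordinatewise_subseq:
  fixes G :: "nat \<Rightarrow> nat \<Rightarrow> complex"
  assumes "\<And>n j. j < D \<Longrightarrow> cmod (G n j) \<le> 1"
  shows "\<exists>\<sigma> l. strict_mono (\<sigma> :: nat \<Rightarrow> nat) \<and> (\<forall>j<D. (\<lambda>n. G (\<sigma> n) j) \<longlonglongrightarrow> l j)"
  using assms
proof (induction D)
  case 0
  show ?case by (intro exI[of _ id]) (auto simp: strict_mono_def)
next
  case (Suc D)
  then obtain \<sigma> l where \<sigma>: "strict_mono (\<sigma> :: nat \<Rightarrow> nat)" "\<forall>j<D. (\<lambda>n. G (\<sigma> n) j) \<longlonglongrightarrow> l j" by fastforce
  have "\<forall>n. G (\<sigma> n) D \<in> cball 0 1" using Suc.prems by simp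
  then obtain x r where r: "strict_mono (r :: nat \<Rightarrow> nat)" "((\<lambda>n. G (\<sigma> n) D) \<circ> r) \<longlonglongrightarrow> x"
    using compact_cball[of "0 :: complex" 1] unfolding compact_def by metis
  have "(\<lambda>n. G ((\<sigma> \<circ> r) n) j) \<longlonglongrightarrow> (if j = D then x else l j)" if "j < Suc D" for j
  proof (cases "j = D")
    case True thus ?thesis using r by (simp add: o_def)
  next
    case False
    hence "(\<lambda>n. G (\<sigma> n) j) \<longlonglongrightarrow> l j" using \<sigma> that by simp
    from LIMSEQ_subseq_LIMSEQ[OF this r(1)] show ?thesis using False by (simp add: o_def)
  qed
  hence "\<forall>j<Suc D. (\<lambda>n. G ((\<sigma> \<circ> r) n) j) \<longlonglongrightarrow> (if j = D then x else l j)" by blast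
  with strict_mono_o[OF \<sigma>(1) r(1)] show ?case
    by (intro exI[of _ "\<sigma> \<circ> r"] exI[of _ "\<lambda>j. if j = D then x else l j"] conjI)
qed

text \<open>\<open>growth\<close> and \<open>exact\<close> together say that, for nonzero
  \<open>g\<close>, the least radius of convergence among the component series is exactly
  \<open>R\<close>.\<close>

locale dominated_family =
  fixes Z :: "complex set" and D :: nat and \<eta> :: "complex \<Rightarrow> nat \<Rightarrow> nat \<Rightarrow> complex" and R :: real
  assumes finite_Z: "finite Z" and nz: "0 \<notin> Z" and R: "0 < R"
    and almost_eigen_sum: "\<And>\<epsilon>. 0 < \<epsilon> \<Longrightarrow> \<exists>k1. \<forall>k\<ge>k1. \<forall>g. \<forall>\<zeta>\<in>Z.
      cmod ((\<Sum>j<D. g j * \<eta> \<zeta> j k) - \<zeta> * (\<Sum>j<D. g j * \<eta> \<zeta> j (Suc k)))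
        \<le> \<epsilon> * (\<Sum>\<zeta>'\<in>Z. cmod (\<Sum>j<D. g j * \<eta> \<zeta>' j (Suc k)))"
    and growth: "\<And>g \<rho>. 0 < \<rho> \<Longrightarrow> \<rho> < R \<Longrightarrow> \<exists>B. \<forall>k. \<forall>\<zeta>\<in>Z. cmod (\<Sum>j<D. g j * \<eta> \<zeta> j k) * \<rho> ^ k \<le> B"
    and exact: "\<And>g \<rho>. \<exists>j<D. g j \<noteq> 0 \<Longrightarrow> R < \<rho> \<Longrightarrow> \<not> (\<exists>B. \<forall>k. \<forall>\<zeta>\<in>Z. cmod (\<Sum>j<D. g j * \<eta> \<zeta> j k) * \<rho> ^ k \<le> B)"
begin

definition h :: "complex \<Rightarrow> (nat \<Rightarrow> complex) \<Rightarrow> nat \<Rightarrow> complex" where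
  "h \<zeta> g k = (\<Sum>j<D. g j * \<eta> \<zeta> j k)"

definition mx :: "complex set \<Rightarrow> (nat \<Rightarrow> complex) \<Rightarrow> nat \<Rightarrow> real" where
  "mx B g k = Max (insert 0 ((\<lambda>\<zeta>. cmod (h \<zeta> g k)) ` B))"

text \<open>A component at \<open>\<zeta>\<close> evolves like \<open>\<zeta> ^ (-k)\<close>.
  Dominant inner components would grow faster than \<open>R ^ (-k)\<close>, against
  \<open>growth\<close>; lasting dominance of outer ones would mean faster decay, against
  \<open>exact\<close>.\<close>

definition inner where "inner = {\<zeta>\<in>Z. cmod \<zeta> < R}"
definition middle where "middle = {\<zeta>\<in>Z. cmod \<zeta> = R}"
definition outer where "outer = {\<zeta>\<in>Z. cmod \<zeta> > R}"

lemma parts: "finite inner" "finite middle" "finite outer" "inner \<subseteq> Z" "middle \<subseteq> Z" "outer \<subseteq> Z"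
  "Z = inner \<union> middle \<union> outer"
  using finite_Z by (auto simp: inner_def middle_def outer_def)

lemma mx_ge: "finite B \<Longrightarrow> \<zeta> \<in> B \<Longrightarrow> cmod (h \<zeta> g k) \<le> mx B g k"
  by (simp add: mx_def)

lemma mx_nonneg: "finite B \<Longrightarrow> 0 \<le> mx B g k"
  by (simp add: mx_def)

lemma mx_le: "finite B \<Longrightarrow> 0 \<le> x \<Longrightarrow> (\<And>\<zeta>. \<zeta> \<in> B \<Longrightarrow> cmod (h \<zeta> g k) \<le> x) \<Longrightarrow> mx B g k \<le> x"
  by (auto simp: mx_def)

lemma mx_less: "finite B \<Longrightarrow> 0 < x \<Longrightarrow> (\<And>\<zeta>. \<zeta> \<in> B \<Longrightarrow> cmod (h \<zeta> g k) < x) \<Longrightarrow> mx B g k < x"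
  by (auto simp: mx_def)

lemma mx_attained:
  assumes "finite B" "0 < mx B g k"
  obtains \<zeta> where "\<zeta> \<in> B" "cmod (h \<zeta> g k) = mx B g k"
proof -
  have "mx B g k \<in> insert 0 ((\<lambda>\<zeta>. cmod (h \<zeta> g k)) ` B)" unfolding mx_def using assms by (intro Max_in) auto
  thus ?thesis using assms that by auto
qed

lemma mx_mono: "finite B' \<Longrightarrow> B \<subseteq> B' \<Longrightarrow> mx B g k \<le> mx B' g k"
  by (rule mx_le) (auto intro: finite_subset mx_ge mx_nonneg)

lemma mx_Z: "mx Z g k = max (mx inner g k) (max (mx middle g k) (mx outer g k))"
proof (rule antisym)
  show "mx Z g k \<le> max (mx inner g k) (max (mx middle g k) (mx outer g k))"
  proof (rule mx_le[OF finite_Z])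
    show "0 \<le> max (mx inner g k) (max (mx middle g k) (mx outer g k))" using mx_nonneg[OF parts(1), of g k] by linarith
    fix \<zeta> assume "\<zeta> \<in> Z"
    hence "\<zeta> \<in> inner \<or> \<zeta> \<in> middle \<or> \<zeta> \<in> outer" using parts(7) by blast
    thus "cmod (h \<zeta> g k) \<le> max (mx inner g k) (max (mx middle g k) (mx outer g k))"
      using mx_ge parts by (meson max.coboundedI1 max.coboundedI2)
  qed
  show "max (mx inner g k) (max (mx middle g k) (mx outer g k)) \<le> mx Z g k"
    using mx_mono[OF finite_Z] parts by auto
qed

lemma almost_eigen:
  assumes "0 < \<epsilon>"
  shows "\<exists>k1. \<forall>k\<ge>k1. \<forall>g. \<forall>\<zeta>\<in>Z. cmod (h \<zeta> g k - \<zeta> * h \<zeta> g (Suc k)) \<le> \<epsilon> * mx Z g (Suc k)"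
proof -
  have "0 < \<epsilon> / (real (card Z) + 1)" using assms by simp
  from almost_eigen_sum[OF this] obtain k1 where k1: "\<forall>k\<ge>k1. \<forall>g. \<forall>\<zeta>\<in>Z. cmod (h \<zeta> g k - \<zeta> * h \<zeta> g (Suc k))
     \<le> \<epsilon> / (real (card Z) + 1) * (\<Sum>\<zeta>'\<in>Z. cmod (h \<zeta>' g (Suc k)))"
    unfolding h_def by blast
  show ?thesis
  proof (intro exI[of _ k1] allI impI ballI)
    fix k g \<zeta> assume "k1 \<le> k" "\<zeta> \<in> Z"
    hence "cmod (h \<zeta> g k - \<zeta> * h \<zeta> g (Suc k)) \<le> \<epsilon> / (real (card Z) + 1) * (\<Sum>\<zeta>'\<in>Z. cmod (h \<zeta>' g (Suc k)))"
      using k1 by blast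
    also have "(\<Sum>\<zeta>'\<in>Z. cmod (h \<zeta>' g (Suc k))) \<le> (\<Sum>\<zeta>'\<in>Z. mx Z g (Suc k))"
      by (rule sum_mono) (rule mx_ge[OF finite_Z])
    hence "\<epsilon> / (real (card Z) + 1) * (\<Sum>\<zeta>'\<in>Z. cmod (h \<zeta>' g (Suc k))) \<le> \<epsilon> / (real (card Z) + 1) * (real (card Z) * mx Z g (Suc k))"
      using assms by (intro mult_left_mono) auto
    also have "\<dots> \<le> \<epsilon> / (real (card Z) + 1) * ((real (card Z) + 1) * mx Z g (Suc k))"
      using assms mx_nonneg[OF finite_Z] by (intro mult_left_mono mult_right_mono) auto
    also have "\<dots> = \<epsilon> * mx Z g (Suc k)" by (simp add: field_simps)
    finally show "cmod (h \<zeta> g k - \<zeta> * h \<zeta> g (Suc k)) \<le> \<epsilon> * mx Z g (Suc k)" .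
  qed
qed

text \<open>Here the error is relative to time \<open>k\<close> instead of \<open>k + 1\<close>.
  Since 0 is not in \<open>Z\<close>, passing from \<open>k\<close> to \<open>k + 1\<close> enlarges
  the maximum by at most \<open>2 / R0\<close> once the relative error is below
  \<open>R0 / 2\<close>.\<close>

lemma almost_eigen_forward:
  assumes "0 < \<epsilon>"
  shows "\<exists>k1. \<forall>k\<ge>k1. \<forall>g. \<forall>\<zeta>\<in>Z. cmod (h \<zeta> g k - \<zeta> * h \<zeta> g (Suc k)) \<le> \<epsilon> * mx Z g k"
proof -
  define R0 where "R0 = Min (insert 1 (cmod ` Z))"
  have R0: "0 < R0" unfolding R0_def using finite_Z nz by (subst Min_gr_iff) auto
  have R0Z: "R0 \<le> cmod \<zeta>" if "\<zeta> \<in> Z" for \<zeta> unfolding R0_def using finite_Z that by auto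
  define \<epsilon>1 where "\<epsilon>1 = min (R0 / 2) (\<epsilon> * R0 / 2)"
  have \<epsilon>1: "0 < \<epsilon>1" "\<epsilon>1 \<le> R0 / 2" "\<epsilon>1 \<le> \<epsilon> * R0 / 2" using R0 assms by (auto simp: \<epsilon>1_def)
  obtain k1 where k1: "\<forall>k\<ge>k1. \<forall>g. \<forall>\<zeta>\<in>Z. cmod (h \<zeta> g k - \<zeta> * h \<zeta> g (Suc k)) \<le> \<epsilon>1 * mx Z g (Suc k)"
    using almost_eigen[OF \<epsilon>1(1)] by blast
  show ?thesis
  proof (intro exI[of _ k1] allI impI ballI)
    fix k g \<zeta> assume k: "k1 \<le> k" and \<zeta>: "\<zeta> \<in> Z"
    have "mx Z g (Suc k) \<le> 2 / R0 * mx Z g k"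
    proof (cases "mx Z g (Suc k) = 0")
      case True thus ?thesis using R0 mx_nonneg[OF finite_Z] by simp
    next
      case False
      hence "0 < mx Z g (Suc k)" using mx_nonneg[OF finite_Z, of g "Suc k"] by simp
      then obtain \<xi> where \<xi>: "\<xi> \<in> Z" "cmod (h \<xi> g (Suc k)) = mx Z g (Suc k)"
        by (rule mx_attained[OF finite_Z])
      have "cmod (\<xi> * h \<xi> g (Suc k)) \<le> cmod (h \<xi> g k) + cmod (h \<xi> g k - \<xi> * h \<xi> g (Suc k))"
        by (metis norm_minus_commute norm_triangle_sub)
      also have "\<dots> \<le> mx Z g k + R0 / 2 * mx Z g (Suc k)"
      proof (rule add_mono)
        show "cmod (h \<xi> g k) \<le> mx Z g k" by (rule mx_ge[OF finite_Z \<xi>(1)])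
        have "cmod (h \<xi> g k - \<xi> * h \<xi> g (Suc k)) \<le> \<epsilon>1 * mx Z g (Suc k)" using k1 k \<xi>(1) by blast
        also have "\<dots> \<le> R0 / 2 * mx Z g (Suc k)" using \<epsilon>1(2) mx_nonneg[OF finite_Z] by (intro mult_right_mono)
        finally show "cmod (h \<xi> g k - \<xi> * h \<xi> g (Suc k)) \<le> R0 / 2 * mx Z g (Suc k)" .
      qed
      finally have "cmod \<xi> * mx Z g (Suc k) \<le> mx Z g k + R0 / 2 * mx Z g (Suc k)" by (simp add: norm_mult \<xi>)
      moreover have "R0 * mx Z g (Suc k) \<le> cmod \<xi> * mx Z g (Suc k)"
        using R0Z[OF \<xi>(1)] mx_nonneg[OF finite_Z] by (intro mult_right_mono) auto
      ultimately have "R0 / 2 * mx Z g (Suc k) \<le> mx Z g k" by (simp add: algebra_simps)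
      thus ?thesis using R0 by (simp add: field_simps)
    qed
    hence "\<epsilon>1 * mx Z g (Suc k) \<le> (\<epsilon> * R0 / 2) * (2 / R0 * mx Z g k)"
      using \<epsilon>1 R0 assms mx_nonneg[OF finite_Z] by (intro mult_mono) auto
    also have "\<dots> = \<epsilon> * mx Z g k" using R0 by simp
    finally have "\<epsilon>1 * mx Z g (Suc k) \<le> \<epsilon> * mx Z g k" .
    thus "cmod (h \<zeta> g k - \<zeta> * h \<zeta> g (Suc k)) \<le> \<epsilon> * mx Z g k" using k1 k \<zeta> by (meson order_trans)
  qed
qed

lemma not_eventually_bounded:
  assumes "\<exists>j<D. g j \<noteq> 0" "R < \<rho>" "\<And>k. k0 \<le> k \<Longrightarrow> mx Z g k * \<rho> ^ k \<le> B"
  shows False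
proof -
  define B' where "B' = Max (insert B ((\<lambda>k. mx Z g k * \<rho> ^ k) ` {..k0}))"
  have "cmod (h \<zeta> g k) * \<rho> ^ k \<le> B'" if "\<zeta> \<in> Z" for k \<zeta>
  proof -
    have "cmod (h \<zeta> g k) * \<rho> ^ k \<le> mx Z g k * \<rho> ^ k"
      using mx_ge[OF finite_Z that] R assms by (intro mult_right_mono) auto
    also have "\<dots> \<le> B'"
    proof (cases "k0 \<le> k")
      case True
      hence "mx Z g k * \<rho> ^ k \<le> B" by (rule assms)
      also have "B \<le> B'" by (simp add: B'_def)
      finally show ?thesis .
    next
      case False thus ?thesis unfolding B'_def by (intro Max_ge) auto
    qed
    finally show ?thesis .
  qed
  thus False using exact[OF assms(1,2)] unfolding h_def by blast
qed

text \<open>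
  Poincare--Perron: a solution that neither grows faster nor decays faster than \<open>R\<^bsup>-k\<^esup>\<close> is
  eventually dominated by its components on the circle of radius \<open>R\<close>; by compactness this happens
  simultaneously for all solutions.
\<close>

lemma middle_dominates:
  "\<exists>k2. \<forall>k\<ge>k2. \<forall>g. mx Z g k = mx middle g k \<and> ((\<exists>j<D. g j \<noteq> 0) \<longrightarrow> 0 < mx middle g k)"
proof -
  define R1 where "R1 = Max (insert (R / 2) (cmod ` inner))"
  define R2 where "R2 = Min (insert (2 * R) (cmod ` outer))"
  have R1: "0 < R1" "R1 < R" "\<And>\<zeta>. \<zeta> \<in> inner \<Longrightarrow> cmod \<zeta> \<le> R1"
  proof -
    have "R / 2 \<le> R1" unfolding R1_def using parts by (intro Max_ge) auto
    thus "0 < R1" using R by simp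
    show "R1 < R" unfolding R1_def using parts R by (subst Max_less_iff) (auto simp: inner_def)
    show "cmod \<zeta> \<le> R1" if "\<zeta> \<in> inner" for \<zeta> unfolding R1_def using parts that by (intro Max_ge) auto
  qed
  have R2: "R < R2" "\<And>\<zeta>. \<zeta> \<in> outer \<Longrightarrow> R2 \<le> cmod \<zeta>"
  proof -
    show "R < R2" unfolding R2_def using parts R by (subst Min_gr_iff) (auto simp: outer_def)
    show "R2 \<le> cmod \<zeta>" if "\<zeta> \<in> outer" for \<zeta> unfolding R2_def using parts that by (intro Min_le) auto
  qed
  \<comment> \<open>Small enough that the gaps \<open>R1 < R < R2\<close> between the three groups
    survive the factors \<open>1 - \<epsilon>\<close> and \<open>1 + \<epsilon>\<close>.\<close>
  obtain \<epsilon> where \<epsilon>: "0 < \<epsilon>" "\<epsilon> < 1" "R1 * (1 + \<epsilon>) < R * (1 - \<epsilon>)" "R * (1 + \<epsilon>) < R2 * (1 - \<epsilon>)"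
  proof -
    have 0: "((\<lambda>e::real. e) \<longlongrightarrow> 0) (at_right 0)" by (intro tendsto_intros)
    have 1: "((\<lambda>e. R * (1 - e) - R1 * (1 + e)) \<longlongrightarrow> R * (1 - 0) - R1 * (1 + 0)) (at_right 0)" by (intro tendsto_intros)
    have 2: "((\<lambda>e. R2 * (1 - e) - R * (1 + e)) \<longlongrightarrow> R2 * (1 - 0) - R * (1 + 0)) (at_right 0)" by (intro tendsto_intros)
    have "\<forall>\<^sub>F e in at_right 0. 0 < e \<and> e < 1 \<and> 0 < R * (1 - e) - R1 * (1 + e) \<and> 0 < R2 * (1 - e) - R * (1 + e)"
      by (intro eventually_conj eventually_at_right_less order_tendstoD(2)[OF 0] order_tendstoD(1)[OF 1] order_tendstoD(1)[OF 2])
         (use R1 R2 in auto)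
    thus ?thesis using that by (auto dest: eventually_happens)
  qed
  obtain k1 where k1: "\<forall>k\<ge>k1. \<forall>g. \<forall>\<zeta>\<in>Z. cmod (h \<zeta> g k - \<zeta> * h \<zeta> g (Suc k)) \<le> \<epsilon> * mx Z g k"
    using almost_eigen_forward[OF \<epsilon>(1)] by blast
  have up: "cmod \<zeta> * cmod (h \<zeta> g (Suc k)) \<le> cmod (h \<zeta> g k) + \<epsilon> * mx Z g k"
    and low: "cmod (h \<zeta> g k) - \<epsilon> * mx Z g k \<le> cmod \<zeta> * cmod (h \<zeta> g (Suc k))" if "k1 \<le> k" "\<zeta> \<in> Z" for \<zeta> g k
  proof -
    have "cmod (h \<zeta> g k - \<zeta> * h \<zeta> g (Suc k)) \<le> \<epsilon> * mx Z g k" using k1 that by blast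
    thus "cmod \<zeta> * cmod (h \<zeta> g (Suc k)) \<le> cmod (h \<zeta> g k) + \<epsilon> * mx Z g k"
      "cmod (h \<zeta> g k) - \<epsilon> * mx Z g k \<le> cmod \<zeta> * cmod (h \<zeta> g (Suc k))"
      using norm_triangle_ineq3[of "h \<zeta> g k" "\<zeta> * h \<zeta> g (Suc k)"] by (auto simp: norm_mult abs_le_iff)
  qed
  have up': "cmod \<zeta> * cmod (h \<zeta> g (Suc k)) \<le> (1 + \<epsilon>) * mx Z g k" if "k1 \<le> k" "\<zeta> \<in> Z" for \<zeta> g k
    using up[OF that, of g] mx_ge[OF finite_Z that(2), of g k] by (simp add: algebra_simps)
  have Z_nonneg: "0 \<le> mx Z g k" for g k by (rule mx_nonneg[OF finite_Z])
  \<comment> \<open>Dominance of the inner components is inherited by the next time and forces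
    growth by at least \<open>(1 - \<epsilon>) / R1\<close>, which exceeds
    \<open>1 / R\<close>.\<close>
  have cone: "R1 * mx inner g (Suc k) \<ge> (1 - \<epsilon>) * mx Z g k \<and> mx Z g (Suc k) = mx inner g (Suc k)"
    if k: "k1 \<le> k" and dom: "mx Z g k = mx inner g k" for g k
  proof (cases "mx Z g k = 0")
    case True
    have "mx Z g (Suc k) \<le> 0"
    proof (rule mx_le[OF finite_Z])
      fix \<zeta> assume \<zeta>: "\<zeta> \<in> Z"
      have "cmod \<zeta> * cmod (h \<zeta> g (Suc k)) \<le> 0" using up'[OF k \<zeta>, of g] True by simp
      moreover have "0 < cmod \<zeta>" using nz \<zeta> by auto
      ultimately show "cmod (h \<zeta> g (Suc k)) \<le> 0" by (simp add: mult_le_0_iff)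
    qed simp
    hence "mx Z g (Suc k) = 0" using Z_nonneg[of g "Suc k"] by simp
    moreover have "mx inner g (Suc k) = 0"
      using calculation mx_mono[OF finite_Z parts(4), of g "Suc k"] mx_nonneg[OF parts(1), of g "Suc k"] by simp
    ultimately show ?thesis using True by simp
  next
    case False
    hence pos: "0 < mx Z g k" using Z_nonneg[of g k] by simp
    obtain \<zeta> where \<zeta>: "\<zeta> \<in> inner" "cmod (h \<zeta> g k) = mx Z g k" using mx_attained[OF parts(1), of g k] pos dom by auto
    have "(1 - \<epsilon>) * mx Z g k \<le> cmod \<zeta> * cmod (h \<zeta> g (Suc k))"
      using low[OF k, of \<zeta> g] \<zeta> parts(4) by (auto simp: algebra_simps)
    also have "\<dots> \<le> R1 * mx inner g (Suc k)" using R1 \<zeta> mx_ge[OF parts(1) \<zeta>(1)] by (intro mult_mono) auto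
    finally have 1: "(1 - \<epsilon>) * mx Z g k \<le> R1 * mx inner g (Suc k)" .
    have other: "cmod (h \<xi> g (Suc k)) \<le> mx inner g (Suc k)" if "\<xi> \<in> Z" "R \<le> cmod \<xi>" for \<xi>
    proof -
      have "R * (R1 * cmod (h \<xi> g (Suc k))) \<le> R1 * (cmod \<xi> * cmod (h \<xi> g (Suc k)))"
        using that R1 by (simp add: mult_left_mono mult_right_mono mult.left_commute)
      also have "\<dots> \<le> R1 * ((1 + \<epsilon>) * mx Z g k)" using up'[OF k that(1), of g] R1 by (intro mult_left_mono) auto
      also have "\<dots> \<le> R * ((1 - \<epsilon>) * mx Z g k)"
        using mult_right_mono[OF less_imp_le[OF \<epsilon>(3)] Z_nonneg[of g k]] by (simp add: mult.assoc)
      also have "\<dots> \<le> R * (R1 * mx inner g (Suc k))" using 1 R by (intro mult_left_mono) auto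
      finally show ?thesis using R R1 by simp
    qed
    have "mx Z g (Suc k) \<le> mx inner g (Suc k)"
    proof (rule mx_le[OF finite_Z mx_nonneg[OF parts(1)]])
      fix \<xi> assume \<xi>: "\<xi> \<in> Z"
      show "cmod (h \<xi> g (Suc k)) \<le> mx inner g (Suc k)"
        using other[OF \<xi>] mx_ge[OF parts(1), of \<xi> g "Suc k"] \<xi> by (cases "cmod \<xi> < R") (auto simp: inner_def)
    qed
    thus ?thesis using 1 mx_mono[OF finite_Z parts(4), of g "Suc k"] by simp
  qed
  have inner_less: "mx inner g k < mx Z g k" if g: "\<exists>j<D. g j \<noteq> 0" and k: "k1 \<le> k" for g k
  proof (rule ccontr)
    assume "\<not> ?thesis"
    hence eq: "mx Z g k = mx inner g k" using mx_mono[OF finite_Z parts(4), of g k] by simp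
    have it: "mx Z g (k + i) = mx inner g (k + i) \<and> ((1 - \<epsilon>) / R1) ^ i * mx Z g k \<le> mx Z g (k + i)" for i
    proof (induction i)
      case (Suc i)
      have c: "(1 - \<epsilon>) * mx Z g (k + i) \<le> R1 * mx inner g (Suc (k + i))" "mx Z g (Suc (k + i)) = mx inner g (Suc (k + i))"
        using cone[of "k + i" g] k Suc by auto
      have "((1 - \<epsilon>) / R1) * (((1 - \<epsilon>) / R1) ^ i * mx Z g k) \<le> ((1 - \<epsilon>) / R1) * mx Z g (k + i)"
        using Suc \<epsilon> R1 by (intro mult_left_mono) auto
      also have "\<dots> \<le> mx Z g (Suc (k + i))" using c R1 by (simp add: field_simps)
      finally show ?case using c by (simp add: mult.assoc)
    qed (simp add: eq)
    define X where "X = R1 / (1 - \<epsilon>)"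
    have X: "0 < X" using R1 \<epsilon> by (simp add: X_def)
    have lt: "X < R"
    proof -
      have "R1 * 1 \<le> R1 * (1 + \<epsilon>)" using R1 \<epsilon> by (intro mult_left_mono) auto
      thus ?thesis using \<epsilon> by (simp add: X_def field_simps)
    qed
    define \<rho> where "\<rho> = (X + R) / 2"
    have \<rho>: "0 < \<rho>" "\<rho> < R" "R1 / (1 - \<epsilon>) < \<rho>"
      using lt R X unfolding X_def[symmetric] by (auto simp: \<rho>_def)
    define b where "b = \<rho> * ((1 - \<epsilon>) / R1)"
    have b: "1 < b" using \<rho>(3) \<epsilon> R1 by (simp add: b_def field_simps)
    obtain B where B: "\<forall>k. \<forall>\<zeta>\<in>Z. cmod (h \<zeta> g k) * \<rho> ^ k \<le> B" using growth[OF \<rho>(1,2), of g] unfolding h_def by blast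
    have B': "mx Z g i * \<rho> ^ i \<le> max 0 B" for i
    proof (cases "mx Z g i = 0")
      case False
      hence "0 < mx Z g i" using Z_nonneg[of g i] by simp
      then obtain \<zeta> where "\<zeta> \<in> Z" "cmod (h \<zeta> g i) = mx Z g i"
        by (rule mx_attained[OF finite_Z])
      have "cmod (h \<zeta> g i) * \<rho> ^ i \<le> B" using B \<open>\<zeta> \<in> Z\<close> by blast
      hence "mx Z g i * \<rho> ^ i \<le> B" using \<open>cmod (h \<zeta> g i) = mx Z g i\<close> by simp
      thus ?thesis by simp
    qed simp
    have "mx Z g k = 0"
    proof (rule ccontr)
      assume "mx Z g k \<noteq> 0"
      hence "0 < mx Z g k" using Z_nonneg[of g k] by linarith
      hence pos: "0 < mx Z g k * \<rho> ^ k" using \<rho>(1) by simp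
      have "b ^ i * (mx Z g k * \<rho> ^ k) \<le> max 0 B" for i
      proof -
        have "b ^ i * (mx Z g k * \<rho> ^ k) = (((1 - \<epsilon>) / R1) ^ i * mx Z g k) * \<rho> ^ (k + i)"
          unfolding b_def power_mult_distrib power_add by (simp only: mult_ac)
        also have "\<dots> \<le> mx Z g (k + i) * \<rho> ^ (k + i)" using it[of i] \<rho> by (intro mult_right_mono) auto
        also have "\<dots> \<le> max 0 B" by (rule B')
        finally show ?thesis .
      qed
      moreover obtain i where "max 0 B / (mx Z g k * \<rho> ^ k) < b ^ i" using real_arch_pow[OF b] by blast
      ultimately show False using pos by (metis not_less pos_divide_less_eq)
    qed
    hence z: "mx inner g k = 0" using eq by simp
    \<comment> \<open>A solution that vanishes at one late time stays zero, which
      \<open>exact\<close> excludes for nonzero \<open>g\<close>.\<close>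
    have zero: "mx Z g (k + i) = 0" for i
    proof (induction i)
      case 0 show ?case using \<open>mx Z g k = 0\<close> by simp
    next
      case (Suc i)
      have "mx Z g (Suc (k + i)) \<le> 0"
      proof (rule mx_le[OF finite_Z])
        fix \<zeta> assume \<zeta>: "\<zeta> \<in> Z"
        have "cmod \<zeta> * cmod (h \<zeta> g (Suc (k + i))) \<le> 0" using up'[OF _ \<zeta>, of "k + i" g] Suc k by simp
        moreover have "0 < cmod \<zeta>" using nz \<zeta> by auto
        ultimately show "cmod (h \<zeta> g (Suc (k + i))) \<le> 0" by (simp add: mult_le_0_iff)
      qed simp
      thus ?case using Z_nonneg[of g "Suc (k + i)"] by simp
    qed
    have "mx Z g i * (2 * R) ^ i \<le> 0" if "k \<le> i" for i using zero[of "i - k"] that by simp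
    from not_eventually_bounded[OF g _ this] show False using R by simp
  qed
  have dom: "mx Z g k = max (mx middle g k) (mx outer g k)" if "\<exists>j<D. g j \<noteq> 0" "k1 \<le> k" for g k
    using inner_less[OF that] mx_Z[of g k] by linarith
  have persist: "mx outer g (Suc k) < mx middle g (Suc k)"
    if g: "\<exists>j<D. g j \<noteq> 0" and k: "k1 \<le> k" and good: "mx outer g k \<le> mx middle g k" for g k
  proof -
    have eq: "mx Z g k = mx middle g k" using dom[OF g k] good by simp
    have pos: "0 < mx Z g k" using inner_less[OF g k] mx_nonneg[OF parts(1), of g k] by linarith
    obtain \<zeta> where \<zeta>: "\<zeta> \<in> middle" "cmod (h \<zeta> g k) = mx Z g k" using mx_attained[OF parts(2), of g k] pos eq by auto
    have "(1 - \<epsilon>) * mx Z g k \<le> R * cmod (h \<zeta> g (Suc k))"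
      using low[OF k, of \<zeta> g] \<zeta> parts(5) by (auto simp: algebra_simps middle_def)
    also have "\<dots> \<le> R * mx middle g (Suc k)" using R mx_ge[OF parts(2) \<zeta>(1)] by (intro mult_left_mono) auto
    finally have 1: "(1 - \<epsilon>) * mx Z g k \<le> R * mx middle g (Suc k)" .
    have mpos: "0 < mx middle g (Suc k)"
    proof -
      have "0 < (1 - \<epsilon>) * mx Z g k" using \<epsilon> pos by simp
      hence "0 < R * mx middle g (Suc k)" using 1 by linarith
      thus ?thesis using R by (simp add: zero_less_mult_iff)
    qed
    show ?thesis
    proof (rule mx_less[OF parts(3) mpos])
      fix \<xi> assume \<xi>: "\<xi> \<in> outer"
      have "R * (R2 * cmod (h \<xi> g (Suc k))) \<le> R * (cmod \<xi> * cmod (h \<xi> g (Suc k)))"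
        using R2(2)[OF \<xi>] R by (intro mult_left_mono mult_right_mono) auto
      also have "\<dots> \<le> R * ((1 + \<epsilon>) * mx Z g k)" using up'[OF k, of \<xi> g] \<xi> parts(6) R by (intro mult_left_mono) auto
      also have "\<dots> < R2 * ((1 - \<epsilon>) * mx Z g k)"
        using mult_strict_right_mono[OF \<epsilon>(4) pos] by (simp add: mult.assoc)
      also have "\<dots> \<le> R2 * (R * mx middle g (Suc k))" using 1 R R2 by (intro mult_left_mono) auto
      finally have "R * R2 * cmod (h \<xi> g (Suc k)) < R * R2 * mx middle g (Suc k)" by (simp add: mult_ac)
      moreover have "0 < R * R2" using R R2 by simp
      ultimately show "cmod (h \<xi> g (Suc k)) < mx middle g (Suc k)" by (simp add: mult_less_cancel_left_pos)
    qed
  qed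
  have persist_iter: "mx outer g k' \<le> mx middle g k'"
    if g: "\<exists>j<D. g j \<noteq> 0" and k: "k1 \<le> k" "k \<le> k'" and good: "mx outer g k \<le> mx middle g k" for g k k'
    using k(2) by (induction k' rule: dec_induct) (use good persist[OF g] k in \<open>auto intro: less_imp_le\<close>)
  \<comment> \<open>Permanent dominance of the outer components would make the solution decay at
    least like \<open>((1 + \<epsilon>) / R2) ^ k\<close>, hence stay bounded at a radius beyond
    \<open>R\<close>.\<close>
  have ev_good: "\<exists>k\<ge>k1. mx outer g k \<le> mx middle g k" if g: "\<exists>j<D. g j \<noteq> 0" for g
  proof (rule ccontr)
    assume "\<not> ?thesis"
    hence eq: "mx Z g k = mx outer g k" if "k1 \<le> k" for k using dom[OF g that] that by fastforce
    have st: "R2 * mx Z g (Suc k) \<le> (1 + \<epsilon>) * mx Z g k" if k: "k1 \<le> k" for k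
    proof (cases "mx outer g (Suc k) = 0")
      case True
      thus ?thesis using eq[of "Suc k"] k \<epsilon> Z_nonneg[of g k] by simp
    next
      case False
      hence "0 < mx outer g (Suc k)" using mx_nonneg[OF parts(3), of g "Suc k"] by simp
      then obtain \<xi> where \<xi>: "\<xi> \<in> outer" "cmod (h \<xi> g (Suc k)) = mx outer g (Suc k)"
        by (rule mx_attained[OF parts(3)])
      have "R2 * mx outer g (Suc k) \<le> cmod \<xi> * cmod (h \<xi> g (Suc k))"
        unfolding \<xi>(2) using R2(2)[OF \<xi>(1)] mx_nonneg[OF parts(3)] by (intro mult_right_mono) auto
      also have "\<dots> \<le> (1 + \<epsilon>) * mx Z g k" using up'[OF k, of \<xi> g] \<xi> parts(6) by auto
      finally show ?thesis using eq[of "Suc k"] k by simp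
    qed
    define \<rho> where "\<rho> = R2 / (1 + \<epsilon>)"
    have \<rho>: "R < \<rho>"
    proof -
      have "R2 * (1 - \<epsilon>) \<le> R2 * 1" using R R2 \<epsilon> by (intro mult_left_mono) auto
      thus ?thesis using \<epsilon> by (simp add: \<rho>_def field_simps)
    qed
    have "mx Z g (k1 + i) * \<rho> ^ (k1 + i) \<le> mx Z g k1 * \<rho> ^ k1" for i
    proof (induction i)
      case (Suc i)
      have "mx Z g (Suc (k1 + i)) * \<rho> \<le> mx Z g (k1 + i)"
        using st[of "k1 + i"] \<epsilon> by (simp add: \<rho>_def field_simps)
      hence "mx Z g (Suc (k1 + i)) * \<rho> * \<rho> ^ (k1 + i) \<le> mx Z g (k1 + i) * \<rho> ^ (k1 + i)"
        using \<rho> R by (intro mult_right_mono) auto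
      thus ?case using Suc by (simp add: mult_ac)
    qed simp
    hence "mx Z g k * \<rho> ^ k \<le> mx Z g k1 * \<rho> ^ k1" if "k1 \<le> k" for k
      using that by (metis le_add_diff_inverse)
    from not_eventually_bounded[OF g \<rho> this] show False .
  qed
  have h_scale: "h \<zeta> (\<lambda>j. c * g j) k = c * h \<zeta> g k" for \<zeta> c g k
    by (simp add: h_def sum_distrib_left mult.assoc)
  \<comment> \<open>Uniformity in \<open>g\<close>: otherwise there are normalised
    \<open>f n\<close> that are bad at time \<open>k1 + n\<close>, and at all earlier times from
    \<open>k1\<close> on, because goodness persists. A limit \<open>l\<close> of them is strictly
    good at some time, and strict inequality at a fixed time holds for nearby \<open>f n\<close> as
    well.\<close>
  have "\<exists>k2\<ge>k1. \<forall>g. (\<exists>j<D. g j \<noteq> 0) \<longrightarrow> mx outer g k2 \<le> mx middle g k2"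
  proof (rule ccontr)
    assume "\<not> ?thesis"
    hence "\<forall>n. \<exists>g. (\<exists>j<D. g j \<noteq> 0) \<and> mx middle g (k1 + n) < mx outer g (k1 + n)"
      by (metis le_add1 not_less)
    from choice[OF this] obtain g where g: "\<And>n. \<exists>j<D. g n j \<noteq> 0" "\<And>n. mx middle (g n) (k1 + n) < mx outer (g n) (k1 + n)" by auto
    define N where "N = (\<lambda>n. \<Sum>j<D. cmod (g n j))"
    have N: "0 < N n" for n
    proof -
      obtain j where j: "j < D" "g n j \<noteq> 0" using g by blast
      have "0 < cmod (g n j)" using j by simp
      also have "\<dots> \<le> N n" unfolding N_def by (rule member_le_sum) (use j in auto)
      finally show ?thesis .
    qed
    define f where "f = (\<lambda>n j. of_real (1 / N n) * g n j)"
    have f_nz: "\<exists>j<D. f n j \<noteq> 0" for n using g(1)[of n] N[of n] by (auto simp: f_def)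
    have f_sum: "(\<Sum>j<D. cmod (f n j)) = 1" for n
      using N[of n] by (simp add: f_def norm_mult norm_divide sum_divide_distrib[symmetric]) (simp add: N_def)
    have f1: "cmod (f n j) \<le> 1" if "j < D" for n j
      using member_le_sum[of j "{..<D}" "\<lambda>j. cmod (f n j)"] that f_sum[of n] by simp
    have mxf: "mx B (f n) k = 1 / N n * mx B (g n) k" if "finite B" for B n k
    proof -
      have eq: "(\<lambda>\<zeta>. cmod (h \<zeta> (f n) k)) ` B = (\<lambda>x. 1 / N n * x) ` ((\<lambda>\<zeta>. cmod (h \<zeta> (g n) k)) ` B)"
        unfolding image_image f_def h_scale using N[of n] by (simp add: norm_mult norm_divide)
      have "mono (\<lambda>x. 1 / N n * x)" using N[of n] by (auto simp: mono_def divide_right_mono)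
      from mono_Max_commute[OF this, of "insert 0 ((\<lambda>\<zeta>. cmod (h \<zeta> (g n) k)) ` B)"] that
      show ?thesis unfolding mx_def eq by simp
    qed
    have f_bad: "mx middle (f n) (k1 + n) < mx outer (f n) (k1 + n)" for n
      unfolding mxf[OF parts(2)] mxf[OF parts(3)] using g(2)[of n] N[of n] by (intro mult_strict_left_mono) auto
    have f_bad': "mx middle (f n) (k1 + i) < mx outer (f n) (k1 + i)" if "i \<le> n" for n i
      using persist_iter[OF f_nz, of "k1 + i" "k1 + n" n] f_bad[of n] that by force
    obtain \<sigma> l where \<sigma>: "strict_mono (\<sigma> :: nat \<Rightarrow> nat)" "\<forall>j<D. (\<lambda>n. f (\<sigma> n) j) \<longlonglongrightarrow> l j"
      using coordinatewise_subseq[of D f] f1 by blast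
    have "(\<lambda>n. \<Sum>j<D. cmod (f (\<sigma> n) j)) \<longlonglongrightarrow> (\<Sum>j<D. cmod (l j))"
      by (intro tendsto_sum tendsto_norm) (use \<sigma> in auto)
    hence "(\<Sum>j<D. cmod (l j)) = 1" unfolding f_sum by (simp add: LIMSEQ_const_iff)
    hence l: "\<exists>j<D. l j \<noteq> 0" by (metis lessThan_iff norm_zero sum.neutral zero_neq_one)
    obtain k where k: "k1 \<le> k" "mx outer l k \<le> mx middle l k" using ev_good[OF l] by blast
    have strict: "mx outer l (Suc k) < mx middle l (Suc k)" by (rule persist[OF l k])
    have pos: "0 < mx middle l (Suc k)" using strict mx_nonneg[OF parts(3), of l "Suc k"] by linarith
    obtain \<zeta>0 where \<zeta>0: "\<zeta>0 \<in> middle" "cmod (h \<zeta>0 l (Suc k)) = mx middle l (Suc k)"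
      using mx_attained[OF parts(2) pos] by blast
    have lim: "(\<lambda>n. cmod (h \<zeta> (f (\<sigma> n)) (Suc k))) \<longlonglongrightarrow> cmod (h \<zeta> l (Suc k))" for \<zeta>
      unfolding h_def by (intro tendsto_norm tendsto_sum tendsto_mult tendsto_const) (use \<sigma> in auto)
    define x where "x = (mx outer l (Suc k) + mx middle l (Suc k)) / 2"
    have x: "mx outer l (Suc k) < x" "x < mx middle l (Suc k)" "0 < x"
      using strict mx_nonneg[OF parts(3), of l "Suc k"] by (auto simp: x_def)
    have "\<forall>\<^sub>F n in sequentially. x < cmod (h \<zeta>0 (f (\<sigma> n)) (Suc k))"
      by (rule order_tendstoD(1)[OF lim]) (use x \<zeta>0 in simp)
    moreover have "\<forall>\<^sub>F n in sequentially. \<forall>\<zeta>\<in>outer. cmod (h \<zeta> (f (\<sigma> n)) (Suc k)) < x"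
    proof (intro eventually_ball_finite parts ballI)
      fix \<zeta> assume "\<zeta> \<in> outer"
      hence "cmod (h \<zeta> l (Suc k)) < x" using mx_ge[OF parts(3), of \<zeta> l "Suc k"] x by linarith
      thus "\<forall>\<^sub>F n in sequentially. cmod (h \<zeta> (f (\<sigma> n)) (Suc k)) < x" by (rule order_tendstoD(2)[OF lim])
    qed
    moreover have "\<forall>\<^sub>F n in sequentially. Suc k \<le> n" by (rule eventually_ge_at_top)
    ultimately have "\<forall>\<^sub>F n in sequentially. False"
    proof eventually_elim
      case (elim n)
      have "mx outer (f (\<sigma> n)) (Suc k) < x" by (rule mx_less[OF parts(3) x(3)]) (use elim in auto)
      also have "x < mx middle (f (\<sigma> n)) (Suc k)" using elim(1) mx_ge[OF parts(2) \<zeta>0(1), of "f (\<sigma> n)" "Suc k"] by linarith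
      finally have "mx outer (f (\<sigma> n)) (Suc k) < mx middle (f (\<sigma> n)) (Suc k)" .
      moreover have "Suc k - k1 \<le> \<sigma> n" using elim(3) seq_suble[OF \<sigma>(1), of n] by linarith
      ultimately show False using f_bad'[of "Suc k - k1" "\<sigma> n"] k(1) by simp
    qed
    thus False by simp
  qed
  then obtain k2 where k2: "k1 \<le> k2" "\<And>g. \<exists>j<D. g j \<noteq> 0 \<Longrightarrow> mx outer g k2 \<le> mx middle g k2" by blast
  show ?thesis
  proof (intro exI[of _ k2] allI impI)
    fix k g assume k: "k2 \<le> k"
    show "mx Z g k = mx middle g k \<and> ((\<exists>j<D. g j \<noteq> 0) \<longrightarrow> 0 < mx middle g k)"
    proof (cases "\<exists>j<D. g j \<noteq> 0")
      case True
      have "mx outer g k \<le> mx middle g k" using persist_iter[OF True k2(1) k k2(2)[OF True]] .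
      hence "mx Z g k = mx middle g k" using dom[OF True, of k] k k2 by simp
      thus ?thesis using inner_less[OF True, of k] mx_nonneg[OF parts(1), of g k] k k2 by auto
    next
      case False
      hence "h \<zeta> g k = 0" for \<zeta> by (auto simp: h_def)
      hence "mx B g k = 0" if "finite B" for B using mx_le[OF that, of 0 g k] mx_nonneg[OF that, of g k] by simp
      thus ?thesis using False finite_Z parts by simp
    qed
  qed
qed

end

text \<open>Rescaling by \<open>R\<close> moves \<open>middle\<close> to the unit circle. Errors
  measured against all of \<open>Z\<close> become errors relative to the circle components because
  these eventually dominate; their strict positivity gives nondegeneracy at each late time by
  compactness of the unit sphere.\<close>

lemma (in dominated_family) circle_count:
  assumes D: "0 < D" and A: "A \<subseteq> middle"
    and conv: "\<And>b j. b \<in> middle - A \<Longrightarrow> j < D \<Longrightarrow> ereal R \<le> fps_conv_radius (Abs_fps (\<eta> b j))"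
    and reg: "\<And>b j. b \<in> middle - A \<Longrightarrow> j < D \<Longrightarrow> \<exists>\<rho>>0. \<exists>H. H holomorphic_on ball b \<rho> \<and>
        (\<forall>z\<in>ball b \<rho>. norm z < R \<longrightarrow> H z = eval_fps (Abs_fps (\<eta> b j)) z)"
  shows "D \<le> card A"
proof -
  obtain k2 where k2: "\<And>k g. k2 \<le> k \<Longrightarrow> mx Z g k = mx middle g k"
    "\<And>k g. k2 \<le> k \<Longrightarrow> \<exists>j<D. g j \<noteq> 0 \<Longrightarrow> 0 < mx middle g k" using middle_dominates by blast
  define sc where "sc = (\<lambda>\<zeta>::complex. \<zeta> / of_real R)"
  define C where "C = sc ` middle"
  define y where "y = (\<lambda>\<zeta> j k. of_real R ^ k * \<eta> (of_real R * \<zeta>) j k)"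
  have inv: "of_real R * sc \<zeta> = \<zeta>" for \<zeta> using R by (simp add: sc_def)
  have inj: "inj sc" using R by (auto simp: inj_on_def sc_def)
  interpret CF: component_family C D y
    by unfold_locales (use parts R in \<open>auto simp: C_def sc_def middle_def norm_divide\<close>)
  have Y: "CF.Y \<zeta> g k = of_real R ^ k * h (of_real R * \<zeta>) g k" for \<zeta> g k
    unfolding CF.Y_def h_def by (simp add: y_def sum_distrib_left mult_ac)
  have finC: "finite C" using parts by (simp add: C_def)
  have size_ge: "R ^ k * mx middle g k \<le> CF.size_at g k" for g k
  proof (cases "0 < mx middle g k")
    case True
    then obtain \<zeta> where \<zeta>: "\<zeta> \<in> middle" "cmod (h \<zeta> g k) = mx middle g k" by (rule mx_attained[OF parts(2)])
    have "cmod (CF.Y (sc \<zeta>) g k) \<le> CF.size_at g k"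
      unfolding CF.size_at_def by (rule member_le_L2_set[OF finC]) (use \<zeta> in \<open>auto simp: C_def\<close>)
    thus ?thesis using R by (simp add: Y inv norm_mult norm_power \<zeta>)
  next
    case False
    hence "mx middle g k = 0" using mx_nonneg[OF parts(2), of g k] by linarith
    thus ?thesis by (simp add: CF.size_at_nonneg)
  qed
  have slow: "\<exists>k1. CF.slow e k1" if e: "0 < e" for e
  proof -
    define \<epsilon> where "\<epsilon> = e * R / (real (card C) + 1)"
    have \<epsilon>: "0 < \<epsilon>" using e R by (simp add: \<epsilon>_def)
    obtain k1 where k1: "\<forall>k\<ge>k1. \<forall>g. \<forall>\<zeta>\<in>Z. cmod (h \<zeta> g k - \<zeta> * h \<zeta> g (Suc k)) \<le> \<epsilon> * mx Z g (Suc k)"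
      using almost_eigen[OF \<epsilon>] by blast
    have "CF.slow e (max k1 k2)"
      unfolding CF.slow_def
    proof (intro allI impI)
      fix k g assume k: "max k1 k2 \<le> k"
      have one: "cmod (CF.Y \<zeta>' g k - \<zeta>' * CF.Y \<zeta>' g (Suc k)) \<le> \<epsilon> / R * CF.size_at g (Suc k)" if \<zeta>': "\<zeta>' \<in> C" for \<zeta>'
      proof -
        obtain \<zeta> where \<zeta>: "\<zeta> \<in> middle" "\<zeta>' = sc \<zeta>" using \<zeta>' by (auto simp: C_def)
        have "CF.Y \<zeta>' g k - \<zeta>' * CF.Y \<zeta>' g (Suc k) = of_real R ^ k * (h \<zeta> g k - \<zeta> * h \<zeta> g (Suc k))"
          unfolding Y \<zeta>(2) inv using R by (simp add: sc_def algebra_simps)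
        hence "cmod (CF.Y \<zeta>' g k - \<zeta>' * CF.Y \<zeta>' g (Suc k)) = R ^ k * cmod (h \<zeta> g k - \<zeta> * h \<zeta> g (Suc k))"
          using R by (simp add: norm_mult norm_power)
        also have "\<dots> \<le> R ^ k * (\<epsilon> * mx Z g (Suc k))"
          using k1 k \<zeta>(1) parts(5) R by (intro mult_left_mono) auto
        also have "mx Z g (Suc k) = mx middle g (Suc k)" using k by (intro k2) auto
        also have "R ^ k * (\<epsilon> * mx middle g (Suc k)) = \<epsilon> / R * (R ^ Suc k * mx middle g (Suc k))" using R by simp
        also have "\<dots> \<le> \<epsilon> / R * CF.size_at g (Suc k)" using \<epsilon> R by (intro mult_left_mono size_ge) auto
        finally show ?thesis .
      qed
      have "L2_set (\<lambda>\<zeta>. cmod (CF.Y \<zeta> g k - \<zeta> * CF.Y \<zeta> g (Suc k))) C \<le> (\<Sum>\<zeta>\<in>C. cmod (CF.Y \<zeta> g k - \<zeta> * CF.Y \<zeta> g (Suc k)))"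
        by (rule L2_set_le_sum) simp
      also have "\<dots> \<le> (\<Sum>\<zeta>\<in>C. \<epsilon> / R * CF.size_at g (Suc k))" by (rule sum_mono) (rule one)
      also have "\<dots> = real (card C) * (\<epsilon> / R) * CF.size_at g (Suc k)" by simp
      also have "\<dots> \<le> e * CF.size_at g (Suc k)"
      proof (intro mult_right_mono CF.size_at_nonneg)
        have eq: "\<epsilon> / R = e / (real (card C) + 1)" using R by (simp add: \<epsilon>_def)
        show "real (card C) * (\<epsilon> / R) \<le> e" unfolding eq using e by (simp add: field_simps)
      qed
      finally show "L2_set (\<lambda>\<zeta>. cmod (CF.Y \<zeta> g k - \<zeta> * CF.Y \<zeta> g (Suc k))) C \<le> e * CF.size_at g (Suc k)" .
    qed
    thus ?thesis by blast
  qed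
  have size_scale: "CF.size_at (\<lambda>j. c * g j) k = cmod c * CF.size_at g k" for c g k
  proof -
    have "CF.Y \<zeta> (\<lambda>j. c * g j) k = c * CF.Y \<zeta> g k" for \<zeta> by (simp add: CF.Y_def sum_distrib_left mult.assoc)
    thus ?thesis unfolding CF.size_at_def by (simp only: L2_set_norm_scale)
  qed
  have nondeg: "\<exists>m>0. \<forall>g. m * L2_set (\<lambda>j. cmod (g j)) {..<D} \<le> CF.size_at g k" if k: "k2 \<le> k" for k
  proof (rule ccontr)
    assume "\<not> ?thesis"
    hence no: "\<And>m. 0 < m \<Longrightarrow> \<exists>g. CF.size_at g k < m * L2_set (\<lambda>j. cmod (g j)) {..<D}" by (meson not_less)
    have "\<forall>n. \<exists>g. CF.size_at g k < inverse (real (Suc n)) * L2_set (\<lambda>j. cmod (g j)) {..<D}"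
      using no by simp
    from choice[OF this] obtain g where g: "\<And>n. CF.size_at (g n) k < inverse (real (Suc n)) * L2_set (\<lambda>j. cmod (g n j)) {..<D}"
      by auto
    define N where "N = (\<lambda>n. L2_set (\<lambda>j. cmod (g n j)) {..<D})"
    have N: "0 < N n" for n
    proof -
      have "0 < inverse (real (Suc n)) * N n" using g[of n] CF.size_at_nonneg[of "g n" k] by (simp add: N_def)
      thus ?thesis by (simp add: zero_less_mult_iff)
    qed
    define f where "f = (\<lambda>n j. of_real (1 / N n) * g n j)"
    have fN: "L2_set (\<lambda>j. cmod (f n j)) {..<D} = 1" for n
      unfolding f_def L2_set_norm_scale using N[of n] by (simp add: norm_divide) (simp add: N_def)
    have f1: "cmod (f n j) \<le> 1" if "j < D" for n j
      using member_le_L2_set[of "{..<D}" j "\<lambda>j. cmod (f n j)"] that fN[of n] by simp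
    have fs: "CF.size_at (f n) k < inverse (real (Suc n))" for n
    proof -
      have "CF.size_at (g n) k < inverse (real (Suc n)) * N n" using g[of n] by (simp only: N_def)
      thus ?thesis using N[of n] unfolding f_def size_scale by (simp add: norm_divide field_simps)
    qed
    obtain \<sigma> l where \<sigma>: "strict_mono (\<sigma> :: nat \<Rightarrow> nat)" "\<forall>j<D. (\<lambda>n. f (\<sigma> n) j) \<longlonglongrightarrow> l j"
      using coordinatewise_subseq[of D f] f1 by blast
    have "(\<lambda>n. L2_set (\<lambda>j. cmod (f (\<sigma> n) j)) {..<D}) \<longlonglongrightarrow> L2_set (\<lambda>j. cmod (l j)) {..<D}"
      unfolding L2_set_def by (intro tendsto_real_sqrt tendsto_sum tendsto_power tendsto_norm) (use \<sigma> in auto)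
    hence l1: "L2_set (\<lambda>j. cmod (l j)) {..<D} = 1" unfolding fN by (simp add: LIMSEQ_const_iff)
    have l: "\<exists>j<D. l j \<noteq> 0"
    proof (rule ccontr)
      assume "\<not> ?thesis"
      hence "L2_set (\<lambda>j. cmod (l j)) {..<D} = 0" by (simp add: L2_set_def)
      thus False using l1 by simp
    qed
    have lim: "(\<lambda>n. CF.size_at (f (\<sigma> n)) k) \<longlonglongrightarrow> CF.size_at l k"
      unfolding CF.size_at_def CF.Y_def L2_set_def
      by (intro tendsto_real_sqrt tendsto_sum tendsto_power tendsto_norm tendsto_mult tendsto_const) (use \<sigma> in auto)
    have "(\<lambda>n. inverse (real (Suc (\<sigma> n)))) \<longlonglongrightarrow> 0"
      using LIMSEQ_subseq_LIMSEQ[OF LIMSEQ_inverse_real_of_nat \<sigma>(1)] by (simp add: o_def)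
    hence "CF.size_at l k \<le> 0"
      by (rule LIMSEQ_le[OF lim]) (use fs in \<open>auto intro: less_imp_le\<close>)
    moreover have "0 < R ^ k * mx middle l k" using k2(2)[OF k l] R by simp
    ultimately show False using size_ge[of k l] by linarith
  qed
  have eval_y: "eval_fps (Abs_fps (y (sc b) j)) z = eval_fps (Abs_fps (\<eta> b j)) (of_real R * z)" for b j z
    by (simp add: eval_fps_def y_def inv power_mult_distrib mult_ac)
  have "D \<le> card (sc ` A)"
  proof (rule CF.component_count[OF D])
    show "sc ` A \<subseteq> C" using A by (auto simp: C_def)
    show "\<And>e. 0 < e \<Longrightarrow> \<exists>k1. CF.slow e k1" by (rule slow)
    show "\<exists>k0. \<forall>k\<ge>k0. \<exists>m>0. \<forall>g. m * L2_set (\<lambda>j. cmod (g j)) {..<D} \<le> CF.size_at g k" using nondeg by blast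
  next
    fix b' j assume b': "b' \<in> C - sc ` A" and j: "j < D"
    then obtain b where b: "b \<in> middle - A" "b' = sc b" by (auto simp: C_def)
    show "1 \<le> fps_conv_radius (Abs_fps (y b' j))"
      unfolding fps_conv_radius_def
    proof (rule conv_radius_geI_ex')
      fix r :: real assume r: "0 < r" "ereal r < 1"
      have "ereal (norm (of_real (R * r) :: complex)) < ereal R" using r R by (simp add: norm_mult)
      also have "\<dots> \<le> conv_radius (\<eta> b j)" using conv[OF b(1) j] by (simp add: fps_conv_radius_def)
      finally have "summable (\<lambda>n. \<eta> b j n * of_real (R * r) ^ n)" by (rule summable_in_conv_radius)
      thus "summable (\<lambda>n. fps_nth (Abs_fps (y b' j)) n * of_real r ^ n)"
        by (simp add: y_def b inv power_mult_distrib mult_ac)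
    qed
    obtain \<rho> H where H: "0 < \<rho>" "H holomorphic_on ball b \<rho>" "\<forall>z\<in>ball b \<rho>. norm z < R \<longrightarrow> H z = eval_fps (Abs_fps (\<eta> b j)) z"
      using reg[OF b(1) j] by blast
    have im: "of_real R * z \<in> ball b \<rho>" if "z \<in> ball b' (\<rho> / R)" for z
    proof -
      have "b - of_real R * z = of_real R * (b' - z)" by (simp add: b algebra_simps inv)
      hence "dist b (of_real R * z) = R * dist b' z" using R by (simp add: dist_norm norm_mult)
      thus ?thesis using that R by (simp add: field_simps)
    qed
    show "\<exists>\<rho>>0. \<exists>H. H holomorphic_on ball b' \<rho> \<and> (\<forall>z\<in>ball b' \<rho>. norm z < 1 \<longrightarrow> H z = eval_fps (Abs_fps (y b' j)) z)"
    proof (intro exI[of _ "\<rho> / R"] conjI exI[of _ "\<lambda>z. H (of_real R * z)"] ballI impI)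
      show "0 < \<rho> / R" using H R by simp
      have "H \<circ> (\<lambda>z. of_real R * z) holomorphic_on ball b' (\<rho> / R)"
        by (rule holomorphic_on_compose_gen[OF _ H(2)]) (use im in \<open>auto intro!: holomorphic_intros\<close>)
      thus "(\<lambda>z. H (of_real R * z)) holomorphic_on ball b' (\<rho> / R)" by (simp add: o_def)
      fix z assume z: "z \<in> ball b' (\<rho> / R)" "norm z < 1"
      have "norm (of_real R * z) < R" using z R by (simp add: norm_mult)
      thus "H (of_real R * z) = eval_fps (Abs_fps (y b' j)) z" using H im[OF z(1)] by (simp add: b eval_y)
    qed
  qed
  also have "card (sc ` A) = card A" by (rule card_image) (use inj in \<open>auto intro: inj_on_subset\<close>)
  finally show ?thesis .
qed


section \<open>Singular zeros on the boundary circle\<close>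

lemma fps_conv_radius_poly_mult: "fps_conv_radius F \<le> fps_conv_radius (fps_of_poly p * (F :: complex fps))"
  using fps_conv_radius_mult[of "fps_of_poly p" F] by simp

lemma eval_fps_poly_mult:
  "ereal (norm z) < fps_conv_radius F \<Longrightarrow> eval_fps (fps_of_poly p * F) z = poly p z * eval_fps (F :: complex fps) z"
  by (subst eval_fps_mult) auto

lemma fps_conv_radius_geI:
  fixes F :: "complex fps"
  assumes "0 < \<rho>" "\<And>k. norm (fps_nth F k) * \<rho> ^ k \<le> B"
  shows "ereal \<rho> \<le> fps_conv_radius F"
  unfolding fps_conv_radius_def
proof (rule conv_radius_geI_ex')
  fix r :: real assume r: "0 < r" "ereal r < ereal \<rho>"
  show "summable (\<lambda>n. fps_nth F n * of_real r ^ n)"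
  proof (rule summable_comparison_test'[where g = "\<lambda>n. B * (r / \<rho>) ^ n" and N = 0])
    show "summable (\<lambda>n. B * (r / \<rho>) ^ n)"
      by (intro summable_mult summable_geometric) (use r assms in \<open>simp add: abs_less_iff\<close>)
    fix n
    have "norm (fps_nth F n * of_real r ^ n) = (norm (fps_nth F n) * \<rho> ^ n) * (r / \<rho>) ^ n"
      using r assms by (simp add: norm_mult norm_power power_divide)
    also have "\<dots> \<le> B * (r / \<rho>) ^ n" using r assms by (intro mult_right_mono) auto
    finally show "norm (fps_nth F n * of_real r ^ n) \<le> B * (r / \<rho>) ^ n" .
  qed
qed

lemma fps_coeffs_bounded:
  fixes F :: "complex fps"
  assumes "0 \<le> \<rho>" "ereal \<rho> < fps_conv_radius F"
  shows "\<exists>B. \<forall>k. norm (fps_nth F k) * \<rho> ^ k \<le> B"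
proof -
  have "summable (\<lambda>n. fps_nth F n * of_real \<rho> ^ n)"
    by (rule summable_in_conv_radius) (use assms in \<open>simp add: fps_conv_radius_def\<close>)
  hence "Bseq (\<lambda>n. fps_nth F n * of_real \<rho> ^ n)"
    by (intro convergent_imp_Bseq convergentI[OF summable_LIMSEQ_zero])
  then obtain B where "\<forall>n. norm (fps_nth F n * of_real \<rho> ^ n) \<le> B" by (auto simp: Bseq_def)
  thus ?thesis using assms by (intro exI[of _ B]) (simp add: norm_mult norm_power)
qed

lemma card_roots_rsquarefree:
  assumes "rsquarefree (Q :: complex poly)"
  shows "card {z. poly Q z = 0} = degree Q"
proof -
  have Q0: "Q \<noteq> 0" using assms by (simp add: rsquarefree_def)
  have "degree Q = degree (smult (lead_coeff Q) (\<Prod>z | poly Q z = 0. [:- z, 1:]))"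
    using complex_poly_decompose_rsquarefree[OF assms] by simp
  also have "\<dots> = (\<Sum>z | poly Q z = 0. degree [:- z, 1:])"
    using Q0 by (simp add: degree_prod_eq_sum_degree)
  finally show ?thesis by simp
qed

lemma lagrange_cofactors:
  fixes Q p :: "complex poly"
  assumes Q: "rsquarefree Q" and deg: "degree p < degree Q"
  defines "W \<equiv> \<lambda>z. Q div [:- z, 1:]"
  shows "p = (\<Sum>z | poly Q z = 0. smult (poly p z / poly (W z) z) (W z))"
    and "\<And>z. poly Q z = 0 \<Longrightarrow> Q = [:- z, 1:] * W z"
    and "\<And>z. poly Q z = 0 \<Longrightarrow> poly (W z) z \<noteq> 0"
proof -
  have Q0: "Q \<noteq> 0" using Q by (simp add: rsquarefree_def)
  let ?Z = "{z. poly Q z = 0}"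
  have fin: "finite ?Z" by (rule poly_roots_finite[OF Q0])
  show fac: "Q = [:- z, 1:] * W z" if "poly Q z = 0" for z
    using that unfolding W_def by (metis dvd_mult_div_cancel poly_eq_0_iff_dvd)
  show nz: "poly (W z) z \<noteq> 0" if z: "poly Q z = 0" for z
  proof
    assume "poly (W z) z = 0"
    moreover have "pderiv Q = [:- z, 1:] * pderiv (W z) + W z * pderiv [:- z, 1:]"
      by (subst fac[OF z]) (rule pderiv_mult)
    ultimately have "poly (pderiv Q) z = 0" by (simp add: pderiv_pCons)
    thus False using Q z by (auto simp: rsquarefree_roots)
  qed
  have other: "poly (W z) x = 0" if "poly Q z = 0" "poly Q x = 0" "x \<noteq> z" for x z
  proof -
    have "poly Q x = (x - z) * poly (W z) x" by (subst fac[OF that(1)]) (simp add: algebra_simps)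
    thus ?thesis using that by simp
  qed
  define T where "T = p - (\<Sum>z\<in>?Z. smult (poly p z / poly (W z) z) (W z))"
  have "degree (W z) < degree Q" if "z \<in> ?Z" for z
  proof -
    have "W z \<noteq> 0" using nz that by force
    hence "degree Q = Suc (degree (W z))" using fac[of z] that degree_mult_eq[of "[:- z, 1:]" "W z"] by simp
    thus ?thesis by simp
  qed
  hence "degree (\<Sum>z\<in>?Z. smult (poly p z / poly (W z) z) (W z)) < degree Q"
    using deg by (intro degree_sum_less) (auto intro: le_less_trans[OF degree_smult_le])
  hence degT: "degree T < degree Q" unfolding T_def using deg by (rule degree_diff_less[rotated])
  have "T = 0"
  proof (rule ccontr)
    assume T: "T \<noteq> 0"
    have "?Z \<subseteq> {z. poly T z = 0}"
    proof safe
      fix x assume x: "poly Q x = 0"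
      have "(\<Sum>z\<in>?Z. poly p z / poly (W z) z * poly (W z) x) = (\<Sum>z\<in>?Z. if z = x then poly p x else 0)"
        by (rule sum.cong) (use x other nz in auto)
      also have "\<dots> = poly p x" using fin x by simp
      finally show "poly T x = 0" by (simp add: T_def poly_sum)
    qed
    hence "card ?Z \<le> card {z. poly T z = 0}" by (rule card_mono[OF poly_roots_finite[OF T]])
    also have "\<dots> \<le> degree T" by (rule card_poly_roots_bound[OF T])
    finally show False using degT card_roots_rsquarefree[OF Q] by simp
  qed
  thus "p = (\<Sum>z\<in>?Z. smult (poly p z / poly (W z) z) (W z))" by (simp add: T_def)
qed

text \<open>As \<open>Q = (z - \<zeta>) * W \<zeta>\<close>, the defect of the eigenvalue relation
  is a coefficient of \<open>Q * v * G\<close>. The recurrence allows \<open>Q\<close> to be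
  replaced there by \<open>Q - q (Suc k)\<close>, which has smaller degree since both are monic.
  Lagrange interpolation then expresses the defect in the components, with coefficients that up to
  sign are \<open>poly (q (Suc k)) z / poly (W z) z\<close> and tend to 0.\<close>

lemma singular_zeros_count:
  fixes Q :: "complex poly" and q :: "nat \<Rightarrow> complex poly" and G :: "complex fps" and R :: real and s :: nat
  assumes Q: "rsquarefree Q" "lead_coeff Q = 1" "poly Q 0 \<noteq> 0" "0 < degree Q"
    and lim: "\<And>i. (\<lambda>n. coeff (q n) i) \<longlonglongrightarrow> coeff Q i"
    and monic: "\<forall>\<^sub>F n in sequentially. degree (q n) = degree Q \<and> lead_coeff (q n) = 1"
    and rec: "\<And>v. degree v \<le> s \<Longrightarrow> \<forall>n\<ge>n0. fps_nth (fps_of_poly (q n) * (fps_of_poly v * G)) n = 0"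
    and R: "0 < R" "ereal R \<le> fps_conv_radius G"
    and exact: "\<And>v. v \<noteq> 0 \<Longrightarrow> degree v \<le> s \<Longrightarrow> fps_conv_radius (fps_of_poly v * G) \<le> ereal R"
    and A: "A \<subseteq> {\<zeta>. poly Q \<zeta> = 0 \<and> cmod \<zeta> = R}"
    and reg: "\<And>\<zeta>. poly Q \<zeta> = 0 \<Longrightarrow> cmod \<zeta> = R \<Longrightarrow> \<zeta> \<notin> A \<Longrightarrow> \<exists>\<rho>>0. \<exists>H. H holomorphic_on ball \<zeta> \<rho> \<and>
        (\<forall>z\<in>ball \<zeta> \<rho>. norm z < R \<longrightarrow> H z = eval_fps G z)"
  shows "Suc s \<le> card A"
proof -
  define Z where "Z = {z. poly Q z = 0}"
  define W where "W = (\<lambda>z. Q div [:- z, 1:])"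
  have Q0: "Q \<noteq> 0" using Q by auto
  have finZ: "finite Z" unfolding Z_def by (rule poly_roots_finite[OF Q0])
  have lagrange: "p = (\<Sum>z\<in>Z. smult (poly p z / poly (W z) z) (W z))" if "degree p < degree Q" for p
    unfolding Z_def W_def by (rule lagrange_cofactors(1)[OF Q(1) that])
  have fac: "Q = [:- z, 1:] * W z" and Wnz: "poly (W z) z \<noteq> 0" if "z \<in> Z" for z
    using lagrange_cofactors(2,3)[OF Q(1), of 1] Q(4) that unfolding Z_def W_def by auto
  define \<eta> where "\<eta> = (\<lambda>\<zeta> j k. fps_nth (fps_of_poly (W \<zeta> * monom 1 j) * G) k)"
  define v where "v = (\<lambda>g :: nat \<Rightarrow> complex. \<Sum>j<Suc s. monom (g j) j)"
  have v_deg: "degree (v g) \<le> s" for g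
    unfolding v_def by (rule degree_sum_le) (auto intro: order_trans[OF degree_monom_le])
  have v_coeff: "coeff (v g) j = (if j < Suc s then g j else 0)" for g j
    by (simp add: v_def coeff_sum)
  have v_nz: "v g \<noteq> 0" if "\<exists>j<Suc s. g j \<noteq> 0" for g
    using that v_coeff[of g] by (metis coeff_0)
  have h_eq: "(\<Sum>j<Suc s. g j * \<eta> \<zeta> j k) = fps_nth (fps_of_poly (W \<zeta>) * (fps_of_poly (v g) * G)) k" for g \<zeta> k
  proof -
    have "fps_of_poly (W \<zeta>) * (fps_of_poly (v g) * G) = (\<Sum>j<Suc s. fps_const (g j) * (fps_of_poly (W \<zeta> * monom 1 j) * G))"
      unfolding v_def fps_of_poly_sum sum_distrib_right sum_distrib_left
      by (rule sum.cong) (simp_all add: fps_of_poly_mult fps_of_poly_monom mult_ac)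
    thus ?thesis by (simp only: fps_sum_nth fps_mult_left_const_nth \<eta>_def)
  qed
  have expand: "fps_nth (fps_of_poly p * F) k = (\<Sum>z\<in>Z. poly p z / poly (W z) z * fps_nth (fps_of_poly (W z) * F) k)"
    if "degree p < degree Q" for p F k
  proof -
    have "fps_of_poly p * F = (\<Sum>z\<in>Z. fps_const (poly p z / poly (W z) z) * (fps_of_poly (W z) * F))"
      by (subst lagrange[OF that]) (simp add: fps_of_poly_sum fps_of_poly_smult sum_distrib_right mult.assoc)
    thus ?thesis by (simp only: fps_sum_nth fps_mult_left_const_nth)
  qed
  interpret DF: dominated_family Z "Suc s" \<eta> R
  proof
    show "finite Z" "0 \<notin> Z" "0 < R" using finZ Q R by (auto simp: Z_def)
  next
    fix \<epsilon> :: real assume \<epsilon>: "0 < \<epsilon>"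
    have lim0: "(\<lambda>n. poly (q n) z / poly (W z) z) \<longlonglongrightarrow> 0" if z: "z \<in> Z" for z
    proof -
      have "\<forall>\<^sub>F n in sequentially. poly (q n) z = (\<Sum>i\<le>degree Q. coeff (q n) i * z ^ i)"
        using monic by eventually_elim (auto simp: poly_altdef)
      moreover have "(\<lambda>n. \<Sum>i\<le>degree Q. coeff (q n) i * z ^ i) \<longlonglongrightarrow> (\<Sum>i\<le>degree Q. coeff Q i * z ^ i)"
        by (intro tendsto_intros lim)
      ultimately have "(\<lambda>n. poly (q n) z) \<longlonglongrightarrow> poly Q z"
        unfolding poly_altdef[of Q] by (simp add: tendsto_cong)
      from tendsto_divide[OF this tendsto_const Wnz[OF z]] show ?thesis using z by (simp add: Z_def)
    qed
    have "\<forall>\<^sub>F n in sequentially. \<forall>z\<in>Z. cmod (poly (q n) z / poly (W z) z) < \<epsilon>"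
    proof (intro eventually_ball_finite finZ ballI)
      fix z assume "z \<in> Z"
      from tendsto_norm[OF lim0[OF this]] show "\<forall>\<^sub>F n in sequentially. cmod (poly (q n) z / poly (W z) z) < \<epsilon>"
        by (intro order_tendstoD(2)) (use \<epsilon> in auto)
    qed
    then obtain N where N: "\<And>n. N \<le> n \<Longrightarrow> degree (q n) = degree Q \<and> lead_coeff (q n) = 1 \<and> (\<forall>z\<in>Z. cmod (poly (q n) z / poly (W z) z) < \<epsilon>)"
      using eventually_conj[OF monic] unfolding eventually_sequentially by (metis (no_types, lifting))
    show "\<exists>k1. \<forall>k\<ge>k1. \<forall>g. \<forall>\<zeta>\<in>Z.
      cmod ((\<Sum>j<Suc s. g j * \<eta> \<zeta> j k) - \<zeta> * (\<Sum>j<Suc s. g j * \<eta> \<zeta> j (Suc k)))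
        \<le> \<epsilon> * (\<Sum>\<zeta>'\<in>Z. cmod (\<Sum>j<Suc s. g j * \<eta> \<zeta>' j (Suc k)))"
    proof (intro exI[of _ "max N n0"] allI impI ballI)
      fix k g \<zeta> assume k: "max N n0 \<le> k" and \<zeta>: "\<zeta> \<in> Z"
      define F where "F = fps_of_poly (v g) * G"
      let ?q = "q (Suc k)"
      have Nk: "degree ?q = degree Q" "lead_coeff ?q = 1" "\<And>z. z \<in> Z \<Longrightarrow> cmod (poly ?q z / poly (W z) z) < \<epsilon>"
        using N[of "Suc k"] k by auto
      have dq: "degree (Q - ?q) < degree Q"
      proof (rule ccontr)
        assume "\<not> ?thesis"
        moreover have "degree (Q - ?q) \<le> degree Q" by (rule degree_diff_le) (use Nk in auto)
        ultimately have "degree (Q - ?q) = degree Q" by simp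
        hence "lead_coeff (Q - ?q) = 0" using Nk Q by simp
        hence "Q - ?q = 0" by (simp only: leading_coeff_0_iff)
        hence "degree (Q - ?q) = 0" by (simp only: degree_0)
        thus False using \<open>degree (Q - ?q) = degree Q\<close> Q(4) by simp
      qed
      have "fps_nth (fps_of_poly (W \<zeta>) * F) k - \<zeta> * fps_nth (fps_of_poly (W \<zeta>) * F) (Suc k) = fps_nth (fps_of_poly Q * F) (Suc k)"
      proof -
        have "fps_of_poly Q * F = fps_X * (fps_of_poly (W \<zeta>) * F) - fps_const \<zeta> * (fps_of_poly (W \<zeta>) * F)"
        proof -
          have fq: "fps_of_poly Q = fps_of_poly [:- \<zeta>, 1:] * fps_of_poly (W \<zeta>)"
            by (subst fac[OF \<zeta>]) (rule fps_of_poly_mult)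
          show ?thesis unfolding fq fps_of_poly_linear by (simp add: algebra_simps flip: fps_const_neg)
        qed
        thus ?thesis by (simp add: fps_mult_fps_X_commute)
      qed
      also have "\<dots> = fps_nth (fps_of_poly (Q - ?q) * F) (Suc k)"
        using rec[OF v_deg[of g]] k by (simp add: fps_of_poly_diff left_diff_distrib F_def)
      also have "\<dots> = (\<Sum>z\<in>Z. poly (Q - ?q) z / poly (W z) z * fps_nth (fps_of_poly (W z) * F) (Suc k))"
        by (rule expand[OF dq])
      also have "cmod \<dots> \<le> (\<Sum>z\<in>Z. \<epsilon> * cmod (fps_nth (fps_of_poly (W z) * F) (Suc k)))"
      proof (rule sum_norm_le)
        fix z assume z: "z \<in> Z"
        have "cmod (poly (Q - ?q) z / poly (W z) z) \<le> \<epsilon>" using Nk(3)[OF z] z by (simp add: Z_def norm_divide)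
        thus "cmod (poly (Q - ?q) z / poly (W z) z * fps_nth (fps_of_poly (W z) * F) (Suc k)) \<le> \<epsilon> * cmod (fps_nth (fps_of_poly (W z) * F) (Suc k))"
          unfolding norm_mult by (rule mult_right_mono) simp
      qed
      finally show "cmod ((\<Sum>j<Suc s. g j * \<eta> \<zeta> j k) - \<zeta> * (\<Sum>j<Suc s. g j * \<eta> \<zeta> j (Suc k)))
        \<le> \<epsilon> * (\<Sum>\<zeta>'\<in>Z. cmod (\<Sum>j<Suc s. g j * \<eta> \<zeta>' j (Suc k)))"
        unfolding h_eq F_def sum_distrib_left .
    qed
  next
    fix g :: "nat \<Rightarrow> complex" and \<rho> :: real assume \<rho>: "0 < \<rho>" "\<rho> < R"
    have "\<forall>\<zeta>\<in>Z. \<exists>B. \<forall>k. cmod (\<Sum>j<Suc s. g j * \<eta> \<zeta> j k) * \<rho> ^ k \<le> B"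
    proof
      fix \<zeta>
      have "ereal \<rho> < ereal R" using \<rho> by simp
      also have "\<dots> \<le> fps_conv_radius (fps_of_poly (W \<zeta>) * (fps_of_poly (v g) * G))"
        by (rule order_trans[OF R(2) order_trans[OF fps_conv_radius_poly_mult fps_conv_radius_poly_mult]])
      finally show "\<exists>B. \<forall>k. cmod (\<Sum>j<Suc s. g j * \<eta> \<zeta> j k) * \<rho> ^ k \<le> B"
        unfolding h_eq using \<rho> by (intro fps_coeffs_bounded) auto
    qed
    from bchoice[OF this] obtain B where B: "\<forall>\<zeta>\<in>Z. \<forall>k. cmod (\<Sum>j<Suc s. g j * \<eta> \<zeta> j k) * \<rho> ^ k \<le> B \<zeta>" by (elim exE)
    show "\<exists>B. \<forall>k. \<forall>\<zeta>\<in>Z. cmod (\<Sum>j<Suc s. g j * \<eta> \<zeta> j k) * \<rho> ^ k \<le> B"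
    proof (intro exI[of _ "Max (B ` Z)"] allI ballI)
      fix k \<zeta> assume \<zeta>: "\<zeta> \<in> Z"
      have "cmod (\<Sum>j<Suc s. g j * \<eta> \<zeta> j k) * \<rho> ^ k \<le> B \<zeta>" using B \<zeta> by blast
      also have "B \<zeta> \<le> Max (B ` Z)" using \<zeta> finZ by simp
      finally show "cmod (\<Sum>j<Suc s. g j * \<eta> \<zeta> j k) * \<rho> ^ k \<le> Max (B ` Z)" .
    qed
  next
    fix g :: "nat \<Rightarrow> complex" and \<rho> :: real assume g: "\<exists>j<Suc s. g j \<noteq> 0" and \<rho>: "R < \<rho>"
    show "\<not> (\<exists>B. \<forall>k. \<forall>\<zeta>\<in>Z. cmod (\<Sum>j<Suc s. g j * \<eta> \<zeta> j k) * \<rho> ^ k \<le> B)"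
    proof
      assume "\<exists>B. \<forall>k. \<forall>\<zeta>\<in>Z. cmod (\<Sum>j<Suc s. g j * \<eta> \<zeta> j k) * \<rho> ^ k \<le> B"
      then obtain B where B: "\<And>k \<zeta>. \<zeta> \<in> Z \<Longrightarrow> cmod (fps_nth (fps_of_poly (W \<zeta>) * (fps_of_poly (v g) * G)) k) * \<rho> ^ k \<le> B"
        unfolding h_eq by blast
      have "ereal \<rho> \<le> fps_conv_radius (fps_of_poly (v g) * G)"
      proof (rule fps_conv_radius_geI)
        show "0 < \<rho>" using R \<rho> by simp
        fix k
        let ?F = "fps_of_poly (v g) * G"
        \<comment> \<open>Interpolating the constant 1 recovers \<open>v * G\<close> from its
          components, so a common bound on these would enlarge its radius of convergence.\<close>
        have "fps_nth ?F k = (\<Sum>z\<in>Z. 1 / poly (W z) z * fps_nth (fps_of_poly (W z) * ?F) k)"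
          using expand[of 1 ?F k] Q(4) by simp
        hence "cmod (fps_nth ?F k) * \<rho> ^ k \<le> (\<Sum>z\<in>Z. cmod (1 / poly (W z) z * fps_nth (fps_of_poly (W z) * ?F) k)) * \<rho> ^ k"
          using R \<rho> by (intro mult_right_mono) (auto intro: sum_norm_le)
        also have "\<dots> = (\<Sum>z\<in>Z. cmod (1 / poly (W z) z) * (cmod (fps_nth (fps_of_poly (W z) * ?F) k) * \<rho> ^ k))"
          by (simp only: sum_distrib_right norm_mult mult.assoc)
        also have "\<dots> \<le> (\<Sum>z\<in>Z. cmod (1 / poly (W z) z) * B)"
          by (intro sum_mono mult_left_mono B) auto
        finally show "cmod (fps_nth ?F k) * \<rho> ^ k \<le> (\<Sum>z\<in>Z. cmod (1 / poly (W z) z) * B)" .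
      qed
      also have "\<dots> \<le> ereal R" by (rule exact[OF v_nz[OF g] v_deg])
      finally show False using \<rho> by simp
    qed
  qed
  have abs: "Abs_fps (\<eta> b j) = fps_of_poly (W b * monom 1 j) * G" for b j by (rule fps_ext) (simp add: \<eta>_def)
  show ?thesis
  proof (rule DF.circle_count)
    show "A \<subseteq> DF.middle" using A unfolding DF.middle_def by (auto simp: Z_def)
  next
    fix b j assume b: "b \<in> DF.middle - A"
    show "ereal R \<le> fps_conv_radius (Abs_fps (\<eta> b j))"
      unfolding abs by (rule order_trans[OF R(2) fps_conv_radius_poly_mult])
    obtain \<rho> H where H: "0 < \<rho>" "H holomorphic_on ball b \<rho>" "\<forall>z\<in>ball b \<rho>. norm z < R \<longrightarrow> H z = eval_fps G z"
      using reg[of b] b unfolding DF.middle_def by (auto simp: Z_def)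
    show "\<exists>\<rho>>0. \<exists>H. H holomorphic_on ball b \<rho> \<and> (\<forall>z\<in>ball b \<rho>. norm z < R \<longrightarrow> H z = eval_fps (Abs_fps (\<eta> b j)) z)"
    proof (intro exI[of _ \<rho>] exI[of _ "\<lambda>z. poly (W b * monom 1 j) z * H z"] conjI ballI impI)
      show "(\<lambda>z. poly (W b * monom 1 j) z * H z) holomorphic_on ball b \<rho>" using H by (intro holomorphic_intros)
      fix z assume z: "z \<in> ball b \<rho>" "norm z < R"
      have "ereal (norm z) < ereal R" using z by simp
      also note R(2)
      finally show "poly (W b * monom 1 j) z * H z = eval_fps (Abs_fps (\<eta> b j)) z"
        unfolding abs using H(3) z by (subst eval_fps_poly_mult) auto
    qed (use H in auto)
  qed simp
qed


section \<open>Consequences of Hermite-Pade interpolation\<close>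

lemma homogeneous_system:
  fixes a :: "'e \<Rightarrow> nat \<Rightarrow> complex"
  assumes "finite E" "card E < n"
  shows "\<exists>x. (\<exists>l<n. x l \<noteq> 0) \<and> (\<forall>e\<in>E. (\<Sum>l<n. a e l * x l) = 0)"
  using assms
proof (induction n arbitrary: E a)
  case (Suc n)
  show ?case
  proof (cases "\<forall>e\<in>E. a e n = 0")
    case True
    thus ?thesis by (intro exI[of _ "\<lambda>l. if l = n then 1 else 0"]) (auto intro!: exI[of _ n])
  next
    case False
    then obtain e0 where e0: "e0 \<in> E" "a e0 n \<noteq> 0" by blast
    have "card (E - {e0}) < n" using card_Diff1_less[OF Suc.prems(1) e0(1)] Suc.prems(2) by linarith
    then obtain x where x: "\<exists>l<n. x l \<noteq> 0" "\<forall>e\<in>E - {e0}. (\<Sum>l<n. (a e l - a e n / a e0 n * a e0 l) * x l) = 0"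
      using Suc.IH[of "E - {e0}" "\<lambda>e l. a e l - a e n / a e0 n * a e0 l"] Suc.prems by auto
    define s where "s = (\<Sum>l<n. a e0 l * x l)"
    define x' where "x' = x(n := - s / a e0 n)"
    have eq: "(\<Sum>l<Suc n. a e l * x' l) = (\<Sum>l<n. a e l * x l) - a e n / a e0 n * s" for e
      by (simp add: x'_def)
    have "(\<Sum>l<Suc n. a e l * x' l) = 0" if "e \<in> E" for e
    proof (cases "e = e0")
      case True thus ?thesis unfolding eq using e0 by (simp add: s_def)
    next
      case False
      have "(\<Sum>l<n. (a e l - a e n / a e0 n * a e0 l) * x l) = (\<Sum>l<n. a e l * x l) - a e n / a e0 n * s"
        by (simp add: s_def left_diff_distrib sum_subtractf sum_distrib_left mult.assoc)
      thus ?thesis unfolding eq using x(2) that False by simp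
    qed
    moreover have "\<exists>l<Suc n. x' l \<noteq> 0" using x(1) by (auto simp: x'_def intro: less_SucI)
    ultimately show ?thesis by blast
  qed
qed simp

lemma cancel_common_roots:
  fixes q :: "complex poly" and p :: "'k \<Rightarrow> complex poly"
  assumes "q \<noteq> 0"
  shows "\<exists>g Q P. q = g * Q \<and> (\<forall>k\<in>I. p k = g * P k) \<and> lead_coeff Q = 1 \<and>
     \<not> (\<exists>z. poly Q z = 0 \<and> (\<forall>k\<in>I. poly (P k) z = 0))"
  using assms
proof (induction "degree q" arbitrary: q p rule: less_induct)
  case less
  show ?case
  proof (cases "\<exists>z. poly q z = 0 \<and> (\<forall>k\<in>I. poly (p k) z = 0)")
    case False
    let ?c = "lead_coeff q"
    have c: "?c \<noteq> 0" using less.prems by simp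
    show ?thesis
    proof (intro exI conjI ballI)
      show "q = [:?c:] * smult (1 / ?c) q" using c by simp
      show "p k = [:?c:] * smult (1 / ?c) (p k)" for k using c by simp
      show "lead_coeff (smult (1 / ?c) q) = 1" using c by simp
      show "\<not> (\<exists>z. poly (smult (1 / ?c) q) z = 0 \<and> (\<forall>k\<in>I. poly (smult (1 / ?c) (p k)) z = 0))"
        using False c by simp
    qed
  next
    case True
    then obtain z where z: "poly q z = 0" "\<forall>k\<in>I. poly (p k) z = 0" by blast
    let ?l = "[:- z, 1:]"
    have fq: "q = ?l * (q div ?l)" using z(1) by (metis dvd_mult_div_cancel poly_eq_0_iff_dvd)
    have fp: "p k = ?l * (p k div ?l)" if "k \<in> I" for k using z(2) that by (metis dvd_mult_div_cancel poly_eq_0_iff_dvd)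
    have nz: "q div ?l \<noteq> 0" using fq less.prems by (metis mult_zero_right)
    have "degree q = Suc (degree (q div ?l))" using fq nz degree_mult_eq[of ?l "q div ?l"] by simp
    hence "degree (q div ?l) < degree q" by simp
    from less.hyps[OF this nz, of "\<lambda>k. p k div ?l"] obtain g Q P where
      g: "q div ?l = g * Q" "\<forall>k\<in>I. p k div ?l = g * P k" "lead_coeff Q = 1"
        "\<not> (\<exists>z. poly Q z = 0 \<and> (\<forall>k\<in>I. poly (P k) z = 0))" by blast
    have "q = (?l * g) * Q" using fq g(1) by (simp only: mult.assoc)
    moreover have "\<forall>k\<in>I. p k = (?l * g) * P k" using fp g(2) by (metis mult.assoc)
    ultimately show ?thesis using g by blast
  qed
qed

definition admissible :: "nat \<Rightarrow> (nat \<Rightarrow> nat) \<Rightarrow> (nat \<Rightarrow> complex poly) \<Rightarrow> bool" where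
  "admissible d m p \<longleftrightarrow> (\<forall>k\<in>{1..d}. p k = 0 \<or> degree (p k) < m k)"

lemma fps_nth_poly_mult_le:
  fixes p :: "complex poly"
  assumes "p = 0 \<or> degree p < m"
  shows "fps_nth (fps_of_poly p * F) n = (\<Sum>i<m. if i \<le> n then coeff p i * fps_nth F (n - i) else 0)"
proof -
  have z: "coeff p i = 0" if "m \<le> i" for i using assms that by (auto intro: coeff_eq_0)
  have "fps_nth (fps_of_poly p * F) n = (\<Sum>i\<le>n. coeff p i * fps_nth F (n - i))"
    by (simp add: fps_mult_nth atLeast0AtMost)
  also have "\<dots> = (\<Sum>i\<in>{..n} \<inter> {..<m}. coeff p i * fps_nth F (n - i))"
  proof (rule sum.mono_neutral_right)
    show "\<forall>i\<in>{..n} - {..n} \<inter> {..<m}. coeff p i * fps_nth F (n - i) = 0"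
    proof
      fix i assume "i \<in> {..n} - {..n} \<inter> {..<m}"
      hence "m \<le> i" by auto
      thus "coeff p i * fps_nth F (n - i) = 0" by (simp add: z)
    qed
  qed auto
  also have "\<dots> = (\<Sum>i<m. if i \<le> n then coeff p i * fps_nth F (n - i) else 0)"
    by (rule sum.mono_neutral_cong_left) auto
  finally show ?thesis .
qed

lemma poly_combination_coeff:
  assumes "admissible d m p"
  shows "fps_nth (fps_of_poly a * poly_combination d f p) n =
    (\<Sum>k\<in>{1..d}. \<Sum>i<m k. if i \<le> n then coeff (p k) i * fps_nth (fps_of_poly a * f k) (n - i) else 0)"
proof -
  have "fps_of_poly a * poly_combination d f p = (\<Sum>k\<in>{1..d}. fps_of_poly (p k) * (fps_of_poly a * f k))"
    unfolding poly_combination_def sum_distrib_left by (simp only: mult_ac)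
  hence "fps_nth (fps_of_poly a * poly_combination d f p) n = (\<Sum>k\<in>{1..d}. fps_nth (fps_of_poly (p k) * (fps_of_poly a * f k)) n)"
    by (simp only: fps_sum_nth)
  also have "\<dots> = (\<Sum>k\<in>{1..d}. \<Sum>i<m k. if i \<le> n then coeff (p k) i * fps_nth (fps_of_poly a * f k) (n - i) else 0)"
    by (intro sum.cong refl fps_nth_poly_mult_le) (use assms in \<open>auto simp: admissible_def\<close>)
  finally show ?thesis .
qed

text \<open>Full degree of \<open>Q\<close> forces the cancelled factor \<open>g\<close> to be
  constant, so the interpolation conditions hold for \<open>Q\<close> itself; for
  \<open>j > n - m k\<close> the numerator has no coefficient left.\<close>

lemma hp_denominator_orthogonal:
  assumes hp: "hp_denominator d f m n Q" and deg: "degree Q = (\<Sum>k\<in>{1..d}. m k)"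
    and k: "k \<in> {1..d}" and j: "n - m k < j" "j \<le> n"
  shows "fps_nth (fps_of_poly Q * f k) j = 0"
proof -
  obtain q p g P where h: "hp_solution d f m n q p" "q = g * Q" "\<forall>k\<in>{1..d}. p k = g * P k" "lead_coeff Q = 1"
    using hp unfolding hp_denominator_def by blast
  have q0: "q \<noteq> 0" "degree q \<le> degree Q" using h(1) deg by (auto simp: hp_solution_def)
  hence "g \<noteq> 0" "Q \<noteq> 0" using h(2) by auto
  hence "degree q = degree g + degree Q" using h(2) by (simp add: degree_mult_eq)
  hence "degree g = 0" using q0 by simp
  then obtain c where c: "g = [:c:]" by (metis degree_eq_zeroE)
  have c0: "c \<noteq> 0" using c \<open>g \<noteq> 0\<close> by auto
  have "coeff (p k) j = 0"
  proof (rule coeff_eq_0)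
    have "degree (p k) \<le> n - m k" using h(1) k by (auto simp: hp_solution_def)
    thus "degree (p k) < j" using j by simp
  qed
  moreover have "fps_nth (fps_of_poly q * f k - fps_of_poly (p k)) j = 0"
    using h(1) k j by (auto simp: hp_solution_def)
  ultimately have "fps_nth (fps_of_poly q * f k) j = 0" by simp
  moreover have "fps_of_poly q * f k = fps_const c * (fps_of_poly Q * f k)"
    unfolding h(2) c fps_of_poly_mult fps_of_poly_const by (simp only: mult.assoc)
  ultimately show ?thesis using c0 by simp
qed

text \<open>The \<open>n\<close>-th coefficient involves only the coefficients \<open>n - i\<close>
  of \<open>Q * f k\<close> with \<open>i < m k\<close>, all of which lie in the range of
  \<open>hp_denominator_orthogonal\<close>.\<close>

lemma admissible_recurrence:
  assumes hp: "hp_denominator d f m n Q" and deg: "degree Q = (\<Sum>k\<in>{1..d}. m k)"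
    and n: "\<And>k. k \<in> {1..d} \<Longrightarrow> m k \<le> n" and p: "admissible d m p"
  shows "fps_nth (fps_of_poly Q * poly_combination d f p) n = 0"
  unfolding poly_combination_coeff[OF p]
proof (intro sum.neutral ballI)
  fix k i assume k: "k \<in> {1..d}" and i: "i \<in> {..<m k}"
  have "fps_nth (fps_of_poly Q * f k) (n - i) = 0" if "i \<le> n"
    by (rule hp_denominator_orthogonal[OF hp deg k]) (use i n[OF k] in auto)
  thus "(if i \<le> n then coeff (p k) i * fps_nth (fps_of_poly Q * f k) (n - i) else 0) = 0" by simp
qed

text \<open>Serves to produce a denominator of deficient degree: the numerators are the truncations
  of \<open>q * f k\<close> at degree \<open>n - m k\<close>, and cancelling common roots can only
  lower the degree.\<close>

lemma hp_denominator_of_vector: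
  fixes x :: "nat \<Rightarrow> complex"
  assumes nz: "\<exists>l<M. x l \<noteq> 0" and M: "M = (\<Sum>k\<in>{1..d}. m k)"
    and ort: "\<And>k j. k \<in> {1..d} \<Longrightarrow> n - m k < j \<Longrightarrow> j \<le> n \<Longrightarrow> fps_nth (fps_of_poly (\<Sum>l<M. monom (x l) l) * f k) j = 0"
  shows "\<exists>Q'. hp_denominator d f m n Q' \<and> degree Q' < M"
proof -
  define q where "q = (\<Sum>l<M. monom (x l) l)"
  define p where "p = (\<lambda>k. \<Sum>j\<le>n - m k. monom (fps_nth (fps_of_poly q * f k) j) j)"
  have cq: "coeff q l = (if l < M then x l else 0)" for l by (simp add: q_def coeff_sum)
  have q0: "q \<noteq> 0" using nz cq by (metis coeff_0)
  have M0: "0 < M" using nz by auto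
  have dq: "degree q < M" using cq M0 by (intro degree_lessI) auto
  have cp: "coeff (p k) j = (if j \<le> n - m k then fps_nth (fps_of_poly q * f k) j else 0)" for k j
    by (simp add: p_def coeff_sum)
  have "hp_solution d f m n q p"
    unfolding hp_solution_def
  proof (intro conjI ballI allI impI q0)
    show "degree q \<le> (\<Sum>k\<in>{1..d}. m k)" using dq M by simp
    fix k assume k: "k \<in> {1..d}"
    show "degree (p k) \<le> n - m k" using cp by (intro degree_le) auto
    fix j assume "j \<le> n"
    thus "fps_nth (fps_of_poly q * f k - fps_of_poly (p k)) j = 0"
      using ort[OF k, of j] unfolding q_def[symmetric] by (cases "j \<le> n - m k") (auto simp: cp)
  qed
  moreover obtain g Q P where g: "q = g * Q" "\<forall>k\<in>{1..d}. p k = g * P k" "lead_coeff Q = 1"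
      "\<not> (\<exists>z. poly Q z = 0 \<and> (\<forall>k\<in>{1..d}. poly (P k) z = 0))"
    using cancel_common_roots[OF q0, of "{1..d}" p] by blast
  ultimately have "hp_denominator d f m n Q" unfolding hp_denominator_def by blast
  moreover have "degree Q \<le> degree q" using g(1) q0 by (auto simp: degree_mult_eq)
  ultimately show ?thesis using dq by (intro exI[of _ Q]) auto
qed

text \<open>Of the \<open>M\<close> conditions on a denominator of degree below \<open>M\<close>,
  drop the one at \<open>(k0, i0)\<close>; the other \<open>M - 1\<close> have a nonzero solution
  \<open>q\<close>. If the combination vanished eventually, so would the coefficient of
  \<open>z ^ n\<close> in its product with \<open>q\<close>, and since
  \<open>coeff (p k0) i0\<close> is nonzero the dropped condition would follow. The resulting
  denominator of deficient degree contradicts \<open>uniq\<close>.\<close>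

lemma combination_not_eventually_zero:
  assumes p: "admissible d m p" "\<exists>k\<in>{1..d}. p k \<noteq> 0"
    and uniq: "\<forall>\<^sub>F n in sequentially. \<forall>Q'. hp_denominator d f m n Q' \<longrightarrow> degree Q' = (\<Sum>k\<in>{1..d}. m k)"
  shows "\<not> (\<forall>\<^sub>F j in sequentially. fps_nth (poly_combination d f p) j = 0)"
proof
  assume "\<forall>\<^sub>F j in sequentially. fps_nth (poly_combination d f p) j = 0"
  then obtain N1 where N1: "\<And>j. N1 \<le> j \<Longrightarrow> fps_nth (poly_combination d f p) j = 0" by (auto simp: eventually_sequentially)
  obtain N2 where N2: "\<And>n Q'. N2 \<le> n \<Longrightarrow> hp_denominator d f m n Q' \<Longrightarrow> degree Q' = (\<Sum>k\<in>{1..d}. m k)"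
    using uniq by (auto simp: eventually_sequentially)
  define M where "M = (\<Sum>k\<in>{1..d}. m k)"
  \<comment> \<open>Large enough that every index \<open>n - l\<close> with \<open>l < M\<close>
    lies in the range where the combination vanishes.\<close>
  define n where "n = N1 + N2 + M"
  have mk: "m k \<le> M" if "k \<in> {1..d}" for k unfolding M_def by (rule member_le_sum) (use that in auto)
  obtain k0 where k0: "k0 \<in> {1..d}" "p k0 \<noteq> 0" using p by blast
  define i0 where "i0 = degree (p k0)"
  have i0: "i0 < m k0" "coeff (p k0) i0 \<noteq> 0" using p(1) k0 by (auto simp: admissible_def i0_def)
  define E where "E = (SIGMA k:{1..d}. {..<m k}) - {(k0, i0)}"
  have finE: "finite E" by (simp add: E_def)
  have cE: "card E < M"
  proof -
    have "(k0, i0) \<in> (SIGMA k:{1..d}. {..<m k})" using k0 i0 by auto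
    moreover have "card (SIGMA k:{1..d}. {..<m k}) = M" by (simp add: M_def)
    ultimately show ?thesis unfolding E_def by (metis card_Diff1_less finite_SigmaI finite_atLeastAtMost finite_lessThan)
  qed
  define a where "a = (\<lambda>e l. if l \<le> n - snd e then fps_nth (f (fst e)) (n - snd e - l) else 0)"
  obtain x where x: "\<exists>l<M. x l \<noteq> 0" "\<forall>e\<in>E. (\<Sum>l<M. a e l * x l) = 0" using homogeneous_system[OF finE cE, of a] by blast
  define q where "q = (\<Sum>l<M. monom (x l) l)"
  have cq: "coeff q l = (if l < M then x l else 0)" for l by (simp add: q_def coeff_sum)
  have M0: "0 < M" using x by auto
  have dq: "degree q < M" using cq M0 by (intro degree_lessI) auto
  have val: "fps_nth (fps_of_poly q * F) j = (\<Sum>l<M. if l \<le> j then x l * fps_nth F (j - l) else 0)" for F j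
  proof -
    have "fps_nth (fps_of_poly q * F) j = (\<Sum>l<M. if l \<le> j then coeff q l * fps_nth F (j - l) else 0)"
      by (rule fps_nth_poly_mult_le) (use dq in simp)
    also have "\<dots> = (\<Sum>l<M. if l \<le> j then x l * fps_nth F (j - l) else 0)"
      by (rule sum.cong) (auto simp: cq)
    finally show ?thesis .
  qed
  have phi: "fps_nth (fps_of_poly q * f k) (n - i) = (\<Sum>l<M. a (k, i) l * x l)" for k i
    unfolding val by (rule sum.cong) (auto simp: a_def)
  have Ez: "fps_nth (fps_of_poly q * f k) (n - i) = 0" if "k \<in> {1..d}" "i < m k" "(k, i) \<noteq> (k0, i0)" for k i
    unfolding phi using x(2) that by (auto simp: E_def)
  have "fps_nth (fps_of_poly q * poly_combination d f p) n = 0"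
    unfolding val by (rule sum.neutral) (auto simp: n_def intro!: N1)
  also have "fps_nth (fps_of_poly q * poly_combination d f p) n =
     (\<Sum>k\<in>{1..d}. \<Sum>i<m k. if k = k0 \<and> i = i0 then coeff (p k0) i0 * fps_nth (fps_of_poly q * f k0) (n - i0) else 0)"
    unfolding poly_combination_coeff[OF p(1)]
  proof (intro sum.cong refl)
    fix k i assume ki: "k \<in> {1..d}" "i \<in> {..<m k}"
    have "i \<le> n" using mk[OF ki(1)] ki by (simp add: n_def)
    thus "(if i \<le> n then coeff (p k) i * fps_nth (fps_of_poly q * f k) (n - i) else 0) =
      (if k = k0 \<and> i = i0 then coeff (p k0) i0 * fps_nth (fps_of_poly q * f k0) (n - i0) else 0)"
      using Ez[of k i] ki by auto
  qed
  also have "\<dots> = (\<Sum>k\<in>{1..d}. if k = k0 then coeff (p k0) i0 * fps_nth (fps_of_poly q * f k0) (n - i0) else 0)"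
    by (intro sum.cong refl) (use i0 in auto)
  also have "\<dots> = coeff (p k0) i0 * fps_nth (fps_of_poly q * f k0) (n - i0)" using k0 by simp
  finally have z0: "fps_nth (fps_of_poly q * f k0) (n - i0) = 0" using i0 by simp
  have "\<exists>Q'. hp_denominator d f m n Q' \<and> degree Q' < M"
  proof (rule hp_denominator_of_vector[OF x(1) M_def])
    fix k j assume kj: "k \<in> {1..d}" "n - m k < j" "j \<le> n"
    have "m k \<le> n" using mk[OF kj(1)] by (simp add: n_def)
    hence "n - j < m k" "n - (n - j) = j" using kj by auto
    thus "fps_nth (fps_of_poly (\<Sum>l<M. monom (x l) l) * f k) j = 0"
      using Ez[of k "n - j"] z0 kj unfolding q_def[symmetric] by (cases "(k, n - j) = (k0, i0)") auto
  qed
  moreover have "N2 \<le> n" by (simp add: n_def)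
  ultimately show False using N2[of n] unfolding M_def by force
qed

section \<open>Scalar recurrences whose coefficients converge\<close>

lemma fps_nth_poly_mult_degree:
  fixes p :: "complex poly"
  assumes "degree p = M" "M \<le> n"
  shows "fps_nth (fps_of_poly p * H) n = (\<Sum>i\<le>M. coeff p i * fps_nth H (n - i))"
proof -
  have "fps_nth (fps_of_poly p * H) n = (\<Sum>i\<le>n. coeff p i * fps_nth H (n - i))"
    by (simp add: fps_mult_nth atLeast0AtMost)
  also have "\<dots> = (\<Sum>i\<le>M. coeff p i * fps_nth H (n - i))"
    by (rule sum.mono_neutral_right) (use assms in \<open>auto intro: coeff_eq_0\<close>)
  finally show ?thesis .
qed

text \<open>
  Multiplied by \<open>a ^ (k + 1)\<close>, the coefficients of \<open>B / (z - a)\<close> converge to \<open>- B a\<close> exponentially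
  fast. The recurrence therefore makes \<open>q n\<close> exponentially small at \<open>a\<close>, which is what the second
  part needs in order to beat the linear growth of the coefficients of \<open>B / (z - a)^2\<close>.
\<close>

lemma pole_is_simple_zero:
  fixes q :: "nat \<Rightarrow> complex poly" and Q :: "complex poly" and B H2 H3 :: "complex fps" and a :: complex
  assumes lim: "\<And>i. (\<lambda>n. coeff (q n) i) \<longlonglongrightarrow> coeff Q i"
    and deg: "\<forall>\<^sub>F n in sequentially. degree (q n) = M" "degree Q = M"
    and a: "a \<noteq> 0" "ereal (norm a) < fps_conv_radius B" "eval_fps B a \<noteq> 0"
    and H2: "fps_of_poly [:- a, 1:] * H2 = B"
    and rec2: "\<forall>\<^sub>F n in sequentially. fps_nth (fps_of_poly (q n) * H2) n = 0"
  shows "poly Q a = 0"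
    and "fps_of_poly [:- a, 1:] * H3 = H2 \<Longrightarrow> \<forall>\<^sub>F n in sequentially. fps_nth (fps_of_poly (q n) * H3) n = 0 \<Longrightarrow> poly (pderiv Q) a = 0"
proof -
  have step: "fps_nth (fps_of_poly [:- a, 1:] * H) k = (if k = 0 then 0 else fps_nth H (k - 1)) - a * fps_nth H k" for H :: "complex fps" and k
  proof -
    have "fps_of_poly [:- a, 1:] * H = fps_X * H - fps_const a * H"
      unfolding fps_of_poly_linear by (simp add: algebra_simps flip: fps_const_neg)
    thus ?thesis by (simp add: fps_mult_fps_X_commute)
  qed
  have partial: "a ^ Suc k * fps_nth H k = - (\<Sum>i\<le>k. fps_nth (fps_of_poly [:- a, 1:] * H) i * a ^ i)" for H :: "complex fps" and k
  proof (induction k)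
    case 0 show ?case using step[of H 0] by simp
  next
    case (Suc k)
    have "a * fps_nth H (Suc k) = fps_nth H k - fps_nth (fps_of_poly [:- a, 1:] * H) (Suc k)"
      using step[of H "Suc k"] by simp
    moreover have "a ^ Suc (Suc k) * fps_nth H (Suc k) = a ^ Suc k * (a * fps_nth H (Suc k))" by simp
    ultimately have "a ^ Suc (Suc k) * fps_nth H (Suc k) = a ^ Suc k * fps_nth H k - fps_nth (fps_of_poly [:- a, 1:] * H) (Suc k) * a ^ Suc k"
      by (simp only: right_diff_distrib mult.commute)
    thus ?case using Suc by simp
  qed
  obtain r where r: "norm a < r" "ereal r < fps_conv_radius B" using ereal_dense2[OF a(2)] by auto
  have r0: "0 < r" using r(1) norm_ge_zero[of a] by linarith
  obtain C where C: "\<And>k. norm (fps_nth B k) * r ^ k \<le> C" using fps_coeffs_bounded[OF less_imp_le[OF r0] r(2)] by blast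
  define t where "t = norm a / r"
  have t: "0 < t" "t < 1" using a r r0 by (auto simp: t_def)
  have Bt: "norm (fps_nth B k * a ^ k) \<le> C * t ^ k" for k
  proof -
    have "norm (fps_nth B k * a ^ k) = (norm (fps_nth B k) * r ^ k) * t ^ k"
      using r0 by (simp add: t_def norm_mult norm_power power_divide)
    also have "\<dots> \<le> C * t ^ k" using C t by (intro mult_right_mono) auto
    finally show ?thesis .
  qed
  have C0: "0 \<le> C" using Bt[of 0] by (simp add: order_trans[OF norm_ge_zero])
  have sums: "(\<lambda>k. fps_nth B k * a ^ k) sums eval_fps B a" by (rule sums_eval_fps[OF a(2)])
  \<comment> \<open>The remainder of the Taylor series of \<open>B\<close> at \<open>a\<close> after
    \<open>k + 1\<close> terms, of order \<open>t ^ k\<close> with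
    \<open>t = norm a / r < 1\<close>.\<close>
  define \<delta> where "\<delta> = (\<lambda>k. eval_fps B a + a ^ Suc k * fps_nth H2 k)"
  have \<delta>: "norm (\<delta> k) \<le> C / (1 - t) * t ^ k" for k
  proof -
    have "\<delta> k = (\<Sum>i. fps_nth B i * a ^ i) - (\<Sum>i<Suc k. fps_nth B i * a ^ i)"
      using partial[of k H2] sums unfolding H2 \<delta>_def by (simp add: sums_iff lessThan_Suc_atMost)
    also have "\<dots> = (\<Sum>i. fps_nth B (i + Suc k) * a ^ (i + Suc k))"
      using suminf_minus_initial_segment[of "\<lambda>k. fps_nth B k * a ^ k" "Suc k"] sums by (simp add: sums_iff)
    finally have eq: "\<delta> k = (\<Sum>i. fps_nth B (i + Suc k) * a ^ (i + Suc k))" .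
    have g: "(\<lambda>i. C * t ^ Suc k * t ^ i) sums (C * t ^ Suc k * (1 / (1 - t)))"
      by (intro sums_mult geometric_sums) (use t in auto)
    have le: "norm (fps_nth B (i + Suc k) * a ^ (i + Suc k)) \<le> C * t ^ Suc k * t ^ i" for i
      using Bt[of "i + Suc k"] by (simp only: power_add mult_ac)
    have sm: "summable (\<lambda>i. norm (fps_nth B (i + Suc k) * a ^ (i + Suc k)))"
      by (rule summable_comparison_test'[OF sums_summable[OF g]]) (use le in simp)
    have "norm (\<delta> k) \<le> (\<Sum>i. norm (fps_nth B (i + Suc k) * a ^ (i + Suc k)))" unfolding eq by (rule summable_norm[OF sm])
    also have "\<dots> \<le> (\<Sum>i. C * t ^ Suc k * t ^ i)" by (rule suminf_le[OF le sm sums_summable[OF g]])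
    also have "\<dots> = C * t ^ Suc k * (1 / (1 - t))" using g by (simp add: sums_iff)
    also have "\<dots> = t * (C / (1 - t) * t ^ k)" by simp
    also have "\<dots> \<le> 1 * (C / (1 - t) * t ^ k)" using t C0 by (intro mult_right_mono) auto
    finally show ?thesis by simp
  qed
  have n\<delta>: "(\<lambda>n. of_nat (Suc n) * \<delta> (n - i)) \<longlonglongrightarrow> 0" for i
  proof (rule LIMSEQ_offset[where k = i])
    have "(\<lambda>n. real n * t ^ n) \<longlonglongrightarrow> 0" using powser_times_n_limit_0[of t] t by simp
    moreover have "(\<lambda>n. t ^ n) \<longlonglongrightarrow> 0" using t by (intro LIMSEQ_power_zero) auto
    ultimately have "(\<lambda>n. C / (1 - t) * (real n * t ^ n + real (Suc i) * t ^ n)) \<longlonglongrightarrow> C / (1 - t) * (0 + real (Suc i) * 0)"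
      by (intro tendsto_mult tendsto_add tendsto_const)
    hence lim': "(\<lambda>n. C / (1 - t) * (real n * t ^ n + real (Suc i) * t ^ n)) \<longlonglongrightarrow> 0" by simp
    show "(\<lambda>n. of_nat (Suc (n + i)) * \<delta> (n + i - i)) \<longlonglongrightarrow> 0"
    proof (rule Lim_null_comparison[OF _ lim'], intro always_eventually allI)
      fix n
      have "norm (of_nat (Suc (n + i)) * \<delta> (n + i - i)) = real (Suc (n + i)) * norm (\<delta> n)"
        by (simp only: norm_mult norm_of_nat add_diff_cancel_right')
      also have "\<dots> \<le> real (Suc (n + i)) * (C / (1 - t) * t ^ n)" by (intro mult_left_mono \<delta>) auto
      also have "real (Suc (n + i)) = real n + real (Suc i)" by simp
      also have "(real n + real (Suc i)) * (C / (1 - t) * t ^ n) = C / (1 - t) * (real n * t ^ n + real (Suc i) * t ^ n)"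
        by (simp only: distrib_left distrib_right mult_ac)
      finally show "norm (of_nat (Suc (n + i)) * \<delta> (n + i - i)) \<le> C / (1 - t) * (real n * t ^ n + real (Suc i) * t ^ n)" .
    qed
  qed
  have coeff_sum: "fps_nth (fps_of_poly (q n) * H) n = (\<Sum>i\<le>M. coeff (q n) i * fps_nth H (n - i))"
    if "degree (q n) = M" "M \<le> n" for n and H :: "complex fps"
    by (rule fps_nth_poly_mult_degree[OF that])
  have apow: "a ^ Suc n = a ^ i * a ^ Suc (n - i)" if "i \<le> n" for i n
    using that by (simp add: power_add[symmetric])
  have key: "\<forall>\<^sub>F n in sequentially. eval_fps B a * poly (q n) a = (\<Sum>i\<le>M. coeff (q n) i * a ^ i * \<delta> (n - i))"
    using deg(1) rec2 eventually_ge_at_top[of M]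
  proof eventually_elim
    case (elim n)
    have "0 = a ^ Suc n * (\<Sum>i\<le>M. coeff (q n) i * fps_nth H2 (n - i))" using elim coeff_sum[of n H2] by simp
    also have "\<dots> = (\<Sum>i\<le>M. coeff (q n) i * a ^ i * (\<delta> (n - i) - eval_fps B a))"
      unfolding sum_distrib_left
    proof (rule sum.cong[OF refl])
      fix i assume "i \<in> {..M}"
      hence "i \<le> n" using elim by simp
      thus "a ^ Suc n * (coeff (q n) i * fps_nth H2 (n - i)) = coeff (q n) i * a ^ i * (\<delta> (n - i) - eval_fps B a)"
        unfolding apow[OF \<open>i \<le> n\<close>] \<delta>_def by simp
    qed
    also have "\<dots> = (\<Sum>i\<le>M. coeff (q n) i * a ^ i * \<delta> (n - i)) - eval_fps B a * poly (q n) a"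
      using elim by (simp add: right_diff_distrib sum_subtractf poly_altdef sum_distrib_left mult_ac)
    finally show ?case by simp
  qed
  have qa: "(\<lambda>n. poly (q n) a) \<longlonglongrightarrow> poly Q a"
  proof -
    have "\<forall>\<^sub>F n in sequentially. (\<Sum>i\<le>M. coeff (q n) i * a ^ i) = poly (q n) a"
      using deg(1) by eventually_elim (simp add: poly_altdef)
    moreover have "(\<lambda>n. \<Sum>i\<le>M. coeff (q n) i * a ^ i) \<longlonglongrightarrow> (\<Sum>i\<le>M. coeff Q i * a ^ i)"
      by (intro tendsto_intros lim)
    ultimately show ?thesis using deg(2) by (simp add: poly_altdef[of Q] tendsto_cong)
  qed
  have nq: "(\<lambda>n. of_nat (Suc n) * poly (q n) a) \<longlonglongrightarrow> 0"
  proof -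
    have "(\<lambda>n. (\<Sum>i\<le>M. coeff (q n) i * a ^ i * (of_nat (Suc n) * \<delta> (n - i))) / eval_fps B a) \<longlonglongrightarrow>
       (\<Sum>i\<le>M. coeff Q i * a ^ i * 0) / eval_fps B a"
      by (intro tendsto_intros lim n\<delta> a)
    moreover have "\<forall>\<^sub>F n in sequentially. (\<Sum>i\<le>M. coeff (q n) i * a ^ i * (of_nat (Suc n) * \<delta> (n - i))) / eval_fps B a = of_nat (Suc n) * poly (q n) a"
      using key
    proof eventually_elim
      case (elim n)
      have "(\<Sum>i\<le>M. coeff (q n) i * a ^ i * (of_nat (Suc n) * \<delta> (n - i))) = of_nat (Suc n) * (\<Sum>i\<le>M. coeff (q n) i * a ^ i * \<delta> (n - i))"
        unfolding sum_distrib_left by (simp only: mult_ac)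
      thus ?case unfolding elim[symmetric] using a(3) by simp
    qed
    ultimately show ?thesis by (simp add: tendsto_cong)
  qed
  show Qa: "poly Q a = 0"
  proof -
    have "(\<lambda>n. inverse (of_nat (Suc n)) * (of_nat (Suc n) * poly (q n) a)) \<longlonglongrightarrow> 0 * 0"
      by (intro tendsto_mult nq LIMSEQ_Suc[OF lim_inverse_n])
    hence "(\<lambda>n. poly (q n) a) \<longlonglongrightarrow> 0" by (simp add: mult.assoc[symmetric] del: of_nat_Suc)
    thus ?thesis using qa LIMSEQ_unique by blast
  qed
  assume H3: "fps_of_poly [:- a, 1:] * H3 = H2" and rec3: "\<forall>\<^sub>F n in sequentially. fps_nth (fps_of_poly (q n) * H3) n = 0"
  define b where "b = eval_fps B a"
  define D where "D = (\<lambda>k. \<Sum>i<k. \<delta> i)"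
  have "summable \<delta>"
    by (rule summable_comparison_test'[where g = "\<lambda>k. C / (1 - t) * t ^ k" and N = 0])
       (use \<delta> t in \<open>auto intro!: summable_mult summable_geometric\<close>)
  hence D: "D \<longlonglongrightarrow> suminf \<delta>" unfolding D_def by (rule summable_LIMSEQ)
  have D': "(\<lambda>n. D (Suc (n - i))) \<longlonglongrightarrow> suminf \<delta>" for i
    by (rule LIMSEQ_offset[where k = i]) (use LIMSEQ_Suc[OF D] in simp)
  have H3k: "a ^ Suc (Suc k) * fps_nth H3 k = of_nat (Suc k) * b - D (Suc k)" for k
  proof -
    have "a * (a ^ Suc k * fps_nth H3 k) = - (\<Sum>i\<le>k. a ^ Suc i * fps_nth H2 i)"
      unfolding partial[of k H3] H3 by (simp add: sum_distrib_left mult_ac)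
    also have "\<dots> = - (\<Sum>i\<le>k. \<delta> i - b)" by (simp add: \<delta>_def b_def)
    also have "\<dots> = of_nat (Suc k) * b - D (Suc k)" by (simp add: sum_subtractf D_def lessThan_Suc_atMost)
    finally show ?thesis by (simp only: power_Suc mult.assoc)
  qed
  \<comment> \<open>In the limit the first term vanishes by \<open>nq\<close>, the last one tends to
    \<open>suminf \<delta> * poly Q a = 0\<close>, and the middle one leaves
    \<open>b * a * poly (pderiv Q) a = 0\<close>.\<close>
  have key3: "\<forall>\<^sub>F n in sequentially. b * (of_nat (Suc n) * poly (q n) a) - b * (\<Sum>i\<le>M. of_nat i * coeff (q n) i * a ^ i)
      - (\<Sum>i\<le>M. coeff (q n) i * a ^ i * D (Suc (n - i))) = 0"
    using deg(1) rec3 eventually_ge_at_top[of M]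
  proof eventually_elim
    case (elim n)
    have "0 = a ^ Suc (Suc n) * (\<Sum>i\<le>M. coeff (q n) i * fps_nth H3 (n - i))" using elim coeff_sum[of n H3] by simp
    also have "\<dots> = (\<Sum>i\<le>M. coeff (q n) i * a ^ i * ((of_nat (Suc n) - of_nat i) * b - D (Suc (n - i))))"
      unfolding sum_distrib_left
    proof (rule sum.cong[OF refl])
      fix i assume "i \<in> {..M}"
      hence i: "i \<le> n" using elim by simp
      have "a ^ Suc (Suc n) = a ^ i * a ^ Suc (Suc (n - i))" using i by (simp add: power_add[symmetric])
      hence "a ^ Suc (Suc n) * (coeff (q n) i * fps_nth H3 (n - i)) = coeff (q n) i * a ^ i * (a ^ Suc (Suc (n - i)) * fps_nth H3 (n - i))"
        by (simp only: mult_ac)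
      also have "\<dots> = coeff (q n) i * a ^ i * (of_nat (Suc (n - i)) * b - D (Suc (n - i)))" by (simp only: H3k)
      also have "of_nat (Suc (n - i)) = (of_nat (Suc n) - of_nat i :: complex)" using i by (simp add: of_nat_diff)
      finally show "a ^ Suc (Suc n) * (coeff (q n) i * fps_nth H3 (n - i)) = coeff (q n) i * a ^ i * ((of_nat (Suc n) - of_nat i) * b - D (Suc (n - i)))" .
    qed
    also have "\<dots> = b * (of_nat (Suc n) * (\<Sum>i\<le>M. coeff (q n) i * a ^ i)) - b * (\<Sum>i\<le>M. of_nat i * coeff (q n) i * a ^ i)
      - (\<Sum>i\<le>M. coeff (q n) i * a ^ i * D (Suc (n - i)))"
      unfolding sum_distrib_left sum_subtractf[symmetric] by (rule sum.cong) (auto simp: algebra_simps)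
    also have "(\<Sum>i\<le>M. coeff (q n) i * a ^ i) = poly (q n) a" using elim by (simp add: poly_altdef)
    finally show ?case by simp
  qed
  have "(\<lambda>n. b * (of_nat (Suc n) * poly (q n) a) - b * (\<Sum>i\<le>M. of_nat i * coeff (q n) i * a ^ i)
      - (\<Sum>i\<le>M. coeff (q n) i * a ^ i * D (Suc (n - i)))) \<longlonglongrightarrow>
      b * 0 - b * (\<Sum>i\<le>M. of_nat i * coeff Q i * a ^ i) - (\<Sum>i\<le>M. coeff Q i * a ^ i * suminf \<delta>)"
    by (intro tendsto_intros nq lim D')
  moreover have "(\<Sum>i\<le>M. coeff Q i * a ^ i * suminf \<delta>) = 0"
    unfolding sum_distrib_right[symmetric] using Qa deg(2) by (simp add: poly_altdef)
  moreover have "(\<Sum>i\<le>M. of_nat i * coeff Q i * a ^ i) = a * poly (pderiv Q) a"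
  proof -
    have "poly (pderiv Q) a = (\<Sum>i<M. coeff (pderiv Q) i * a ^ i)"
    proof (cases "M = 0")
      case True thus ?thesis using deg(2) using pderiv_eq_0_iff[of Q] by simp
    next
      case False
      have "degree (pderiv Q) = M - 1" using deg(2) by (simp add: degree_pderiv)
      moreover have "{..M - 1} = {..<M}" using False by auto
      ultimately show ?thesis by (simp add: poly_altdef)
    qed
    hence "a * poly (pderiv Q) a = (\<Sum>i<M. of_nat (Suc i) * coeff Q (Suc i) * a ^ Suc i)"
      by (simp add: coeff_pderiv sum_distrib_left mult_ac)
    also have "\<dots> = (\<Sum>i<Suc M. of_nat i * coeff Q i * a ^ i)" by (subst sum.lessThan_Suc_shift) simp
    finally show ?thesis by (simp only: lessThan_Suc_atMost)
  qed
  ultimately have "(\<lambda>n. b * (of_nat (Suc n) * poly (q n) a) - b * (\<Sum>i\<le>M. of_nat i * coeff (q n) i * a ^ i)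
      - (\<Sum>i\<le>M. coeff (q n) i * a ^ i * D (Suc (n - i)))) \<longlonglongrightarrow> - (b * (a * poly (pderiv Q) a))" by simp
  hence "(\<lambda>n. 0) \<longlonglongrightarrow> - (b * (a * poly (pderiv Q) a))" by (rule Lim_transform_eventually[OF _ key3])
  hence "b * (a * poly (pderiv Q) a) = 0" by (simp add: LIMSEQ_const_iff)
  thus "poly (pderiv Q) a = 0" using a by (simp add: b_def)
qed

lemma uniformly_bounded_coeffs:
  fixes q :: "nat \<Rightarrow> complex poly"
  assumes "\<And>i. (\<lambda>n. coeff (q n) i) \<longlonglongrightarrow> coeff Q i"
  shows "\<exists>K>0. \<forall>n. \<forall>i\<le>M. norm (coeff (q n) i) \<le> K"
proof -
  have "\<exists>K>0. \<forall>n. norm (coeff (q n) i) \<le> K" for i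
    using convergent_imp_Bseq[OF convergentI[OF assms[of i]]] by (auto simp: Bseq_def)
  then obtain K where K: "\<And>i. 0 < K i" "\<And>i n. norm (coeff (q n) i) \<le> K i" by metis
  have "norm (coeff (q n) i) \<le> (\<Sum>i\<le>M. K i)" if "i \<le> M" for n i
    using K(2)[of n i] member_le_sum[of i "{..M}" K] that K(1) by (force intro: less_imp_le)
  moreover have "0 < (\<Sum>i\<le>M. K i)" by (intro sum_pos K(1)) auto
  ultimately show ?thesis by blast
qed

text \<open>The constant coefficients of \<open>q n\<close> eventually stay away from 0, so the
  recurrence can be solved for the newest coefficient and gives at most geometric growth.\<close>

lemma recurrence_conv_radius_pos:
  fixes q :: "nat \<Rightarrow> complex poly" and F :: "complex fps"
  assumes lim: "\<And>i. (\<lambda>n. coeff (q n) i) \<longlonglongrightarrow> coeff Q i"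
    and deg: "\<forall>\<^sub>F n in sequentially. degree (q n) = M"
    and Q0: "poly Q 0 \<noteq> 0"
    and rec: "\<forall>\<^sub>F n in sequentially. fps_nth (fps_of_poly (q n) * F) n = 0"
  shows "0 < fps_conv_radius F"
proof -
  obtain K where K: "0 < K" "\<And>n i. i \<le> M \<Longrightarrow> norm (coeff (q n) i) \<le> K" using uniformly_bounded_coeffs[of q Q M, OF lim] by blast
  define c where "c = norm (coeff Q 0) / 2"
  have c: "0 < c" using Q0 by (simp add: c_def poly_0_coeff_0)
  have "\<forall>\<^sub>F n in sequentially. c < norm (coeff (q n) 0)"
    by (rule order_tendstoD(1)[OF tendsto_norm[OF lim]]) (use c in \<open>simp add: c_def\<close>)
  hence "\<forall>\<^sub>F n in sequentially. degree (q n) = M \<and> c < norm (coeff (q n) 0) \<and> fps_nth (fps_of_poly (q n) * F) n = 0 \<and> Suc M \<le> n"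
    using deg rec eventually_ge_at_top[of "Suc M"] by eventually_elim auto
  then obtain N where N: "\<And>n. N \<le> n \<Longrightarrow> degree (q n) = M" "\<And>n. N \<le> n \<Longrightarrow> c < norm (coeff (q n) 0)"
      "\<And>n. N \<le> n \<Longrightarrow> fps_nth (fps_of_poly (q n) * F) n = 0" "\<And>n. N \<le> n \<Longrightarrow> Suc M \<le> n"
    unfolding eventually_sequentially by blast
  define L where "L = 1 + real M * K / c"
  have L: "1 \<le> L" "real M * K \<le> L * c" using K(1) c by (auto simp: L_def field_simps)
  define B where "B = (\<Sum>n<N. norm (fps_nth F n))"
  have B0: "0 \<le> B" by (simp add: B_def sum_nonneg)
  have bd: "norm (fps_nth F n) \<le> B * L ^ n" for n
  proof (induction n rule: less_induct)
    case (less n)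
    show ?case
    proof (cases "n < N")
      case True
      have "norm (fps_nth F n) \<le> B" unfolding B_def by (rule member_le_sum) (use True in auto)
      also have "\<dots> \<le> B * L ^ n" using mult_left_mono[OF one_le_power[OF L(1)] B0, of n] by simp
      finally show ?thesis .
    next
      case False
      hence n: "N \<le> n" by simp
      have Mn: "Suc M \<le> n" by (rule N(4)[OF n])
      have "{..M} = insert 0 {1..M}" by auto
      hence "(\<Sum>i\<le>M. coeff (q n) i * fps_nth F (n - i)) = coeff (q n) 0 * fps_nth F n + (\<Sum>i=1..M. coeff (q n) i * fps_nth F (n - i))"
        by simp
      hence "coeff (q n) 0 * fps_nth F n = - (\<Sum>i=1..M. coeff (q n) i * fps_nth F (n - i))"
        using fps_nth_poly_mult_degree[OF N(1)[OF n], of n F] N(3)[OF n] Mn by (simp add: eq_neg_iff_add_eq_0)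
      hence "norm (coeff (q n) 0) * norm (fps_nth F n) = norm (\<Sum>i=1..M. coeff (q n) i * fps_nth F (n - i))"
        by (metis norm_minus_cancel norm_mult)
      also have "\<dots> \<le> (\<Sum>i=1..M. K * (B * L ^ (n - 1)))"
      proof (rule sum_norm_le)
        fix i assume i: "i \<in> {1..M}"
        have "norm (fps_nth F (n - i)) \<le> B * L ^ (n - i)" by (rule less.IH) (use i Mn in auto)
        also have "\<dots> \<le> B * L ^ (n - 1)" by (intro mult_left_mono power_increasing B0) (use i L in auto)
        finally show "norm (coeff (q n) i * fps_nth F (n - i)) \<le> K * (B * L ^ (n - 1))"
          unfolding norm_mult by (intro mult_mono K(2)) (use i K(1) in auto)
      qed
      also have "\<dots> = (real M * K) * (B * L ^ (n - 1))" by simp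
      also have "\<dots> \<le> (L * c) * (B * L ^ (n - 1))" using B0 L by (intro mult_right_mono) auto
      also have "\<dots> = c * (B * L ^ Suc (n - 1))" by simp
      also have "Suc (n - 1) = n" using Mn by simp
      finally have "norm (coeff (q n) 0) * norm (fps_nth F n) \<le> c * (B * L ^ n)" .
      moreover have "c * norm (fps_nth F n) \<le> norm (coeff (q n) 0) * norm (fps_nth F n)"
        using N(2)[OF n] by (intro mult_right_mono) auto
      ultimately have "c * norm (fps_nth F n) \<le> c * (B * L ^ n)" by linarith
      thus ?thesis using c by simp
    qed
  qed
  have "ereal (1 / L) \<le> fps_conv_radius F"
  proof (rule fps_conv_radius_geI[where B = B])
    show "0 < 1 / L" using L by simp
    fix k show "norm (fps_nth F k) * (1 / L) ^ k \<le> B"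
      using bd[of k] L by (simp add: power_divide divide_le_eq)
  qed
  moreover have "0 < ereal (1 / L)" using L by simp
  ultimately show ?thesis by order
qed

text \<open>
  Solving the recurrence backwards bounds each coefficient by the following \<open>M\<close> ones, while the
  coefficients of an entire series decay faster than any geometric sequence.
\<close>

lemma entire_recurrence_eventually_zero:
  fixes q :: "nat \<Rightarrow> complex poly" and H :: "complex fps"
  assumes lim: "\<And>i. (\<lambda>n. coeff (q n) i) \<longlonglongrightarrow> coeff Q i"
    and monic: "\<forall>\<^sub>F n in sequentially. degree (q n) = M \<and> lead_coeff (q n) = 1"
    and entire: "fps_conv_radius H = \<infinity>"
    and rec: "\<forall>\<^sub>F n in sequentially. fps_nth (fps_of_poly (q n) * H) n = 0"
  shows "\<forall>\<^sub>F k in sequentially. fps_nth H k = 0"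
proof -
  obtain K where K: "0 < K" "\<And>n i. i \<le> M \<Longrightarrow> norm (coeff (q n) i) \<le> K" using uniformly_bounded_coeffs[of q Q M, OF lim] by blast
  obtain N where N: "\<And>n. N \<le> n \<Longrightarrow> degree (q n) = M" "\<And>n. N \<le> n \<Longrightarrow> coeff (q n) M = 1"
      "\<And>n. N \<le> n \<Longrightarrow> fps_nth (fps_of_poly (q n) * H) n = 0"
    using eventually_conj[OF monic rec] unfolding eventually_sequentially by blast
  \<comment> \<open>Each coefficient is a combination of \<open>M\<close> later ones with factors at
    most \<open>K\<close>, so at this scale one backward step halves any bound valid for all late
    coefficients; iteration makes the bound 0.\<close>
  define \<rho> where "\<rho> = 1 + 2 * K * real M"
  have \<rho>: "1 \<le> \<rho>" "2 * K * real M \<le> \<rho>" using K(1) by (auto simp: \<rho>_def)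
  obtain B where B: "\<And>k. norm (fps_nth H k) * \<rho> ^ k \<le> B" using fps_coeffs_bounded[of \<rho> H] \<rho> entire by auto
  have B0: "0 \<le> B" using B[of 0] by (simp add: order_trans[OF norm_ge_zero])
  have half: "norm (fps_nth H k) * \<rho> ^ k \<le> B / 2 ^ l" if "N \<le> k" for k l
    using that
  proof (induction l arbitrary: k)
    case 0 thus ?case using B by simp
  next
    case (Suc l)
    define n where "n = k + M"
    have n: "N \<le> n" using Suc.prems by (simp add: n_def)
    have "(\<Sum>i\<le>M. coeff (q n) i * fps_nth H (n - i)) = (\<Sum>i<M. coeff (q n) i * fps_nth H (n - i)) + coeff (q n) M * fps_nth H (n - M)"
      unfolding lessThan_Suc_atMost[symmetric] by simp
    hence "fps_nth H k + (\<Sum>i<M. coeff (q n) i * fps_nth H (n - i)) = 0"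
      using fps_nth_poly_mult_degree[OF N(1)[OF n], of n H] N(2,3)[OF n] by (simp add: n_def add.commute)
    hence "norm (fps_nth H k) = norm (\<Sum>i<M. coeff (q n) i * fps_nth H (n - i))"
      by (metis add_eq_0_iff norm_minus_cancel)
    hence "norm (fps_nth H k) * \<rho> ^ Suc k = norm (\<Sum>i<M. coeff (q n) i * fps_nth H (n - i)) * \<rho> ^ Suc k" by simp
    also have "\<dots> \<le> (\<Sum>i<M. K * (B / 2 ^ l))"
      unfolding norm_mult[symmetric]
    proof -
      have "norm (\<Sum>i<M. coeff (q n) i * fps_nth H (n - i)) * \<rho> ^ Suc k \<le> (\<Sum>i<M. norm (coeff (q n) i * fps_nth H (n - i))) * \<rho> ^ Suc k"
        by (intro mult_right_mono norm_sum) (use \<rho> in auto)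
      also have "\<dots> = (\<Sum>i<M. norm (coeff (q n) i * fps_nth H (n - i)) * \<rho> ^ Suc k)" by (rule sum_distrib_right)
      also have "\<dots> \<le> (\<Sum>i<M. K * (B / 2 ^ l))"
      proof (rule sum_mono)
        fix i assume i: "i \<in> {..<M}"
        have "norm (fps_nth H (n - i)) * \<rho> ^ Suc k \<le> norm (fps_nth H (n - i)) * \<rho> ^ (n - i)"
          by (intro mult_left_mono power_increasing) (use i \<rho> in \<open>auto simp: n_def\<close>)
        also have "\<dots> \<le> B / 2 ^ l" by (rule Suc.IH) (use i Suc.prems in \<open>auto simp: n_def\<close>)
        finally have "norm (coeff (q n) i) * (norm (fps_nth H (n - i)) * \<rho> ^ Suc k) \<le> K * (B / 2 ^ l)"
          by (intro mult_mono K(2)) (use i K(1) \<rho> in auto)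
        thus "norm (coeff (q n) i * fps_nth H (n - i)) * \<rho> ^ Suc k \<le> K * (B / 2 ^ l)"
          by (simp only: norm_mult mult.assoc)
      qed
      finally show "norm (\<Sum>i<M. coeff (q n) i * fps_nth H (n - i)) * \<rho> ^ Suc k \<le> (\<Sum>i<M. K * (B / 2 ^ l))" .
    qed
    also have "\<dots> = (2 * K * real M) * (B / 2 ^ Suc l)" by simp
    also have "\<dots> \<le> \<rho> * (B / 2 ^ Suc l)" by (intro mult_right_mono \<rho>) (use B0 in auto)
    finally have "\<rho> * (norm (fps_nth H k) * \<rho> ^ k) \<le> \<rho> * (B / 2 ^ Suc l)" by (simp only: power_Suc mult_ac)
    thus ?case using \<rho>(1) by (simp only: mult_le_cancel_left_pos)
  qed
  have "fps_nth H k = 0" if "N \<le> k" for k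
  proof -
    have "(\<lambda>l. B * (1 / 2) ^ l) \<longlonglongrightarrow> B * 0" by (intro tendsto_mult tendsto_const LIMSEQ_power_zero) simp
    moreover have "norm (fps_nth H k) * \<rho> ^ k \<le> B * (1 / 2) ^ l" for l using half[OF that, of l] by (simp add: power_divide)
    ultimately have "norm (fps_nth H k) * \<rho> ^ k \<le> B * 0" by (intro LIMSEQ_le_const) auto
    moreover have "0 < \<rho> ^ k" using \<rho> by (intro zero_less_power) linarith
    ultimately show ?thesis by (metis mult_zero_right norm_le_zero_iff not_less zero_less_mult_iff zero_less_norm_iff)
  qed
  thus ?thesis unfolding eventually_sequentially by blast
qed


section \<open>Meromorphic extensions and polynomial multipliers\<close>

lemma has_fps_expansion_poly: "poly p has_fps_expansion fps_of_poly (p :: complex poly)"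
  unfolding has_fps_expansion_def by simp

text \<open>Cancelling \<open>v\<close> among formal series identifies the Taylor series of
  \<open>g\<close> at 0 with \<open>H\<close>.\<close>

lemma fps_conv_radius_quotient:
  fixes H G :: "complex fps"
  assumes v: "v \<noteq> 0" "G = fps_of_poly v * H" and g: "g holomorphic_on eball 0 \<rho>" "0 < \<rho>" "\<rho> \<le> fps_conv_radius G"
    and eq: "\<And>z. z \<in> eball 0 \<rho> \<Longrightarrow> poly v z * g z = eval_fps G z"
  shows "\<rho> \<le> fps_conv_radius H"
proof -
  have 0: "0 \<in> eball 0 \<rho>" using g(2) by (simp add: zero_ereal_def)
  hence "g analytic_on {0}" using g(1) analytic_at open_eball by blast
  hence e: "g has_fps_expansion fps_expansion g 0" by (rule analytic_at_imp_has_fps_expansion_0)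
  have "(\<lambda>z. poly v z * g z) has_fps_expansion fps_of_poly v * fps_expansion g 0"
    by (intro has_fps_expansion_mult has_fps_expansion_poly e)
  moreover have "(\<lambda>z. poly v z * g z) has_fps_expansion fps_of_poly v * H"
  proof -
    have "eval_fps G has_fps_expansion G" using g(2,3) by (intro eval_fps_has_fps_expansion) order
    moreover have "eventually (\<lambda>z. poly v z * g z = eval_fps G z) (nhds 0)"
      using eventually_nhds_in_open[OF open_eball 0] by eventually_elim (rule eq)
    ultimately show ?thesis unfolding v(2) by (subst has_fps_expansion_cong[OF _ refl])
  qed
  ultimately have "fps_of_poly v * fps_expansion g 0 = fps_of_poly v * H" by (rule fps_expansion_unique_complex)
  hence "fps_expansion g 0 = H" using v(1) by simp
  thus ?thesis using holomorphic_on_imp_fps_conv_radius_ge[OF e g(1)] by simp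
qed

lemma fps_conv_radius_divide_linear:
  fixes H G :: "complex fps"
  assumes G: "G = fps_of_poly [:- a, 1:] * H" "0 < \<rho>" "\<rho> \<le> fps_conv_radius G"
    and a: "ereal (norm a) < \<rho> \<Longrightarrow> eval_fps G a = 0"
  shows "\<rho> \<le> fps_conv_radius H"
proof -
  have hG: "eval_fps G holomorphic_on eball 0 \<rho>" by (intro holomorphic_on_eval_fps eball_mono G)
  show ?thesis
  proof (cases "ereal (norm a) < \<rho>")
    case True
    show ?thesis
    proof (rule fps_conv_radius_quotient[OF _ G(1) pole_lemma_open[OF hG open_eball, of a] G(2,3)])
      fix z :: complex assume z: "z \<in> eball 0 \<rho>"
      show "poly [:- a, 1:] z * (if z = a then deriv (eval_fps G) a else (eval_fps G z - eval_fps G a) / (z - a)) = eval_fps G z"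
        using a[OF True] by auto
    qed simp
  next
    case False
    show ?thesis
    proof (rule fps_conv_radius_quotient[OF _ G(1) _ G(2,3)])
      show "(\<lambda>z. eval_fps G z / (z - a)) holomorphic_on eball 0 \<rho>"
        using False by (intro holomorphic_intros hG) auto
      fix z :: complex assume z: "z \<in> eball 0 \<rho>"
      hence "z \<noteq> a" using False by auto
      thus "poly [:- a, 1:] z * (eval_fps G z / (z - a)) = eval_fps G z" by simp
    qed simp
  qed
qed

text \<open>Dividing \<open>w\<close> by \<open>z - a\<close> must lose convergence, which is
  possible only if \<open>a\<close> lies in the disk and \<open>w * F\<close> does not vanish there.
  The quotients of \<open>w\<close> by \<open>z - a\<close> and, for a multiple zero, by its square
  still satisfy the recurrence, so \<open>pole_is_simple_zero\<close> applies, and a multiple zero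
  would contradict the simplicity of the zeros of \<open>Q\<close>.\<close>

lemma minimal_multiplier_zeros:
  fixes q :: "nat \<Rightarrow> complex poly" and Q w :: "complex poly" and F :: "complex fps"
  assumes lim: "\<And>i. (\<lambda>n. coeff (q n) i) \<longlonglongrightarrow> coeff Q i"
    and deg: "\<forall>\<^sub>F n in sequentially. degree (q n) = degree Q"
    and simple: "\<And>z. poly Q z = 0 \<Longrightarrow> poly (pderiv Q) z \<noteq> 0"
    and rec: "\<And>v. degree v \<le> J \<Longrightarrow> \<forall>\<^sub>F n in sequentially. fps_nth (fps_of_poly (q n) * (fps_of_poly v * F)) n = 0"
    and w: "w \<noteq> 0" "degree w \<le> J" "0 < \<rho>" "\<rho> \<le> fps_conv_radius (fps_of_poly w * F)"
    and minimal: "\<And>v. v \<noteq> 0 \<Longrightarrow> degree v < degree w \<Longrightarrow> \<not> \<rho> \<le> fps_conv_radius (fps_of_poly v * F)"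
    and a: "poly w a = 0"
  shows "a \<noteq> 0 \<and> ereal (norm a) < \<rho> \<and> eval_fps (fps_of_poly w * F) a \<noteq> 0 \<and> poly Q a = 0 \<and> order a w = 1"
proof -
  obtain u where u: "w = [:- a, 1:] * u" using a by (auto simp: poly_eq_0_iff_dvd dvd_def)
  have u0: "u \<noteq> 0" using w(1) u by auto
  hence du: "degree w = Suc (degree u)" unfolding u by (subst degree_mult_eq) auto
  have eq: "fps_of_poly [:- a, 1:] * (fps_of_poly u * F) = fps_of_poly w * F"
    unfolding u fps_of_poly_mult by (simp only: mult.assoc)
  have na: "\<not> (ereal (norm a) < \<rho> \<longrightarrow> eval_fps (fps_of_poly w * F) a = 0)"
    using fps_conv_radius_divide_linear[OF eq[symmetric] w(3,4)] minimal[OF u0] du by auto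
  hence a1: "ereal (norm a) < \<rho>" "eval_fps (fps_of_poly w * F) a \<noteq> 0" by auto
  have a0: "a \<noteq> 0"
  proof
    assume "a = 0"
    hence "eval_fps (fps_of_poly w * F) a = 0" unfolding eq[symmetric] by (simp add: eval_fps_at_0)
    thus False using a1 by simp
  qed
  have a2: "ereal (norm a) < fps_conv_radius (fps_of_poly w * F)" using a1(1) w(4) by order
  note psz = pole_is_simple_zero[OF lim deg refl a0 a2 a1(2) eq]
  have rec2: "\<forall>\<^sub>F n in sequentially. fps_nth (fps_of_poly (q n) * (fps_of_poly u * F)) n = 0"
    by (rule rec) (use du w(2) in simp)
  have Qa: "poly Q a = 0" by (rule psz(1)[OF rec2])
  have "poly u a \<noteq> 0"
  proof
    assume "poly u a = 0"
    then obtain v where v: "u = [:- a, 1:] * v" by (auto simp: poly_eq_0_iff_dvd dvd_def)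
    have "v \<noteq> 0" using u0 v by auto
    hence "degree u = Suc (degree v)" unfolding v by (subst degree_mult_eq) auto
    hence "\<forall>\<^sub>F n in sequentially. fps_nth (fps_of_poly (q n) * (fps_of_poly v * F)) n = 0"
      by (intro rec) (use du w(2) in simp)
    moreover have "fps_of_poly [:- a, 1:] * (fps_of_poly v * F) = fps_of_poly u * F"
      unfolding v fps_of_poly_mult by (simp only: mult.assoc)
    ultimately have "poly (pderiv Q) a = 0" using psz(2)[OF rec2] by blast
    thus False using simple[OF Qa] by simp
  qed
  hence "order a u = 0" by (rule order_0I)
  moreover have "order a [:- a, 1:] = 1" using order_power_n_n[of a 1] by simp
  moreover have "order a ([:- a, 1:] * u) = order a [:- a, 1:] + order a u" by (rule order_mult) (metis u w(1))
  ultimately have "order a w = 1" unfolding u by linarith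
  thus ?thesis using a0 a1 Qa by simp
qed


section \<open>Passing between polynomial multipliers and meromorphic extensions\<close>

lemma poly_analytic_on: "poly p analytic_on (A :: complex set)"
  by (rule analytic_on_subset[of _ UNIV]) (auto simp: analytic_on_open intro!: holomorphic_intros)

lemma quotient_pole:
  assumes A: "open A" "a \<in> A" and h: "h holomorphic_on A" "h a \<noteq> 0" and w: "w \<noteq> 0" "order a w = 1"
    and f: "\<And>z. z \<in> A \<Longrightarrow> f z = h z / poly w z"
  shows "is_pole f a" "zorder f a = -1"
proof -
  have w0: "w \<noteq> 0" and "poly w a = 0" using w order_root[of w a] by auto
  then obtain u where u: "w = [:- a, 1:] * u" by (auto simp: poly_eq_0_iff_dvd dvd_def)
  have "u \<noteq> 0" using w0 u by auto
  have "poly u a \<noteq> 0"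
  proof
    assume "poly u a = 0"
    hence "[:- a, 1:] ^ 2 dvd w" unfolding u power2_eq_square by (intro mult_dvd_mono) (auto simp: poly_eq_0_iff_dvd)
    hence "2 \<le> order a w" using w0 by (simp add: order_divides)
    thus False using w by simp
  qed
  define B where "B = A - {z. poly u z = 0}"
  have "closed {z. poly u z = 0}" using poly_roots_finite[OF \<open>u \<noteq> 0\<close>] by (rule finite_imp_closed)
  hence B: "open B" "a \<in> B" using A \<open>poly u a \<noteq> 0\<close> by (auto simp: B_def open_Diff)
  have hol: "(\<lambda>z. h z / poly u z) holomorphic_on B"
    by (intro holomorphic_intros holomorphic_on_subset[OF h(1)]) (auto simp: B_def)
  have eq: "f z = (h z / poly u z) * (z - a) powi (-1)" if "z \<in> B" "z \<noteq> a" for z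
    using that f[of z] by (simp add: B_def u field_simps power_int_minus)
  show z: "zorder f a = -1"
    by (rule zorder_eqI[OF B hol]) (use h(2) \<open>poly u a \<noteq> 0\<close> eq in auto)
  have "is_pole (\<lambda>z. (h z / poly u z) / (z - a) ^ 1) a"
    by (rule is_pole_basic[OF hol B]) (use h(2) \<open>poly u a \<noteq> 0\<close> in auto)
  moreover have "\<forall>\<^sub>F z in at a. (h z / poly u z) / (z - a) ^ 1 = f z"
    using eventually_at_in_open[OF B] by eventually_elim (auto simp: eq power_int_minus divide_inverse)
  ultimately show "is_pole f a" by (rule is_pole_transform) simp
qed

lemma mero_extension_of_multiplier:
  assumes w: "w \<noteq> 0" "degree w \<le> J" and \<rho>: "0 < \<rho>" "\<rho> \<le> fps_conv_radius (fps_of_poly w * F)"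
    and F: "0 < fps_conv_radius F"
    and z: "\<And>a. poly w a = 0 \<Longrightarrow> a \<noteq> 0 \<and> ereal (norm a) < \<rho> \<and> eval_fps (fps_of_poly w * F) a \<noteq> 0 \<and> order a w = 1"
  shows "mero_extension F (eball 0 \<rho>) J (\<lambda>z. eval_fps (fps_of_poly w * F) z / poly w z)"
proof -
  define h where "h = eval_fps (fps_of_poly w * F)"
  define g where "g = (\<lambda>z. h z / poly w z)"
  have hol: "h holomorphic_on eball 0 \<rho>" unfolding h_def by (intro holomorphic_on_eval_fps eball_mono \<rho>)
  have pole: "is_pole g a" "zorder g a = -1" if "poly w a = 0" for a
    using quotient_pole[OF open_eball _ hol _ w(1), of a g] z[OF that] by (auto simp: g_def h_def)
  have an: "g analytic_on {a}" if "a \<in> eball 0 \<rho>" "poly w a \<noteq> 0" for a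
    unfolding g_def by (intro analytic_intros poly_analytic_on analytic_on_subset[OF hol[folded analytic_on_open[OF open_eball]]]) (use that in auto)
  have iff: "is_pole g a \<longleftrightarrow> poly w a = 0" if "a \<in> eball 0 \<rho>" for a
    using pole an[OF that] analytic_at_imp_no_pole by blast
  have P: "{a \<in> eball 0 \<rho>. is_pole g a} = {a. poly w a = 0}" using iff z by auto
  have "g nicely_meromorphic_on eball 0 \<rho>"
  proof (rule nicely_meromorphic_onI_open)
    show "g analytic_on eball 0 \<rho> - {a. poly w a = 0}"
      using an by (subst analytic_on_analytic_at) auto
    \<comment> \<open>Division by zero gives \<open>g\<close> the value 0 at its poles that
      \<open>nicely_meromorphic_on\<close> demands.\<close>
    show "is_pole g a \<and> g a = 0" if "a \<in> {a. poly w a = 0}" for a using that pole by (auto simp: g_def)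
    fix a :: complex assume a: "a \<in> eball 0 \<rho>"
    define B where "B = eball 0 \<rho> - ({z. poly w z = 0} - {a})"
    have "open B" unfolding B_def by (intro open_Diff open_eball finite_imp_closed) (use poly_roots_finite[OF w(1)] in auto)
    moreover have "a \<in> B" using a by (auto simp: B_def)
    moreover have "g holomorphic_on B - {a}"
      unfolding g_def by (intro holomorphic_intros holomorphic_on_subset[OF hol]) (auto simp: B_def)
    ultimately show "isolated_singularity_at g a" by (meson isolated_singularity_at_holomorphic)
  qed auto
  moreover have "g has_fps_expansion F"
  proof -
    have w0: "poly w 0 \<noteq> 0" using z by blast
    have "\<forall>\<^sub>F z in nhds 0. eval_fps F z = g z"
    proof -
      have "\<forall>\<^sub>F z in nhds 0. z \<in> eball 0 (fps_conv_radius F)"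
        by (rule eventually_nhds_in_open) (use F in \<open>auto simp: zero_ereal_def\<close>)
      moreover have "\<forall>\<^sub>F z in nhds 0. z \<in> - {z. poly w z = 0}"
        by (rule eventually_nhds_in_open[OF open_Compl[OF finite_imp_closed[OF poly_roots_finite[OF w(1)]]]]) (use w0 in auto)
      ultimately show ?thesis by eventually_elim (simp add: g_def h_def eval_fps_poly_mult)
    qed
    thus ?thesis using eval_fps_has_fps_expansion[OF F] has_fps_expansion_cong[OF _ refl] by blast
  qed
  moreover have "(\<Sum>a | poly w a = 0. nat (- zorder g a)) \<le> J"
  proof -
    have "(\<Sum>a | poly w a = 0. nat (- zorder g a)) = card {a. poly w a = 0}" using pole by simp
    also have "\<dots> \<le> degree w" by (rule card_poly_roots_bound[OF w(1)])
    finally show ?thesis using w(2) by simp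
  qed
  ultimately show ?thesis
    unfolding mero_extension_def P using poly_roots_finite[OF w(1)] P by (simp add: g_def h_def)
qed

text \<open>The identity theorem gives equality on a punctured neighbourhood of every point of the
  disk; the value at the point is then determined too, as the limit or, at a pole, as 0.\<close>

lemma mero_extension_unique:
  assumes 1: "mero_extension F (eball 0 r) j g" and 2: "mero_extension F (eball 0 r) j' h" and z: "z \<in> eball 0 r"
  shows "g z = h z"
proof -
  let ?D = "eball 0 r :: complex set"
  have m: "g nicely_meromorphic_on ?D" "h nicely_meromorphic_on ?D" using 1 2 by (auto simp: mero_extension_def)
  have "0 < r" using z by (metis eball_empty empty_iff not_less)
  hence 0: "0 \<in> ?D" by (simp add: zero_ereal_def)
  have "\<forall>\<^sub>F z in nhds 0. g z - h z = 0"
    using 1 2 by (auto simp: mero_extension_def has_fps_expansion_def elim: eventually_elim2)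
  hence near: "\<forall>\<^sub>F z in at 0. g z - h z = 0" by (rule eventually_nhds_conv_at[THEN iffD1, THEN conjunct1])
  have "(\<lambda>z. g z - h z) meromorphic_on ?D"
    using m by (intro meromorphic_on_diff) (auto simp: nicely_meromorphic_on_def)
  from meromorphic_imp_constant_or_avoid[OF this open_eball connected_eball, of 0]
  have "eventually (\<lambda>z. g z - h z = 0) (cosparse ?D)"
  proof
    assume "eventually (\<lambda>z. g z - h z \<noteq> 0) (cosparse ?D)"
    hence "\<forall>\<^sub>F z in at 0. g z - h z \<noteq> 0" using 0 by (simp add: eventually_cosparse_open_eq)
    with near have "\<forall>\<^sub>F z in at (0::complex). False" by eventually_elim simp
    thus ?thesis by simp
  qed
  hence eq: "\<forall>\<^sub>F x in at z. g x = h x" using z by (simp add: eventually_cosparse_open_eq)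
  show ?thesis
  proof (cases "is_pole g z")
    case True
    hence "is_pole h z" using eq by (rule is_pole_transform) simp
    thus ?thesis using True m z by (metis is_pole_zero_at_nicely_mero)
  next
    case False
    have "\<not> is_pole h z" using False is_pole_cong[OF eq refl] by simp
    hence "g \<midarrow>z\<rightarrow> g z" "h \<midarrow>z\<rightarrow> h z" using False m z unfolding nicely_meromorphic_on_def by auto
    moreover have "h \<midarrow>z\<rightarrow> g z" using \<open>g \<midarrow>z\<rightarrow> g z\<close> tendsto_cong[OF eq] by simp
    ultimately show ?thesis using LIM_unique by blast
  qed
qed

text \<open>Clearing each pole with the power given by its order costs a total degree of at most
  \<open>j\<close>.\<close>

lemma multiplier_of_mero_extension:
  assumes g: "mero_extension F (eball 0 r) j g" and r: "0 < r"
  shows "\<exists>v. v \<noteq> 0 \<and> degree v \<le> j \<and> r \<le> fps_conv_radius (fps_of_poly v * F)"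
proof -
  define P where "P = {z \<in> eball 0 r. is_pole g z}"
  define n where "n = (\<lambda>z. nat (- zorder g z))"
  define v where "v = (\<Prod>z\<in>P. [:- z, 1:] ^ n z)"
  have P: "finite P" "(\<Sum>z\<in>P. n z) \<le> j" and nm: "g nicely_meromorphic_on eball 0 r" and e: "g has_fps_expansion F"
    using g by (auto simp: mero_extension_def P_def n_def)
  have v0: "v \<noteq> 0" using P by (simp add: v_def)
  have "degree v = (\<Sum>z\<in>P. degree ([:- z, 1:] ^ n z))" unfolding v_def by (rule degree_prod_eq_sum_degree) auto
  also have "\<dots> = (\<Sum>z\<in>P. n z)" by (intro sum.cong refl) (simp add: degree_linear_power)
  finally have dv: "degree v \<le> j" using P by simp
  define h where "h = (\<lambda>z. poly v z * g z)"
  have gan: "g analytic_on {z}" if "z \<in> eball 0 r" "z \<notin> P" for z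
    using nicely_meromorphic_on_imp_analytic_at[OF nm that(1)] that by (auto simp: P_def)
  have han: "h analytic_on {z}" if "z \<in> eball 0 r" "z \<notin> P" for z
    unfolding h_def by (intro analytic_intros poly_analytic_on gan that)
  have "remove_sings h analytic_on {a}" if a: "a \<in> eball 0 r" for a
  proof (cases "a \<in> P")
    case False
    have "h \<midarrow>a\<rightarrow> h a" using han[OF a False] by (intro isContD analytic_at_imp_isCont)
    thus ?thesis by (intro remove_sings_analytic_at isolated_singularity_at_analytic han a False)
  next
    case True
    define B where "B = eball 0 r - (P - {a})"
    have B: "open B" "a \<in> B" unfolding B_def using a P by (auto intro!: open_Diff finite_imp_closed)
    have hol: "g holomorphic_on B - {a}"
    proof -
      have "g analytic_on B - {a}" unfolding analytic_on_analytic_at[of g "B - {a}"] by (intro ballI gan) (auto simp: B_def)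
      thus ?thesis by (rule analytic_imp_holomorphic)
    qed
    have "h holomorphic_on B - {a}" unfolding h_def by (intro holomorphic_intros hol)
    hence iso: "isolated_singularity_at h a" using B by (meson isolated_singularity_at_holomorphic)
    have pole: "is_pole g a" using True by (simp add: P_def)
    obtain s where s: "s > 0" "zor_poly g a holomorphic_on cball a s"
        "\<And>x. x \<in> cball a s - {a} \<Longrightarrow> g x = zor_poly g a x / (x - a) ^ n a"
      using zorder_exist_pole[OF hol B pole] unfolding n_def by blast
    define u where "u = (\<Prod>z\<in>P - {a}. [:- z, 1:] ^ n z)"
    have vu: "v = [:- a, 1:] ^ n a * u" unfolding v_def u_def using P True by (simp add: prod.remove)
    have "isCont (zor_poly g a) a"
      using s holomorphic_on_imp_continuous_on[OF s(2)] by (intro continuous_on_interior[of "cball a s"]) auto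
    hence "(\<lambda>z. poly u z * zor_poly g a z) \<midarrow>a\<rightarrow> poly u a * zor_poly g a a"
      by (intro tendsto_mult isContD) (auto intro: continuous_intros)
    moreover have "\<forall>\<^sub>F z in at a. poly u z * zor_poly g a z = h z"
    proof (rule eventually_mono[OF eventually_at_in_open[OF open_ball, of a a s]])
      show "a \<in> ball a s" using s(1) by simp
    next
      fix z assume z: "z \<in> ball a s - {a}"
      hence "z \<in> cball a s - {a}" by auto
      hence "zor_poly g a z = g z * (z - a) ^ n a" using s(3) by simp
      moreover have "poly v z = poly u z * (z - a) ^ n a" unfolding vu by simp
      ultimately show "poly u z * zor_poly g a z = h z" by (simp add: h_def)
    qed
    ultimately have "h \<midarrow>a\<rightarrow> poly u a * zor_poly g a a" by (rule Lim_transform_eventually)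
    thus ?thesis by (rule remove_sings_analytic_at[OF iso])
  qed
  hence "remove_sings h analytic_on eball 0 r" by (subst analytic_on_analytic_at) blast
  hence hol: "remove_sings h holomorphic_on eball 0 r" by (rule analytic_imp_holomorphic)
  have "remove_sings h has_fps_expansion fps_of_poly v * F"
  proof -
    have he: "h has_fps_expansion fps_of_poly v * F"
      unfolding h_def by (intro has_fps_expansion_mult has_fps_expansion_poly e)
    have "0 \<notin> P" using has_fps_expansion_imp_analytic_0[OF e] analytic_at_imp_no_pole by (auto simp: P_def)
    have "\<forall>\<^sub>F z in nhds 0. z \<in> eball 0 r - P"
      by (rule eventually_nhds_in_open) (use r P \<open>0 \<notin> P\<close> in \<open>auto simp: zero_ereal_def intro!: open_Diff finite_imp_closed\<close>)
    hence "\<forall>\<^sub>F z in nhds 0. h z = remove_sings h z" by eventually_elim (use han in simp)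
    thus ?thesis using he has_fps_expansion_cong[OF _ refl] by blast
  qed
  from holomorphic_on_imp_fps_conv_radius_ge[OF this hol] show ?thesis using v0 dv by blast
qed

lemma degree_diff_less_monic:
  fixes u v :: "complex poly"
  assumes "degree u = degree v" "lead_coeff u = 1" "lead_coeff v = 1" "u \<noteq> v"
  shows "degree (u - v) < degree v"
proof -
  have "coeff (u - v) (degree v) = 0" using assms by simp
  moreover have "lead_coeff (u - v) \<noteq> 0" using assms(4) by (simp del: coeff_diff)
  ultimately have "degree (u - v) \<noteq> degree v" by metis
  moreover have "degree (u - v) \<le> degree v" using degree_diff_le_max[of u v] assms(1) by simp
  ultimately show ?thesis by simp
qed

text \<open>
  The minimal monic multipliers for radii below \<^term>\<open>mero_radius J F\<close> are eventually the same
  polynomial, since the difference of two of them would have smaller degree. Hence the supremum is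
  attained.
\<close>

lemma mero_radius_multiplier:
  fixes q :: "nat \<Rightarrow> complex poly" and Q :: "complex poly" and F :: "complex fps"
  assumes lim: "\<And>i. (\<lambda>n. coeff (q n) i) \<longlonglongrightarrow> coeff Q i"
    and monic: "\<forall>\<^sub>F n in sequentially. degree (q n) = degree Q \<and> lead_coeff (q n) = 1"
    and Q0: "poly Q 0 \<noteq> 0"
    and simple: "\<And>z. poly Q z = 0 \<Longrightarrow> poly (pderiv Q) z \<noteq> 0"
    and rec: "\<And>v. degree v \<le> J \<Longrightarrow> \<forall>\<^sub>F n in sequentially. fps_nth (fps_of_poly (q n) * (fps_of_poly v * F)) n = 0"
    and nz: "\<And>v. v \<noteq> 0 \<Longrightarrow> degree v \<le> J \<Longrightarrow> \<not> (\<forall>\<^sub>F k in sequentially. fps_nth (fps_of_poly v * F) k = 0)"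
  shows "\<exists>R w. 0 < R \<and> mero_radius J F = ereal R \<and> 0 < fps_conv_radius F \<and>
    w \<noteq> 0 \<and> degree w \<le> J \<and> ereal R \<le> fps_conv_radius (fps_of_poly w * F) \<and>
    (\<forall>a. poly w a = 0 \<longrightarrow> a \<noteq> 0 \<and> norm a < R \<and> eval_fps (fps_of_poly w * F) a \<noteq> 0 \<and> poly Q a = 0 \<and> order a w = 1) \<and>
    (\<forall>v. v \<noteq> 0 \<longrightarrow> degree v \<le> J \<longrightarrow> fps_conv_radius (fps_of_poly v * F) \<le> ereal R)"
proof -
  let ?rad = "\<lambda>v. fps_conv_radius (fps_of_poly v * F)"
  define ok where "ok = (\<lambda>\<rho> v. v \<noteq> 0 \<and> degree v \<le> J \<and> \<rho> \<le> ?rad v)"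
  define mini where "mini = (\<lambda>\<rho> w. ok \<rho> w \<and> lead_coeff w = 1 \<and> (\<forall>v. v \<noteq> 0 \<longrightarrow> degree v < degree w \<longrightarrow> \<not> \<rho> \<le> ?rad v))"
  have deg: "\<forall>\<^sub>F n in sequentially. degree (q n) = degree Q" using monic by eventually_elim simp
  have ex: "\<exists>w. mini \<rho> w" if v: "ok \<rho> v" for \<rho> v
  proof -
    obtain u where u: "ok \<rho> u" "\<And>y. ok \<rho> y \<Longrightarrow> degree u \<le> degree y" using ex_has_least_nat[of "ok \<rho>" v degree] v by blast
    define c where "c = 1 / lead_coeff u"
    have u0: "u \<noteq> 0" "degree u \<le> J" "\<rho> \<le> ?rad u" using u(1) by (auto simp: ok_def)
    hence c: "c \<noteq> 0" "c * lead_coeff u = 1" by (auto simp: c_def)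
    have "fps_of_poly (smult c u) * F = fps_of_poly [:c:] * (fps_of_poly u * F)"
      by (simp add: fps_of_poly_smult fps_of_poly_const mult.assoc)
    hence "?rad u \<le> ?rad (smult c u)" using fps_conv_radius_poly_mult by metis
    hence "ok \<rho> (smult c u)" using u0 c by (auto simp: ok_def)
    moreover have "\<not> \<rho> \<le> ?rad y" if "y \<noteq> 0" "degree y < degree u" for y
      using u(2)[of y] u0 that unfolding ok_def by linarith
    ultimately have "mini \<rho> (smult c u)" using c by (auto simp: mini_def)
    thus ?thesis ..
  qed
  have zeros: "a \<noteq> 0 \<and> ereal (norm a) < \<rho> \<and> eval_fps (fps_of_poly w * F) a \<noteq> 0 \<and> poly Q a = 0 \<and> order a w = 1"
    if w: "mini \<rho> w" "0 < \<rho>" "poly w a = 0" for \<rho> w a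
  proof (rule minimal_multiplier_zeros[OF lim deg simple rec _ _ w(2) _ _ w(3)])
    show "w \<noteq> 0" "degree w \<le> J" "\<rho> \<le> ?rad w" using w(1) by (auto simp: mini_def ok_def)
    show "\<not> \<rho> \<le> ?rad v" if "v \<noteq> 0" "degree v < degree w" for v using w(1) that by (auto simp: mini_def)
  qed auto
  have F0: "0 < fps_conv_radius F"
  proof (rule recurrence_conv_radius_pos[OF lim deg Q0])
    show "\<forall>\<^sub>F n in sequentially. fps_nth (fps_of_poly (q n) * F) n = 0" using rec[of 1] by simp
  qed
  have ext: "\<rho> \<le> mero_radius J F" if v: "ok \<rho> v" "0 < \<rho>" for \<rho> v
  proof -
    obtain w where w: "mini \<rho> w" using ex[OF v(1)] by blast
    have "mero_extension F (eball 0 \<rho>) J (\<lambda>z. eval_fps (fps_of_poly w * F) z / poly w z)"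
      by (rule mero_extension_of_multiplier[OF _ _ v(2) _ F0]) (use w zeros[OF w v(2)] in \<open>auto simp: mini_def ok_def\<close>)
    thus ?thesis unfolding mero_radius_def by (intro Sup_upper) blast
  qed
  have conv: "\<exists>v. ok \<rho> v" if \<rho>: "0 < \<rho>" "\<rho> < mero_radius J F" for \<rho>
  proof -
    obtain r where r: "r \<in> insert 0 {r. \<exists>g. mero_extension F (eball 0 r) J g}" "\<rho> < r"
      using \<rho>(2) unfolding mero_radius_def less_Sup_iff by blast
    have "0 < r" using r(2) \<rho>(1) by order
    then obtain g where "mero_extension F (eball 0 r) J g" using r(1) by auto
    from multiplier_of_mero_extension[OF this \<open>0 < r\<close>] obtain v where "v \<noteq> 0" "degree v \<le> J" "r \<le> ?rad v" by blast
    thus ?thesis using r(2) unfolding ok_def by (intro exI[of _ v]) auto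
  qed
  have "ok (fps_conv_radius F) 1" by (simp add: ok_def)
  from ext[OF this F0] have R0: "0 < mero_radius J F" using F0 by order
  obtain \<rho>1 where \<rho>1: "0 < \<rho>1" "\<rho>1 < mero_radius J F" using dense[OF R0] by blast
  define P where "P = (\<lambda>x :: ereal \<times> complex poly. 0 < fst x \<and> fst x < mero_radius J F \<and> mini (fst x) (snd x))"
  obtain w1 where "mini \<rho>1 w1" using conv[OF \<rho>1] ex by blast
  hence P1: "P (\<rho>1, w1)" using \<rho>1 by (simp add: P_def)
  have PJ: "\<forall>x. P x \<longrightarrow> degree (snd x) < Suc J" by (auto simp: P_def mini_def ok_def)
  \<comment> \<open>A minimal multiplier of greatest degree over all radii below the supremum. For
    larger radii the degree cannot rise by this choice, and it cannot drop because a multiplier for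
    a larger radius also serves for \<open>r0\<close>.\<close>
  obtain x where x: "P x" "\<And>y. P y \<Longrightarrow> degree (snd y) \<le> degree (snd x)"
    using ex_has_greatest_nat[of P, OF P1 PJ] by blast
  obtain r0 w0 where xr: "x = (r0, w0)" by fastforce
  have r0: "0 < r0" "r0 < mero_radius J F" "mini r0 w0" using x(1) by (auto simp: P_def xr)
  have w0: "w0 \<noteq> 0" "degree w0 \<le> J" "r0 \<le> ?rad w0" "lead_coeff w0 = 1" using r0(3) by (auto simp: mini_def ok_def)
  have all: "r \<le> ?rad w0" if r: "r < mero_radius J F" for r
  proof (cases "r \<le> r0")
    case True thus ?thesis using w0(3) by order
  next
    case False
    hence "0 < r" using r0(1) by order
    then obtain u where u: "mini r u" using conv[OF _ r] ex by blast
    have u': "u \<noteq> 0" "r \<le> ?rad u" "lead_coeff u = 1" using u by (auto simp: mini_def ok_def)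
    have ru: "r0 \<le> ?rad u" using u'(2) False by order
    have "degree u \<le> degree w0" using x(2)[of "(r, u)"] u r \<open>0 < r\<close> by (simp add: P_def xr)
    moreover have "\<not> degree u < degree w0" using r0(3) u'(1) ru by (auto simp: mini_def)
    ultimately have du: "degree u = degree w0" by simp
    have "u = w0"
    proof (rule ccontr)
      assume ne: "u \<noteq> w0"
      have "degree (u - w0) < degree w0" by (rule degree_diff_less_monic[OF du u'(3) w0(4) ne])
      moreover have "fps_of_poly (u - w0) * F = fps_of_poly u * F - fps_of_poly w0 * F"
        by (simp only: fps_of_poly_diff left_diff_distrib)
      hence "r0 \<le> ?rad (u - w0)" using fps_conv_radius_diff[of "fps_of_poly u * F" "fps_of_poly w0 * F"] ru w0(3)
        by (metis min.boundedI order_trans)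
      ultimately show False using r0(3) ne by (auto simp: mini_def)
    qed
    thus ?thesis using u'(2) by simp
  qed
  have at: "mero_radius J F \<le> ?rad w0" by (rule dense_le) (rule all)
  \<comment> \<open>An infinite radius would make \<open>w0 * F\<close> entire, hence eventually
    zero by the recurrence, which \<open>nz\<close> excludes.\<close>
  have fin: "mero_radius J F \<noteq> \<infinity>"
  proof
    assume "mero_radius J F = \<infinity>"
    hence "?rad w0 = \<infinity>" using at by simp
    from entire_recurrence_eventually_zero[OF lim monic this rec[OF w0(2)]] show False using nz[OF w0(1,2)] by blast
  qed
  then obtain R where R: "mero_radius J F = ereal R" using R0 by (cases "mero_radius J F") auto
  have "ok (ereal R) w0" using w0 at by (simp add: ok_def R)
  then obtain w where w: "mini (ereal R) w" using ex by blast
  have RR: "0 < R" using R0 R by simp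
  hence eR: "0 < ereal R" by simp
  show ?thesis
  proof (intro exI conjI allI impI)
    show "0 < R" "mero_radius J F = ereal R" "0 < fps_conv_radius F" by (rule RR R F0)+
    show "w \<noteq> 0" "degree w \<le> J" "ereal R \<le> ?rad w" using w by (auto simp: mini_def ok_def)
    show "a \<noteq> 0" "norm a < R" "eval_fps (fps_of_poly w * F) a \<noteq> 0" "poly Q a = 0" "order a w = 1" if "poly w a = 0" for a
      using zeros[OF w eR that] by auto
    show "?rad v \<le> ereal R" if v: "v \<noteq> 0" "degree v \<le> J" for v
    proof (cases "0 < ?rad v")
      case True thus ?thesis using ext[of "?rad v" v] v R by (simp add: ok_def)
    next
      case False
      thus ?thesis using eR by order
    qed
  qed
qed

section \<open>Counting the singular zeros of \<open>Q\<close> and identifying them as system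
  singularities\<close>

lemma poly_combination_mult:
  "poly_combination d f (\<lambda>k. v * p k) = fps_of_poly v * poly_combination d f p"
  unfolding poly_combination_def sum_distrib_left by (simp add: fps_of_poly_mult mult.assoc)

theorem theorem5p1:
  fixes d :: nat and f :: "nat \<Rightarrow> complex fps" and m :: "nat \<Rightarrow> nat"
    and q :: "nat \<Rightarrow> complex poly" and Q :: "complex poly"
    and mstar :: nat and p :: "nat \<Rightarrow> complex poly" and F :: "complex fps"
    and S :: "complex set"
  assumes m_nonzero: "\<exists>k\<in>{1..d}. m k \<noteq> 0"
    and q_denominator: "\<And>n. n \<ge> Max (m ` {1..d}) \<Longrightarrow> hp_denominator d f m n (q n)"
    and q_limit: "\<And>i. (\<lambda>n. coeff (q n) i) \<longlonglongrightarrow> coeff Q i"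
    and Q_degree: "degree Q = (\<Sum>k\<in>{1..d}. m k)"
    and Q_at_0: "poly Q 0 \<noteq> 0"
    and Q_simple: "\<And>z. poly Q z = 0 \<Longrightarrow> order z Q = 1"
    and mstar: "1 \<le> mstar" "mstar \<le> Max (m ` {1..d})"
    and q_unique: "\<forall>\<^sub>F n in sequentially. \<forall>Q'. hp_denominator d f m n Q' \<longrightarrow> Q' = q n"
    and q_degree: "\<forall>\<^sub>F n in sequentially. degree (q n) = (\<Sum>k\<in>{1..d}. m k)"
    and p_degree: "\<And>k. k \<in> {1..d} \<Longrightarrow> p k = 0 \<or> int (degree (p k)) \<le> int (m k) - int mstar"
    and p_nonzero: "\<exists>k\<in>{1..d}. p k \<noteq> 0"
    and F_def: "F = poly_combination d f p"
    and S_def: "S = {\<zeta>. \<zeta> \<in> closure (mero_disk (mstar - 1) F) \<and>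
                        singular_point (mstar - 1) F \<zeta> \<and> poly Q \<zeta> = 0}"
  shows "mstar \<le> card S
    \<and> (\<forall>\<zeta>\<in>S \<inter> mero_disk (mstar - 1) F. simple_pole_in_disk (mstar - 1) F \<zeta>)
    \<and> (\<forall>\<zeta>\<in>S. system_singularity d f m \<zeta>)"
proof -
  \<comment> \<open>This is both the number of poles allowed and the largest degree of
    \<open>v\<close> for which \<open>v * p k\<close> stays below degree \<open>m k\<close>, since
    \<open>J + (m k - mstar) < m k\<close>.\<close>
  define J where "J = mstar - 1"
  have M0: "0 < degree Q" using m_nonzero unfolding Q_degree by (auto simp: sum_pos2)
  have Q0: "Q \<noteq> 0" using Q_at_0 by auto
  have sqf: "rsquarefree Q" unfolding rsquarefree_def using Q0 Q_simple order_root[of Q] by (metis)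
  have simple: "poly (pderiv Q) z \<noteq> 0" if "poly Q z = 0" for z
    using sqf that by (simp add: rsquarefree_roots)
  obtain n0 where n0: "\<And>n. n0 \<le> n \<Longrightarrow> degree (q n) = degree Q" "\<And>n. n0 \<le> n \<Longrightarrow> Max (m ` {1..d}) \<le> n"
    using eventually_conj[OF q_degree eventually_ge_at_top[of "Max (m ` {1..d})"]]
    unfolding eventually_sequentially Q_degree by blast
  have hp: "hp_denominator d f m n (q n)" if "n0 \<le> n" for n using q_denominator n0(2)[OF that] by simp
  have lc: "lead_coeff (q n) = 1" if "n0 \<le> n" for n using hp[OF that] by (auto simp: hp_denominator_def)
  have monic: "\<forall>\<^sub>F n in sequentially. degree (q n) = degree Q \<and> lead_coeff (q n) = 1"
    unfolding eventually_sequentially using n0(1) lc by blast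
  have lcQ: "lead_coeff Q = 1"
  proof -
    have "\<forall>\<^sub>F n in sequentially. coeff (q n) (degree Q) = 1" using monic by eventually_elim metis
    hence "(\<lambda>n. coeff (q n) (degree Q)) \<longlonglongrightarrow> 1" by (rule tendsto_eventually)
    thus ?thesis using q_limit LIMSEQ_unique by blast
  qed
  have adm: "admissible d m (\<lambda>k. v * p k)" if v: "degree v \<le> J" for v
    unfolding admissible_def
  proof
    fix k assume k: "k \<in> {1..d}"
    have "degree (v * p k) < m k" if "p k \<noteq> 0"
      using p_degree[OF k] that degree_mult_le[of v "p k"] v mstar(1) unfolding J_def by linarith
    thus "v * p k = 0 \<or> degree (v * p k) < m k" by auto
  qed
  have comb: "poly_combination d f (\<lambda>k. v * p k) = fps_of_poly v * F" for v
    unfolding F_def by (rule poly_combination_mult)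
  have rec: "fps_nth (fps_of_poly (q n) * (fps_of_poly v * F)) n = 0" if "degree v \<le> J" "n0 \<le> n" for v n
  proof -
    have "m k \<le> n" if "k \<in> {1..d}" for k
    proof -
      have "m k \<le> Max (m ` {1..d})" using that by (intro Max_ge) auto
      thus ?thesis using n0(2)[OF \<open>n0 \<le> n\<close>] by simp
    qed
    thus ?thesis using admissible_recurrence[OF hp[OF that(2)] _ _ adm[OF that(1)]] n0(1)[OF that(2)] Q_degree
      unfolding comb by simp
  qed
  have rec': "\<forall>\<^sub>F n in sequentially. fps_nth (fps_of_poly (q n) * (fps_of_poly v * F)) n = 0" if "degree v \<le> J" for v
    unfolding eventually_sequentially using rec[OF that] by blast
  have uniq: "\<forall>\<^sub>F n in sequentially. \<forall>Q'. hp_denominator d f m n Q' \<longrightarrow> degree Q' = (\<Sum>k\<in>{1..d}. m k)"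
    using q_unique q_degree by eventually_elim auto
  have nz: "\<not> (\<forall>\<^sub>F k in sequentially. fps_nth (fps_of_poly v * F) k = 0)" if "v \<noteq> 0" "degree v \<le> J" for v
    unfolding comb[symmetric] by (rule combination_not_eventually_zero[OF adm[OF that(2)] _ uniq]) (use p_nonzero that in auto)
  have sing: "system_singularity d f m \<zeta>"
    if "\<zeta> \<noteq> 0" "degree v \<le> J" "ereal (norm \<zeta>) \<le> fps_conv_radius (fps_of_poly v * F)"
      "\<not> holo_extends_near (eval_fps (fps_of_poly v * F)) (ball 0 (norm \<zeta>)) \<zeta>" for \<zeta> v
    unfolding system_singularity_def
    by (intro conjI exI[of _ "\<lambda>k. v * p k"]) (use that adm[OF that(2)] in \<open>auto simp: comb admissible_def\<close>)
  obtain R w where R: "0 < R" "mero_radius J F = ereal R" and F0: "0 < fps_conv_radius F"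
    and w: "w \<noteq> 0" "degree w \<le> J" "ereal R \<le> fps_conv_radius (fps_of_poly w * F)"
    and zw': "\<forall>a. poly w a = 0 \<longrightarrow> a \<noteq> 0 \<and> norm a < R \<and> eval_fps (fps_of_poly w * F) a \<noteq> 0 \<and> poly Q a = 0 \<and> order a w = 1"
    and exact': "\<forall>v. v \<noteq> 0 \<longrightarrow> degree v \<le> J \<longrightarrow> fps_conv_radius (fps_of_poly v * F) \<le> ereal R"
    by (rule exE[OF mero_radius_multiplier[of q Q J F, OF q_limit monic Q_at_0]],
        erule simple, erule rec', erule (1) nz, elim exE conjE, rule that)
  note zw = zw'[THEN spec, THEN mp] and exact = exact'[rule_format]
  define G where "G = fps_of_poly w * F"
  define g where "g = (\<lambda>z. eval_fps G z / poly w z)"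
  have D: "mero_disk J F = ball 0 R" by (simp add: mero_disk_def R)
  have g: "mero_extension F (ball 0 R) J g"
    unfolding g_def G_def eball_ereal[symmetric]
    by (rule mero_extension_of_multiplier) (use w R F0 zw in auto)
  have hG: "eval_fps G holomorphic_on ball 0 R"
    unfolding G_def by (intro holomorphic_on_eval_fps ball_eball_mono w)
  \<comment> \<open>\<open>singular_point\<close> speaks of an arbitrary extension, so its poles and
    boundary behaviour are transferred to the explicit \<open>g\<close>.\<close>
  have agree: "h z = g z" if "mero_extension F (ball 0 R) J h" "z \<in> ball 0 R" for h z
    using mero_extension_unique[of F "ereal R" J h J g z] that g by simp
  have pole: "is_pole g a" "zorder g a = -1" if "poly w a = 0" for a
    using quotient_pole[OF open_ball _ hG _ w(1), of a g] zw[OF that] by (auto simp: g_def G_def)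
  have no_pole: "\<not> is_pole g a" if "a \<in> ball 0 R" "poly w a \<noteq> 0" for a
  proof -
    have "g analytic_on {a}" unfolding g_def
      by (intro analytic_intros poly_analytic_on analytic_on_subset[OF hG[folded analytic_on_open[OF open_ball]]]) (use that in auto)
    thus ?thesis by (rule analytic_at_imp_no_pole)
  qed
  have pole_iff: "is_pole h a \<longleftrightarrow> poly w a = 0" if h: "mero_extension F (ball 0 R) J h" and a: "a \<in> ball 0 R" for h a
  proof -
    have "\<forall>\<^sub>F z in at a. h z = g z"
      using eventually_at_in_open'[OF open_ball a] by eventually_elim (rule agree[OF h])
    hence "is_pole h a \<longleftrightarrow> is_pole g a" by (rule is_pole_cong) simp
    thus ?thesis using pole no_pole[OF a] by blast
  qed
  define W where "W = {z. poly w z = 0}"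
  define A where "A = {\<zeta>. poly Q \<zeta> = 0 \<and> cmod \<zeta> = R \<and> \<not> holo_extends_near g (ball 0 R) \<zeta>}"
  have S_iff: "\<zeta> \<in> S \<longleftrightarrow> \<zeta> \<in> W \<union> A" for \<zeta>
  proof -
    have "singular_point J F \<zeta> \<longleftrightarrow> poly w \<zeta> = 0 \<or> (cmod \<zeta> = R \<and> \<not> holo_extends_near g (ball 0 R) \<zeta>)"
    proof
      assume "singular_point J F \<zeta>"
      then obtain h where h: "mero_extension F (ball 0 R) J h"
        "\<zeta> \<in> ball 0 R \<and> is_pole h \<zeta> \<or> \<zeta> \<in> frontier (ball 0 R) \<and> \<not> holo_extends_near h (ball 0 R) \<zeta>"
        unfolding singular_point_def D by blast
      have "holo_extends_near h (ball 0 R) \<zeta> \<longleftrightarrow> holo_extends_near g (ball 0 R) \<zeta>"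
        using agree[OF h(1)] unfolding holo_extends_near_def by auto
      thus "poly w \<zeta> = 0 \<or> (cmod \<zeta> = R \<and> \<not> holo_extends_near g (ball 0 R) \<zeta>)"
        using h(2) pole_iff[OF h(1)] R(1) by auto
    next
      assume *: "poly w \<zeta> = 0 \<or> (cmod \<zeta> = R \<and> \<not> holo_extends_near g (ball 0 R) \<zeta>)"
      have "\<zeta> \<in> ball 0 R \<and> is_pole g \<zeta> \<or> \<zeta> \<in> frontier (ball 0 R) \<and> \<not> holo_extends_near g (ball 0 R) \<zeta>"
        using * zw[of \<zeta>] pole[of \<zeta>] R(1) by auto
      thus "singular_point J F \<zeta>" unfolding singular_point_def D using g by blast
    qed
    moreover have "closure (mero_disk J F) = cball 0 R" unfolding D using R(1) by simp
    ultimately show ?thesis unfolding S_def J_def[symmetric] W_def A_def using zw[of \<zeta>] by auto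
  qed
  hence S: "S = W \<union> A" by blast
  have wG: "fps_of_poly v * G = fps_of_poly (v * w) * F" for v
    by (simp add: G_def fps_of_poly_mult mult.assoc)
  have ext: "\<exists>\<rho>>0. \<exists>H. H holomorphic_on ball \<zeta> \<rho> \<and> (\<forall>z\<in>ball \<zeta> \<rho>. norm z < R \<longrightarrow> H z = eval_fps G z)"
    if \<zeta>: "cmod \<zeta> = R" "holo_extends_near g (ball 0 R) \<zeta>" for \<zeta>
  proof -
    obtain U h where U: "open U" "\<zeta> \<in> U" "h holomorphic_on U" "\<And>z. z \<in> U \<inter> ball 0 R \<Longrightarrow> h z = g z"
      using \<zeta>(2) unfolding holo_extends_near_def by blast
    have "poly w \<zeta> \<noteq> 0" using zw[of \<zeta>] \<zeta>(1) by auto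
    moreover have "open (U - {z. poly w z = 0})" using U poly_roots_finite[OF w(1)] by (intro open_Diff finite_imp_closed)
    ultimately obtain \<rho> where \<rho>: "0 < \<rho>" "ball \<zeta> \<rho> \<subseteq> U - {z. poly w z = 0}"
      using U(2) by (metis (mono_tags, lifting) DiffI mem_Collect_eq open_contains_ball)
    have "(\<lambda>z. h z * poly w z) holomorphic_on ball \<zeta> \<rho>"
      by (intro holomorphic_intros holomorphic_on_subset[OF U(3)]) (use \<rho> in auto)
    moreover have "h z * poly w z = eval_fps G z" if "z \<in> ball \<zeta> \<rho>" "norm z < R" for z
    proof -
      have "z \<in> U \<inter> ball 0 R" "poly w z \<noteq> 0" using that \<rho>(2) by auto
      thus ?thesis using U(4)[of z] by (simp add: g_def)
    qed
    ultimately show ?thesis using \<rho>(1) by blast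
  qed
  have fin: "finite W" "finite A"
    using poly_roots_finite[OF w(1)] finite_subset[OF _ poly_roots_finite[OF Q0], of A] by (auto simp: W_def A_def)
  \<comment> \<open>\<open>Suc (J - degree w)\<close> is \<open>mstar - degree w\<close>, which
    complements the \<open>degree w\<close> poles inside the disk.\<close>
  have cA: "Suc (J - degree w) \<le> card A"
  proof (rule singular_zeros_count[OF sqf lcQ Q_at_0 M0 q_limit monic, where G = G and R = R and ?n0.0 = n0])
    fix v :: "complex poly" assume v: "degree v \<le> J - degree w"
    have dv: "degree (v * w) \<le> J" using degree_mult_le[of v w] v w(2) by linarith
    show "\<forall>n\<ge>n0. fps_nth (fps_of_poly (q n) * (fps_of_poly v * G)) n = 0" unfolding wG using rec[OF dv] by blast
    assume "v \<noteq> 0"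
    thus "fps_conv_radius (fps_of_poly v * G) \<le> ereal R" unfolding wG using exact[OF _ dv] w(1) by simp
  next
    fix \<zeta> assume "poly Q \<zeta> = 0" "cmod \<zeta> = R" "\<zeta> \<notin> A"
    thus "\<exists>\<rho>>0. \<exists>H. H holomorphic_on ball \<zeta> \<rho> \<and> (\<forall>z\<in>ball \<zeta> \<rho>. norm z < R \<longrightarrow> H z = eval_fps G z)"
      by (intro ext) (auto simp: A_def)
  qed (use R w in \<open>auto simp: A_def G_def\<close>)
  have "rsquarefree w" unfolding rsquarefree_def using w(1) zw order_root[of w] by metis
  hence "card W = degree w" unfolding W_def by (rule card_roots_rsquarefree)
  moreover have "W \<inter> A = {}" using zw by (fastforce simp: W_def A_def)
  ultimately have "card S = degree w + card A" unfolding S using fin by (simp add: card_Un_disjoint)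
  hence "mstar \<le> card S" using cA w(2) mstar(1) unfolding J_def by linarith
  moreover have "simple_pole_in_disk J F \<zeta>" if \<zeta>: "\<zeta> \<in> S \<inter> mero_disk J F" for \<zeta>
  proof -
    have "poly w \<zeta> = 0" using \<zeta> unfolding S D by (auto simp: W_def A_def)
    thus ?thesis unfolding simple_pole_in_disk_def D using \<zeta> pole g by (auto simp: D)
  qed
  moreover have "system_singularity d f m \<zeta>" if \<zeta>: "\<zeta> \<in> S" for \<zeta>
  proof (cases "poly w \<zeta> = 0")
    case True
    note z = zw[OF True]
    \<comment> \<open>Removing just the factor \<open>z - \<zeta>\<close> from \<open>w\<close>
      leaves a combination that is analytic for \<open>norm z < norm \<zeta>\<close> but singular at
      \<open>\<zeta>\<close>, because \<open>G\<close> does not vanish there.\<close>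
    obtain u where u: "w = [:- \<zeta>, 1:] * u" using True by (auto simp: poly_eq_0_iff_dvd dvd_def)
    have "u \<noteq> 0" using w(1) u by auto
    hence "degree w = Suc (degree u)" unfolding u by (subst degree_mult_eq) auto
    hence du: "degree u \<le> J" using w(2) by simp
    have Gu: "G = fps_of_poly [:- \<zeta>, 1:] * (fps_of_poly u * F)"
      unfolding G_def u fps_of_poly_mult by (simp only: mult.assoc)
    have rad: "ereal (norm \<zeta>) \<le> fps_conv_radius (fps_of_poly u * F)"
    proof (rule fps_conv_radius_divide_linear[OF Gu])
      show "ereal (norm \<zeta>) \<le> fps_conv_radius G" using z w(3) unfolding G_def by (meson ereal_less_eq(3) less_imp_le order_trans)
    qed (use z in auto)
    show ?thesis
    proof (rule sing[OF _ du rad])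
      show "\<not> holo_extends_near (eval_fps (fps_of_poly u * F)) (ball 0 (norm \<zeta>)) \<zeta>"
      proof
        assume "holo_extends_near (eval_fps (fps_of_poly u * F)) (ball 0 (norm \<zeta>)) \<zeta>"
        then obtain U h where U: "open U" "\<zeta> \<in> U" "h holomorphic_on U"
          "\<And>x. x \<in> U \<inter> ball 0 (norm \<zeta>) \<Longrightarrow> h x = eval_fps (fps_of_poly u * F) x"
          unfolding holo_extends_near_def by blast
        define V where "V = U \<inter> ball 0 R"
        have V: "open V" "\<zeta> \<in> V" using U z by (auto simp: V_def)
        \<comment> \<open>\<open>k\<close> vanishes on the inner side of \<open>\<zeta>\<close>,
          hence by continuity at \<open>\<zeta>\<close>, which would give
          \<open>eval_fps G \<zeta> = 0\<close>.\<close>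
        define k where "k = (\<lambda>x. (x - \<zeta>) * h x - eval_fps G x)"
        have "k holomorphic_on V" unfolding k_def V_def
          by (intro holomorphic_intros holomorphic_on_subset[OF U(3)] holomorphic_on_subset[OF hG]) auto
        hence "isCont k \<zeta>" using V by (metis continuous_on_eq_continuous_at holomorphic_on_imp_continuous_on)
        hence lim: "(k \<longlongrightarrow> k \<zeta>) (at \<zeta> within ball 0 (norm \<zeta>))"
          unfolding isCont_def by (rule tendsto_within_subset) auto
        have "\<forall>\<^sub>F x in at \<zeta> within ball 0 (norm \<zeta>). x \<in> V \<inter> ball 0 (norm \<zeta>)"
          using eventually_at_topological[of _ \<zeta> "ball 0 (norm \<zeta>)"] V by blast
        hence ev: "\<forall>\<^sub>F x in at \<zeta> within ball 0 (norm \<zeta>). k x = 0"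
        proof eventually_elim
          case (elim x)
          have "ereal (norm x) < fps_conv_radius (fps_of_poly u * F)" by (rule less_le_trans[OF _ rad]) (use elim in simp)
          hence "eval_fps G x = (x - \<zeta>) * eval_fps (fps_of_poly u * F) x" unfolding Gu by (subst eval_fps_poly_mult) auto
          thus ?case using U(4)[of x] elim by (simp add: k_def V_def)
        qed
        have "at \<zeta> within ball 0 (norm \<zeta>) \<noteq> bot"
          using z unfolding trivial_limit_within islimpt_ball by simp
        from tendsto_unique[OF this lim tendsto_eventually[OF ev]] have "k \<zeta> = 0" .
        thus False using z by (simp add: k_def G_def)
      qed
    qed (use z in auto)
  next
    case False
    \<comment> \<open>Here \<open>w\<close> is nonzero near \<open>\<zeta>\<close>, so an extension
      of \<open>w * F\<close> past \<open>\<zeta>\<close> would yield one of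
      \<open>g\<close>.\<close>
    hence A: "cmod \<zeta> = R" "\<not> holo_extends_near g (ball 0 R) \<zeta>" using \<zeta> unfolding S by (auto simp: W_def A_def)
    show ?thesis
    proof (rule sing[OF _ w(2)])
      show "\<zeta> \<noteq> 0" using A(1) R(1) by auto
      show "ereal (norm \<zeta>) \<le> fps_conv_radius (fps_of_poly w * F)" using w(3) A(1) by simp
      show "\<not> holo_extends_near (eval_fps (fps_of_poly w * F)) (ball 0 (norm \<zeta>)) \<zeta>"
      proof
        assume "holo_extends_near (eval_fps (fps_of_poly w * F)) (ball 0 (norm \<zeta>)) \<zeta>"
        then obtain U h where U: "open U" "\<zeta> \<in> U" "h holomorphic_on U" "\<And>z. z \<in> U \<inter> ball 0 R \<Longrightarrow> h z = eval_fps G z"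
          unfolding holo_extends_near_def A(1) G_def by blast
        have "open (U - W)" using U(1) fin(1) by (intro open_Diff finite_imp_closed)
        moreover have "\<zeta> \<in> U - W" using U(2) False by (simp add: W_def)
        moreover have "(\<lambda>z. h z / poly w z) holomorphic_on U - W"
          by (intro holomorphic_intros holomorphic_on_subset[OF U(3)]) (auto simp: W_def)
        moreover have "\<forall>z\<in>(U - W) \<inter> ball 0 R. h z / poly w z = g z" using U(4) by (auto simp: g_def)
        ultimately have "holo_extends_near g (ball 0 R) \<zeta>" unfolding holo_extends_near_def by blast
        thus False using A(2) by simp
      qed
    qed
  qed
  ultimately show ?thesis unfolding J_def by blast
qed

end
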